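(* Let $g$ satisfy (KPP$_g$) and $\rho>0$. For any $i\in\{1,\ldots,N-1\}$ and every non-negative, continuous, bounded, compactly supported initial datum $(u_0,v_0)\not\equiv(0,0)$, the solution $(u,v)$ of (HM) satisfies: (i) for all $c>c^*_{m,\infty}$, $\lim_{t\to\infty}\sup_{|x_i|\geq ct}(u,v)=(0,0)$ uniformly in $x_j$, $j\neq i$; (ii) for all $0<c<c^*_{m,\infty}$, $\lim_{t\to\infty}\sup_{|x_i|\leq ct}|(u,v)-(U,V)|=0$ locally uniformly in $x_j$, $j\neq i$, where $(U,V)$ is the unique bounded positive steady state of (HM) depending only on $x_N$.
   Context: Problem (HM) ($N\geq2$, $D,d,\mu,\nu,\rho>0$): $u_t-D\Delta u=g(u)$ in $\{x_N<0\}\times(0,\infty)$, $v_t-d\Delta v=-\rho v$ in $\{x_N>0\}\times(0,\infty)$, $D\partial_{x_N}u=\nu v-\mu u$ and $-d\partial_{x_N}v=\mu u-\nu v$ on $\{x_N=0\}\times(0,\infty)$. (KPP$_g$): $g$ locally Lipschitz, differentiable at $0$, $g(0)=g(1)=0$, $0<g(s)\leq g'(0)s$ on $(0,1)$, $g(s)<0$ for $s>1$. $c_g:=2\sqrt{Dg'(0)}$; $c^*_{m,\infty}:=c_g$ if $\frac{d}{D}\leq2+\frac{\rho}{g'(0)}$, and $c^*_{m,\infty}:=\frac{D\rho+dg'(0)}{\sqrt{(d-D)(\rho+g'(0))}}$ otherwise. *)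

theory Defs
  imports "HOL-Analysis.Analysis"
begin

text \<open>Points of R^N are elements of real^'n with CARD('n) = N. A distinguished
coordinate k plays the role of x_N (the normal direction).\<close>

definition pdx :: "(real^'n::finite \<Rightarrow> real) \<Rightarrow> 'n \<Rightarrow> real^'n \<Rightarrow> real" where
  "pdx f j x = deriv (\<lambda>s. f (x + s *\<^sub>R axis j 1)) 0"

definition pdt :: "('a \<Rightarrow> real \<Rightarrow> real) \<Rightarrow> 'a \<Rightarrow> real \<Rightarrow> real" where
  "pdt u x t = deriv (\<lambda>s. u x s) t"

definition lapx :: "(real^'n::finite \<Rightarrow> real \<Rightarrow> real) \<Rightarrow> real^'n \<Rightarrow> real \<Rightarrow> real" where
  "lapx u x t = (\<Sum>j\<in>UNIV. pdx (pdx (\<lambda>y. u y t) j) j x)"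

definition C21_on :: "(real^'n::finite \<Rightarrow> real \<Rightarrow> real) \<Rightarrow> (real^'n) set \<Rightarrow> bool" where
  "C21_on u \<Omega> \<longleftrightarrow>
     (\<forall>x\<in>\<Omega>. \<forall>t>0. ((\<lambda>s. u x s) has_real_derivative pdt u x t) (at t) \<and>
        (\<forall>j. ((\<lambda>s. u (x + s *\<^sub>R axis j 1) t) has_real_derivative pdx (\<lambda>y. u y t) j x) (at 0) \<and>
             ((\<lambda>s. pdx (\<lambda>y. u y t) j (x + s *\<^sub>R axis j 1)) has_real_derivative
                 pdx (pdx (\<lambda>y. u y t) j) j x) (at 0))) \<and>
     continuous_on (\<Omega> \<times> {0<..}) (\<lambda>(x,t). pdt u x t) \<and>
     (\<forall>j. continuous_on (\<Omega> \<times> {0<..}) (\<lambda>(x,t). pdx (\<lambda>y. u y t) j x) \<and>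
          continuous_on (\<Omega> \<times> {0<..}) (\<lambda>(x,t). pdx (pdx (\<lambda>y. u y t) j) j x))"

definition HM_sol :: "real \<Rightarrow> real \<Rightarrow> real \<Rightarrow> real \<Rightarrow> real \<Rightarrow> (real \<Rightarrow> real) \<Rightarrow> 'n::finite \<Rightarrow>
    (real^'n \<Rightarrow> real \<Rightarrow> real) \<Rightarrow> (real^'n \<Rightarrow> real \<Rightarrow> real) \<Rightarrow> bool" where
  "HM_sol D d \<mu> \<nu> \<rho> g k u v \<longleftrightarrow>
     continuous_on ({x. x$k \<le> 0} \<times> {0..}) (\<lambda>(x,t). u x t) \<and>
     continuous_on ({x. x$k \<ge> 0} \<times> {0..}) (\<lambda>(x,t). v x t) \<and>
     C21_on u {x. x$k < 0} \<and> C21_on v {x. x$k > 0} \<and>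
     (\<forall>x t. x$k < 0 \<longrightarrow> t > 0 \<longrightarrow> pdt u x t - D * lapx u x t = g (u x t)) \<and>
     (\<forall>x t. x$k > 0 \<longrightarrow> t > 0 \<longrightarrow> pdt v x t - d * lapx v x t = - \<rho> * v x t) \<and>
     (\<forall>x t. x$k = 0 \<longrightarrow> t > 0 \<longrightarrow>
        (\<exists>a b. ((\<lambda>s. u (x + s *\<^sub>R axis k 1) t) has_real_derivative a) (at_left 0) \<and>
               ((\<lambda>s. v (x + s *\<^sub>R axis k 1) t) has_real_derivative b) (at_right 0) \<and>
               D * a = \<nu> * v x t - \<mu> * u x t \<and>
               - d * b = \<mu> * u x t - \<nu> * v x t)) \<and>
     (\<forall>T. \<exists>M. \<forall>x t. 0 \<le> t \<and> t \<le> T \<longrightarrow>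
        (x$k \<le> 0 \<longrightarrow> \<bar>u x t\<bar> \<le> M) \<and> (x$k \<ge> 0 \<longrightarrow> \<bar>v x t\<bar> \<le> M))"

definition KPP :: "(real \<Rightarrow> real) \<Rightarrow> bool" where
  "KPP g \<longleftrightarrow>
     (\<forall>R. \<exists>L. \<forall>a b. \<bar>a\<bar> \<le> R \<and> \<bar>b\<bar> \<le> R \<longrightarrow> \<bar>g a - g b\<bar> \<le> L * \<bar>a - b\<bar>) \<and>
     g differentiable (at 0) \<and> g 0 = 0 \<and> g 1 = 0 \<and>
     (\<forall>s. 0 < s \<and> s < 1 \<longrightarrow> 0 < g s \<and> g s \<le> deriv g 0 * s) \<and>
     (\<forall>s>1. g s < 0)"

definition c_g :: "real \<Rightarrow> (real \<Rightarrow> real) \<Rightarrow> real" where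
  "c_g D g = 2 * sqrt (D * deriv g 0)"

definition cstar :: "real \<Rightarrow> real \<Rightarrow> real \<Rightarrow> (real \<Rightarrow> real) \<Rightarrow> real" where
  "cstar D d \<rho> g =
     (if d / D \<le> 2 + \<rho> / deriv g 0 then c_g D g
      else (D * \<rho> + d * deriv g 0) / sqrt ((d - D) * (\<rho> + deriv g 0)))"

definition HM_steady :: "real \<Rightarrow> real \<Rightarrow> real \<Rightarrow> real \<Rightarrow> real \<Rightarrow> (real \<Rightarrow> real) \<Rightarrow> 'n::finite \<Rightarrow>
    (real \<Rightarrow> real) \<Rightarrow> (real \<Rightarrow> real) \<Rightarrow> bool" where
  "HM_steady D d \<mu> \<nu> \<rho> g k U V \<longleftrightarrow>
     HM_sol D d \<mu> \<nu> \<rho> g k (\<lambda>x t. U (x$k)) (\<lambda>x t. V (x$k)) \<and>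
     (\<forall>y\<le>0. U y > 0) \<and> (\<forall>y\<ge>0. V y > 0) \<and>
     (\<exists>M. (\<forall>y\<le>0. U y \<le> M) \<and> (\<forall>y\<ge>0. V y \<le> M))"

end

(* The second half-space is reflected onto the first, which makes the system symmetric under exchange of
   its components, and a comparison principle against explicit barriers replaces all regularity and existence theory.
   Decay: nu, mu times exp (-alpha (+-x_i - c t)), constant in x_N, is a supersolution for the exponent alpha at which
   c^* is attained, since both D alpha^2 + g'(0) and d alpha^2 - rho are then at most c^* alpha.
   Spreading: truncated Gaussians moving with velocity a grow at rate g'(0) - a^2/(4D) in the field u and
   -rho - a^2/(4d) in v, and mass crosses the interface at a cost independent of time. If c^* > c_g, spending a suitable
   fraction of the time in each half-space, with velocities just below 2 D alpha and 2 d alpha, gives positive net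
   growth at every speed below c^*.
   Convergence: the positive steady state is a piece of the separatrix D U'^2/2 + G(U) = G(1). Translates of
   the separatrices for g + m and g - m are a monotone family of strict super- and subsolutions that is swept slowly onto a
   neighbourhood of the steady state; m -> 0 gives convergence, and applying this to a steady state gives uniqueness. *)
theory Submission
  imports Defs
begin

section \<open>Second-order jets along coordinate lines\<close>

text \<open>A barrier has to satisfy its inequalities only where it has passed the solution.
  Truncated, folded or compactly supported barriers therefore need no smoothness at their edges, and
  bounds already known for the solution may be used while a barrier is checked; this replaces
  gluing.

  In the second regime of \<open>cstar\<close>, alpha solves D alpha^2 + g'(0) = d alpha^2 - rho =
  cstar alpha. At the velocities 2 D alpha and 2 d alpha the growth rates are g'(0) - D alpha^2 and
  -rho - d alpha^2. As cstar lies strictly between these velocities, some division of time has mean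
  velocity cstar, and its mean growth is then exactly 0. Slowing both motions by a factor s < 1
  leaves the margin cstar alpha (1 - s^2) / 2, which pays for linearisation and for confinement to
  balls; long stays pay for the crossings.

  A bounded stationary v is a multiple of exp (- sqrt (rho / d) x_N), so it can be eliminated and
  leaves a Robin condition for u. The level theta at which the separatrix meets this condition is
  the interface value of the steady state.\<close>

definition jetg ::
  "(real^'n::finite \<Rightarrow> real \<Rightarrow> real) \<Rightarrow> real^'n \<Rightarrow> real \<Rightarrow> real \<Rightarrow> ('n \<Rightarrow> real) \<Rightarrow> ('n \<Rightarrow> real) \<Rightarrow> bool" where
  "jetg w x t a \<gamma> q \<longleftrightarrow> (w x has_real_derivative a) (at t) \<and>
     (\<forall>j. \<exists>p. (\<forall>\<^sub>F s in nhds 0. ((\<lambda>r. w (x + r *\<^sub>R axis j 1) t) has_real_derivative p s) (at s)) \<and>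
          p 0 = \<gamma> j \<and> (p has_real_derivative q j) (at 0))"

lemma jetgI:
  assumes "(w x has_real_derivative a) (at t)"
    and "\<And>j s. ((\<lambda>r. w (x + r *\<^sub>R axis j 1) t) has_real_derivative p j s) (at s)"
    and "\<And>j. p j 0 = \<gamma> j" and "\<And>j. (p j has_real_derivative q j) (at 0)"
  shows "jetg w x t a \<gamma> q"
  unfolding jetg_def
proof (intro conjI allI)
  fix j
  show "\<exists>p. (\<forall>\<^sub>F s in nhds 0. ((\<lambda>r. w (x + r *\<^sub>R axis j 1) t) has_real_derivative p s) (at s)) \<and>
          p 0 = \<gamma> j \<and> (p has_real_derivative q j) (at 0)"
    by (rule exI[of _ "p j"]) (simp add: assms)
qed (rule assms)

lemma jetg_cong:
  assumes "jetg w x t a \<gamma> q" "a = a'" "\<And>j. \<gamma> j = \<gamma>' j" "\<And>j. q j = q' j"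
  shows "jetg w x t a' \<gamma>' q'"
proof -
  have "\<gamma> = \<gamma>'" "q = q'" using assms by auto
  then show ?thesis using assms by simp
qed

lemma jetg_line:
  assumes "jetg w x t a \<gamma> q"
  obtains p where "\<forall>\<^sub>F s in nhds 0. ((\<lambda>r. w (x + r *\<^sub>R axis j 1) t) has_real_derivative p s) (at s)"
    "p 0 = \<gamma> j" "(p has_real_derivative q j) (at 0)"
  using assms unfolding jetg_def by blast

lemma jetg_time:
  assumes "(\<phi> has_real_derivative a) (at t)"
  shows "jetg (\<lambda>x s. \<phi> s) x t a (\<lambda>j. 0) (\<lambda>j. 0)"
  by (rule jetgI[where p="\<lambda>j s. 0"]) (use assms in auto)

lemma jetg_const: "jetg (\<lambda>x s. c) x t 0 (\<lambda>j. 0) (\<lambda>j. 0)"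
  by (rule jetg_time) auto

lemma jetg_coord:
  "jetg (\<lambda>x s. x $ i) x t 0 (\<lambda>j. if j = i then 1 else 0) (\<lambda>j. 0)"
  by (rule jetgI[where p="\<lambda>j s. if j = i then 1 else 0"])
     (auto simp: axis_def intro!: derivative_eq_intros)

lemma sqdist_line:
  fixes x c :: "real^'n::finite"
  shows "(norm (x + r *\<^sub>R axis j 1 - c))\<^sup>2 = (norm (x - c))\<^sup>2 + 2 * r * (x - c) $ j + r\<^sup>2"
proof -
  have "x + r *\<^sub>R axis j 1 - c = (x - c) + r *\<^sub>R axis j 1" by simp
  moreover have "(norm ((x - c) + r *\<^sub>R axis j 1))\<^sup>2
      = (norm (x - c))\<^sup>2 + 2 * ((x - c) \<bullet> (r *\<^sub>R axis j 1)) + (norm (r *\<^sub>R axis j (1::real)))\<^sup>2"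
    by (simp only: power2_norm_eq_inner inner_add_left inner_add_right inner_commute)
  ultimately show ?thesis
    by (simp add: inner_axis power_mult_distrib algebra_simps)
qed

lemma jetg_sqdist:
  "jetg (\<lambda>x s. (norm (x - c))\<^sup>2) x t 0 (\<lambda>j. 2 * (x - c) $ j) (\<lambda>j. 2)"
  by (rule jetgI[where p="\<lambda>j s. 2 * (x - c) $ j + 2 * s"])
     (auto simp: sqdist_line intro!: derivative_eq_intros)

lemma jetg_add:
  assumes "jetg w1 x t a1 g1 q1" "jetg w2 x t a2 g2 q2"
  shows "jetg (\<lambda>x s. w1 x s + w2 x s) x t (a1 + a2) (\<lambda>j. g1 j + g2 j) (\<lambda>j. q1 j + q2 j)"
  unfolding jetg_def
proof (intro conjI allI)
  show "((\<lambda>s. w1 x s + w2 x s) has_real_derivative a1 + a2) (at t)"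
    using assms by (auto simp: jetg_def intro!: derivative_eq_intros)
  fix j
  obtain p1 where
    p1: "\<forall>\<^sub>F s in nhds 0. ((\<lambda>r. w1 (x + r *\<^sub>R axis j 1) t) has_real_derivative p1 s) (at s)" "p1 0 = g1 j"
        "(p1 has_real_derivative q1 j) (at 0)"
    by (rule jetg_line[OF assms(1)])
  obtain p2 where
    p2: "\<forall>\<^sub>F s in nhds 0. ((\<lambda>r. w2 (x + r *\<^sub>R axis j 1) t) has_real_derivative p2 s) (at s)" "p2 0 = g2 j"
        "(p2 has_real_derivative q2 j) (at 0)"
    by (rule jetg_line[OF assms(2)])
  show "\<exists>p. (\<forall>\<^sub>F s in nhds 0. ((\<lambda>r. w1 (x + r *\<^sub>R axis j 1) t + w2 (x + r *\<^sub>R axis j 1) t) has_real_derivative p s) (at s)) \<and>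
        p 0 = g1 j + g2 j \<and> (p has_real_derivative q1 j + q2 j) (at 0)"
    apply (rule exI[of _ "\<lambda>s. p1 s + p2 s"])
    using p1 p2 by (auto intro!: derivative_eq_intros elim: eventually_elim2)
qed

lemma jetg_mult:
  assumes "jetg w1 x t a1 g1 q1" "jetg w2 x t a2 g2 q2"
  shows "jetg (\<lambda>x s. w1 x s * w2 x s) x t (a1 * w2 x t + w1 x t * a2)
     (\<lambda>j. g1 j * w2 x t + w1 x t * g2 j) (\<lambda>j. q1 j * w2 x t + 2 * g1 j * g2 j + w1 x t * q2 j)"
  unfolding jetg_def
proof (intro conjI allI)
  show "((\<lambda>s. w1 x s * w2 x s) has_real_derivative a1 * w2 x t + w1 x t * a2) (at t)"
    using assms by (auto simp: jetg_def intro!: derivative_eq_intros)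
  fix j
  obtain p1 where
    p1: "\<forall>\<^sub>F s in nhds 0. ((\<lambda>r. w1 (x + r *\<^sub>R axis j 1) t) has_real_derivative p1 s) (at s)" "p1 0 = g1 j"
        "(p1 has_real_derivative q1 j) (at 0)"
    by (rule jetg_line[OF assms(1)])
  obtain p2 where
    p2: "\<forall>\<^sub>F s in nhds 0. ((\<lambda>r. w2 (x + r *\<^sub>R axis j 1) t) has_real_derivative p2 s) (at s)" "p2 0 = g2 j"
        "(p2 has_real_derivative q2 j) (at 0)"
    by (rule jetg_line[OF assms(2)])
  \<comment> \<open>Jets use \<open>nhds 0\<close>, not \<open>at 0\<close>, so the line derivative
    may be read off at s = 0 itself.\<close>
  have d1: "((\<lambda>r. w1 (x + r *\<^sub>R axis j 1) t) has_real_derivative g1 j) (at 0)"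
   and d2: "((\<lambda>r. w2 (x + r *\<^sub>R axis j 1) t) has_real_derivative g2 j) (at 0)"
    using eventually_nhds_x_imp_x[OF p1(1)] eventually_nhds_x_imp_x[OF p2(1)] p1(2) p2(2) by auto
  show "\<exists>p. (\<forall>\<^sub>F s in nhds 0. ((\<lambda>r. w1 (x + r *\<^sub>R axis j 1) t * w2 (x + r *\<^sub>R axis j 1) t) has_real_derivative p s) (at s)) \<and>
        p 0 = g1 j * w2 x t + w1 x t * g2 j \<and>
        (p has_real_derivative q1 j * w2 x t + 2 * g1 j * g2 j + w1 x t * q2 j) (at 0)"
    apply (rule exI[of _ "\<lambda>s. p1 s * w2 (x + s *\<^sub>R axis j 1) t + w1 (x + s *\<^sub>R axis j 1) t * p2 s"])
    apply (intro conjI)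
    subgoal using p1(1) p2(1) by (rule eventually_elim2) (auto intro!: derivative_eq_intros)
    subgoal using p1 p2 by simp
    subgoal using p1 p2 d1 d2 by (auto intro!: derivative_eq_intros)
    done
qed

text \<open>The derivative of \<open>\<Phi>'\<close> is requested at the single value
  \<open>w x t\<close>: a jet asks for the second derivative only at its base point, while the first
  one must exist along a whole piece of the line.\<close>

lemma jetg_compose:
  assumes "jetg w x t a g q" and "\<And>r. (\<Phi> has_real_derivative \<Phi>' r) (at r)"
    and "(\<Phi>' has_real_derivative \<Phi>'') (at (w x t))"
  shows "jetg (\<lambda>x s. \<Phi> (w x s)) x t (\<Phi>' (w x t) * a) (\<lambda>j. \<Phi>' (w x t) * g j)
     (\<lambda>j. \<Phi>'' * (g j)\<^sup>2 + \<Phi>' (w x t) * q j)"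
  unfolding jetg_def
proof (intro conjI allI)
  show "((\<lambda>s. \<Phi> (w x s)) has_real_derivative \<Phi>' (w x t) * a) (at t)"
    using assms by (intro DERIV_chain2[where f=\<Phi>]) (auto simp: jetg_def)
  fix j
  obtain p where
    p: "\<forall>\<^sub>F s in nhds 0. ((\<lambda>r. w (x + r *\<^sub>R axis j 1) t) has_real_derivative p s) (at s)" "p 0 = g j"
        "(p has_real_derivative q j) (at 0)"
    by (rule jetg_line[OF assms(1)])
  have d: "((\<lambda>r. w (x + r *\<^sub>R axis j 1) t) has_real_derivative g j) (at 0)"
    using eventually_nhds_x_imp_x[OF p(1)] p(2) by auto
  have d': "((\<lambda>s. \<Phi>' (w (x + s *\<^sub>R axis j 1) t)) has_real_derivative \<Phi>'' * g j) (at 0)"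
    by (rule DERIV_chain2[where f=\<Phi>']) (use assms(3) d in auto)
  show "\<exists>p. (\<forall>\<^sub>F s in nhds 0. ((\<lambda>r. \<Phi> (w (x + r *\<^sub>R axis j 1) t)) has_real_derivative p s) (at s)) \<and>
        p 0 = \<Phi>' (w x t) * g j \<and> (p has_real_derivative \<Phi>'' * (g j)\<^sup>2 + \<Phi>' (w x t) * q j) (at 0)"
    apply (rule exI[of _ "\<lambda>s. \<Phi>' (w (x + s *\<^sub>R axis j 1) t) * p s"])
    apply (intro conjI)
    subgoal using p(1) by (rule eventually_mono) (intro DERIV_chain2[where f=\<Phi>] assms(2))
    subgoal using p by simp
    subgoal using p d' by (auto intro!: derivative_eq_intros simp: power2_eq_square)
    done
qed

lemma jetg_cmult:
  assumes "jetg w x t a g q"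
  shows "jetg (\<lambda>x s. c * w x s) x t (c * a) (\<lambda>j. c * g j) (\<lambda>j. c * q j)"
  using jetg_mult[OF jetg_const[of c] assms] by simp

lemma jetg_uminus:
  assumes "jetg w x t a g q"
  shows "jetg (\<lambda>x s. - w x s) x t (- a) (\<lambda>j. - g j) (\<lambda>j. - q j)"
  using jetg_cmult[OF assms, of "-1"] by simp

lemma jetg_diff:
  assumes "jetg w1 x t a1 g1 q1" "jetg w2 x t a2 g2 q2"
  shows "jetg (\<lambda>x s. w1 x s - w2 x s) x t (a1 - a2) (\<lambda>j. g1 j - g2 j) (\<lambda>j. q1 j - q2 j)"
  using jetg_add[OF assms(1) jetg_uminus[OF assms(2)]] by simp

lemma jetg_exp:
  assumes "jetg w x t a g q"
  shows "jetg (\<lambda>x s. exp (w x s)) x t (exp (w x t) * a) (\<lambda>j. exp (w x t) * g j)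
     (\<lambda>j. exp (w x t) * ((g j)\<^sup>2 + q j))"
  by (rule jetg_cong[OF jetg_compose[OF assms, where \<Phi>=exp and \<Phi>'=exp and \<Phi>''="exp (w x t)"]])
     (auto intro!: derivative_eq_intros simp: algebra_simps)

section \<open>Inequalities at a point of contact\<close>

lemma second_derivative_min:
  fixes \<phi> p :: "real \<Rightarrow> real"
  assumes "\<forall>\<^sub>F s in nhds 0. (\<phi> has_real_derivative p s) (at s)"
    and "\<forall>\<^sub>F s in nhds 0. \<phi> 0 \<le> \<phi> s" and "(p has_real_derivative q) (at 0)"
  shows "p 0 = 0" "0 \<le> q"
proof -
  obtain e1 where e1: "e1 > 0" "\<And>s. \<bar>s\<bar> < e1 \<Longrightarrow> (\<phi> has_real_derivative p s) (at s)"
    using assms(1) unfolding eventually_nhds_metric dist_real_def by auto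
  obtain e2 where e2: "e2 > 0" "\<And>s. \<bar>s\<bar> < e2 \<Longrightarrow> \<phi> 0 \<le> \<phi> s"
    using assms(2) unfolding eventually_nhds_metric dist_real_def by auto
  show p0: "p 0 = 0"
    by (rule DERIV_local_min[of \<phi> "p 0" 0 e2]) (use e1(1) e1(2)[of 0] e2 in auto)
  \<comment> \<open>Since p 0 = 0, a negative q makes p negative just to the right of 0, and the
    mean value theorem then puts \<phi> h below the minimum; no continuity of a second derivative is
    involved.\<close>
  show "0 \<le> q"
  proof (rule ccontr)
    assume "\<not> 0 \<le> q"
    then obtain e3 where e3: "e3 > 0" "\<And>h. 0 < h \<Longrightarrow> h < e3 \<Longrightarrow> p h < 0"
      using DERIV_neg_dec_right[OF assms(3)] p0 by auto
    define h where "h = min e1 (min e2 e3) / 2"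
    have h: "0 < h" "h < e1" "h < e2" "h < e3" using e1 e2 e3 by (auto simp: h_def)
    obtain z where z: "0 < z" "z < h" "\<phi> h - \<phi> 0 = (h - 0) * p z"
      using MVT2[of 0 h \<phi> p] e1(2) h by auto
    have "(h - 0) * p z < 0" using z h e3 by (auto simp: mult_pos_neg)
    then show False using z e2(2)[of h] h by auto
  qed
qed

text \<open>\<open>f - w\<close> vanishes at \<open>(x, t)\<close> and is nonnegative nearby at time
  t, and at x in the past. The past is one-sided, so the time derivative only gets a sign; each
  coordinate line has a two-sided minimum. Jets record just this much, which is why they contain no
  mixed derivatives.\<close>

lemma jetg_contact:
  fixes f w :: "real^'n::finite \<Rightarrow> real \<Rightarrow> real"
  assumes F: "jetg f x t a1 g1 q1" and W: "jetg w x t a2 g2 q2" and eq: "f x t = w x t"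
    and sp: "\<forall>\<^sub>F y in nhds x. w y t \<le> f y t"
    and tm: "\<And>s. t0 \<le> s \<Longrightarrow> s \<le> t \<Longrightarrow> w x s \<le> f x s" and "t0 < t"
  shows "a1 \<le> a2" "q2 j \<le> q1 j"
proof -
  have J: "jetg (\<lambda>x s. f x s - w x s) x t (a1 - a2) (\<lambda>j. g1 j - g2 j) (\<lambda>j. q1 j - q2 j)"
    by (rule jetg_diff[OF F W])
  show "a1 \<le> a2"
  proof (rule ccontr)
    assume "\<not> a1 \<le> a2"
    moreover have "((\<lambda>s. f x s - w x s) has_real_derivative a1 - a2) (at t)"
      using J by (auto simp: jetg_def)
    ultimately obtain d where d: "d > 0" "\<And>h. 0 < h \<Longrightarrow> h < d \<Longrightarrow> f x (t - h) - w x (t - h) < f x t - w x t"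
      using DERIV_pos_inc_left[of "\<lambda>s. f x s - w x s" "a1 - a2" t] by auto
    define h where "h = min d (t - t0) / 2"
    have "0 < h" "h < d" "t0 \<le> t - h" using d \<open>t0 < t\<close> by (auto simp: h_def min_def field_simps)
    then show False using d(2)[of h] tm[of "t - h"] eq by auto
  qed
  obtain p where
    p: "\<forall>\<^sub>F s in nhds 0. ((\<lambda>r. f (x + r *\<^sub>R axis j 1) t - w (x + r *\<^sub>R axis j 1) t) has_real_derivative p s) (at s)"
       "(p has_real_derivative q1 j - q2 j) (at 0)"
    using J unfolding jetg_def by blast
  have lim: "((\<lambda>s. x + s *\<^sub>R axis j 1) \<longlongrightarrow> x) (nhds 0)"
  proof -
    have "isCont (\<lambda>s::real. x + s *\<^sub>R axis j 1) 0" by (intro continuous_intros)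
    then show ?thesis by (simp add: isCont_def tendsto_nhds_iff)
  qed
  have "\<forall>\<^sub>F s in nhds 0. f (x + 0 *\<^sub>R axis j 1) t - w (x + 0 *\<^sub>R axis j 1) t
        \<le> f (x + s *\<^sub>R axis j 1) t - w (x + s *\<^sub>R axis j 1) t"
    using filterlim_iff[THEN iffD1, OF lim, rule_format, OF sp] eq by (auto elim: eventually_mono)
  from second_derivative_min(2)[OF p(1) this p(2)] show "q2 j \<le> q1 j" by simp
qed

section \<open>Comparison principle for the exchange system\<close>

text \<open>Contact at the interface is seen only from inside the half-space, so the normal
  derivative gets a sign instead of vanishing: the difference quotients have nonnegative numerators
  and negative denominators.\<close>

lemma at_left_deriv_nonpos:
  fixes \<phi> :: "real \<Rightarrow> real"
  assumes "(\<phi> has_real_derivative d) (at_left 0)" and "\<And>s. s < 0 \<Longrightarrow> \<phi> 0 \<le> \<phi> s"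
  shows "d \<le> 0"
proof -
  have "((\<lambda>y. (\<phi> y - \<phi> 0) / (y - 0)) \<longlongrightarrow> d) (at_left 0)"
    using assms(1) by (simp add: has_field_derivative_iff)
  then show ?thesis
    by (rule tendsto_upperbound)
       (auto simp: eventually_at_filter assms(2) divide_nonneg_neg intro!: always_eventually divide_nonneg_neg)
qed

text \<open>The set where some Z is nonpositive lies in a compact set because of \<open>far\<close>,
  so time attains a minimum on the union over both fields. Both must be treated together, since the
  exchange condition compares them at the time of contact.\<close>

lemma first_contact:
  fixes Z :: "bool \<Rightarrow> real^'n::finite \<Rightarrow> real \<Rightarrow> real"
  assumes cont: "\<And>b. continuous_on ({x. x$k \<le> 0} \<times> {t0..t1}) (\<lambda>(x,t). Z b x t)"
    and init: "\<And>b x. x$k \<le> 0 \<Longrightarrow> Z b x t0 > 0"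
    and far: "\<And>b x t. x$k \<le> 0 \<Longrightarrow> t0 \<le> t \<Longrightarrow> t \<le> t1 \<Longrightarrow> norm x > \<rho> \<Longrightarrow> Z b x t > 0"
    and bad: "x0$k \<le> 0" "t0 \<le> s0" "s0 \<le> t1" "Z b0 x0 s0 \<le> 0"
  shows "\<exists>b x t. x$k \<le> 0 \<and> t0 < t \<and> t \<le> t1 \<and> Z b x t = 0 \<and>
    (\<forall>b' y s. y$k \<le> 0 \<longrightarrow> t0 \<le> s \<longrightarrow> s \<le> t \<longrightarrow> Z b' y s \<ge> 0)"
proof -
  define K where "K = (cball (0::real^'n) \<rho> \<inter> {x. x$k \<le> 0}) \<times> {t0..t1}"
  define S where "S b = K \<inter> (\<lambda>(x,t). Z b x t) -` {..0}" for b
  have cH: "closed {x::real^'n. x$k \<le> 0}"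
    by (simp add: closed_halfspace_component_le_cart)
  have cK: "compact K" unfolding K_def using cH by (intro compact_Times compact_Int_closed) auto
  have cS: "compact (S b)" for b
  proof -
    have "closed (S b)" unfolding S_def
      by (rule continuous_closed_preimage[OF continuous_on_subset[OF cont]])
         (use cK in \<open>auto simp: K_def compact_imp_closed\<close>)
    then show ?thesis using cK by (metis S_def compact_Int_closed inf.left_idem)
  qed
  have inS: "(x,t) \<in> S b" if "x$k \<le> 0" "t0 \<le> t" "t \<le> t1" "Z b x t \<le> 0" for b x t
    using far[of x t b] that by (force simp: S_def K_def)
  have "compact (S True \<union> S False)" "S True \<union> S False \<noteq> {}"
    using cS inS[OF bad] by (auto intro: compact_Un) (metis empty_iff)
  then obtain p where p: "p \<in> S True \<union> S False" "\<And>q. q \<in> S True \<union> S False \<Longrightarrow> snd p \<le> snd q"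
    using continuous_attains_inf[of "S True \<union> S False" snd] continuous_on_snd[OF continuous_on_id] by blast
  obtain b where b: "p \<in> S b" using p(1) by auto
  obtain x t where xt: "p = (x,t)" by force
  have x: "x$k \<le> 0" "t0 \<le> t" "t \<le> t1" "Z b x t \<le> 0" using b by (auto simp: S_def K_def xt)
  have lt: "t0 < t" using init[of x b] x by (cases "t = t0") auto
  have pos: "Z b' y s > 0" if "y$k \<le> 0" "t0 \<le> s" "s < t" for b' y s
  proof (rule ccontr)
    assume "\<not> Z b' y s > 0"
    then have "(y,s) \<in> S b'" using that x by (intro inS) auto
    then have "(y,s) \<in> S True \<union> S False" by (cases b') auto
    from p(2)[OF this] that show False by (simp add: xt)
  qed
  have nn: "Z b' y s \<ge> 0" if "y$k \<le> 0" "t0 \<le> s" "s \<le> t" for b' y s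
  proof (cases "s < t")
    case True then show ?thesis using pos[of y s b'] that by simp
  next
    case False
    \<comment> \<open>Strict positivity is known for s < t only; at s = t it survives as
      nonnegativity in the limit.\<close>
    have cl: "closure {t0..<t} = {t0..t}" using lt by (simp add: closure_atLeastLessThan)
    have "continuous_on {t0..t} (\<lambda>s. case (y,s) of (x,t) \<Rightarrow> Z b' x t)"
      by (rule continuous_on_compose2[OF cont[of b']]) (use that x in \<open>auto intro!: continuous_intros\<close>)
    then have "continuous_on (closure {t0..<t}) (\<lambda>s. Z b' y s)" by (simp add: cl)
    then show ?thesis
      by (rule continuous_ge_on_closure) (use cl that pos[of y _ b'] in \<open>auto simp: less_imp_le\<close>)
  qed
  have "Z b x t = 0" using nn[of x t b] x lt by linarith
  then show ?thesis using x lt nn by blast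
qed

text \<open>The half-spaces are folded onto \<open>{x$k \<le> 0}\<close> by reflecting the second component, so that the
  two equations and the two exchange conditions become exchanged by \<open>b \<mapsto> \<not> b\<close>.\<close>

locale coupled =
  fixes Dc mu :: "bool \<Rightarrow> real" and G :: "bool \<Rightarrow> real \<Rightarrow> real" and k :: "'n::finite"
    and f :: "bool \<Rightarrow> real^'n \<Rightarrow> real \<Rightarrow> real"
  assumes Dpos: "Dc b > 0" and mupos: "mu b > 0"
    and Glip: "\<exists>L. \<forall>p q. \<bar>p\<bar> \<le> R \<and> \<bar>q\<bar> \<le> R \<longrightarrow> \<bar>G b p - G b q\<bar> \<le> L * \<bar>p - q\<bar>"
    and cont: "continuous_on ({x. x$k \<le> 0} \<times> {0..}) (\<lambda>(x,t). f b x t)"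
    and eqn: "x$k < 0 \<Longrightarrow> t > 0 \<Longrightarrow> \<exists>a \<gamma> q. jetg (f b) x t a \<gamma> q \<and> a - Dc b * (\<Sum>j\<in>UNIV. q j) = G b (f b x t)"
    and bdry: "x$k = 0 \<Longrightarrow> t > 0 \<Longrightarrow> ((\<lambda>s. f b (x + s *\<^sub>R axis k 1) t) has_real_derivative
        (mu (\<not> b) * f (\<not> b) x t - mu b * f b x t) / Dc b) (at_left 0)"
    and bdd: "\<exists>M. \<forall>b x t. 0 \<le> t \<and> t \<le> T \<and> x$k \<le> 0 \<longrightarrow> \<bar>f b x t\<bar> \<le> M"
begin

text \<open>The term \<open>x$k\<close> is negative inside the half-space; half of the quadratic
  part absorbs it by \<open>2 * norm x \<le> 1 + (norm x)\<^sup>2\<close>, so the penalty stays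
  positive and still grows at infinity.\<close>

lemma pen_ge: "1 + (norm (x::real^'n))\<^sup>2 + x$k \<ge> (1 + (norm x)\<^sup>2) / 2"
proof -
  have "- (x$k) \<le> norm x" using component_le_norm_cart[of x k] by linarith
  moreover have "2 * norm x \<le> 1 + (norm x)\<^sup>2" using sum_squares_bound[of 1 "norm x"] by simp
  ultimately show ?thesis by (simp add: field_simps)
qed

text \<open>Lowering \<open>w\<close> by a small multiple of \<open>exp (\<Gamma> t) (1 + norm x ^ 2 + x$k)\<close> makes every inequality strict
  and confines a first contact to a compact set; the term \<open>x$k\<close> provides strictness at the interface.\<close>

theorem comparison_sub:
  assumes t0: "0 \<le> t0"
    and wc: "\<And>b. continuous_on ({x. x$k \<le> 0} \<times> {t0..t1}) (\<lambda>(x,t). w b x t)"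
    and wB: "\<And>b x t. x$k \<le> 0 \<Longrightarrow> t0 \<le> t \<Longrightarrow> t \<le> t1 \<Longrightarrow> w b x t \<le> B"
    and w0: "\<And>b x. x$k \<le> 0 \<Longrightarrow> w b x t0 \<le> f b x t0"
    and wj: "\<And>b x t. x$k \<le> 0 \<Longrightarrow> t0 < t \<Longrightarrow> t \<le> t1 \<Longrightarrow> f b x t < w b x t \<Longrightarrow>
       \<exists>a \<gamma> q. jetg (w b) x t a \<gamma> q \<and>
         (x$k < 0 \<longrightarrow> a - Dc b * (\<Sum>j\<in>UNIV. q j) \<le> G b (w b x t)) \<and>
         (x$k = 0 \<longrightarrow> Dc b * \<gamma> k \<le> mu (\<not> b) * w (\<not> b) x t - mu b * w b x t)"
    and x: "x$k \<le> 0" "t0 \<le> t" "t \<le> t1"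
  shows "w b x t \<le> f b x t"
proof -
  obtain M where M: "\<And>b x t. 0 \<le> t \<Longrightarrow> t \<le> t1 \<Longrightarrow> x$k \<le> 0 \<Longrightarrow> \<bar>f b x t\<bar> \<le> M"
    using bdd[of t1] by blast
  \<comment> \<open>\<open>w\<close> is bounded only from above. At a contact,
    \<open>f b x t < w b x t\<close> also bounds it below by \<open>- M\<close>, so \<open>R\<close>
    serves for both arguments of \<open>G\<close>.\<close>
  define R where "R = max M B"
  obtain L0 where L0: "\<And>b p q. \<bar>p\<bar> \<le> R \<Longrightarrow> \<bar>q\<bar> \<le> R \<Longrightarrow> \<bar>G b p - G b q\<bar> \<le> L0 b * \<bar>p - q\<bar>"
    using Glip by metis
  define L where "L = max (L0 True) (L0 False)"
  have L: "\<bar>G b p - G b q\<bar> \<le> L * \<bar>p - q\<bar>" if "\<bar>p\<bar> \<le> R" "\<bar>q\<bar> \<le> R" for b p q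
  proof -
    have "L0 b \<le> L" by (cases b) (auto simp: L_def)
    then show ?thesis using L0[OF that, of b] by (meson abs_ge_zero mult_right_mono order_trans)
  qed
  define N where "N = real CARD('n)"
  \<comment> \<open>As \<open>Q x \<ge> 1/2\<close>, the growth of the penalty supplies at least
    half of \<open>\<Gamma> - L\<close>, which has to exceed \<open>2 * N * Dc b\<close>, the
    diffusion coefficient times the Laplacian of the penalty.\<close>
  define \<Gamma> where "\<Gamma> = L + 4 * N * (Dc True + Dc False) + 1"
  define Q where "Q x = 1 + (norm (x::real^'n))\<^sup>2 + x$k" for x
  have Q: "Q x \<ge> 1/2" "Q x \<ge> (norm x)\<^sup>2 / 2" for x
    using pen_ge[of x] by (auto simp: Q_def field_simps) (smt (verit) zero_le_power2)
  have N0: "N > 0" by (simp add: N_def)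
  have key: "w b x t - \<delta> * (mu (\<not> b) * (exp (\<Gamma> * t) * Q x)) \<le> f b x t" if \<delta>: "\<delta> > 0" for \<delta>
  proof (rule ccontr)
    assume neg: "\<not> ?thesis"
    \<comment> \<open>The crossed weight makes \<open>mu b * P b x s\<close> the same for both
      fields, so the penalty drops out of the exchange condition.\<close>
    define P where "P b x s = mu (\<not> b) * (exp (\<Gamma> * s) * Q x)" for b x s
    define Z where "Z b x t = f b x t - (w b x t - \<delta> * P b x t)" for b x t
    have P0: "P b x s > 0" for b x s
      using Q(1)[of x] mupos[of "\<not> b"] by (auto simp: P_def)
    have jP: "jetg (P b) x s (\<Gamma> * P b x s) (\<lambda>j. mu (\<not> b) * exp (\<Gamma> * s) * (2 * x$j + (if j = k then 1 else 0)))
         (\<lambda>j. mu (\<not> b) * exp (\<Gamma> * s) * 2)" for b x s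
    proof -
      have 1: "jetg (\<lambda>x s. exp (\<Gamma> * s)) x s (\<Gamma> * exp (\<Gamma> * s)) (\<lambda>j. 0) (\<lambda>j. 0)"
        by (rule jetg_time) (auto intro!: derivative_eq_intros)
      have 2: "jetg (\<lambda>x s. Q x) x s 0 (\<lambda>j. 2 * x$j + (if j = k then 1 else 0)) (\<lambda>j. 2)"
        using jetg_add[OF jetg_add[OF jetg_const[of 1] jetg_sqdist[of 0]] jetg_coord[of k], of x s]
        by (simp add: Q_def)
      show ?thesis unfolding P_def
        by (rule jetg_cong[OF jetg_cmult[OF jetg_mult[OF 1 2]]]) auto
    qed
    have Zc: "continuous_on ({x. x$k \<le> 0} \<times> {t0..t1}) (\<lambda>(x,t). Z b x t)" for b
    proof -
      have "continuous_on ({x. x$k \<le> 0} \<times> {t0..t1}) (\<lambda>p. (case p of (x,t) \<Rightarrow> f b x t) - ((case p of (x,t) \<Rightarrow> w b x t)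
          - \<delta> * (mu (\<not> b) * (exp (\<Gamma> * snd p) * (1 + (norm (fst p))\<^sup>2 + (fst p)$k)))))"
        by (intro continuous_intros wc continuous_on_subset[OF cont[of b]]) (use t0 in auto)
      then show ?thesis by (simp add: Z_def P_def Q_def case_prod_unfold)
    qed
    define E0 where "E0 = exp (- \<bar>\<Gamma>\<bar> * \<bar>t1\<bar>) * min (mu True) (mu False) * \<delta>"
    have E0: "E0 > 0" using mupos[of True] mupos[of False] \<delta> by (simp add: E0_def)
    have PE: "\<delta> * P b x s \<ge> E0 * Q x" if "t0 \<le> s" "s \<le> t1" for b x s
    proof -
      have "\<bar>\<Gamma> * s\<bar> \<le> \<bar>\<Gamma>\<bar> * \<bar>t1\<bar>" using that t0 by (simp add: abs_mult mult_left_mono)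
      then have "exp (- \<bar>\<Gamma>\<bar> * \<bar>t1\<bar>) \<le> exp (\<Gamma> * s)" by simp
      moreover have "min (mu True) (mu False) \<le> mu (\<not> b)" by (cases b) auto
      ultimately have "exp (- \<bar>\<Gamma>\<bar> * \<bar>t1\<bar>) * min (mu True) (mu False) \<le> exp (\<Gamma> * s) * mu (\<not> b)"
        using mupos[of True] mupos[of False] by (intro mult_mono) auto
      from mult_right_mono[OF this, of "\<delta> * Q x"] Q(1)[of x] \<delta>
      show ?thesis by (simp add: E0_def P_def algebra_simps)
    qed
    \<comment> \<open>Outside this radius the penalty exceeds any possible excess of
      \<open>w\<close> over \<open>f\<close>, which is at most
      \<open>\<bar>M\<bar> + \<bar>B\<bar>\<close>.\<close>
    define \<rho> where "\<rho> = sqrt (2 * (\<bar>M\<bar> + \<bar>B\<bar> + 1) / E0)"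
    have far: "Z b x s > 0" if "x$k \<le> 0" "t0 \<le> s" "s \<le> t1" "norm x > \<rho>" for b x s
    proof -
      have "2 * (\<bar>M\<bar> + \<bar>B\<bar> + 1) / E0 \<le> (norm x)\<^sup>2"
        using sqrt_le_D[OF less_imp_le[OF that(4)[unfolded \<rho>_def]]] .
      then have "\<bar>M\<bar> + \<bar>B\<bar> + 1 \<le> E0 * ((norm x)\<^sup>2 / 2)" using E0 by (simp add: field_simps)
      also have "\<dots> \<le> E0 * Q x" using E0 Q(2)[of x] by (intro mult_left_mono) auto
      also have "\<dots> \<le> \<delta> * P b x s" by (rule PE) (use that in auto)
      finally show ?thesis using M[of s x b] wB[of x s b] that t0 by (auto simp: Z_def)
    qed
    have init: "Z b x t0 > 0" if "x$k \<le> 0" for b x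
      using w0[OF that, of b] mult_pos_pos[OF \<delta> P0[of b x t0]] by (simp add: Z_def)
    have neg': "Z b x t \<le> 0" using neg by (simp add: Z_def P_def)
    obtain b x t where c: "x$k \<le> 0" "t0 < t" "t \<le> t1" "Z b x t = 0"
       and nn: "\<And>b' y s. y$k \<le> 0 \<Longrightarrow> t0 \<le> s \<Longrightarrow> s \<le> t \<Longrightarrow> Z b' y s \<ge> 0"
      using first_contact[of k t0 t1 Z \<rho> x t b, OF Zc init far x neg'] by blast
    have fw: "f b x t < w b x t" using c(4) mult_pos_pos[OF \<delta> P0[of b x t]] by (simp add: Z_def)
    obtain a \<gamma> q where J: "jetg (w b) x t a \<gamma> q"
         "x$k < 0 \<Longrightarrow> a - Dc b * (\<Sum>j\<in>UNIV. q j) \<le> G b (w b x t)"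
         "x$k = 0 \<Longrightarrow> Dc b * \<gamma> k \<le> mu (\<not> b) * w (\<not> b) x t - mu b * w b x t"
      using wj[OF c(1,2,3) fw] by blast
    define e where "e = \<delta> * (mu (\<not> b) * exp (\<Gamma> * t))"
    have e0: "e > 0" using \<delta> mupos[of "\<not> b"] by (simp add: e_def)
    have J': "jetg (\<lambda>x t. w b x t - \<delta> * P b x t) x t (a - e * \<Gamma> * Q x) (\<lambda>j. \<gamma> j - e * (2 * x$j + (if j = k then 1 else 0)))
          (\<lambda>j. q j - e * 2)"
      by (rule jetg_cong[OF jetg_diff[OF J(1) jetg_cmult[OF jP]]]) (auto simp: e_def P_def)
    have eq: "f b x t = w b x t - \<delta> * P b x t" using c(4) by (simp add: Z_def)
    have eP: "\<delta> * P b x t = e * Q x" by (simp add: e_def P_def)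
    show False
    proof (cases "x$k < 0")
      case True
      obtain a1 g1 q1 where F: "jetg (f b) x t a1 g1 q1" "a1 - Dc b * (\<Sum>j\<in>UNIV. q1 j) = G b (f b x t)"
        using eqn[OF True, of t b] c t0 by auto
      have "open {y::real^'n. y$k < 0}" by (simp add: open_halfspace_component_lt_cart)
      then have "\<forall>\<^sub>F y in nhds x. y$k < 0" using True eventually_nhds_in_open[of "{y. y$k < 0}" x] by auto
      then have sp: "\<forall>\<^sub>F y in nhds x. w b y t - \<delta> * P b y t \<le> f b y t"
        by (rule eventually_mono) (use nn[of _ t b] c in \<open>auto simp: Z_def\<close>)
      have tm: "w b x s - \<delta> * P b x s \<le> f b x s" if "t0 \<le> s" "s \<le> t" for s
        using nn[of x s b] that c by (auto simp: Z_def)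
      note C = jetg_contact[OF F(1) J' eq sp tm c(2)]
      have "(\<Sum>j\<in>UNIV. q j - e * 2) \<le> (\<Sum>j\<in>UNIV. q1 j)" by (intro sum_mono C(2))
      then have S: "(\<Sum>j\<in>UNIV. q j) - 2 * e * N \<le> (\<Sum>j\<in>UNIV. q1 j)"
        by (simp add: sum_subtractf N_def algebra_simps)
      have "G b (f b x t) \<le> (a - e * \<Gamma> * Q x) - Dc b * ((\<Sum>j\<in>UNIV. q j) - 2 * e * N)"
        using C(1) mult_left_mono[OF S less_imp_le[OF Dpos[of b]]] F(2) by linarith
      also have "\<dots> \<le> G b (w b x t) - e * \<Gamma> * Q x + 2 * e * N * Dc b"
        using J(2)[OF True] by (simp add: algebra_simps)
      finally have 1: "e * \<Gamma> * Q x - 2 * e * N * Dc b \<le> G b (w b x t) - G b (f b x t)" by simp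
      have b1: "\<bar>f b x t\<bar> \<le> M" using M[of t x b] c t0 by auto
      have b2: "w b x t \<le> B" using wB[of x t b] c by auto
      have "\<bar>G b (w b x t) - G b (f b x t)\<bar> \<le> L * \<bar>w b x t - f b x t\<bar>"
        by (rule L) (use b1 b2 fw in \<open>auto simp: R_def abs_le_iff\<close>)
      then have 2: "G b (w b x t) - G b (f b x t) \<le> L * (e * Q x)" using eq eP fw by simp
      have "e * ((\<Gamma> - L) * Q x - 2 * N * Dc b) \<le> 0" using 1 2 by (simp add: algebra_simps)
      then have 3: "(\<Gamma> - L) * Q x \<le> 2 * N * Dc b" using e0 by (simp add: mult_le_0_iff)
      have "\<Gamma> - L > 0" using N0 Dpos[of True] Dpos[of False] by (simp add: \<Gamma>_def add_pos_pos)
      from mult_left_mono[OF Q(1)[of x] less_imp_le[OF this]]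
      have "(\<Gamma> - L) / 2 \<le> 2 * N * Dc b" using 3 by simp
      moreover have "N * Dc b \<le> N * (Dc True + Dc False)"
        using N0 Dpos[of True] Dpos[of False] by (cases b) (auto simp: algebra_simps)
      ultimately show False by (simp add: \<Gamma>_def)
    next
      case False
      then have xk: "x$k = 0" using c by simp
      \<comment> \<open>On the interface the penalty has normal derivative \<open>e > 0\<close>,
        coming from the term \<open>x$k\<close> alone; this strictness contradicts the sign at a
        first contact.\<close>
      have "((\<lambda>s. w b (x + s *\<^sub>R axis k 1) t - \<delta> * P b (x + s *\<^sub>R axis k 1) t) has_real_derivative \<gamma> k - e) (at 0)"
      proof -
        obtain p where "\<forall>\<^sub>F s in nhds 0. ((\<lambda>r. w b (x + r *\<^sub>R axis k 1) t - \<delta> * P b (x + r *\<^sub>R axis k 1) t) has_real_derivative p s) (at s)"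
           "p 0 = \<gamma> k - e * (2 * x$k + (if k = k then 1 else 0))" by (rule jetg_line[OF J'])
        from eventually_nhds_x_imp_x[OF this(1)] this(2) xk show ?thesis by simp
      qed
      then have dw: "((\<lambda>s. w b (x + s *\<^sub>R axis k 1) t - \<delta> * P b (x + s *\<^sub>R axis k 1) t) has_real_derivative \<gamma> k - e) (at_left 0)"
        by (rule has_field_derivative_at_within)
      have t: "t > 0" using c t0 by simp
      have "((\<lambda>s. Z b (x + s *\<^sub>R axis k 1) t) has_real_derivative
          (mu (\<not> b) * f (\<not> b) x t - mu b * f b x t) / Dc b - (\<gamma> k - e)) (at_left 0)"
        unfolding Z_def by (rule DERIV_diff[OF bdry[OF xk t] dw])
      then have "(mu (\<not> b) * f (\<not> b) x t - mu b * f b x t) / Dc b - (\<gamma> k - e) \<le> 0"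
        by (rule at_left_deriv_nonpos) (use c nn[of _ t b] xk in \<open>auto simp: axis_def\<close>)
      then have 1: "mu (\<not> b) * f (\<not> b) x t - mu b * f b x t \<le> Dc b * \<gamma> k - Dc b * e"
        using Dpos[of b] by (simp add: field_simps)
      have wf: "w b x t = f b x t + \<delta> * P b x t" using eq by simp
      have "f (\<not> b) x t \<ge> w (\<not> b) x t - \<delta> * P (\<not> b) x t" using nn[of x t "\<not> b"] c by (simp add: Z_def)
      from mult_left_mono[OF this less_imp_le[OF mupos[of "\<not> b"]]]
      have "mu (\<not> b) * f (\<not> b) x t - mu b * f b x t \<ge> mu (\<not> b) * w (\<not> b) x t - mu b * w b x t"
        unfolding wf by (simp add: P_def algebra_simps)
      with 1 J(3)[OF xk] mult_pos_pos[OF Dpos[of b] e0] show False by linarith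
    qed
  qed
  define P where "P = mu (\<not> b) * (exp (\<Gamma> * t) * Q x)"
  have P0: "P > 0" using Q(1)[of x] mupos[of "\<not> b"] by (auto simp: P_def)
  show ?thesis
  proof (rule ccontr)
    assume n: "\<not> ?thesis"
    \<comment> \<open>In place of a limit \<delta> \<rightarrow> 0: this \<delta> makes the penalty
      half of the alleged gap.\<close>
    then have "(w b x t - f b x t) / (2 * P) > 0" using P0 by simp
    from key[OF this] have "w b x t - (w b x t - f b x t) / (2 * P) * P \<le> f b x t" by (simp only: P_def)
    moreover have "(w b x t - f b x t) / (2 * P) * P = (w b x t - f b x t) / 2" using P0 by simp
    ultimately have "w b x t - (w b x t - f b x t) / 2 \<le> f b x t" by (simp only:)
    then show False using n by (simp add: field_simps)
  qed
qed

text \<open>The exchange conditions are linear, so changing the sign of both fields only turns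
  \<open>G b s\<close> into \<open>- G b (- s)\<close>. Supersolutions thus become
  subsolutions.\<close>

lemma coupled_uminus: "coupled Dc mu (\<lambda>b s. - G b (- s)) k (\<lambda>b x t. - f b x t)"
proof
  fix b show "Dc b > 0" "mu b > 0" using Dpos mupos by auto
next
  fix b R
  obtain L where L: "\<And>p q. \<bar>p\<bar> \<le> R \<Longrightarrow> \<bar>q\<bar> \<le> R \<Longrightarrow> \<bar>G b p - G b q\<bar> \<le> L * \<bar>p - q\<bar>" using Glip by blast
  have "\<bar>- G b (- p) - - G b (- q)\<bar> \<le> L * \<bar>p - q\<bar>" if "\<bar>p\<bar> \<le> R" "\<bar>q\<bar> \<le> R" for p q
    using L[of "-p" "-q"] that by (simp add: abs_minus_commute)
  then show "\<exists>L. \<forall>p q. \<bar>p\<bar> \<le> R \<and> \<bar>q\<bar> \<le> R \<longrightarrow> \<bar>- G b (- p) - - G b (- q)\<bar> \<le> L * \<bar>p - q\<bar>" by blast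
next
  fix b show "continuous_on ({x. x$k \<le> 0} \<times> {0..}) (\<lambda>(x,t). - f b x t)"
    using continuous_on_minus[OF cont[of b]] by (simp add: case_prod_unfold)
next
  fix x :: "real^'n" and t b assume "x$k < 0" "0 < (t::real)"
  then obtain a \<gamma> q where "jetg (f b) x t a \<gamma> q" "a - Dc b * (\<Sum>j\<in>UNIV. q j) = G b (f b x t)"
    using eqn by blast
  then have "jetg (\<lambda>x t. - f b x t) x t (- a) (\<lambda>j. - \<gamma> j) (\<lambda>j. - q j) \<and>
      - a - Dc b * (\<Sum>j\<in>UNIV. - q j) = - G b (- (- f b x t))"
    by (auto simp: sum_negf intro: jetg_uminus)
  then show "\<exists>a \<gamma> q. jetg (\<lambda>x t. - f b x t) x t a \<gamma> q \<and> a - Dc b * (\<Sum>j\<in>UNIV. q j) = - G b (- (- f b x t))" by blast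
next
  fix x :: "real^'n" and t b assume "x$k = 0" "0 < (t::real)"
  from DERIV_minus[OF bdry[OF this, of b]]
  show "((\<lambda>s. - f b (x + s *\<^sub>R axis k 1) t) has_real_derivative (mu (\<not> b) * (- f (\<not> b) x t) - mu b * (- f b x t)) / Dc b) (at_left 0)"
    by (rule DERIV_cong) (simp add: diff_divide_distrib)
next
  fix T show "\<exists>M. \<forall>b x t. 0 \<le> t \<and> t \<le> T \<and> x$k \<le> 0 \<longrightarrow> \<bar>- f b x t\<bar> \<le> M" using bdd[of T] by simp
qed

theorem comparison_super:
  assumes t0: "0 \<le> t0"
    and wc: "\<And>b. continuous_on ({x. x$k \<le> 0} \<times> {t0..t1}) (\<lambda>(x,t). w b x t)"
    and wB: "\<And>b x t. x$k \<le> 0 \<Longrightarrow> t0 \<le> t \<Longrightarrow> t \<le> t1 \<Longrightarrow> B \<le> w b x t"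
    and w0: "\<And>b x. x$k \<le> 0 \<Longrightarrow> f b x t0 \<le> w b x t0"
    and wj: "\<And>b x t. x$k \<le> 0 \<Longrightarrow> t0 < t \<Longrightarrow> t \<le> t1 \<Longrightarrow> w b x t < f b x t \<Longrightarrow>
       \<exists>a \<gamma> q. jetg (w b) x t a \<gamma> q \<and>
         (x$k < 0 \<longrightarrow> G b (w b x t) \<le> a - Dc b * (\<Sum>j\<in>UNIV. q j)) \<and>
         (x$k = 0 \<longrightarrow> mu (\<not> b) * w (\<not> b) x t - mu b * w b x t \<le> Dc b * \<gamma> k)"
    and x: "x$k \<le> 0" "t0 \<le> t" "t \<le> t1"
  shows "f b x t \<le> w b x t"
proof -
  interpret n: coupled Dc mu "\<lambda>b s. - G b (- s)" k "\<lambda>b x t. - f b x t" by (rule coupled_uminus)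
  have "- w b x t \<le> - f b x t"
  proof (rule n.comparison_sub[where w="\<lambda>b x t. - w b x t" and B="- B", OF t0])
    show "continuous_on ({x. x$k \<le> 0} \<times> {t0..t1}) (\<lambda>(x,t). - w b x t)" for b
      using continuous_on_minus[OF wc[of b]] by (simp add: case_prod_unfold)
    show "- w b x t \<le> - B" if "x$k \<le> 0" "t0 \<le> t" "t \<le> t1" for b x t using wB that by simp
    show "- w b x t0 \<le> - f b x t0" if "x$k \<le> 0" for b x using w0 that by simp
    fix b x t assume h: "x$k \<le> 0" "t0 < t" "t \<le> t1" "- f b x t < - w b x t"
    obtain a \<gamma> q where J: "jetg (w b) x t a \<gamma> q"
         "x$k < 0 \<Longrightarrow> G b (w b x t) \<le> a - Dc b * (\<Sum>j\<in>UNIV. q j)"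
         "x$k = 0 \<Longrightarrow> mu (\<not> b) * w (\<not> b) x t - mu b * w b x t \<le> Dc b * \<gamma> k"
      using wj[of x t b] h by auto
    show "\<exists>a \<gamma> q. jetg (\<lambda>x t. - w b x t) x t a \<gamma> q \<and>
         (x$k < 0 \<longrightarrow> a - Dc b * (\<Sum>j\<in>UNIV. q j) \<le> - G b (- (- w b x t))) \<and>
         (x$k = 0 \<longrightarrow> Dc b * \<gamma> k \<le> mu (\<not> b) * (- w (\<not> b) x t) - mu b * (- w b x t))"
      by (intro exI conjI, rule jetg_uminus[OF J(1)]) (use J(2,3) in \<open>auto simp: sum_negf\<close>)
  qed (use x in auto)
  then show ?thesis by simp
qed

lemma nonneg:
  assumes "\<And>b x. x$k \<le> 0 \<Longrightarrow> 0 \<le> f b x 0" and "\<And>b. G b 0 = 0" and "x$k \<le> 0" "0 \<le> t"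
  shows "0 \<le> f b x t"
proof (rule comparison_sub[where w="\<lambda>b x t. 0" and B=0 and ?t0.0=0 and ?t1.0=t])
  fix b x t assume "f b x t < 0"
  show "\<exists>a \<gamma> q. jetg (\<lambda>x t. 0) x t a \<gamma> q \<and>
         (x$k < 0 \<longrightarrow> a - Dc b * (\<Sum>j\<in>UNIV. q j) \<le> G b 0) \<and>
         (x$k = 0 \<longrightarrow> Dc b * \<gamma> k \<le> mu (\<not> b) * 0 - mu b * 0)"
    by (intro exI conjI, rule jetg_const) (auto simp: assms)
qed (use assms in \<open>auto intro!: continuous_intros\<close>)

end

section \<open>Growth inside one half-space\<close>

lemma norm_sq_sum: "(norm (x::real^'n::finite))\<^sup>2 = (\<Sum>j\<in>UNIV. (x$j)\<^sup>2)"
  unfolding power2_norm_eq_inner inner_vec_def by (simp add: power2_eq_square)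

lemma jetg_moving_sqdist:
  "jetg (\<lambda>x s. (norm (x - c - (s - t0) *\<^sub>R a))\<^sup>2) x t (- 2 * (a \<bullet> (x - c - (t - t0) *\<^sub>R a)))
     (\<lambda>j. 2 * (x - c - (t - t0) *\<^sub>R a) $ j) (\<lambda>j. 2)"
proof (rule jetgI[where p="\<lambda>j s. 2 * (x - c - (t - t0) *\<^sub>R a) $ j + 2 * s"])
  have "((\<lambda>s. (x - c - (s - t0) *\<^sub>R a) \<bullet> (x - c - (s - t0) *\<^sub>R a)) has_vector_derivative
      - a \<bullet> (x - c - (t - t0) *\<^sub>R a) + (x - c - (t - t0) *\<^sub>R a) \<bullet> (- a)) (at t)"
    unfolding has_vector_derivative_def
    by (auto intro!: derivative_eq_intros simp: algebra_simps inner_commute)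
  then show "((\<lambda>s. (norm (x - c - (s - t0) *\<^sub>R a))\<^sup>2) has_real_derivative - 2 * (a \<bullet> (x - c - (t - t0) *\<^sub>R a))) (at t)"
    unfolding power2_norm_eq_inner has_real_derivative_iff_has_vector_derivative
    by (simp add: inner_commute inner_diff_right algebra_simps)
  fix j s
  have e: "x + r *\<^sub>R axis j 1 - c - (t - t0) *\<^sub>R a = x + r *\<^sub>R axis j 1 - (c + (t - t0) *\<^sub>R a)" for r
    by simp
  have e': "x - c - (t - t0) *\<^sub>R a = x - (c + (t - t0) *\<^sub>R a)" by simp
  show "((\<lambda>r. (norm (x + r *\<^sub>R axis j 1 - c - (t - t0) *\<^sub>R a))\<^sup>2) has_real_derivative
      2 * (x - c - (t - t0) *\<^sub>R a) $ j + 2 * s) (at s)"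
    unfolding e e' sqdist_line by (auto intro!: derivative_eq_intros)
qed (auto intro!: derivative_eq_intros)

lemma jetg_moving_inner:
  "jetg (\<lambda>x s. a \<bullet> (x - c - (s - t0) *\<^sub>R a)) x t (- (norm a)\<^sup>2) (\<lambda>j. a $ j) (\<lambda>j. 0)"
  by (rule jetgI[where p="\<lambda>j s. a $ j"])
     (auto intro!: derivative_eq_intros simp: inner_diff_right inner_add_right inner_axis power2_norm_eq_inner)

lemma exp1_ge2: "exp (-1::real) \<le> 1/2"
proof -
  have "exp 1 \<ge> (2::real)" using exp_ge_add_one_self[of 1] by simp
  then show ?thesis by (simp add: exp_minus field_simps)
qed

text \<open>All that propagation requires of the nonlinearity: near 0 it dominates a linear term
  with rate \<open>\<kappa> b\<close>, which may be negative. Barriers for propagation are therefore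
  kept below \<open>s0\<close>.\<close>

locale coupled_low = coupled Dc mu G k f
  for Dc mu :: "bool \<Rightarrow> real" and G :: "bool \<Rightarrow> real \<Rightarrow> real" and k :: "'n::finite"
    and f :: "bool \<Rightarrow> real^'n \<Rightarrow> real \<Rightarrow> real" +
  fixes \<kappa> :: "bool \<Rightarrow> real" and s0 :: real
  assumes nn: "x$k \<le> 0 \<Longrightarrow> 0 \<le> t \<Longrightarrow> 0 \<le> f b x t"
    and Glow: "0 \<le> s \<Longrightarrow> s \<le> s0 \<Longrightarrow> \<kappa> b * s \<le> G b s"
    and s0pos: "0 < s0"
begin

text \<open>The price in growth rate for living in a ball of radius r instead of the whole space: it
  is 4 N K D for a Gaussian exp (- K norm x ^ 2) with K r^2 = N / 2 + 1, and tends to 0 as r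
  grows.\<close>

definition loss :: "bool \<Rightarrow> real \<Rightarrow> real" where
  "loss b r = 4 * real CARD('n) * (real CARD('n) / 2 + 1) * Dc b / r\<^sup>2"

lemma loss_nonneg: "0 \<le> loss b r"
  using Dpos[of b] by (simp add: loss_def)

text \<open>The moving profile is \<open>exp (- a \<bullet> \<xi> / (2 D)) (exp (- K norm \<xi> ^ 2) - exp (- K r ^ 2))\<close>,
  \<open>\<xi> = x - x1 - (t - t0) a\<close>: the Galilean factor absorbs the drift at the cost \<open>norm a ^ 2 / (4 D)\<close>, and the
  truncated Gaussian is positive exactly on the ball and satisfies \<open>- D \<Delta>\<Psi> \<le> loss \<Psi>\<close> there.\<close>

lemma field_growth:
  assumes r: "0 < r" and A: "0 < A" and k1: "x1$k \<le> - r" "y$k \<le> - r" and t0: "0 \<le> t0" and \<tau>: "0 < \<tau>"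
    and src: "\<And>x. norm (x - x1) < r \<Longrightarrow> A \<le> f b x t0"
    and cap: "A * exp (\<bar>\<kappa> b\<bar> * \<tau>) \<le> s0"
  shows "A / 2 * exp (- (norm (y - x1) * r / (2 * Dc b * \<tau>))
      + ((\<kappa> b - loss b r) * \<tau> - (norm (y - x1))\<^sup>2 / (4 * Dc b * \<tau>))) \<le> f b y (t0 + \<tau>)"
proof -
  \<comment> \<open>The velocity that carries the centre from \<open>x1\<close> to \<open>y\<close>
    in time \<tau>.\<close>
  define a where "a = (1 / \<tau>) *\<^sub>R (y - x1)"
  define D where "D = Dc b"
  have D0: "D > 0" using Dpos by (simp add: D_def)
  define \<Lambda> where "\<Lambda> = \<kappa> b - loss b r - (norm a)\<^sup>2 / (4 * D)"
  \<comment> \<open>The Gaussian is subharmonic where K norm \<xi> ^ 2 is at least N / 2; the extra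
    1 makes the truncation level at most half of the Gaussian in the remaining core.\<close>
  define K where "K = (real CARD('n) / 2 + 1) / r\<^sup>2"
  have N0: "real CARD('n) > 0" by simp
  have K0: "K > 0" using r N0 by (simp add: K_def add_pos_pos)
  have Kr: "K * r\<^sup>2 = real CARD('n) / 2 + 1" using r by (simp add: K_def)
  have lK: "loss b r = 4 * real CARD('n) * K * D" using r by (simp add: loss_def K_def D_def)
  define \<psi>r where "\<psi>r = exp (- K * r\<^sup>2)"
  \<comment> \<open>On the ball the Galilean factor can be as large as
    \<open>exp (norm a * r / (2 * D))\<close>; dividing by it keeps the profile below the source
    level A at time \<open>t0\<close>.\<close>
  define A' where "A' = A * exp (- (norm a * r / (2 * D)))"
  have A'0: "A' > 0" using A by (simp add: A'_def)
  define \<xi> where "\<xi> x t = x - x1 - (t - t0) *\<^sub>R a" for x t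
  define E where "E x t = exp (\<Lambda> * (t - t0) - (1 / (2 * D)) * (a \<bullet> \<xi> x t))" for x t
  define \<Psi> where "\<Psi> x t = exp (- K * (norm (\<xi> x t))\<^sup>2)" for x t
  define W where "W x t = A' * (E x t * (\<Psi> x t - \<psi>r))" for x t
  define w where "w b' x t = (if b' = b then W x t else 0)" for b' x t
  have pos: "norm (\<xi> x t) < r" if "W x t > 0" for x t
  proof -
    have "\<Psi> x t > \<psi>r" using that A'0 by (simp add: W_def E_def zero_less_mult_iff)
    then have "(norm (\<xi> x t))\<^sup>2 < r\<^sup>2" using K0 by (simp add: \<Psi>_def \<psi>r_def)
    then show ?thesis using r by (simp add: power_less_imp_less_base)
  qed
  have upper: "W x t \<le> A * exp (\<Lambda> * (t - t0))" for x t
  proof (cases "W x t > 0")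
    case True
    note p = pos[OF True]
    have 1: "\<Psi> x t - \<psi>r \<le> 1" "\<Psi> x t - \<psi>r > 0" using K0 True A'0
      by (auto simp: \<Psi>_def \<psi>r_def W_def E_def zero_less_mult_iff intro: order_trans[of _ "exp _ - 0"])
         (smt (verit) exp_gt_zero exp_le_one_iff mult_nonneg_nonneg zero_le_power2)
    have "\<bar>a \<bullet> \<xi> x t\<bar> \<le> norm a * norm (\<xi> x t)" by (rule Cauchy_Schwarz_ineq2)
    also have "\<dots> \<le> norm a * r" using p by (intro mult_left_mono) auto
    finally have "- (1 / (2 * D)) * (a \<bullet> \<xi> x t) \<le> norm a * r / (2 * D)"
      using D0 by (simp add: field_simps abs_le_iff)
    then have "E x t \<le> exp (\<Lambda> * (t - t0) + norm a * r / (2 * D))" by (simp add: E_def)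
    then have "E x t * (\<Psi> x t - \<psi>r) \<le> exp (\<Lambda> * (t - t0) + norm a * r / (2 * D)) * 1"
      using 1 by (intro mult_mono) auto
    then have "W x t \<le> A' * exp (\<Lambda> * (t - t0) + norm a * r / (2 * D))"
      using A'0 by (simp add: W_def)
    also have "\<dots> = A * exp (\<Lambda> * (t - t0))" by (simp add: A'_def exp_add exp_minus)
    finally show ?thesis .
  next
    case False
    moreover have "0 \<le> A * exp (\<Lambda> * (t - t0))" using A by simp
    ultimately show ?thesis by linarith
  qed
  have cap': "A * exp (\<Lambda> * (t - t0)) \<le> s0" if "t0 \<le> t" "t \<le> t0 + \<tau>" for t
  proof -
    have "(norm a)\<^sup>2 / (4 * D) \<ge> 0" using D0 by simp
    then have "\<Lambda> \<le> \<bar>\<kappa> b\<bar>" using loss_nonneg[of b r] by (simp add: \<Lambda>_def)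
    then have "\<Lambda> * (t - t0) \<le> \<bar>\<kappa> b\<bar> * (t - t0)" using that by (intro mult_right_mono) auto
    also have "\<dots> \<le> \<bar>\<kappa> b\<bar> * \<tau>" using that by (intro mult_left_mono) auto
    finally have "A * exp (\<Lambda> * (t - t0)) \<le> A * exp (\<bar>\<kappa> b\<bar> * \<tau>)" using A by simp
    then show ?thesis using cap by simp
  qed
  \<comment> \<open>The centre moves along a segment between two points of depth at least r, so the
    ball never meets the interface and no exchange condition has to be checked.\<close>
  have tube: "(x1 + (t - t0) *\<^sub>R a) $ k \<le> - r" if "t0 \<le> t" "t \<le> t0 + \<tau>" for t
  proof -
    define \<theta> where "\<theta> = (t - t0) / \<tau>"
    have \<theta>: "0 \<le> \<theta>" "\<theta> \<le> 1" using that \<tau> by (auto simp: \<theta>_def)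
    have "(x1 + (t - t0) *\<^sub>R a) $ k = (1 - \<theta>) * x1$k + \<theta> * y$k"
      by (simp add: a_def \<theta>_def field_simps)
    also have "\<dots> \<le> (1 - \<theta>) * (- r) + \<theta> * (- r)" using \<theta> k1 by (intro add_mono mult_left_mono) auto
    finally show ?thesis by (simp add: algebra_simps)
  qed
  have "w b y (t0 + \<tau>) \<le> f b y (t0 + \<tau>)"
  proof (rule comparison_sub[where w=w and B=s0 and ?t0.0=t0 and ?t1.0="t0 + \<tau>"])
    fix b' show "continuous_on ({x. x$k \<le> 0} \<times> {t0..t0+\<tau>}) (\<lambda>(x,t). w b' x t)"
      unfolding w_def W_def E_def \<Psi>_def \<xi>_def case_prod_unfold
      using D0 by (cases "b' = b") (auto intro!: continuous_intros)
  next
    fix b' and x :: "real^'n" and t assume h: "x$k \<le> 0" "t0 \<le> t" "t \<le> t0 + \<tau>"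
    show "w b' x t \<le> s0" using upper[of x t] cap'[of t] h s0pos by (auto simp: w_def)
  next
    fix b' and x :: "real^'n" assume h: "x$k \<le> 0"
    show "w b' x t0 \<le> f b' x t0"
    proof (cases "b' = b \<and> W x t0 > 0")
      case True
      then have "A \<le> f b x t0" using pos[of x t0] src[of x] by (simp add: \<xi>_def)
      then show ?thesis using True upper[of x t0] by (simp add: w_def)
    next
      case False
      then show ?thesis using nn[OF h t0, of b'] by (auto simp: w_def)
    qed
  next
    fix b' and x :: "real^'n" and t assume h: "x$k \<le> 0" "t0 < t" "t \<le> t0 + \<tau>" "f b' x t < w b' x t"
    have f0: "0 \<le> f b' x t" using nn h t0 by auto
    then have b': "b' = b" and Wp: "W x t > 0" using h by (auto simp: w_def split: if_splits)
    have weq: "w b' = W" using b' by (intro ext) (simp add: w_def)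
    note p = pos[OF Wp]
    have xk: "x$k < 0"
    proof -
      have "\<bar>\<xi> x t $ k\<bar> < r" using p component_le_norm_cart[of "\<xi> x t" k] by linarith
      moreover have "x$k = \<xi> x t $ k + (x1 + (t - t0) *\<^sub>R a) $ k" by (simp add: \<xi>_def)
      ultimately show ?thesis using tube[of t] h by linarith
    qed
    have Psi: "\<Psi> x t > \<psi>r" using Wp A'0 by (simp add: W_def E_def zero_less_mult_iff)
    have jE: "jetg E x t (E x t * (\<Lambda> + (norm a)\<^sup>2 / (2 * D))) (\<lambda>j. E x t * (- a$j / (2 * D)))
       (\<lambda>j. E x t * ((a$j)\<^sup>2 / (4 * D\<^sup>2)))"
    proof -
      have 1: "jetg (\<lambda>x s. \<Lambda> * (s - t0)) x t \<Lambda> (\<lambda>j. 0) (\<lambda>j. 0)"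
        by (rule jetg_time) (auto intro!: derivative_eq_intros)
      show ?thesis unfolding E_def \<xi>_def
        by (rule jetg_cong[OF jetg_exp[OF jetg_diff[OF 1 jetg_cmult[OF jetg_moving_inner]]]])
           (auto simp: power2_eq_square)
    qed
    have jP: "jetg (\<lambda>x t. \<Psi> x t - \<psi>r) x t (\<Psi> x t * (2 * K * (a \<bullet> \<xi> x t))) (\<lambda>j. \<Psi> x t * (- 2 * K * \<xi> x t $ j))
       (\<lambda>j. \<Psi> x t * (4 * K\<^sup>2 * (\<xi> x t $ j)\<^sup>2 - 2 * K))"
      unfolding \<Psi>_def \<xi>_def
      by (rule jetg_cong[OF jetg_diff[OF jetg_exp[OF jetg_cmult[OF jetg_moving_sqdist]] jetg_const]])
         (auto simp: power2_eq_square algebra_simps)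
    note jW = jetg_cmult[OF jetg_mult[OF jE jP], of A', folded W_def]
    let ?E = "E x t" and ?P = "\<Psi> x t" and ?X = "\<xi> x t"
    have q1: "E x t * ((a$j)\<^sup>2 / (4 * D\<^sup>2)) * (?P - \<psi>r) + 2 * (?E * (- a$j / (2 * D))) * (?P * (- 2 * K * ?X$j))
        + ?E * (?P * (4 * K\<^sup>2 * (?X$j)\<^sup>2 - 2 * K))
      = ?E * ((?P - \<psi>r) / (4 * D\<^sup>2)) * (a$j)\<^sup>2 + ?E * ?P * (2 * K / D) * (a$j * ?X$j)
        + ?E * ?P * 4 * K\<^sup>2 * (?X$j)\<^sup>2 - ?E * ?P * 2 * K" for j
      using D0 by (simp add: field_simps)
    have S: "(\<Sum>j\<in>UNIV. E x t * ((a$j)\<^sup>2 / (4 * D\<^sup>2)) * (?P - \<psi>r) + 2 * (?E * (- a$j / (2 * D))) * (?P * (- 2 * K * ?X$j))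
        + ?E * (?P * (4 * K\<^sup>2 * (?X$j)\<^sup>2 - 2 * K)))
      = ?E * ((?P - \<psi>r) / (4 * D\<^sup>2)) * (norm a)\<^sup>2 + ?E * ?P * (2 * K / D) * (a \<bullet> ?X)
        + ?E * ?P * 4 * K\<^sup>2 * (norm ?X)\<^sup>2 - ?E * ?P * 2 * K * real CARD('n)"
      unfolding q1 sum_subtractf sum.distrib
      by (simp add: sum_distrib_left[symmetric] sum_divide_distrib[symmetric] norm_sq_sum inner_vec_def)
    \<comment> \<open>Far from the centre the Gaussian is subharmonic and the left side is
      nonpositive; in the core the Gaussian is at most twice its truncation, which is what
      \<open>loss\<close> is made for.\<close>
    have G: "D * (2 * real CARD('n) * K - 4 * K\<^sup>2 * (norm ?X)\<^sup>2) * ?P \<le> loss b r * (?P - \<psi>r)"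
    proof (cases "2 * K * (norm ?X)\<^sup>2 \<ge> real CARD('n)")
      case True
      then have "2 * K * (2 * K * (norm ?X)\<^sup>2) \<ge> 2 * K * real CARD('n)" using K0 by (intro mult_left_mono) auto
      then have "2 * real CARD('n) * K - 4 * K\<^sup>2 * (norm ?X)\<^sup>2 \<le> 0" by (simp add: power2_eq_square algebra_simps)
      then have "D * (2 * real CARD('n) * K - 4 * K\<^sup>2 * (norm ?X)\<^sup>2) * ?P \<le> 0" using D0
        by (simp add: \<Psi>_def mult_le_0_iff)
      also have "0 \<le> loss b r * (?P - \<psi>r)" using loss_nonneg Psi by simp
      finally show ?thesis .
    next
      case False
      have "\<psi>r = exp (- real CARD('n) / 2) * exp (- 1)" by (simp add: \<psi>r_def Kr exp_add[symmetric])
      also have "\<dots> \<le> exp (- real CARD('n) / 2) * (1 / 2)" by (intro mult_left_mono exp1_ge2) auto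
      also have "\<dots> \<le> ?P * (1 / 2)" using False by (simp add: \<Psi>_def)
      finally have h: "?P / 2 \<le> ?P - \<psi>r" by simp
      have "D * (2 * real CARD('n) * K - 4 * K\<^sup>2 * (norm ?X)\<^sup>2) * ?P \<le> D * (2 * real CARD('n) * K) * ?P"
        using D0 K0 by (intro mult_right_mono mult_left_mono) (auto simp: \<Psi>_def)
      also have "\<dots> = loss b r * (?P / 2)" by (simp add: lK)
      also have "\<dots> \<le> loss b r * (?P - \<psi>r)" using h loss_nonneg by (intro mult_left_mono) auto
      finally show ?thesis .
    qed
    \<comment> \<open>The motion of the Gaussian contributes a term in
      \<open>a \<bullet> \<xi>\<close>, which the cross term with the Galilean factor cancels; of
      \<open>(norm a)\<^sup>2 / (2 * D)\<close> one half is used up by the squared gradient of that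
      factor.\<close>
    have id: "A' * (E x t * (\<Lambda> + (norm a)\<^sup>2 / (2 * D)) * (?P - \<psi>r) + ?E * (?P * (2 * K * (a \<bullet> ?X))))
       - D * (A' * (?E * ((?P - \<psi>r) / (4 * D\<^sup>2)) * (norm a)\<^sup>2 + ?E * ?P * (2 * K / D) * (a \<bullet> ?X)
        + ?E * ?P * 4 * K\<^sup>2 * (norm ?X)\<^sup>2 - ?E * ?P * 2 * K * real CARD('n)))
      = A' * ?E * ((\<Lambda> + (norm a)\<^sup>2 / (4 * D)) * (?P - \<psi>r) + D * (2 * real CARD('n) * K - 4 * K\<^sup>2 * (norm ?X)\<^sup>2) * ?P)"
      using D0 by (simp add: field_simps power2_eq_square)
    have "(\<Lambda> + (norm a)\<^sup>2 / (4 * D)) * (?P - \<psi>r) + D * (2 * real CARD('n) * K - 4 * K\<^sup>2 * (norm ?X)\<^sup>2) * ?P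
        \<le> (\<Lambda> + (norm a)\<^sup>2 / (4 * D)) * (?P - \<psi>r) + loss b r * (?P - \<psi>r)" using G by simp
    also have "\<dots> = \<kappa> b * (?P - \<psi>r)" by (simp add: \<Lambda>_def algebra_simps)
    finally have "A' * ?E * ((\<Lambda> + (norm a)\<^sup>2 / (4 * D)) * (?P - \<psi>r) + D * (2 * real CARD('n) * K - 4 * K\<^sup>2 * (norm ?X)\<^sup>2) * ?P)
        \<le> A' * ?E * (\<kappa> b * (?P - \<psi>r))" using A'0 by (intro mult_left_mono) (auto simp: E_def)
    also have "\<dots> = \<kappa> b * W x t" by (simp add: W_def)
    also have "\<dots> \<le> G b (W x t)"
      using Wp upper[of x t] cap'[of t] h by (intro Glow) auto
    finally have fin: "A' * ?E * ((\<Lambda> + (norm a)\<^sup>2 / (4 * D)) * (?P - \<psi>r) + D * (2 * real CARD('n) * K - 4 * K\<^sup>2 * (norm ?X)\<^sup>2) * ?P)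
        \<le> G b (W x t)" .
    show "\<exists>a \<gamma> q. jetg (w b') x t a \<gamma> q \<and>
         (x$k < 0 \<longrightarrow> a - Dc b' * (\<Sum>j\<in>UNIV. q j) \<le> G b' (w b' x t)) \<and>
         (x$k = 0 \<longrightarrow> Dc b' * \<gamma> k \<le> mu (\<not> b') * w (\<not> b') x t - mu b' * w b' x t)"
      unfolding weq
      apply (intro exI conjI impI)
        apply (rule jW)
      subgoal unfolding sum_distrib_left[symmetric] S b' D_def[symmetric] id by (rule fin)
      subgoal using xk by simp
      done
  qed (use t0 \<tau> k1 r in auto)
  then have 1: "W y (t0 + \<tau>) \<le> f b y (t0 + \<tau>)" by (simp add: w_def)
  \<comment> \<open>At the final time the ball is centred at y, where the truncated Gaussian is at
    least 1/2.\<close>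
  have "\<xi> y (t0 + \<tau>) = 0" using \<tau> by (simp add: \<xi>_def a_def)
  then have 2: "W y (t0 + \<tau>) = A' * (exp (\<Lambda> * \<tau>) * (1 - \<psi>r))" by (simp add: W_def E_def \<Psi>_def)
  have "\<psi>r \<le> exp (- 1)" by (simp add: \<psi>r_def Kr)
  then have "1 - \<psi>r \<ge> 1 / 2" using exp1_ge2 by linarith
  then have 3: "A' * (exp (\<Lambda> * \<tau>) * (1 / 2)) \<le> A' * (exp (\<Lambda> * \<tau>) * (1 - \<psi>r))" using A'0
    by (intro mult_left_mono) auto
  have na: "norm a = norm (y - x1) / \<tau>" using \<tau> by (simp add: a_def)
  have "A' * (exp (\<Lambda> * \<tau>) * (1 / 2)) = A / 2 * exp (- (norm a * r / (2 * D)) + \<Lambda> * \<tau>)"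
    by (simp only: A'_def exp_add)
  also have "- (norm a * r / (2 * D)) + \<Lambda> * \<tau> = - (norm (y - x1) * r / (2 * D * \<tau>))
      + ((\<kappa> b - loss b r) * \<tau> - (norm (y - x1))\<^sup>2 / (4 * D * \<tau>))"
    using \<tau> D0 by (simp add: na \<Lambda>_def field_simps power2_eq_square)
  finally show ?thesis using 1 2 3 by (simp add: D_def)
qed

text \<open>For moves of bounded length and duration only a uniform positive factor matters: the
  exponent of \<open>field_growth\<close> is bounded below by its worst case. The factor must not
  depend on positions, since the moves are repeated all along the interface.\<close>

lemma field_crude:
  assumes r: "0 < r" and \<tau>: "0 < \<tau>1" "\<tau>1 \<le> \<tau>2" and d: "0 \<le> d"
  obtains c where "0 < c" "c \<le> 1"
    "\<And>x1 y t0 \<tau> A. 0 < A \<Longrightarrow> A * exp (\<bar>\<kappa> b\<bar> * \<tau>2) \<le> s0 \<Longrightarrow> x1$k \<le> - r \<Longrightarrow> y$k \<le> - r \<Longrightarrow> 0 \<le> t0 \<Longrightarrow>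
       \<tau>1 \<le> \<tau> \<Longrightarrow> \<tau> \<le> \<tau>2 \<Longrightarrow> norm (y - x1) \<le> d \<Longrightarrow> (\<And>x. norm (x - x1) < r \<Longrightarrow> A \<le> f b x t0) \<Longrightarrow>
       c * A \<le> f b y (t0 + \<tau>)"
proof -
  define D where "D = Dc b"
  have D0: "D > 0" using Dpos by (simp add: D_def)
  define e where "e = d * r / (2 * D * \<tau>1) + (\<bar>\<kappa> b\<bar> + loss b r) * \<tau>2 + d\<^sup>2 / (4 * D * \<tau>1)"
  have e0: "0 \<le> e" using d r D0 \<tau> loss_nonneg[of b r] by (auto simp: e_def intro!: add_nonneg_nonneg)
  show ?thesis
  proof (rule that[of "exp (- e) / 2"])
    show "exp (- e) / 2 \<le> 1" using e0 by (smt (verit) exp_le_one_iff field_sum_of_halves)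
    fix x1 y t0 \<tau> and A :: real
    assume h: "0 < A" "A * exp (\<bar>\<kappa> b\<bar> * \<tau>2) \<le> s0" "x1$k \<le> - r" "y$k \<le> - r" "0 \<le> t0"
       "\<tau>1 \<le> \<tau>" "\<tau> \<le> \<tau>2" "norm (y - x1) \<le> d" "\<And>x. norm (x - x1) < r \<Longrightarrow> A \<le> f b x t0"
    have "A * exp (\<bar>\<kappa> b\<bar> * \<tau>) \<le> A * exp (\<bar>\<kappa> b\<bar> * \<tau>2)" using h by (intro mult_left_mono) (auto simp: mult_left_mono)
    then have cap: "A * exp (\<bar>\<kappa> b\<bar> * \<tau>) \<le> s0" using h(2) by linarith
    have 1: "norm (y - x1) * r / (2 * D * \<tau>) \<le> d * r / (2 * D * \<tau>1)"
      using h d r D0 \<tau> by (intro frac_le mult_mono) auto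
    have 2: "(norm (y - x1))\<^sup>2 / (4 * D * \<tau>) \<le> d\<^sup>2 / (4 * D * \<tau>1)"
      using h d r D0 \<tau> by (intro frac_le mult_mono power_mono) auto
    have "(\<bar>\<kappa> b\<bar> + loss b r) * \<tau> \<le> (\<bar>\<kappa> b\<bar> + loss b r) * \<tau>2"
      using h loss_nonneg[of b r] by (intro mult_left_mono) auto
    moreover have "- (\<bar>\<kappa> b\<bar> + loss b r) * \<tau> \<le> (\<kappa> b - loss b r) * \<tau>"
      using h \<tau> by (intro mult_right_mono) auto
    ultimately have 3: "- ((\<bar>\<kappa> b\<bar> + loss b r) * \<tau>2) \<le> (\<kappa> b - loss b r) * \<tau>" by linarith
    have "exp (- e) / 2 * A \<le> A / 2 * exp (- (norm (y - x1) * r / (2 * D * \<tau>))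
      + ((\<kappa> b - loss b r) * \<tau> - (norm (y - x1))\<^sup>2 / (4 * D * \<tau>)))"
      using 1 2 3 h(1) by (simp add: e_def)
    also have "\<dots> \<le> f b y (t0 + \<tau>)" unfolding D_def
      by (rule field_growth) (use h r \<tau> cap in auto)
    finally show "exp (- e) / 2 * A \<le> f b y (t0 + \<tau>)" .
  qed simp
qed

end

section \<open>Transmission across the interface\<close>

context coupled_low
begin

text \<open>Mirror paraboloids \<open>R t - norm (x - x0) ^ 2\<close> and \<open>R t - norm (x - x0') ^ 2\<close> with \<open>x0'\<close> the reflection of
  \<open>x0\<close> agree on the interface; \<open>exp (K p)\<close> with large \<open>K\<close> is a subsolution away from the centre, and the
  second component starts later (shift \<open>1/2\<close>) so that the exchange condition drives it.\<close>

lemma crossing: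
  obtains c where "0 < c" "c \<le> 1"
    "\<And>x0 A t0 x. 0 < A \<Longrightarrow> A \<le> s0 \<Longrightarrow> x0$k = -1 \<Longrightarrow> 0 \<le> t0 \<Longrightarrow>
       (\<And>x t. norm (x - x0) < 1/2 \<Longrightarrow> t0 \<le> t \<Longrightarrow> t \<le> t0 + 1 \<Longrightarrow> A \<le> f b x t) \<Longrightarrow>
       norm (x - (x0 + (4/5) *\<^sub>R axis k 1)) < 1/5 \<Longrightarrow> c * A \<le> f (\<not> b) x (t0 + 1)"
proof -
  define N where "N = real CARD('n)"
  define Lc where "Lc = \<bar>\<kappa> True\<bar> + \<bar>\<kappa> False\<bar>"
  have Lc: "- Lc * s \<le> G b s" if "0 \<le> s" "s \<le> s0" for b s
  proof -
    have "- Lc \<le> \<kappa> b" by (cases b) (auto simp: Lc_def)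
    then have "- Lc * s \<le> \<kappa> b * s" using that by (intro mult_right_mono) auto
    then show ?thesis using Glow[OF that, of b] by linarith
  qed
  define m where "m = mu b" define m' where "m' = mu (\<not> b)"
  have m: "m > 0" "m' > 0" using mupos by (auto simp: m_def m'_def)
  define D0 where "D0 = min (Dc True) (Dc False)"
  have D0: "D0 > 0" "D0 \<le> Dc b" for b
    using Dpos[of True] Dpos[of False] by (cases b; auto simp: D0_def)+
  define Dm where "Dm = Dc True + Dc False"
  have Dm: "Dc b \<le> Dm" for b using Dpos[of True] Dpos[of False] by (cases b) (auto simp: Dm_def)
  \<comment> \<open>Chosen so that \<open>Dc b' * K\<close> outweighs, in both half-spaces, the
    growth 11/4 of the squared radius, the Laplacian of the paraboloid, the reaction and both
    exchange rates.\<close>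
  define K where "K = 1 + (11/4 + 2 * Dm * N + Lc + m + m') / D0"
  have N0: "N > 0" by (simp add: N_def)
  have Lc0: "Lc \<ge> 0" by (simp add: Lc_def)
  have Dm0: "Dm > 0" using Dpos[of True] Dpos[of False] by (simp add: Dm_def)
  have K1: "K \<ge> 1" using D0(1) N0 Lc0 Dm0 m by (auto simp: K_def intro!: divide_nonneg_pos add_nonneg_nonneg)
  have KD: "Dc b' * K \<ge> 11/4 + 2 * Dc b' * N + Lc + m + m'" for b'
  proof -
    have "D0 * K = D0 + (11/4 + 2 * Dm * N + Lc + m + m')" using D0(1) by (simp add: K_def field_simps)
    moreover have "D0 * K \<le> Dc b' * K" using D0 K1 by (intro mult_right_mono) auto
    moreover have "2 * Dc b' * N \<le> 2 * Dm * N" using Dm N0 by (intro mult_right_mono) auto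
    ultimately show ?thesis using D0(1) by linarith
  qed
  define e where "e = exp (- K / 2)"
  have e: "0 < e" "e < 1" using K1 by (auto simp: e_def)
  define D' where "D' = Dc (\<not> b)"
  have D'0: "D' > 0" using Dpos by (simp add: D'_def)
  \<comment> \<open>An amplitude ratio small enough that the influx left by the delay,
    \<open>m * (1 - e)\<close>, covers the normal derivative and the exchange back; the summand m in
    the denominator forces \<open>c1 \<le> 1\<close>.\<close>
  define c1 where "c1 = m * (1 - e) / (2 * D' * K + m' + m)"
  have den: "2 * D' * K + m' + m > 0" using D'0 K1 m by (simp add: add_pos_pos)
  have c1: "0 < c1" "c1 \<le> 1"
  proof -
    show "0 < c1" using den m e by (simp add: c1_def)
    have "m * (1 - e) \<le> m * 1" using m e by (intro mult_left_mono) auto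
    moreover have "0 < 2 * D' * K" using D'0 K1 by simp
    ultimately have "m * (1 - e) \<le> 2 * D' * K + m' + m" using m by linarith
    then show "c1 \<le> 1" using den by (simp add: c1_def)
  qed
  have c1e: "c1 * (2 * D' * K + m') * e \<le> m * (1 - e)"
  proof -
    have "c1 * (2 * D' * K + m') * e \<le> c1 * (2 * D' * K + m') * 1"
      using c1 D'0 K1 m e by (intro mult_left_mono) auto
    also have "\<dots> \<le> c1 * (2 * D' * K + m' + m)" using c1 m by simp
    also have "\<dots> = m * (1 - e)" using den by (simp add: c1_def)
    finally show ?thesis .
  qed
  define c where "c = exp (- 3 * K) * c1 * (exp (K / 2) - 1)"
  show ?thesis
  proof (rule that[of c])
    show "0 < c" using c1 K1 by (simp add: c_def)
    have "exp (- 3 * K) * c1 * (exp (K / 2) - 1) \<le> exp (- 3 * K) * 1 * (exp (3 * K) - 0)"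
      using c1 K1 by (intro mult_mono diff_mono) auto
    then show "c \<le> 1" by (simp add: c_def exp_minus)
  next
    fix x0 :: "real^'n" and A t0 x
    assume A: "0 < A" "A \<le> s0" and x0: "x0$k = -1" and t0: "0 \<le> t0"
      and src: "\<And>x t. norm (x - x0) < 1/2 \<Longrightarrow> t0 \<le> t \<Longrightarrow> t \<le> t0 + 1 \<Longrightarrow> A \<le> f b x t"
      and x: "norm (x - (x0 + (4/5) *\<^sub>R axis k 1)) < 1/5"
    define x0' where "x0' = x0 + 2 *\<^sub>R axis k 1"
    have x0'k: "x0'$k = 1" by (simp add: x0'_def x0)
    define cen where "cen b' = (if b' = b then x0 else x0')" for b'
    \<comment> \<open>The squared radius starts at 1/4, the source ball, and reaches 3 at time
      \<open>t0 + 1\<close>.\<close>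
    define R where "R t = 1/4 + 11/4 * (t - t0)" for t
    define p where "p b' x t = R t - (norm (x - cen b'))\<^sup>2" for b' x t
    \<comment> \<open>With this delay the second component is positive only where
      \<open>p > 1/2\<close>, which at time \<open>t0\<close> is nowhere.\<close>
    define sh where "sh b' = (if b' = b then 0 else K / 2)" for b'
    define A0 where "A0 = A * exp (- 3 * K)"
    define Am where "Am b' = (if b' = b then A0 else c1 * A0)" for b'
    have A0: "A0 > 0" using A by (simp add: A0_def)
    have Am: "0 < Am b'" "Am b' \<le> A0" for b' using A0 c1 by (auto simp: Am_def mult_le_cancel_right1)
    define w where "w b' x t = Am b' * (exp (K * p b' x t - sh b') - 1)" for b' x t
    have sh: "sh b' \<ge> 0" for b' using K1 by (simp add: sh_def)
    have pu: "p b' x t \<le> 3" if "t \<le> t0 + 1" for b' x t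
    proof -
      have "p b' x t \<le> R t" by (simp add: p_def)
      also have "R t \<le> 3" using that by (simp add: R_def field_simps)
      finally show ?thesis .
    qed
    have wu: "w b' x t \<le> A" if "t \<le> t0 + 1" for b' x t
    proof -
      have "K * p b' x t \<le> K * 3" using pu[OF that, of b' x] K1 by (intro mult_left_mono) auto
      then have "exp (K * p b' x t - sh b') \<le> exp (3 * K)" using sh[of b'] by simp
      then have "exp (K * p b' x t - sh b') - 1 \<le> exp (3 * K)" by linarith
      then have "w b' x t \<le> Am b' * exp (3 * K)" using Am(1)[of b'] by (simp add: w_def)
      also have "\<dots> \<le> A0 * exp (3 * K)" using Am by simp
      also have "\<dots> = A" by (simp add: A0_def exp_minus)
      finally show ?thesis .
    qed
    have bd: "(norm (y - x0'))\<^sup>2 = (norm (y - x0))\<^sup>2 - 4 * y$k" for y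
    proof -
      have "y - x0' = y + (- 2) *\<^sub>R axis k 1 - x0" by (simp add: x0'_def)
      then show ?thesis using sqdist_line[of y "-2" k x0] by (simp only:) (simp add: x0)
    qed
    have "w (\<not> b) x (t0 + 1) \<le> f (\<not> b) x (t0 + 1)"
    proof (rule comparison_sub[where w=w and B=A and ?t0.0=t0 and ?t1.0="t0 + 1"])
      fix b' show "continuous_on ({x. x$k \<le> 0} \<times> {t0..t0+1}) (\<lambda>(x,t). w b' x t)"
        unfolding w_def p_def R_def case_prod_unfold by (auto intro!: continuous_intros)
    next
      fix b' and y :: "real^'n" assume h: "y$k \<le> 0"
      show "w b' y t0 \<le> f b' y t0"
      proof (cases "w b' y t0 > 0")
        case False then show ?thesis using nn[OF h t0, of b'] by linarith
      next
        case True
        then have "K * p b' y t0 - sh b' > 0" using Am[of b'] by (simp add: w_def zero_less_mult_iff)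
        then have "p b' y t0 > 0" using sh[of b'] K1 by (smt (verit) mult_nonneg_nonpos)
        then have n: "(norm (y - cen b'))\<^sup>2 < (1/2)\<^sup>2" by (simp add: p_def R_def power2_eq_square)
        then have n': "norm (y - cen b') < 1/2" by (rule power_less_imp_less_base) simp
        have "b' = b"
        proof (rule ccontr)
          assume "b' \<noteq> b"
          then have "\<bar>(y - x0')$k\<bar> < 1/2" using n' component_le_norm_cart[of "y - x0'" k] by (simp add: cen_def)
          then show False using h x0'k by simp
        qed
        then have "A \<le> f b' y t0" using src[of y t0] n' by (simp add: cen_def)
        then show ?thesis using wu[of t0 b' y] by linarith
      qed
    next
      fix b' and y :: "real^'n" and t assume h: "y$k \<le> 0" "t0 < t" "t \<le> t0 + 1" "f b' y t < w b' y t"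
      have f0: "0 \<le> f b' y t" using nn h t0 by auto
      then have wp: "w b' y t > 0" using h by linarith
      define E where "E = exp (K * p b' y t - sh b')"
      have E1: "E > 1" using wp Am[of b'] by (simp add: w_def E_def zero_less_mult_iff)
      \<comment> \<open>Near the source centre f is at least A, which bounds \<open>w\<close>, so no
        contact is possible; near the mirror centre there are no points of the half-space. Hence the
        gradient of p is bounded below at contacts.\<close>
      have cd: "(norm (y - cen b'))\<^sup>2 \<ge> 1/4"
      proof (rule ccontr)
        assume "\<not> ?thesis"
        then have "(norm (y - cen b'))\<^sup>2 < (1/2)\<^sup>2" by (simp add: power2_eq_square)
        then have n': "norm (y - cen b') < 1/2" by (rule power_less_imp_less_base) simp
        have "b' = b"
        proof (rule ccontr)
          assume "b' \<noteq> b"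
          then have "\<bar>(y - x0')$k\<bar> < 1/2" using n' component_le_norm_cart[of "y - x0'" k] by (simp add: cen_def)
          then show False using h x0'k by simp
        qed
        then have "A \<le> f b' y t" using src[of y t] n' h by (simp add: cen_def)
        then show False using wu[of t b' y] h by linarith
      qed
      have jp: "jetg (p b') y t (11/4) (\<lambda>j. - 2 * (y - cen b')$j) (\<lambda>j. - 2)"
      proof -
        have 1: "jetg (\<lambda>x s. R s) y t (11/4) (\<lambda>j. 0) (\<lambda>j. 0)"
          unfolding R_def by (rule jetg_time) (auto intro!: derivative_eq_intros)
        show ?thesis unfolding p_def
          by (rule jetg_cong[OF jetg_diff[OF 1 jetg_sqdist]]) auto
      qed
      have jw: "jetg (w b') y t (Am b' * (E * (K * (11/4)))) (\<lambda>j. Am b' * (E * (K * (- 2 * (y - cen b')$j))))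
         (\<lambda>j. Am b' * (E * (K\<^sup>2 * 4 * ((y - cen b')$j)\<^sup>2 - 2 * K)))"
        unfolding w_def
        by (rule jetg_cong[OF jetg_cmult[OF jetg_diff[OF jetg_exp[OF jetg_diff[OF jetg_cmult[OF jp] jetg_const]] jetg_const]]])
           (auto simp: E_def power2_eq_square algebra_simps)
      have S: "(\<Sum>j\<in>UNIV. Am b' * (E * (K\<^sup>2 * 4 * ((y - cen b')$j)\<^sup>2 - 2 * K)))
         = Am b' * (E * (K\<^sup>2 * 4 * (norm (y - cen b'))\<^sup>2 - 2 * K * N))"
        unfolding sum_distrib_left[symmetric] sum_subtractf norm_sq_sum by (simp add: N_def)
      have int: "Am b' * (E * (K * (11/4))) - Dc b' * (Am b' * (E * (K\<^sup>2 * 4 * (norm (y - cen b'))\<^sup>2 - 2 * K * N)))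
            \<le> G b' (w b' y t)"
      proof -
        have "K * (11/4) - Dc b' * (K\<^sup>2 * 4 * (norm (y - cen b'))\<^sup>2 - 2 * K * N)
            = K * (11/4 + 2 * Dc b' * N - Dc b' * K * (4 * (norm (y - cen b'))\<^sup>2))"
          by (simp add: algebra_simps power2_eq_square)
        also have "\<dots> \<le> K * (11/4 + 2 * Dc b' * N - Dc b' * K * 1)"
          using cd K1 Dpos[of b'] by (intro mult_left_mono diff_mono) auto
        also have "\<dots> \<le> K * (- Lc)"
        proof -
          have "11/4 + 2 * Dc b' * N - Dc b' * K * 1 \<le> - Lc" using KD[of b'] m by linarith
          then show ?thesis using K1 by (intro mult_left_mono) auto
        qed
        also have "\<dots> \<le> - Lc" using K1 Lc0 by (simp add: mult_le_cancel_right1)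
        finally have 1: "K * (11/4) - Dc b' * (K\<^sup>2 * 4 * (norm (y - cen b'))\<^sup>2 - 2 * K * N) \<le> - Lc" .
        have "Am b' * (E * (K * (11/4))) - Dc b' * (Am b' * (E * (K\<^sup>2 * 4 * (norm (y - cen b'))\<^sup>2 - 2 * K * N)))
           = (Am b' * E) * (K * (11/4) - Dc b' * (K\<^sup>2 * 4 * (norm (y - cen b'))\<^sup>2 - 2 * K * N))"
          by (simp add: algebra_simps)
        also have "\<dots> \<le> (Am b' * E) * (- Lc)" using 1 Am[of b'] E1 by (intro mult_left_mono) auto
        also have "\<dots> \<le> - Lc * w b' y t"
        proof -
          have "w b' y t \<le> Am b' * E" using Am[of b'] by (simp add: w_def E_def)
          from mult_left_mono[OF this Lc0] show ?thesis by (simp add: mult.commute)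
        qed
        also have "\<dots> \<le> G b' (w b' y t)" using Lc[of "w b' y t" b'] wp wu[of t b' y] h A by auto
        finally show ?thesis .
      qed
      have bdr: "Dc b' * (Am b' * (E * (K * (- 2 * (y - cen b')$k)))) \<le> mu (\<not> b') * w (\<not> b') y t - mu b' * w b' y t"
        if yk: "y$k = 0"
      proof -
        \<comment> \<open>Points of the interface are equidistant from the two mirror
          centres.\<close>
        have peq: "p (\<not> b') y t = p b' y t" using bd[of y] yk by (simp add: p_def cen_def)
        show ?thesis
        proof (cases "b' = b")
          case True
          have ck: "(y - cen b')$k = 1" using True yk x0 by (simp add: cen_def)
          have w1: "w (\<not> b') y t \<ge> - A0"
          proof -
            have "w (\<not> b') y t \<ge> - Am (\<not> b')" using Am[of "\<not> b'"] by (simp add: w_def algebra_simps)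
            then show ?thesis using Am(2)[of "\<not> b'"] by linarith
          qed
          have w2: "w b' y t \<le> A0 * E" using A0 True by (simp add: w_def Am_def E_def)
          have "m' * (- A0) \<le> m' * w (\<not> b') y t" "m * w b' y t \<le> m * (A0 * E)"
            by (intro mult_left_mono w1 w2 less_imp_le[OF m(1)] less_imp_le[OF m(2)])+
          moreover have "m' * A0 \<le> m' * (A0 * E)" using m A0 E1 by simp
          ultimately have r: "- (m' + m) * (A0 * E) \<le> m' * w (\<not> b') y t - m * w b' y t"
            by (simp add: algebra_simps)
          have "0 \<le> 2 * Dc b * N" using Dpos[of b] N0 by simp
          then have "m + m' \<le> Dc b * K * 2" using KD[of b] Lc0 m by linarith
          then have "(m' + m) * (A0 * E) \<le> (Dc b * K * 2) * (A0 * E)"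
            using A0 E1 by (intro mult_right_mono) auto
          then have "Dc b' * (Am b' * (E * (K * (- 2 * (y - cen b')$k)))) \<le> - (m' + m) * (A0 * E)"
            using True unfolding ck by (simp add: Am_def algebra_simps)
          then show ?thesis using r True by (simp add: m_def m'_def)
        next
          case False
          then have b': "b' = (\<not> b)" "(\<not> b') = b" by auto
          have ck: "(y - cen b')$k = - 1" using False yk x0'k by (simp add: cen_def)
          define F where "F = exp (K * p b' y t)"
          have EF: "E = F * e" using False by (simp add: E_def F_def sh_def e_def exp_add[symmetric])
          have w1: "w b y t = A0 * (F - 1)" using peq by (simp add: w_def Am_def sh_def F_def b')
          have w2: "w b' y t = c1 * A0 * (F * e - 1)" 
            unfolding w_def E_def[symmetric] EF using False by (simp add: Am_def)
          have F1: "1 < F * e" using E1 EF by simp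
          have F0: "F > 0" by (simp add: F_def)
          have "D' * (c1 * A0 * (F * e * (K * 2))) + m' * (c1 * A0 * (F * e - 1))
             \<le> D' * (c1 * A0 * (F * e * (K * 2))) + m' * (c1 * A0 * (F * e))"
            using m c1 A0 by simp
          also have "\<dots> = A0 * F * (c1 * (2 * D' * K + m') * e)" by (simp add: algebra_simps)
          also have "\<dots> \<le> A0 * F * (m * (1 - e))" using c1e A0 F0 by (intro mult_left_mono) auto
          also have "\<dots> = A0 * m * (F - F * e)" by (simp add: algebra_simps)
          also have "\<dots> \<le> A0 * m * (F - 1)" using F1 A0 m by (intro mult_left_mono) auto
          finally have "D' * (c1 * A0 * (F * e * (K * 2))) \<le> m * (A0 * (F - 1)) - m' * (c1 * A0 * (F * e - 1))"
            by (simp add: algebra_simps)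
          then show ?thesis unfolding ck w2 b'(2) w1 EF
            using b' by (simp add: Am_def D'_def m_def m'_def algebra_simps)
        qed
      qed
      show "\<exists>a \<gamma> q. jetg (w b') y t a \<gamma> q \<and>
         (y$k < 0 \<longrightarrow> a - Dc b' * (\<Sum>j\<in>UNIV. q j) \<le> G b' (w b' y t)) \<and>
         (y$k = 0 \<longrightarrow> Dc b' * \<gamma> k \<le> mu (\<not> b') * w (\<not> b') y t - mu b' * w b' y t)"
        by (intro exI conjI impI, rule jw) (use S int bdr in auto)
    next
      show "x$k \<le> 0"
      proof -
        have "\<bar>(x - (x0 + (4/5) *\<^sub>R axis k 1))$k\<bar> < 1/5"
          using x component_le_norm_cart[of "x - (x0 + (4/5) *\<^sub>R axis k 1)" k] by linarith
        then have "(x - (x0 + (4/5) *\<^sub>R axis k 1))$k < 1/5" by (simp only: abs_less_iff)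
        then show ?thesis using x0 by simp
      qed
    qed (use t0 wu in auto)
    moreover have "c * A \<le> w (\<not> b) x (t0 + 1)"
    proof -
      \<comment> \<open>The target ball is centred at distance 6/5 from the mirror centre, so its
        points are within 7/5 of it and p is at least 3 - 49/25 > 1.\<close>
      have two: "(2::real) *\<^sub>R axis k 1 = (4/5) *\<^sub>R axis k 1 + (6/5) *\<^sub>R (axis k 1 :: real^'n)"
        by (simp add: scaleR_left_distrib[symmetric])
      have "x - x0' = (x - (x0 + (4/5) *\<^sub>R axis k 1)) + (- (6/5)) *\<^sub>R axis k 1"
        unfolding x0'_def two scaleR_minus_left by simp
      then have "norm (x - x0') \<le> norm (x - (x0 + (4/5) *\<^sub>R axis k 1)) + norm ((- (6/5)) *\<^sub>R (axis k 1 :: real^'n))"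
        by (metis norm_triangle_ineq)
      then have "norm (x - x0') \<le> 7/5" using x by simp
      then have "(norm (x - x0'))\<^sup>2 \<le> (7/5)\<^sup>2" by (intro power_mono) auto
      then have "p (\<not> b) x (t0 + 1) \<ge> 1" by (simp add: p_def R_def cen_def power2_eq_square)
      then have "K * p (\<not> b) x (t0 + 1) \<ge> K * 1" using K1 by (intro mult_left_mono) auto
      then have "exp (K / 2) \<le> exp (K * p (\<not> b) x (t0 + 1) - sh (\<not> b))" by (simp add: sh_def)
      then have "c1 * A0 * (exp (K / 2) - 1) \<le> w (\<not> b) x (t0 + 1)"
        using c1 A0 by (auto simp: w_def Am_def intro!: mult_left_mono)
      then show ?thesis by (simp add: c_def A0_def algebra_simps)
    qed
    ultimately show "c * A \<le> f (\<not> b) x (t0 + 1)" by linarith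
  qed
qed

text \<open>Three stages of unit duration: fill a small ball at depth 1, which then stays filled for
  a unit time; cross meanwhile; return to the original ball in the other field. The cost depends on
  r, but not on time or position.\<close>

lemma transfer:
  assumes r: "1 \<le> r"
  obtains c Amax where "0 < c" "c \<le> 1" "0 < Amax"
    "\<And>x0 A t0 x. 0 < A \<Longrightarrow> A \<le> Amax \<Longrightarrow> x0$k = - 2 * r \<Longrightarrow> 0 \<le> t0 \<Longrightarrow>
       (\<And>x. norm (x - x0) < r \<Longrightarrow> A \<le> f b x t0) \<Longrightarrow> norm (x - x0) < r \<Longrightarrow> c * A \<le> f (\<not> b) x (t0 + 3)"
proof -
  obtain c1 where c1: "0 < c1" "c1 \<le> 1"
    "\<And>x1 y t0 \<tau> A. 0 < A \<Longrightarrow> A * exp (\<bar>\<kappa> b\<bar> * 2) \<le> s0 \<Longrightarrow> x1$k \<le> - (1/2) \<Longrightarrow> y$k \<le> - (1/2) \<Longrightarrow> 0 \<le> t0 \<Longrightarrow>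
       1 \<le> \<tau> \<Longrightarrow> \<tau> \<le> 2 \<Longrightarrow> norm (y - x1) \<le> 2 * r \<Longrightarrow> (\<And>x. norm (x - x1) < 1/2 \<Longrightarrow> A \<le> f b x t0) \<Longrightarrow>
       c1 * A \<le> f b y (t0 + \<tau>)"
    by (rule field_crude[of "1/2" 1 2 "2 * r" b]) (use r in auto)
  obtain c2 where c2: "0 < c2" "c2 \<le> 1"
    "\<And>x0 A t0 x. 0 < A \<Longrightarrow> A \<le> s0 \<Longrightarrow> x0$k = -1 \<Longrightarrow> 0 \<le> t0 \<Longrightarrow>
       (\<And>x t. norm (x - x0) < 1/2 \<Longrightarrow> t0 \<le> t \<Longrightarrow> t \<le> t0 + 1 \<Longrightarrow> A \<le> f b x t) \<Longrightarrow>
       norm (x - (x0 + (4/5) *\<^sub>R axis k 1)) < 1/5 \<Longrightarrow> c2 * A \<le> f (\<not> b) x (t0 + 1)"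
    by (rule crossing[of b]) auto
  obtain c3 where c3: "0 < c3" "c3 \<le> 1"
    "\<And>x1 y t0 \<tau> A. 0 < A \<Longrightarrow> A * exp (\<bar>\<kappa> (\<not> b)\<bar> * 1) \<le> s0 \<Longrightarrow> x1$k \<le> - (1/5) \<Longrightarrow> y$k \<le> - (1/5) \<Longrightarrow> 0 \<le> t0 \<Longrightarrow>
       1 \<le> \<tau> \<Longrightarrow> \<tau> \<le> 1 \<Longrightarrow> norm (y - x1) \<le> 3 * r \<Longrightarrow> (\<And>x. norm (x - x1) < 1/5 \<Longrightarrow> A \<le> f (\<not> b) x t0) \<Longrightarrow>
       c3 * A \<le> f (\<not> b) y (t0 + \<tau>)"
    by (rule field_crude[of "1/5" 1 1 "3 * r" "\<not> b"]) (use r in auto)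
  \<comment> \<open>Both rates and the longest duration 2 are covered, so no stage lifts a barrier
    above \<open>s0\<close>.\<close>
  define Amax where "Amax = s0 * exp (- (\<bar>\<kappa> True\<bar> + \<bar>\<kappa> False\<bar>) * 2)"
  have cap: "A * exp (\<bar>\<kappa> b'\<bar> * \<tau>) \<le> s0" if "0 < A" "A \<le> Amax" "0 \<le> \<tau>" "\<tau> \<le> 2" for A b' \<tau>
  proof -
    have "\<bar>\<kappa> b'\<bar> * \<tau> \<le> (\<bar>\<kappa> True\<bar> + \<bar>\<kappa> False\<bar>) * 2"
      using that by (intro mult_mono) (cases b'; auto)+
    then have "A * exp (\<bar>\<kappa> b'\<bar> * \<tau>) \<le> Amax * exp ((\<bar>\<kappa> True\<bar> + \<bar>\<kappa> False\<bar>) * 2)"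
      using that by (intro mult_mono) auto
    also have "\<dots> = s0" by (simp only: Amax_def mult.assoc exp_add[symmetric]) simp
    finally show ?thesis .
  qed
  show ?thesis
  proof (rule that[of "c3 * (c2 * c1)" Amax])
    show "0 < c3 * (c2 * c1)" "0 < Amax" using c1 c2 c3 s0pos by (auto simp: Amax_def)
    show "c3 * (c2 * c1) \<le> 1" using c1 c2 c3 by (simp add: mult_le_one)
    fix x0 x :: "real^'n" and A t0
    assume A: "0 < A" "A \<le> Amax" and x0: "x0$k = - 2 * r" and t0: "0 \<le> t0"
      and src: "\<And>x. norm (x - x0) < r \<Longrightarrow> A \<le> f b x t0" and x: "norm (x - x0) < r"
    \<comment> \<open>The point at depth 1 straight towards the interface from
      \<open>x0\<close>.\<close>
    define z where "z = x0 + (2 * r - 1) *\<^sub>R axis k 1"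
    have zk: "z$k = -1" by (simp add: z_def x0)
    have 1: "c1 * A \<le> f b y t" if "norm (y - z) < 1/2" "t0 + 1 \<le> t" "t \<le> t0 + 1 + 1" for y t
    proof -
      have "\<bar>(y - z)$k\<bar> < 1/2" using that component_le_norm_cart[of "y - z" k] by linarith
      then have "y$k - z$k < 1/2" unfolding vector_minus_component by linarith
      then have yk: "y$k \<le> - (1/2)" using zk by linarith
      have "y - x0 = (y - z) + (2 * r - 1) *\<^sub>R axis k 1" by (simp add: z_def)
      then have "norm (y - x0) \<le> norm (y - z) + norm ((2 * r - 1) *\<^sub>R (axis k 1 :: real^'n))"
        by (metis norm_triangle_ineq)
      then have d: "norm (y - x0) \<le> 2 * r" using that r by simp
      have "c1 * A \<le> f b y (t0 + (t - t0))"
        by (rule c1(3)[of A x0]) (use A cap[of A 2 b] x0 r yk d that t0 in \<open>auto intro!: src\<close>)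
      then show ?thesis by simp
    qed
    have c1A: "c1 * A \<le> A" using c1 A by (simp add: mult_le_cancel_right1)
    have As: "A \<le> s0" using cap[of A 0 b] A by simp
    have 2: "c2 * (c1 * A) \<le> f (\<not> b) y (t0 + 2)" if "norm (y - (z + (4/5) *\<^sub>R axis k 1)) < 1/5" for y
    proof -
      have "c2 * (c1 * A) \<le> f (\<not> b) y ((t0 + 1) + 1)"
        by (rule c2(3)[of "c1 * A" z]) (use c1(1) A(1) order_trans[OF c1A As] zk t0 1 that in auto)
      then show ?thesis by (simp add: add.assoc)
    qed
    define z2 where "z2 = z + (4/5) *\<^sub>R axis k (1::real)"
    have z2: "z2 = x0 + (2 * r - 1/5) *\<^sub>R axis k 1"
      by (simp add: z2_def z_def scaleR_left_distrib[symmetric] add.assoc)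
    have z2k: "z2$k = - (1/5)" by (simp add: z2_def zk)
    have "\<bar>(x - x0)$k\<bar> < r" using x component_le_norm_cart[of "x - x0" k] by linarith
    then have xk: "x$k \<le> - (1/5)" using x0 r by simp
    have "x - z2 = (x - x0) + (- (2 * r - 1/5)) *\<^sub>R axis k 1" unfolding z2 scaleR_minus_left by simp
    then have "norm (x - z2) \<le> norm (x - x0) + norm ((- (2 * r - 1/5)) *\<^sub>R (axis k 1 :: real^'n))"
      by (metis norm_triangle_ineq)
    then have d: "norm (x - z2) \<le> 3 * r" using x r by simp
    have "c2 * (c1 * A) \<le> A" using mult_mono[OF c2(2) c1A] c1(1) A(1) by simp
    then have le: "c2 * (c1 * A) \<le> Amax" using A(2) by linarith
    have "c3 * (c2 * (c1 * A)) \<le> f (\<not> b) x ((t0 + 2) + 1)"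
      by (rule c3(3)[of "c2 * (c1 * A)" z2])
         (use c1 c2 A cap[of "c2 * (c1 * A)" 1 "\<not> b"] le z2k xk d t0 2 in \<open>auto simp: z2_def[symmetric]\<close>)
    then show "c3 * (c2 * c1) * A \<le> f (\<not> b) x (t0 + 3)" by (simp add: mult.assoc add.assoc)
  qed
qed

end

section \<open>Spreading along the interface\<close>

context coupled_low
begin

text \<open>The factor from \<open>field_growth\<close> for carrying a full ball of radius r onto
  another one: its points are at distance at most \<zeta> + r from the old centre.\<close>

definition gain :: "bool \<Rightarrow> real \<Rightarrow> real \<Rightarrow> real \<Rightarrow> real" where
  "gain b r \<zeta> \<tau> = exp (- ((\<zeta> + r) * r / (2 * Dc b * \<tau>)) + ((\<kappa> b - loss b r) * \<tau> - (\<zeta> + r)\<^sup>2 / (4 * Dc b * \<tau>))) / 2"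

lemma ball_growth:
  assumes r: "0 < r" and A: "0 < A" and k1: "x0$k \<le> - 2 * r" "y0$k \<le> - 2 * r" and t0: "0 \<le> t0" and \<tau>: "0 < \<tau>"
    and src: "\<And>x. norm (x - x0) < r \<Longrightarrow> A \<le> f b x t0"
    and cap: "A * exp (\<bar>\<kappa> b\<bar> * \<tau>) \<le> s0" and \<zeta>: "norm (y0 - x0) \<le> \<zeta>" and x: "norm (x - y0) < r"
  shows "A * gain b r \<zeta> \<tau> \<le> f b x (t0 + \<tau>)"
proof -
  have "\<bar>(x - y0)$k\<bar> < r" using x component_le_norm_cart[of "x - y0" k] by linarith
  then have xk: "x$k \<le> - r" using k1 by simp
  have "x - x0 = (x - y0) + (y0 - x0)" by simp
  then have "norm (x - x0) \<le> norm (x - y0) + norm (y0 - x0)" by (metis norm_triangle_ineq)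
  then have d: "norm (x - x0) \<le> \<zeta> + r" using x \<zeta> by linarith
  have D0: "Dc b > 0" by (rule Dpos)
  have 1: "norm (x - x0) * r / (2 * Dc b * \<tau>) \<le> (\<zeta> + r) * r / (2 * Dc b * \<tau>)"
    using d r D0 \<tau> by (intro divide_right_mono mult_right_mono) auto
  have 2: "(norm (x - x0))\<^sup>2 / (4 * Dc b * \<tau>) \<le> (\<zeta> + r)\<^sup>2 / (4 * Dc b * \<tau>)"
    using d D0 \<tau> by (intro divide_right_mono power_mono) auto
  have "A * gain b r \<zeta> \<tau> \<le> A / 2 * exp (- (norm (x - x0) * r / (2 * Dc b * \<tau>))
      + ((\<kappa> b - loss b r) * \<tau> - (norm (x - x0))\<^sup>2 / (4 * Dc b * \<tau>)))"
    using 1 2 A by (simp add: gain_def)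
  also have "\<dots> \<le> f b x (t0 + \<tau>)"
    by (rule field_growth) (use assms xk in auto)
  finally show ?thesis .
qed

text \<open>For the displacement \<open>a * \<tau>\<close> the radius enters the exponent only
  through terms that stay bounded as \<tau> grows, so long moves realise the full rate. The bound
  \<tau> \<ge> 1 controls the terms with \<open>r\<^sup>2 / \<tau>\<close>.\<close>

lemma gain_lower:
  assumes r: "0 < r" and \<tau>: "1 \<le> \<tau>" and a: "0 \<le> a"
  shows "exp ((\<kappa> b - loss b r - a\<^sup>2 / (4 * Dc b)) * \<tau> - (a * r + r\<^sup>2) / Dc b) / 2 \<le> gain b r (a * \<tau>) \<tau>"
proof -
  define D where "D = Dc b"
  have D0: "D > 0" using Dpos by (simp add: D_def)
  have 1: "(a * \<tau> + r) * r / (2 * D * \<tau>) = a * r / (2 * D) + r\<^sup>2 / (2 * D * \<tau>)"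
    using D0 \<tau> by (simp add: field_simps power2_eq_square)
  have 2: "(a * \<tau> + r)\<^sup>2 / (4 * D * \<tau>) = a\<^sup>2 / (4 * D) * \<tau> + a * r / (2 * D) + r\<^sup>2 / (4 * D * \<tau>)"
    using D0 \<tau> by (simp add: field_simps power2_eq_square)
  have 3: "r\<^sup>2 / (2 * D * \<tau>) \<le> r\<^sup>2 / (2 * D)" "r\<^sup>2 / (4 * D * \<tau>) \<le> r\<^sup>2 / (4 * D)"
    using D0 \<tau> by (auto intro!: divide_left_mono)
  have "r\<^sup>2 / (2 * D) + r\<^sup>2 / (4 * D) \<le> r\<^sup>2 / D" using D0 by (simp add: field_simps)
  then have 4: "r\<^sup>2 / (2 * D * \<tau>) + r\<^sup>2 / (4 * D * \<tau>) \<le> r\<^sup>2 / D" using 3 by linarith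
  have 5: "a * r / (2 * D) + a * r / (2 * D) = a * r / D" by (simp add: field_simps)
  have "(\<kappa> b - loss b r - a\<^sup>2 / (4 * D)) * \<tau> - (a * r + r\<^sup>2) / D
     = (\<kappa> b - loss b r) * \<tau> - a\<^sup>2 / (4 * D) * \<tau> - a * r / D - r\<^sup>2 / D"
    by (simp add: algebra_simps add_divide_distrib)
  also have "\<dots> \<le> - ((a * \<tau> + r) * r / (2 * D * \<tau>)) + ((\<kappa> b - loss b r) * \<tau> - (a * \<tau> + r)\<^sup>2 / (4 * D * \<tau>))"
    unfolding 1 2 using 4 5 by linarith
  finally show ?thesis by (simp add: gain_def D_def)
qed

definition occ :: "real \<Rightarrow> real \<Rightarrow> real^'n \<Rightarrow> real \<Rightarrow> bool" where
  "occ r \<epsilon> x0 t \<longleftrightarrow> (\<forall>x. norm (x - x0) < r \<longrightarrow> \<epsilon> \<le> f True x t)"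

text \<open>One period of an indefinitely repeatable motion: the level \<epsilon> is kept, for all
  small \<epsilon> and in both directions, so the step can be iterated without tracking amplitudes.
  Time spent on crossings is hidden in S.\<close>

definition travels :: "'n \<Rightarrow> real \<Rightarrow> real \<Rightarrow> bool" where
  "travels i r c \<longleftrightarrow> (\<exists>S L \<epsilon>1. 0 < S \<and> c * S \<le> L \<and> 0 < \<epsilon>1 \<and> (\<forall>\<epsilon> x0 t \<sigma>. 0 < \<epsilon> \<longrightarrow> \<epsilon> \<le> \<epsilon>1 \<longrightarrow> x0$k = - 2 * r \<longrightarrow> 0 \<le> t \<longrightarrow>
      \<bar>\<sigma>\<bar> = 1 \<longrightarrow> occ r \<epsilon> x0 t \<longrightarrow> occ r \<epsilon> (x0 + (\<sigma> * L) *\<^sub>R axis i 1) (t + S)))"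

lemma travels_single:
  assumes r: "0 < r" and c: "0 \<le> c" and ik: "i \<noteq> k"
    and rate: "0 < \<kappa> True - loss True r - c\<^sup>2 / (4 * Dc True)"
  shows "travels i r c"
proof -
  define \<gamma> where "\<gamma> = \<kappa> True - loss True r - c\<^sup>2 / (4 * Dc True)"
  define C where "C = (c * r + r\<^sup>2) / Dc True"
  \<comment> \<open>Long enough for the rate to beat the bounded loss C by 1; then the exponential
    is at least 2 and outweighs the factor 1/2 in \<open>gain\<close>.\<close>
  define T where "T = max 1 ((C + 1) / \<gamma>)"
  have g0: "\<gamma> > 0" using rate by (simp add: \<gamma>_def)
  have T1: "T \<ge> 1" by (simp add: T_def)
  have "\<gamma> * ((C + 1) / \<gamma>) \<le> \<gamma> * T" using g0 by (intro mult_left_mono) (auto simp: T_def)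
  then have "1 \<le> \<gamma> * T - C" using g0 by simp
  then have "2 \<le> exp (\<gamma> * T - C)" using exp_ge_add_one_self[of "\<gamma> * T - C"] by linarith
  then have g1: "1 \<le> gain True r (c * T) T" using gain_lower[OF r T1 c, of True] unfolding \<gamma>_def C_def by linarith
  define \<epsilon>1 where "\<epsilon>1 = s0 * exp (- (\<bar>\<kappa> True\<bar> * T))"
  show ?thesis unfolding travels_def
  proof (rule exI[of _ T], rule exI[of _ "c * T"], rule exI[of _ \<epsilon>1], intro conjI allI impI)
    show "0 < \<epsilon>1" using s0pos by (simp add: \<epsilon>1_def)
    fix \<epsilon> t \<sigma> :: real and x0 :: "real^'n"
    assume h: "0 < \<epsilon>" "\<epsilon> \<le> \<epsilon>1" "x0$k = - 2 * r" "0 \<le> t" "\<bar>\<sigma>\<bar> = 1" "occ r \<epsilon> x0 t"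
    have "\<epsilon> * exp (\<bar>\<kappa> True\<bar> * T) \<le> \<epsilon>1 * exp (\<bar>\<kappa> True\<bar> * T)" using h by (intro mult_right_mono) auto
    also have "\<dots> = s0" unfolding \<epsilon>1_def mult.assoc exp_add[symmetric] by simp
    finally have cap: "\<epsilon> * exp (\<bar>\<kappa> True\<bar> * T) \<le> s0" .
    have n: "norm (x0 + (\<sigma> * (c * T)) *\<^sub>R axis i 1 - x0) \<le> c * T" using c T1 h(5) by (simp add: abs_mult)
    show "occ r \<epsilon> (x0 + (\<sigma> * (c * T)) *\<^sub>R axis i 1) (t + T)"
      unfolding occ_def
    proof (intro allI impI)
      fix x assume x: "norm (x - (x0 + (\<sigma> * (c * T)) *\<^sub>R axis i 1)) < r"
      have "\<epsilon> * 1 \<le> \<epsilon> * gain True r (c * T) T" using g1 h by (intro mult_left_mono) auto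
      also have "\<dots> \<le> f True x (t + T)"
        by (rule ball_growth[OF r h(1) _ _ h(4) _ _ cap n x]) (use h T1 ik in \<open>auto simp: occ_def axis_def\<close>)
      finally show "\<epsilon> \<le> f True x (t + T)" by simp
    qed
  qed (use T1 in auto)
qed

text \<open>The two crossings of a period cost fixed factors and the fixed time 6. Positive mean
  growth repays the factors and surplus velocity repays the time, once T is large. The growth in one
  of the fields alone may be negative.\<close>

lemma travels_double:
  assumes r: "1 \<le> r" and ik: "i \<noteq> k" and a: "0 \<le> a" and a': "0 \<le> a'" and \<theta>: "0 < \<theta>" "\<theta> < 1"
    and rate: "0 < \<theta> * (\<kappa> True - loss True r - a\<^sup>2 / (4 * Dc True)) + (1 - \<theta>) * (\<kappa> False - loss False r - a'\<^sup>2 / (4 * Dc False))"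
    and c: "0 \<le> c" "c < \<theta> * a + (1 - \<theta>) * a'"
  shows "travels i r c"
proof -
  obtain c1 A1 where c1: "0 < c1" "c1 \<le> 1" "0 < A1"
    "\<And>x0 A t0 x. 0 < A \<Longrightarrow> A \<le> A1 \<Longrightarrow> x0$k = - 2 * r \<Longrightarrow> 0 \<le> t0 \<Longrightarrow>
       (\<And>x. norm (x - x0) < r \<Longrightarrow> A \<le> f True x t0) \<Longrightarrow> norm (x - x0) < r \<Longrightarrow> c1 * A \<le> f (\<not> True) x (t0 + 3)"
    by (rule transfer[OF r, of True]) auto
  obtain c2 A2 where c2: "0 < c2" "c2 \<le> 1" "0 < A2"
    "\<And>x0 A t0 x. 0 < A \<Longrightarrow> A \<le> A2 \<Longrightarrow> x0$k = - 2 * r \<Longrightarrow> 0 \<le> t0 \<Longrightarrow>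
       (\<And>x. norm (x - x0) < r \<Longrightarrow> A \<le> f False x t0) \<Longrightarrow> norm (x - x0) < r \<Longrightarrow> c2 * A \<le> f (\<not> False) x (t0 + 3)"
    by (rule transfer[OF r, of False]) auto
  define g1 where "g1 = \<kappa> True - loss True r - a\<^sup>2 / (4 * Dc True)"
  define g2 where "g2 = \<kappa> False - loss False r - a'\<^sup>2 / (4 * Dc False)"
  define C1 where "C1 = (a * r + r\<^sup>2) / Dc True"
  define C2 where "C2 = (a' * r + r\<^sup>2) / Dc False"
  define \<gamma> where "\<gamma> = \<theta> * g1 + (1 - \<theta>) * g2"
  define v where "v = \<theta> * a + (1 - \<theta>) * a'"
  have \<gamma>0: "\<gamma> > 0" using rate by (simp add: \<gamma>_def g1_def g2_def)
  have vc: "v - c > 0" using c by (simp add: v_def)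
  \<comment> \<open>The logarithm of everything lost per period; 4 collects the factors 1/2 of the
    two \<open>gain\<close> bounds.\<close>
  define B where "B = C1 + C2 + ln (4 / (c1 * c2))"
  define T where "T = max (max (1 / \<theta>) (1 / (1 - \<theta>))) (max (B / \<gamma>) (6 * c / (v - c)))"
  have T: "T \<ge> 1 / \<theta>" "T \<ge> 1 / (1 - \<theta>)" "T \<ge> B / \<gamma>" "T \<ge> 6 * c / (v - c)" by (auto simp: T_def)
  define T1 where "T1 = \<theta> * T" define T2 where "T2 = (1 - \<theta>) * T"
  have T12: "1 \<le> T1" "1 \<le> T2" "T1 + T2 = T"
    using T(1,2) \<theta> by (auto simp: T1_def T2_def field_simps)
  have BT: "B \<le> \<gamma> * T" using T(3) \<gamma>0 by (simp add: field_simps)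
  have cT: "c * (T + 6) \<le> v * T" using T(4) vc by (simp add: field_simps)
  define G1 where "G1 = exp (g1 * T1 - C1) / 2"
  define G2 where "G2 = exp (g2 * T2 - C2) / 2"
  have G: "G1 \<le> gain True r (a * T1) T1" "G2 \<le> gain False r (a' * T2) T2"
    using gain_lower[of r T1 a True] gain_lower[of r T2 a' False] T12 r a a'
    by (auto simp: G1_def G2_def g1_def g2_def C1_def C2_def)
  have G0: "G1 > 0" "G2 > 0" by (auto simp: G1_def G2_def)
  have tot: "1 \<le> c2 * G2 * (c1 * G1)"
  proof -
    have "ln (4 / (c1 * c2)) \<le> (g1 * T1 - C1) + (g2 * T2 - C2)"
      using BT by (simp add: B_def \<gamma>_def T1_def T2_def algebra_simps)
    then have "4 / (c1 * c2) \<le> exp ((g1 * T1 - C1) + (g2 * T2 - C2))"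
      using c1(1) c2(1) ln_ge_iff[of "4 / (c1 * c2)"] by (metis divide_pos_pos exp_le_cancel_iff exp_ln mult_pos_pos zero_less_numeral)
    then have "4 \<le> exp (g1 * T1 - C1) * exp (g2 * T2 - C2) * (c1 * c2)"
      unfolding exp_add using c1(1) c2(1) by (simp add: pos_divide_le_eq)
    then show ?thesis by (simp add: G1_def G2_def mult_ac)
  qed
  \<comment> \<open>One summand for each of the four stages of a period; \<open>1 / Q\<close> bounds
    \<epsilon> so that every intermediate amplitude respects its cap.\<close>
  define Q where "Q = exp (\<bar>\<kappa> True\<bar> * T1) / s0 + G1 / A1 + c1 * G1 * exp (\<bar>\<kappa> False\<bar> * T2) / s0 + c1 * G1 * G2 / A2"
  have Q4: "0 < exp (\<bar>\<kappa> True\<bar> * T1) / s0" "0 < G1 / A1" "0 < c1 * G1 * exp (\<bar>\<kappa> False\<bar> * T2) / s0" "0 < c1 * G1 * G2 / A2"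
    using s0pos c1 c2 G0 by auto
  have Q0: "Q > 0" unfolding Q_def using Q4 by linarith
  have Qs: "\<epsilon> * X \<le> Y" if "0 < \<epsilon>" "\<epsilon> \<le> 1 / Q" "0 < Y" "X / Y \<le> Q" for \<epsilon> X Y
  proof -
    have "\<epsilon> * (X / Y) \<le> \<epsilon> * Q" using that by (intro mult_left_mono) auto
    also have "\<dots> \<le> 1" using that Q0 by (simp add: field_simps)
    finally show ?thesis using that by (simp add: field_simps)
  qed
  show ?thesis unfolding travels_def
  proof (rule exI[of _ "T + 6"], rule exI[of _ "v * T"], rule exI[of _ "1 / Q"], intro conjI allI impI)
    show "0 < T + 6" using T12 by linarith
    show "c * (T + 6) \<le> v * T" by (rule cT)
    show "0 < 1 / Q" using Q0 by simp
    fix \<epsilon> t \<sigma> :: real and x0 :: "real^'n"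
    assume h: "0 < \<epsilon>" "\<epsilon> \<le> 1 / Q" "x0$k = - 2 * r" "0 \<le> t" "\<bar>\<sigma>\<bar> = 1" "occ r \<epsilon> x0 t"
    have cap1: "\<epsilon> * exp (\<bar>\<kappa> True\<bar> * T1) \<le> s0" by (rule Qs) (use h s0pos Q4 in \<open>auto simp: Q_def\<close>)
    have cap2: "\<epsilon> * G1 \<le> A1" by (rule Qs) (use h c1 Q4 in \<open>auto simp: Q_def\<close>)
    have "\<epsilon> * (c1 * G1 * exp (\<bar>\<kappa> False\<bar> * T2)) \<le> s0"
      by (rule Qs) (use h s0pos Q4 in \<open>auto simp: Q_def\<close>)
    then have cap3: "(c1 * (\<epsilon> * G1)) * exp (\<bar>\<kappa> False\<bar> * T2) \<le> s0" by (simp add: algebra_simps)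
    have "\<epsilon> * (c1 * G1 * G2) \<le> A2" by (rule Qs) (use h c2 Q4 in \<open>auto simp: Q_def\<close>)
    then have cap4: "c1 * (\<epsilon> * G1) * G2 \<le> A2" by (simp add: algebra_simps)
    define x1 where "x1 = x0 + (\<sigma> * (a * T1)) *\<^sub>R axis i (1::real)"
    define x2 where "x2 = x1 + (\<sigma> * (a' * T2)) *\<^sub>R axis i (1::real)"
    have xk: "x1$k = - 2 * r" "x2$k = - 2 * r" using h(3) ik by (auto simp: x1_def x2_def axis_def)
    have n1: "norm (x1 - x0) \<le> a * T1" "norm (x2 - x1) \<le> a' * T2"
      using a a' T12 h(5) by (auto simp: x1_def x2_def abs_mult)
    have 1: "\<epsilon> * G1 \<le> f True x (t + T1)" if "norm (x - x1) < r" for x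
    proof -
      have "\<epsilon> * G1 \<le> \<epsilon> * gain True r (a * T1) T1" using G h by (intro mult_left_mono) auto
      also have "\<dots> \<le> f True x (t + T1)"
        by (rule ball_growth[OF _ h(1) _ _ h(4) _ _ cap1 n1(1) that]) (use h T12 xk r in \<open>auto simp: occ_def\<close>)
      finally show ?thesis .
    qed
    have 2: "c1 * (\<epsilon> * G1) \<le> f False x (t + T1 + 3)" if "norm (x - x1) < r" for x
      using c1(4)[of "\<epsilon> * G1" x1 "t + T1" x, OF _ cap2 xk(1) _ 1 that] h G0 T12 by auto
    have 3: "c1 * (\<epsilon> * G1) * G2 \<le> f False x (t + T1 + 3 + T2)" if "norm (x - x2) < r" for x
    proof -
      have "c1 * (\<epsilon> * G1) * G2 \<le> c1 * (\<epsilon> * G1) * gain False r (a' * T2) T2"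
        using G h c1 G0 by (intro mult_left_mono) auto
      also have "\<dots> \<le> f False x (t + T1 + 3 + T2)"
        by (rule ball_growth[OF _ _ _ _ _ _ 2 cap3 n1(2) that]) (use h T12 xk r c1 G0 in auto)
      finally show ?thesis .
    qed
    have 4: "c2 * (c1 * (\<epsilon> * G1) * G2) \<le> f True x (t + T1 + 3 + T2 + 3)" if "norm (x - x2) < r" for x
      using c2(4)[of "c1 * (\<epsilon> * G1) * G2" x2 "t + T1 + 3 + T2" x, OF _ cap4 xk(2) _ 3 that] h G0 T12 c1 by auto
    have x2: "x2 = x0 + (\<sigma> * (v * T)) *\<^sub>R axis i 1"
      by (simp add: x2_def x1_def v_def T1_def T2_def algebra_simps)
    have t2: "t + T1 + 3 + T2 + 3 = t + (T + 6)" using T12 by simp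
    have "\<epsilon> * 1 \<le> \<epsilon> * (c2 * G2 * (c1 * G1))" using tot h by (intro mult_left_mono) auto
    then have "\<epsilon> \<le> c2 * (c1 * (\<epsilon> * G1) * G2)" by (simp add: algebra_simps)
    then show "occ r \<epsilon> (x0 + (\<sigma> * (v * T)) *\<^sub>R axis i 1) (t + (T + 6))"
      using 4 unfolding occ_def x2[symmetric] t2 by (meson order_trans)
  qed
qed

text \<open>A ball can be moved by at most r without loss in any time between \<tau>0 and 2 \<tau>0.
  Chains of such steps reach any distance and, since the number of steps may be chosen, realise any
  sufficiently long time: this provides both filling and waiting.\<close>

lemma spreads:
  assumes r: "0 < r" and rate: "0 < \<kappa> True - loss True r"
  obtains \<tau>0 \<epsilon>1 where "0 < \<tau>0" "0 < \<epsilon>1"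
    "\<And>\<epsilon> x0 y t \<tau> n. 0 < \<epsilon> \<Longrightarrow> \<epsilon> \<le> \<epsilon>1 \<Longrightarrow> x0$k \<le> - 2 * r \<Longrightarrow> y$k \<le> - 2 * r \<Longrightarrow> 0 \<le> t \<Longrightarrow>
       occ r \<epsilon> x0 t \<Longrightarrow> norm (y - x0) \<le> real n * r \<Longrightarrow> 1 \<le> n \<Longrightarrow> real n * \<tau>0 \<le> \<tau> \<Longrightarrow> occ r \<epsilon> y (t + \<tau>)"
proof -
  define D where "D = Dc True"
  have D0: "D > 0" using Dpos by (simp add: D_def)
  define \<gamma> where "\<gamma> = \<kappa> True - loss True r"
  have \<gamma>0: "\<gamma> > 0" using rate by (simp add: \<gamma>_def)
  \<comment> \<open>With displacement and radius both r, the two losses in the exponent are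
    \<open>r\<^sup>2 / (D * \<tau>)\<close> each.\<close>
  define \<tau>0 where "\<tau>0 = max 1 ((2 * r\<^sup>2 / D + 1) / \<gamma>)"
  have \<tau>0: "\<tau>0 \<ge> 1" "\<tau>0 > 0" by (auto simp: \<tau>0_def)
  define \<epsilon>1 where "\<epsilon>1 = s0 * exp (- (\<bar>\<kappa> True\<bar> * (2 * \<tau>0)))"
  have gn: "1 \<le> gain True r r \<tau>" if "\<tau>0 \<le> \<tau>" for \<tau>
  proof -
    have \<tau>: "\<tau> \<ge> 1" using that \<tau>0 by simp
    have "(2 * r\<^sup>2 / D + 1) / \<gamma> \<le> \<tau>" using that by (simp add: \<tau>0_def)
    then have 1: "2 * r\<^sup>2 / D + 1 \<le> \<gamma> * \<tau>" using \<gamma>0 by (simp add: pos_divide_le_eq mult.commute)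
    have "(r + r) * r / (2 * D * \<tau>) = r\<^sup>2 / (D * \<tau>)" "(r + r)\<^sup>2 / (4 * D * \<tau>) = r\<^sup>2 / (D * \<tau>)"
      using D0 \<tau> by (auto simp: field_simps power2_eq_square)
    moreover have "r\<^sup>2 / (D * \<tau>) \<le> r\<^sup>2 / D" using D0 \<tau> by (auto intro!: divide_left_mono)
    moreover have "2 * (r\<^sup>2 / D) + 1 \<le> \<gamma> * \<tau>" using 1 by simp
    ultimately have "1 \<le> - ((r + r) * r / (2 * D * \<tau>)) + (\<gamma> * \<tau> - (r + r)\<^sup>2 / (4 * D * \<tau>))" (is "_ \<le> ?e")
      by linarith
    then have "2 \<le> exp ?e" using exp_ge_add_one_self[of ?e] by linarith
    then show ?thesis by (simp add: gain_def \<gamma>_def D_def)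
  qed
  have one: "occ r \<epsilon> y (t + \<tau>)"
    if h: "0 < \<epsilon>" "\<epsilon> \<le> \<epsilon>1" "x0$k \<le> - 2 * r" "y$k \<le> - 2 * r" "0 \<le> t" "occ r \<epsilon> x0 t" "norm (y - x0) \<le> r" "\<tau>0 \<le> \<tau>" "\<tau> \<le> 2 * \<tau>0"
    for \<epsilon> x0 y t \<tau>
    unfolding occ_def
  proof (intro allI impI)
    fix x assume x: "norm (x - y) < r"
    have "\<epsilon> * exp (\<bar>\<kappa> True\<bar> * \<tau>) \<le> \<epsilon>1 * exp (\<bar>\<kappa> True\<bar> * (2 * \<tau>0))" using h s0pos
      by (intro mult_mono) (auto simp: mult_left_mono \<epsilon>1_def)
    also have "\<dots> = s0" unfolding \<epsilon>1_def mult.assoc exp_add[symmetric] by simp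
    finally have cap: "\<epsilon> * exp (\<bar>\<kappa> True\<bar> * \<tau>) \<le> s0" .
    have "\<epsilon> * 1 \<le> \<epsilon> * gain True r r \<tau>" using gn[of \<tau>] h by (intro mult_left_mono) auto
    also have "\<dots> \<le> f True x (t + \<tau>)"
      by (rule ball_growth[OF r h(1,3,4,5) _ _ cap h(7) x]) (use h \<tau>0 in \<open>auto simp: occ_def\<close>)
    finally show "\<epsilon> \<le> f True x (t + \<tau>)" by simp
  qed
  have many: "occ r \<epsilon> y (t + \<tau>)"
    if "0 < \<epsilon>" "\<epsilon> \<le> \<epsilon>1" "x0$k \<le> - 2 * r" "y$k \<le> - 2 * r" "0 \<le> t" "occ r \<epsilon> x0 t" "norm (y - x0) \<le> real n * r"
       "1 \<le> n" "real n * \<tau>0 \<le> \<tau>" "\<tau> \<le> 2 * real n * \<tau>0" for \<epsilon> x0 y t \<tau> n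
    using that(8,4,7,9,10)
  proof (induction n arbitrary: y \<tau> rule: nat_induct_at_least)
    case base
    then show ?case using one[OF that(1,2,3) _ that(5,6)] by simp
  next
    case (Suc n)
    \<comment> \<open>Segment and time are cut in the same proportion, which leaves a last step of
      length at most r and admissible duration.\<close>
    define \<theta> where "\<theta> = real n / real (Suc n)"
    have \<theta>: "0 \<le> \<theta>" "\<theta> \<le> 1" "\<theta> * real (Suc n) = real n" "(1 - \<theta>) * real (Suc n) = 1"
      by (auto simp: \<theta>_def field_simps)
    define y' where "y' = x0 + \<theta> *\<^sub>R (y - x0)"
    have y1: "y' - x0 = \<theta> *\<^sub>R (y - x0)" "y - y' = (1 - \<theta>) *\<^sub>R (y - x0)" by (auto simp: y'_def algebra_simps)
    have "y'$k = (1 - \<theta>) * x0$k + \<theta> * y$k" by (simp add: y'_def algebra_simps)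
    also have "\<dots> \<le> (1 - \<theta>) * (- 2 * r) + \<theta> * (- 2 * r)"
      using \<theta> Suc.prems(1) that(3) by (intro add_mono mult_left_mono) auto
    finally have y'k: "y'$k \<le> - 2 * r" by (simp add: algebra_simps)
    have n1: "norm (y' - x0) \<le> real n * r"
    proof -
      have "norm (y' - x0) = \<theta> * norm (y - x0)" using \<theta> by (simp add: y1)
      also have "\<dots> \<le> \<theta> * (real (Suc n) * r)" using \<theta> Suc.prems by (intro mult_left_mono) auto
      also have "\<dots> = real n * r" using \<theta>(3) by (metis mult.assoc)
      finally show ?thesis .
    qed
    have n2: "norm (y - y') \<le> r"
    proof -
      have "norm (y - y') = (1 - \<theta>) * norm (y - x0)" using \<theta> by (simp add: y1)
      also have "\<dots> \<le> (1 - \<theta>) * (real (Suc n) * r)" using \<theta> Suc.prems by (intro mult_left_mono) auto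
      also have "\<dots> = r" using \<theta>(4) by (metis mult.assoc mult_1)
      finally show ?thesis .
    qed
    have a1: "real n * \<tau>0 \<le> \<theta> * \<tau>" "\<theta> * \<tau> \<le> 2 * real n * \<tau>0"
      using mult_left_mono[OF Suc.prems(3) \<theta>(1)] mult_left_mono[OF Suc.prems(4) \<theta>(1)] \<theta>(3)
      by (metis mult.assoc mult.left_commute)+
    have a2: "\<tau>0 \<le> (1 - \<theta>) * \<tau>" "(1 - \<theta>) * \<tau> \<le> 2 * \<tau>0"
      using mult_left_mono[OF Suc.prems(3), of "1 - \<theta>"] mult_left_mono[OF Suc.prems(4), of "1 - \<theta>"] \<theta>(2,4)
      by (metis diff_ge_0_iff_ge mult.assoc mult.left_commute mult_1)+
    have o1: "occ r \<epsilon> y' (t + \<theta> * \<tau>)" by (rule Suc.IH) (use y'k n1 a1 in auto)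
    have "occ r \<epsilon> y ((t + \<theta> * \<tau>) + (1 - \<theta>) * \<tau>)"
      by (rule one[OF that(1,2) y'k Suc.prems(1) _ o1 n2 a2])
         (use that(5) \<theta> \<tau>0 Suc.prems(3) in \<open>auto intro!: add_nonneg_nonneg mult_nonneg_nonneg order_trans[OF _ Suc.prems(3)]\<close>)
    then show ?case by (simp add: algebra_simps)
  qed
  show ?thesis
  proof (rule that[of \<tau>0 \<epsilon>1])
    show "0 < \<tau>0" "0 < \<epsilon>1" using \<tau>0 s0pos by (auto simp: \<epsilon>1_def)
    fix \<epsilon> x0 y t \<tau> n
    assume h: "0 < \<epsilon>" "\<epsilon> \<le> \<epsilon>1" "x0$k \<le> - 2 * r" "y$k \<le> - 2 * r" "0 \<le> t"
       "occ r \<epsilon> x0 t" "norm (y - x0) \<le> real n * r" "1 \<le> n" "real n * \<tau>0 \<le> \<tau>"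
    \<comment> \<open>The number of steps is adapted to \<tau>, not to the distance, to keep each
      duration between \<tau>0 and 2 \<tau>0.\<close>
    define m where "m = nat \<lfloor>\<tau> / \<tau>0\<rfloor>"
    have "real n \<le> \<tau> / \<tau>0" using h \<tau>0 by (simp add: field_simps)
    then have m: "n \<le> m" unfolding m_def by (simp add: le_nat_iff le_floor_iff)
    have "0 \<le> \<tau> / \<tau>0" using \<open>real n \<le> \<tau> / \<tau>0\<close> by (meson of_nat_0_le_iff order_trans)
    then have m2: "real m \<le> \<tau> / \<tau>0" "\<tau> / \<tau>0 \<le> real m + 1" unfolding m_def by (auto simp: of_nat_nat)
    have m3: "real m * \<tau>0 \<le> \<tau>" using m2(1) \<tau>0 by (simp add: field_simps)
    have "\<tau> \<le> (real m + 1) * \<tau>0" using m2(2) \<tau>0 by (simp add: field_simps)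
    also have "\<dots> \<le> (2 * real m) * \<tau>0" using m h(8) \<tau>0 by (intro mult_right_mono) auto
    finally have m4: "\<tau> \<le> 2 * real m * \<tau>0" .
    have "real n * r \<le> real m * r" using m r by (intro mult_right_mono) auto
    then have "norm (y - x0) \<le> real m * r" using h(7) by linarith
    then show "occ r \<epsilon> y (t + \<tau>)" by (rule many[OF h(1-6)]) (use m m3 m4 h in auto)
  qed
qed

text \<open>A quantitative strong maximum principle: continuity supplies a filled ball, pushed
  inwards in case x lies on the interface, and one application of \<open>field_growth\<close>
  carries it to y.\<close>

lemma positivity:
  assumes x: "x$k \<le> 0" "0 < f b x 0" and y: "y$k < 0" and t: "0 < t"
  shows "0 < f b y t"
proof -
  define A where "A = f b x 0 / 2"
  have "0 < A" "(x, 0::real) \<in> {x. x$k \<le> 0} \<times> {0..}" using x by (auto simp: A_def)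
  from cont[of b, unfolded continuous_on_iff, rule_format, OF this(2,1)]
  obtain \<delta> where \<delta>: "\<delta> > 0" "\<And>p. p \<in> {x. x$k \<le> 0} \<times> {0..} \<Longrightarrow> dist p (x,0) < \<delta> \<Longrightarrow>
     dist (case p of (x,t) \<Rightarrow> f b x t) (f b x 0) < A" by auto
  define x1 where "x1 = x - (\<delta> / 2) *\<^sub>R axis k 1"
  define r where "r = min (\<delta> / 4) (- y$k)"
  have r: "r > 0" "r \<le> \<delta> / 4" "r \<le> - y$k" using \<delta> y by (auto simp: r_def)
  have x1: "x1$k \<le> - (\<delta> / 2)" using x by (simp add: x1_def)
  have src: "A \<le> f b z 0" if z: "norm (z - x1) < r" for z
  proof -
    have "(z - x1)$k < r" using z component_le_norm_cart[of "z - x1" k] by linarith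
    then have zk: "z$k \<le> 0" using x1 r \<delta> by simp
    have "z - x = (z - x1) + (- (\<delta> / 2)) *\<^sub>R axis k 1" by (simp add: x1_def)
    then have "norm (z - x) \<le> norm (z - x1) + norm ((- (\<delta> / 2)) *\<^sub>R (axis k 1 :: real^'n))"
      by (metis norm_triangle_ineq)
    then have "norm (z - x) < \<delta>" using z r \<delta> by simp
    then have "dist (f b z 0) (f b x 0) < A" using \<delta>(2)[of "(z,0)"] zk by (simp add: dist_Pair_Pair dist_norm)
    then have "f b x 0 - f b z 0 < A" unfolding dist_real_def by linarith
    moreover have "f b x 0 = A + A" by (simp add: A_def)
    ultimately show ?thesis by linarith
  qed
  define A' where "A' = min A (s0 * exp (- (\<bar>\<kappa> b\<bar> * t)))"
  have A'0: "0 < A'" using x s0pos by (simp add: A'_def A_def)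
  have "A' * exp (\<bar>\<kappa> b\<bar> * t) \<le> (s0 * exp (- (\<bar>\<kappa> b\<bar> * t))) * exp (\<bar>\<kappa> b\<bar> * t)"
    by (intro mult_right_mono) (auto simp: A'_def)
  also have "\<dots> = s0" unfolding mult.assoc exp_add[symmetric] by simp
  finally have cap: "A' * exp (\<bar>\<kappa> b\<bar> * t) \<le> s0" .
  have s: "A' \<le> f b z 0" if "norm (z - x1) < r" for z using src[OF that] by (simp add: A'_def)
  have yk: "y$k \<le> - r" using r by simp
  have x1k: "x1$k \<le> - r" using x1 r \<delta> by simp
  have "0 < A' / 2 * exp (- (norm (y - x1) * r / (2 * Dc b * t))
      + ((\<kappa> b - loss b r) * t - (norm (y - x1))\<^sup>2 / (4 * Dc b * t)))" using A'0 by simp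
  also have "\<dots> \<le> f b y (0 + t)"
    by (rule field_growth[OF r(1) A'0 x1k yk _ t s cap]) auto
  finally show ?thesis by simp
qed

text \<open>By \<open>positivity\<close> at time 1 and compactness, the field that starts nonzero is
  bounded below on a ball; if it is the second field, one \<open>transfer\<close> brings the mass
  over.\<close>

lemma occ_start:
  assumes r: "1 \<le> r" and x: "x$k \<le> 0" "0 < f b x 0"
  obtains \<epsilon> t where "0 < \<epsilon>" "0 \<le> t" "occ r \<epsilon> ((- 2 * r) *\<^sub>R axis k 1) t"
proof -
  define x0 where "x0 = (- 2 * r) *\<^sub>R axis k (1::real)"
  have x0k: "x0$k = - 2 * r" by (simp add: x0_def)
  have bk: "y$k < 0" if "norm (y - x0) \<le> r" for y
  proof -
    have "(y - x0)$k \<le> r" using that component_le_norm_cart[of "y - x0" k] by linarith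
    then show ?thesis using x0k r by simp
  qed
  have "continuous_on (cball x0 r) (\<lambda>y. (\<lambda>(x,t). f b x t) (y, 1))"
    by (rule continuous_on_compose2[OF cont[of b]])
       (use bk in \<open>auto intro!: continuous_intros simp: dist_norm norm_minus_commute less_imp_le\<close>)
  then obtain y0 where y0: "y0 \<in> cball x0 r" "\<And>y. y \<in> cball x0 r \<Longrightarrow> f b y0 1 \<le> f b y 1"
    using continuous_attains_inf[of "cball x0 r" "\<lambda>y. f b y 1"] r by auto
  define A where "A = f b y0 1"
  have A0: "A > 0" unfolding A_def by (rule positivity[OF x]) (use bk[of y0] y0 in \<open>auto simp: dist_norm norm_minus_commute\<close>)
  have A: "A \<le> f b y 1" if "norm (y - x0) < r" for y
    using y0(2)[of y] that by (auto simp: A_def dist_norm norm_minus_commute)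
  show ?thesis
  proof (cases b)
    case True
    then show ?thesis using that[of A 1] A0 A by (auto simp: occ_def x0_def)
  next
    case False
    obtain c Am where c: "0 < c" "c \<le> 1" "0 < Am"
      "\<And>x0 A t0 x. 0 < A \<Longrightarrow> A \<le> Am \<Longrightarrow> x0$k = - 2 * r \<Longrightarrow> 0 \<le> t0 \<Longrightarrow>
         (\<And>x. norm (x - x0) < r \<Longrightarrow> A \<le> f b x t0) \<Longrightarrow> norm (x - x0) < r \<Longrightarrow> c * A \<le> f (\<not> b) x (t0 + 3)"
      by (rule transfer[OF r, of b]) auto
    have "occ r (c * min A Am) x0 (1 + 3)" unfolding occ_def
    proof (intro allI impI)
      fix x assume xx: "norm (x - x0) < r"
      have "c * min A Am \<le> f (\<not> b) x (1 + 3)"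
        by (rule c(4)[OF _ _ x0k _ _ xx]) (use A0 A c in \<open>auto simp: min_le_iff_disj\<close>)
      then show "c * min A Am \<le> f True x (1 + 3)" using False by simp
    qed
    then show ?thesis using that[of "c * min A Am" "1 + 3"] A0 c by (auto simp: x0_def)
  qed
qed

text \<open>Travel along the i-axis to within one period of \<open>y$i\<close>, then use
  \<open>spreads\<close> for the remaining time, which grows linearly in t because c < c'. Neither
  stage lowers the level, so \<epsilon> is independent of R.\<close>

theorem spreading_lower_bound:
  assumes r: "1 \<le> r" and ik: "i \<noteq> k" and rate: "0 < \<kappa> True - loss True r" and tr: "travels i r c'" and c: "0 < c" "c < c'"
    and x: "x$k \<le> 0" "0 < f b x 0"
  obtains \<epsilon> where "0 < \<epsilon>"
    "\<And>R. \<exists>t1. \<forall>t\<ge>t1. \<forall>y. \<bar>y$i\<bar> \<le> c * t \<longrightarrow> (\<forall>j. j \<noteq> i \<longrightarrow> \<bar>y$j\<bar> \<le> R) \<longrightarrow> y$k \<le> - 2 * r \<longrightarrow> \<epsilon> \<le> f True y t"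
proof -
  have r0: "0 < r" using r by simp
  obtain \<tau>0 \<epsilon>1 where sp: "0 < \<tau>0" "0 < \<epsilon>1"
    "\<And>\<epsilon> x0 y t \<tau> n. 0 < \<epsilon> \<Longrightarrow> \<epsilon> \<le> \<epsilon>1 \<Longrightarrow> x0$k \<le> - 2 * r \<Longrightarrow> y$k \<le> - 2 * r \<Longrightarrow> 0 \<le> t \<Longrightarrow>
       occ r \<epsilon> x0 t \<Longrightarrow> norm (y - x0) \<le> real n * r \<Longrightarrow> 1 \<le> n \<Longrightarrow> real n * \<tau>0 \<le> \<tau> \<Longrightarrow> occ r \<epsilon> y (t + \<tau>)"
    by (rule spreads[OF r0 rate]) (rule that)
  obtain S L \<epsilon>2 where st: "0 < S" "c' * S \<le> L" "0 < \<epsilon>2"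
    "\<And>\<epsilon> x0 t \<sigma>. 0 < \<epsilon> \<Longrightarrow> \<epsilon> \<le> \<epsilon>2 \<Longrightarrow> x0$k = - 2 * r \<Longrightarrow> 0 \<le> t \<Longrightarrow>
      \<bar>\<sigma>\<bar> = 1 \<Longrightarrow> occ r \<epsilon> x0 t \<Longrightarrow> occ r \<epsilon> (x0 + (\<sigma> * L) *\<^sub>R axis i 1) (t + S)"
    using tr unfolding travels_def by blast
  obtain \<epsilon>3 ts where s3: "0 < \<epsilon>3" "0 \<le> ts" "occ r \<epsilon>3 ((- 2 * r) *\<^sub>R axis k 1) ts"
    by (rule occ_start[OF r x]) (rule that)
  define \<epsilon> where "\<epsilon> = min \<epsilon>1 (min \<epsilon>2 \<epsilon>3)"
  have e: "0 < \<epsilon>" "\<epsilon> \<le> \<epsilon>1" "\<epsilon> \<le> \<epsilon>2" "\<epsilon> \<le> \<epsilon>3" using sp st s3 by (auto simp: \<epsilon>_def)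
  define x0 where "x0 = (- 2 * r) *\<^sub>R axis k (1::real)"
  have o0: "occ r \<epsilon> x0 ts" using s3(3) e(4) unfolding occ_def x0_def by (meson order_trans)
  have L0: "L > 0" using st c by (smt (verit) mult_pos_pos)
  have om: "occ r \<epsilon> (x0 + (\<sigma> * (real m * L)) *\<^sub>R axis i 1) (ts + real m * S)" if "\<bar>\<sigma>\<bar> = 1" for m \<sigma>
  proof (induction m)
    case 0 then show ?case using o0 by simp
  next
    case (Suc m)
    have "occ r \<epsilon> (x0 + (\<sigma> * (real m * L)) *\<^sub>R axis i 1 + (\<sigma> * L) *\<^sub>R axis i 1) (ts + real m * S + S)"
      by (rule st(4)[OF e(1,3) _ _ that Suc.IH]) (use ik s3 st in \<open>auto simp: x0_def axis_def\<close>)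
    moreover have "x0 + (\<sigma> * (real m * L)) *\<^sub>R axis i 1 + (\<sigma> * L) *\<^sub>R axis i 1 = x0 + (\<sigma> * (real (Suc m) * L)) *\<^sub>R axis i 1"
      by (simp add: algebra_simps)
    moreover have "ts + real m * S + S = ts + real (Suc m) * S" by (simp add: algebra_simps)
    ultimately show ?case by (simp only:)
  qed
  show ?thesis
  proof (rule that[OF e(1)])
    fix R :: real
    \<comment> \<open>Bounds the l1 distance between y and the station chosen below: L in direction
      i, and \<open>\<bar>R\<bar> + 2 * r\<close> in every direction.\<close>
    define Rm where "Rm = L + real CARD('n) * (\<bar>R\<bar> + 2 * r)"
    define n where "n = Suc (nat \<lceil>Rm / r\<rceil>)"
    have n1: "1 \<le> n" by (simp add: n_def)
    have "Rm / r \<le> real n" unfolding n_def by linarith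
    then have nR: "Rm \<le> real n * r" using r0 by (simp add: field_simps)
    \<comment> \<open>From this time on, the fraction \<open>1 - c / c'\<close> of t covers the
      start-up time and n final steps.\<close>
    define t1 where "t1 = (ts + real n * \<tau>0) / (1 - c / c')"
    have q: "1 - c / c' > 0" using c by (simp add: field_simps)
    show "\<exists>t1. \<forall>t\<ge>t1. \<forall>y. \<bar>y$i\<bar> \<le> c * t \<longrightarrow> (\<forall>j. j \<noteq> i \<longrightarrow> \<bar>y$j\<bar> \<le> R) \<longrightarrow> y$k \<le> - 2 * r \<longrightarrow> \<epsilon> \<le> f True y t"
    proof (intro exI[of _ t1] allI impI)
      fix t and y :: "real^'n"
      assume t: "t1 \<le> t" and y: "\<bar>y$i\<bar> \<le> c * t" "\<forall>j. j \<noteq> i \<longrightarrow> \<bar>y$j\<bar> \<le> R" "y$k \<le> - 2 * r"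
      define m where "m = nat \<lfloor>\<bar>y$i\<bar> / L\<rfloor>"
      define \<sigma> where "\<sigma> = (if y$i \<ge> 0 then 1 else - 1 :: real)"
      have \<sigma>: "\<bar>\<sigma>\<bar> = 1" "y$i = \<sigma> * \<bar>y$i\<bar>" by (auto simp: \<sigma>_def)
      have m1: "real m \<le> \<bar>y$i\<bar> / L" "\<bar>y$i\<bar> / L \<le> real m + 1"
        using L0 unfolding m_def by (auto simp: of_nat_nat)
      have m2: "real m * L \<le> \<bar>y$i\<bar>" "\<bar>y$i\<bar> \<le> real m * L + L" using m1 L0 by (auto simp: field_simps)
      define x1 where "x1 = x0 + (\<sigma> * (real m * L)) *\<^sub>R axis i (1::real)"
      have x1k: "x1$k = - 2 * r" using ik by (simp add: x1_def x0_def axis_def)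
      have comp: "\<bar>(y - x1)$j\<bar> \<le> (if j = i then L else 0) + (\<bar>R\<bar> + 2 * r)" for j
      proof (cases "j = i")
        case True
        have "(y - x1)$i = \<sigma> * (\<bar>y$i\<bar> - real m * L)"
          using ik \<sigma>(2) by (simp add: x1_def x0_def axis_def algebra_simps)
        then have "\<bar>(y - x1)$i\<bar> = \<bar>\<bar>y$i\<bar> - real m * L\<bar>" using \<sigma>(1) by (simp add: abs_mult)
        also have "\<dots> \<le> L" using m2 by linarith
        finally show ?thesis using True r0 by simp
      next
        case False
        have "\<bar>(y - x1)$j\<bar> \<le> \<bar>y$j\<bar> + \<bar>x1$j\<bar>" by simp
        also have "\<bar>y$j\<bar> \<le> \<bar>R\<bar>" using y(2) False by (smt (verit))
        also have "\<bar>x1$j\<bar> \<le> 2 * r" using False r0 by (auto simp: x1_def x0_def axis_def)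
        finally show ?thesis using False by simp
      qed
      have "norm (y - x1) \<le> (\<Sum>j\<in>UNIV. \<bar>(y - x1)$j\<bar>)" by (rule norm_le_l1_cart)
      also have "\<dots> \<le> (\<Sum>j\<in>UNIV. (if j = i then L else 0) + (\<bar>R\<bar> + 2 * r))" by (intro sum_mono comp)
      also have "\<dots> = Rm" by (simp add: Rm_def sum.distrib)
      finally have nn1: "norm (y - x1) \<le> real n * r" using nR by simp
      have "ts + real n * \<tau>0 \<le> t * (1 - c / c')" using t q by (simp add: t1_def field_simps)
      then have h1: "ts + real n * \<tau>0 + c * t / c' \<le> t" by (simp add: algebra_simps)
      have "real m * (c' * S) \<le> real m * L" using st by (intro mult_left_mono) auto
      then have "real m * (c' * S) \<le> c * t" using m2 y by linarith
      then have "real m * S \<le> c * t / c'" using c by (simp add: field_simps)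
      then have h2: "real n * \<tau>0 \<le> t - (ts + real m * S)" using h1 by linarith
      have "occ r \<epsilon> y ((ts + real m * S) + (t - (ts + real m * S)))"
        by (rule sp(3)[OF e(1,2) _ y(3) _ om[OF \<sigma>(1), of m, folded x1_def] nn1 n1 h2]) (use x1k s3 st in auto)
      then show "\<epsilon> \<le> f True y t" using r0 by (auto simp: occ_def)
    qed
  qed
qed

end

section \<open>One-dimensional profiles\<close>

lemma antiderivative_real:
  fixes h :: "real \<Rightarrow> real"
  assumes "continuous_on UNIV h"
  obtains H where "\<And>s. (H has_real_derivative h s) (at s)"
proof -
  define H where "H s = (LBINT y=ereal 0..ereal s. h y)" for s
  have "(H has_real_derivative h s) (at s)" for s
  proof -
    define a where "a = \<bar>s\<bar> + 1"
    have "((\<lambda>u. LBINT y=ereal 0..ereal u. h y) has_vector_derivative h s) (at s within {- a..a})"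
      by (rule interval_integral_FTC2) (auto simp: a_def intro: continuous_on_subset[OF assms])
    moreover have "at s within {- a..a} = at s"
      by (rule at_within_interior) (simp add: a_def interior_atLeastAtMost_real abs_if)
    ultimately show ?thesis
      by (simp add: H_def[abs_def] has_real_derivative_iff_has_vector_derivative)
  qed
  then show ?thesis by (rule that)
qed

text \<open>Separation of variables: an antiderivative Y of 1 / \<Phi> has slope at least 1 / C,
  hence is a bijection of the line, and its inverse is the solution. Continuity of \<Phi> suffices,
  and the solution is global and takes every value.\<close>

lemma autonomous_flow:
  fixes \<Phi> :: "real \<Rightarrow> real"
  assumes cont: "continuous_on UNIV \<Phi>" and pos: "\<And>x. 0 < \<Phi> x" and bd: "\<And>x. \<Phi> x \<le> C"
  obtains q where "q 0 = q0" "\<And>t. (q has_real_derivative \<Phi> (q t)) (at t)" "surj q"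
proof -
  have C0: "C > 0" using pos[of 0] bd[of 0] by linarith
  have "continuous_on UNIV (\<lambda>x. 1 / \<Phi> x)" using pos
    by (intro continuous_intros cont) (auto simp: less_le)
  then obtain Y0 where Y0: "\<And>s. (Y0 has_real_derivative 1 / \<Phi> s) (at s)" by (rule antiderivative_real) auto
  define Y where "Y s = Y0 s - Y0 q0" for s
  have Y: "(Y has_real_derivative 1 / \<Phi> s) (at s)" for s
    unfolding Y_def by (auto intro!: derivative_eq_intros Y0)
  have low: "(y - x) / C \<le> Y y - Y x" if "x \<le> y" for x y
  proof -
    have "(\<lambda>s. Y s - s / C) x \<le> (\<lambda>s. Y s - s / C) y"
    proof (rule DERIV_nonneg_imp_nondecreasing[OF that, of "\<lambda>s. Y s - s / C"])
      fix s
      have "1 / C \<le> 1 / \<Phi> s" using pos[of s] bd[of s] by (intro divide_left_mono) auto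
      moreover have "((\<lambda>s. Y s - s / C) has_real_derivative 1 / \<Phi> s - 1 / C) (at s)"
        using C0 by (auto intro!: derivative_eq_intros Y)
      ultimately show "\<exists>y. ((\<lambda>s. Y s - s / C) has_real_derivative y) (at s) \<and> 0 \<le> y" by auto
    qed
    then show ?thesis by (simp add: diff_divide_distrib)
  qed
  have Yc: "isCont Y s" for s using Y by (rule DERIV_isCont)
  have sY: "\<exists>x. Y x = t" for t
  proof -
    define a where "a = C * (\<bar>t\<bar> + \<bar>Y 0\<bar>)"
    have a0: "a \<ge> 0" using C0 by (simp add: a_def)
    have "a / C \<le> Y a - Y 0" "a / C \<le> Y 0 - Y (- a)" using low[of 0 a] low[of "- a" 0] a0 by auto
    moreover have "a / C = \<bar>t\<bar> + \<bar>Y 0\<bar>" using C0 by (simp add: a_def)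
    ultimately have "Y (- a) \<le> t" "t \<le> Y a" by linarith+
    then show ?thesis using IVT[of Y "- a" t a] a0 Yc by auto
  qed
  have inj: "x = y" if "Y x = Y y" for x y
  proof (rule ccontr)
    assume "x \<noteq> y"
    then consider "x < y" | "y < x" by linarith
    then show False
    proof cases
      case 1 then show False using low[of x y] that C0 by (auto simp: divide_le_0_iff)
    next
      case 2 then show False using low[of y x] that C0 by (auto simp: divide_le_0_iff)
    qed
  qed
  define q where "q t = (SOME x. Y x = t)" for t
  have Yq: "Y (q t) = t" for t
    unfolding q_def by (rule someI_ex[OF sY])
  have qY: "q (Y x) = x" for x by (rule inj) (rule Yq)
  have lip1: "q s - q t \<le> C * \<bar>s - t\<bar>" if "q t \<le> q s" for s t
  proof -
    have "(q s - q t) / C \<le> s - t" using low[OF that] unfolding Yq .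
    then have "q s - q t \<le> (s - t) * C" using C0 by (simp add: pos_divide_le_eq)
    also have "\<dots> \<le> \<bar>s - t\<bar> * C" using C0 by (intro mult_right_mono) auto
    finally show ?thesis by (simp add: mult.commute)
  qed
  have lip: "\<bar>q s - q t\<bar> \<le> C * \<bar>s - t\<bar>" for s t
    using lip1[of t s] lip1[of s t] by (cases "q t \<le> q s") (auto simp: abs_minus_commute[of t s] abs_of_nonneg abs_of_nonpos)
  have qc: "isCont q t" for t
    unfolding continuous_at_eps_delta
  proof (intro allI impI)
    fix e :: real assume e: "e > 0"
    show "\<exists>d>0. \<forall>x'. dist x' t < d \<longrightarrow> dist (q x') (q t) < e"
    proof (intro exI[of _ "e / C"] conjI allI impI)
      show "0 < e / C" using e C0 by simp
      fix s assume "dist s t < e / C"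
      then have "C * \<bar>s - t\<bar> < e" using C0 by (simp add: dist_real_def field_simps)
      then show "dist (q s) (q t) < e" using lip[of s t] by (simp add: dist_real_def)
    qed
  qed
  have dq: "(q has_real_derivative \<Phi> (q t)) (at t)" for t
  proof -
    have "(q has_real_derivative inverse (1 / \<Phi> (q t))) (at t)"
      by (rule DERIV_inverse_function[where f=Y and a="t - 1" and b="t + 1"])
         (use Y Yq qc pos[of "q t"] in \<open>auto simp: less_le\<close>)
    then show ?thesis by simp
  qed
  show ?thesis
  proof (rule that[OF _ dq])
    show "q 0 = q0" using qY[of q0] by (simp add: Y_def)
    show "surj q" using qY by (metis surjI)
  qed
qed

text \<open>An increasing solution of D W'' + h (W) = 0, with t standing for depth. That every value
  below z is attained allows a barrier to be shifted until it is as close to z, or as low, as the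
  start of a comparison needs.\<close>

definition profile :: "real \<Rightarrow> (real \<Rightarrow> real) \<Rightarrow> real \<Rightarrow> (real \<Rightarrow> real) \<Rightarrow> (real \<Rightarrow> real) \<Rightarrow> bool" where
  "profile D h z W W' \<longleftrightarrow> (\<forall>t. (W has_real_derivative W' t) (at t)) \<and>
     (\<forall>t. (W' has_real_derivative - h (W t) / D) (at t)) \<and> (\<forall>t. W t < z) \<and> (\<forall>t. 0 < W' t) \<and>
     (\<forall>s<z. \<exists>t. W t = s)"

text \<open>The separatrix \<open>D W'^2 / 2 + H W = H z\<close>; in the variable \<open>- ln (z - W)\<close> the first-order equation
  has a bounded right-hand side and therefore a global solution.\<close>

lemma profile_exists:
  fixes h H :: "real \<Rightarrow> real"
  assumes D: "0 < D" and H: "\<And>s. (H has_real_derivative h s) (at s)" and a: "a < z"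
    and pos: "\<And>s. s < z \<Longrightarrow> H s < H z" and qu: "\<And>s. s \<le> z \<Longrightarrow> h s \<le> L * (z - s)"
  obtains W W' where "profile D h z W W'" "W 0 = a" "\<And>t. (D * W' t)\<^sup>2 = 2 * D * (H z - H (W t))"
proof -
  define F where "F s = sqrt (2 * (H z - H s) / D)" for s
  \<comment> \<open>With W = z - exp (- q) the equation W' = F W becomes q' = \<Phi> q.\<close>
  define \<Phi> where "\<Phi> x = F (z - exp (- x)) * exp x" for x
  have F0: "F s > 0" if "s < z" for s using pos[OF that] D by (simp add: F_def)
  have quad: "H z - H s \<le> L / 2 * (z - s)\<^sup>2" if "s < z" for s
  proof -
    define Q where "Q s = H s + L / 2 * (z - s)\<^sup>2" for s
    have "Q z \<le> Q s"
    proof (rule DERIV_nonpos_imp_nonincreasing[of s z Q])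
      show "s \<le> z" using that by simp
      fix x assume x: "s \<le> x" "x \<le> z"
      have "h x \<le> L * (z - x)" using x by (intro qu)
      moreover have "(Q has_real_derivative h x - L * (z - x)) (at x)" unfolding Q_def
        by (auto intro!: derivative_eq_intros H simp: algebra_simps diff_divide_distrib)
      ultimately show "\<exists>y. (Q has_real_derivative y) (at x) \<and> y \<le> 0" by auto
    qed
    then show ?thesis by (simp add: Q_def)
  qed
  have Hc: "continuous_on UNIV H" by (meson DERIV_continuous_on H has_field_derivative_at_within)
  have "continuous_on UNIV \<Phi>" unfolding \<Phi>_def F_def
    using D by (intro continuous_intros continuous_on_compose2[OF Hc]) auto
  moreover have "0 < \<Phi> x" for x using F0[of "z - exp (- x)"] by (simp add: \<Phi>_def)
  moreover have "\<Phi> x \<le> sqrt (\<bar>L\<bar> / D)" for x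
  proof -
    have "2 * (H z - H (z - exp (- x))) / D \<le> 2 * (L / 2 * (exp (- x))\<^sup>2) / D"
      using quad[of "z - exp (- x)"] D by (intro divide_right_mono) auto
    also have "\<dots> \<le> (\<bar>L\<bar> / D) * (exp (- x))\<^sup>2" using D by (simp add: divide_right_mono mult_right_mono)
    finally have "F (z - exp (- x)) \<le> sqrt ((\<bar>L\<bar> / D) * (exp (- x))\<^sup>2)" unfolding F_def by (rule real_sqrt_le_mono)
    then have "F (z - exp (- x)) \<le> sqrt (\<bar>L\<bar> / D) * exp (- x)" unfolding real_sqrt_mult by simp
    then have "\<Phi> x \<le> sqrt (\<bar>L\<bar> / D) * exp (- x) * exp x" by (simp add: \<Phi>_def)
    then show ?thesis unfolding mult.assoc exp_add[symmetric] by simp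
  qed
  ultimately obtain q where q: "q 0 = - ln (z - a)" "\<And>t. (q has_real_derivative \<Phi> (q t)) (at t)" "surj q"
    by (rule autonomous_flow) auto
  define W where "W t = z - exp (- q t)" for t
  define W' where "W' t = F (W t)" for t
  have Wz: "W t < z" for t by (simp add: W_def)
  have dW: "(W has_real_derivative W' t) (at t)" for t
  proof -
    have "(W has_real_derivative exp (- q t) * \<Phi> (q t)) (at t)" unfolding W_def
      by (auto intro!: derivative_eq_intros q)
    moreover have "exp (- q t) * \<Phi> (q t) = W' t" by (simp add: \<Phi>_def W'_def W_def exp_minus)
    ultimately show ?thesis by simp
  qed
  have W'0: "0 < W' t" for t using F0[OF Wz] by (simp add: W'_def)
  \<comment> \<open>Differentiating the square root leaves a quotient with W' above and below;
    strict positivity of W' permits the cancellation.\<close>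
  have dW': "(W' has_real_derivative - h (W t) / D) (at t)" for t
  proof -
    have 1: "((\<lambda>t. 2 * (H z - H (W t)) / D) has_real_derivative 2 * (0 - h (W t) * W' t) / D) (at t)"
      by (rule DERIV_cdivide[OF DERIV_cmult[OF DERIV_diff[OF DERIV_const DERIV_chain2[OF H dW]]]])
    have "0 < 2 * (H z - H (W t)) / D" using pos[OF Wz[of t]] D by simp
    from DERIV_chain2[OF DERIV_real_sqrt[OF this] 1]
    have "(W' has_real_derivative inverse (sqrt (2 * (H z - H (W t)) / D)) / 2 * (2 * (0 - h (W t) * W' t) / D)) (at t)"
      by (simp add: W'_def[abs_def] F_def)
    moreover have "sqrt (2 * (H z - H (W t)) / D) = W' t" by (simp add: W'_def F_def)
    ultimately show ?thesis using W'0[of t] by (simp add: field_simps)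
  qed
  show ?thesis
  proof (rule that[of W W'])
    show "W 0 = a" using a by (simp add: W_def q)
    show "(D * W' t)\<^sup>2 = 2 * D * (H z - H (W t))" for t
    proof -
      have "0 \<le> 2 * (H z - H (W t)) / D" using pos[OF Wz[of t]] D by simp
      then have "(W' t)\<^sup>2 = 2 * (H z - H (W t)) / D" by (simp add: W'_def F_def)
      then have "(D * W' t)\<^sup>2 = D\<^sup>2 * (2 * (H z - H (W t)) / D)" by (simp only: power_mult_distrib)
      then show ?thesis using D by (simp add: power2_eq_square)
    qed
    have "\<exists>t. W t = s" if "s < z" for s
    proof -
      obtain t where "q t = - ln (z - s)" using q(3) by (metis surjD)
      then have "W t = s" using that by (simp add: W_def)
      then show ?thesis ..
    qed
    then show "profile D h z W W'" using dW dW' Wz W'0 by (auto simp: profile_def)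
  qed
qed

text \<open>The constant \<open>(m / D)\<^sup>2\<close> inside the energy E absorbs the
  inhomogeneity m and turns an affine differential inequality into the homogeneous one E' \<le> K
  E.\<close>

lemma profile_gronwall:
  assumes D: "0 < D" and P: "profile D h z W W'" and P0: "profile D h0 z0 W0 W0'"
    and hh: "\<And>t. 0 \<le> t \<Longrightarrow> \<bar>h (W t) - h0 (W0 t)\<bar> \<le> L * \<bar>W t - W0 t\<bar> + m" and L: "0 \<le> L" and m: "0 \<le> m" and t: "0 \<le> t"
  shows "(W t - W0 t)\<^sup>2 \<le> ((W 0 - W0 0)\<^sup>2 + (W' 0 - W0' 0)\<^sup>2 + (m / D)\<^sup>2) * exp ((2 + L / D) * t)"
proof -
  define K where "K = 2 + L / D"
  have K: "K \<ge> 2" using L D by (simp add: K_def)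
  define E where "E t = (W t - W0 t)\<^sup>2 + (W' t - W0' t)\<^sup>2 + (m / D)\<^sup>2" for t
  have dE: "(E has_real_derivative 2 * (W t - W0 t) * (W' t - W0' t) +
      2 * (W' t - W0' t) * (- h (W t) / D - - h0 (W0 t) / D)) (at t)" for t
  proof -
    have a: "((\<lambda>t. W t - W0 t) has_real_derivative (W' t - W0' t)) (at t)"
      using P P0 by (intro DERIV_diff) (auto simp: profile_def)
    have b: "((\<lambda>t. W' t - W0' t) has_real_derivative (- h (W t) / D - - h0 (W0 t) / D)) (at t)"
      using P P0 by (intro DERIV_diff) (auto simp: profile_def)
    show ?thesis unfolding E_def
      using DERIV_add[OF DERIV_add[OF DERIV_power[OF a, of 2] DERIV_power[OF b, of 2]] DERIV_const[of "(m / D)\<^sup>2"]]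
      by (rule DERIV_cong) (simp add: algebra_simps add_divide_distrib diff_divide_distrib)
  qed
  have ineq: "2 * (W t - W0 t) * (W' t - W0' t) + 2 * (W' t - W0' t) * (- h (W t) / D - - h0 (W0 t) / D) \<le> K * E t"
    if "0 \<le> t" for t
  proof -
    define x where "x = W t - W0 t" define y where "y = W' t - W0' t" define w where "w = m / D"
    define p where "p = - h (W t) / D - - h0 (W0 t) / D"
    have w0: "w \<ge> 0" using m D by (simp add: w_def)
    have "\<bar>p\<bar> = \<bar>h (W t) - h0 (W0 t)\<bar> / D" using D by (simp add: p_def abs_minus_commute flip: diff_divide_distrib)
    also have "\<dots> \<le> (L * \<bar>x\<bar> + m) / D" using hh[OF that] D by (intro divide_right_mono) (auto simp: x_def)
    also have "\<dots> = L / D * \<bar>x\<bar> + w" by (simp add: w_def add_divide_distrib)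
    finally have p: "\<bar>p\<bar> \<le> L / D * \<bar>x\<bar> + w" .
    have i1: "2 * x * y \<le> x\<^sup>2 + y\<^sup>2" by (rule sum_squares_bound)
    have i2: "2 * (\<bar>y\<bar> * \<bar>x\<bar>) \<le> x\<^sup>2 + y\<^sup>2" using sum_squares_bound[of "\<bar>x\<bar>" "\<bar>y\<bar>"] by (simp add: mult_ac)
    have i3: "2 * (\<bar>y\<bar> * w) \<le> y\<^sup>2 + w\<^sup>2" using sum_squares_bound[of "\<bar>y\<bar>" w] by (simp add: mult_ac)
    have "2 * y * p \<le> 2 * (\<bar>y\<bar> * \<bar>p\<bar>)" by (metis abs_ge_self abs_mult mult.assoc mult_left_mono zero_le_numeral)
    also have "\<dots> \<le> 2 * (\<bar>y\<bar> * (L / D * \<bar>x\<bar> + w))" using p by (intro mult_left_mono) auto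
    also have "\<dots> = L / D * (2 * (\<bar>y\<bar> * \<bar>x\<bar>)) + 2 * (\<bar>y\<bar> * w)" by (simp add: algebra_simps)
    also have "\<dots> \<le> L / D * (x\<^sup>2 + y\<^sup>2) + (y\<^sup>2 + w\<^sup>2)"
      using i2 i3 L D by (intro add_mono mult_left_mono) auto
    finally have "2 * x * y + 2 * y * p \<le> (1 + L / D) * (x\<^sup>2 + y\<^sup>2) + y\<^sup>2 + w\<^sup>2" using i1 by (simp add: algebra_simps)
    also have "\<dots> \<le> K * (x\<^sup>2 + y\<^sup>2 + w\<^sup>2)"
    proof -
      have "K * (x\<^sup>2 + y\<^sup>2 + w\<^sup>2) - ((1 + L / D) * (x\<^sup>2 + y\<^sup>2) + y\<^sup>2 + w\<^sup>2) = x\<^sup>2 + w\<^sup>2 + L / D * w\<^sup>2"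
        by (simp add: K_def algebra_simps)
      moreover have "0 \<le> x\<^sup>2 + w\<^sup>2 + L / D * w\<^sup>2" using L D by simp
      ultimately show ?thesis by linarith
    qed
    finally show ?thesis by (simp add: x_def y_def p_def w_def E_def)
  qed
  have "(\<lambda>t. E t * exp (- (K * t))) t \<le> (\<lambda>t. E t * exp (- (K * t))) 0"
  proof (rule DERIV_nonpos_imp_nonincreasing[OF t])
    fix s assume s: "0 \<le> s" "s \<le> t"
    define d where "d = 2 * (W s - W0 s) * (W' s - W0' s) + 2 * (W' s - W0' s) * (- h (W s) / D - - h0 (W0 s) / D)"
    have "((\<lambda>t. E t * exp (- (K * t))) has_real_derivative (d - K * E s) * exp (- (K * s))) (at s)"
      by (rule DERIV_cong[OF DERIV_mult[OF dE[of s, folded d_def] DERIV_chain2[OF DERIV_exp DERIV_minus[OF DERIV_cmult_Id]]]])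
         (simp add: algebra_simps)
    moreover have "(d - K * E s) * exp (- (K * s)) \<le> 0"
      using ineq[OF s(1)] by (simp add: d_def mult_le_0_iff)
    ultimately show "\<exists>y. ((\<lambda>t. E t * exp (- (K * t))) has_real_derivative y) (at s) \<and> y \<le> 0" by blast
  qed
  then have "E t * exp (- (K * t)) * exp (K * t) \<le> E 0 * exp (K * t)" by (intro mult_right_mono) auto
  then have "E t \<le> E 0 * exp (K * t)" unfolding mult.assoc exp_add[symmetric] by simp
  moreover have "(W t - W0 t)\<^sup>2 \<le> E t" by (simp add: E_def)
  ultimately have "(W t - W0 t)\<^sup>2 \<le> E 0 * exp (K * t)" by (rule order_trans[rotated])
  then show ?thesis by (simp only: E_def K_def)
qed


text \<open>Perturbing by \<open>m * ramp s\<close> instead of \<open>m\<close> keeps the energy constant below \<open>-1\<close>, so that the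
  separatrix of the perturbed nonlinearity is still a global graph.\<close>

definition ext :: "(real \<Rightarrow> real) \<Rightarrow> real \<Rightarrow> real" where "ext g s = g (max 0 s)"

definition ramp :: "real \<Rightarrow> real" where "ramp s = max 0 (min 1 (s + 1))"

lemma ramp_bounds: "0 \<le> ramp s" "ramp s \<le> 1" "0 \<le> s \<Longrightarrow> ramp s = 1" "s \<le> -1 \<Longrightarrow> ramp s = 0"
  by (auto simp: ramp_def)

lemma ramp_lipschitz: "\<bar>ramp a - ramp b\<bar> \<le> \<bar>a - b\<bar>"
  by (auto simp: ramp_def max_def min_def abs_if)

text \<open>\<kappa> is the coefficient of the Robin condition D W' = \<kappa> W at t = 0. As
  \<open>KPP\<close> does not fix the sign of g on negative numbers, profiles use
  \<open>ext g\<close>, which vanishes there and agrees with g where solutions live.\<close>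

locale kpp_profile =
  fixes g :: "real \<Rightarrow> real" and D \<kappa> :: real
  assumes kpp: "KPP g" and D: "0 < D" and \<kappa>: "0 < \<kappa>"
begin

abbreviation g' :: "real \<Rightarrow> real" where "g' \<equiv> ext g"

section \<open>The nonlinearity, its primitives and the interface level\<close>

lemma g0: "g 0 = 0" and g1: "g 1 = 0" and gpos: "0 < s \<Longrightarrow> s < 1 \<Longrightarrow> 0 < g s" and gneg: "1 < s \<Longrightarrow> g s < 0"
  using kpp by (auto simp: KPP_def)

lemma g_cont: "isCont g s"
proof -
  obtain L where L: "\<And>a b. \<bar>a\<bar> \<le> \<bar>s\<bar> + 1 \<Longrightarrow> \<bar>b\<bar> \<le> \<bar>s\<bar> + 1 \<Longrightarrow> \<bar>g a - g b\<bar> \<le> L * \<bar>a - b\<bar>"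
    using kpp unfolding KPP_def by blast
  have "((\<lambda>y. L * \<bar>y - s\<bar>) \<longlongrightarrow> L * \<bar>s - s\<bar>) (at s)" by (intro tendsto_intros)
  then have lim: "((\<lambda>y. L * \<bar>y - s\<bar>) \<longlongrightarrow> 0) (at s)" by simp
  have "\<forall>\<^sub>F y in at s. norm (g y - g s) \<le> L * \<bar>y - s\<bar>"
    unfolding eventually_at dist_real_def
    by (intro exI[of _ 1] conjI ballI impI, simp, unfold real_norm_def, rule L) (auto simp: abs_if split: if_splits)
  then have "((\<lambda>y. g y - g s) \<longlongrightarrow> 0) (at s)" using lim by (rule Lim_null_comparison)
  then show ?thesis by (simp add: isCont_def LIM_zero_iff)
qed

lemma ext_cont: "continuous_on UNIV g'"
proof -
  have "continuous_on UNIV g" using g_cont by (simp add: continuous_at_imp_continuous_on)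
  then show ?thesis unfolding ext_def[abs_def]
    by (rule continuous_on_compose2) (auto intro!: continuous_intros)
qed

text \<open>Freezing g below 0 makes the bounds valid on the whole ray below 2. The number 2 leaves
  room for the zeros of the perturbed nonlinearities, which do not exceed it.\<close>

lemma ext_lipschitz:
  obtains L where "0 < L" "\<And>a b. a \<le> 2 \<Longrightarrow> b \<le> 2 \<Longrightarrow> \<bar>g' a - g' b\<bar> \<le> L * \<bar>a - b\<bar>"
    "\<And>a. a \<le> 2 \<Longrightarrow> \<bar>g' a\<bar> \<le> 2 * L"
proof -
  obtain L0 where L0: "\<And>a b. \<bar>a\<bar> \<le> 2 \<Longrightarrow> \<bar>b\<bar> \<le> 2 \<Longrightarrow> \<bar>g a - g b\<bar> \<le> L0 * \<bar>a - b\<bar>"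
    using kpp unfolding KPP_def by blast
  define L where "L = \<bar>L0\<bar> + 1"
  have l: "\<bar>g' a - g' b\<bar> \<le> L * \<bar>a - b\<bar>" if "a \<le> 2" "b \<le> 2" for a b
  proof -
    have "\<bar>g' a - g' b\<bar> \<le> L0 * \<bar>max 0 a - max 0 b\<bar>" unfolding ext_def using that by (intro L0) auto
    also have "\<dots> \<le> L * \<bar>a - b\<bar>" by (intro mult_mono) (auto simp: L_def max_def)
    finally show ?thesis .
  qed
  have "\<bar>g' a\<bar> \<le> 2 * L" if "a \<le> 2" for a
  proof -
    have "\<bar>g' (max 0 a) - g' 0\<bar> \<le> L * \<bar>max 0 a - 0\<bar>" using that by (intro l) auto
    also have "\<dots> \<le> L * 2" using that by (intro mult_left_mono) (auto simp: L_def)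
    finally show ?thesis by (simp add: ext_def g0)
  qed
  then show ?thesis using that[of L] l by (auto simp: L_def)
qed

text \<open>The additive constants of H and X are left to the choice operator, since only
  differences of energies are used.\<close>

definition H :: "real \<Rightarrow> real" where "H = (SOME H. \<forall>s. (H has_real_derivative g' s) (at s))"

definition X :: "real \<Rightarrow> real" where "X = (SOME X. \<forall>s. (X has_real_derivative ramp s) (at s))"

lemma dH: "(H has_real_derivative g' s) (at s)"
proof -
  have "\<exists>H. \<forall>s. (H has_real_derivative g' s) (at s)" using antiderivative_real[OF ext_cont] by blast
  from someI_ex[OF this] show ?thesis by (simp add: H_def)
qed

lemma dX: "(X has_real_derivative ramp s) (at s)"
proof -
  have "continuous_on UNIV ramp" unfolding ramp_def[abs_def] by (intro continuous_intros)
  then have "\<exists>X. \<forall>s. (X has_real_derivative ramp s) (at s)" using antiderivative_real by blast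
  from someI_ex[OF this] show ?thesis by (simp add: X_def)
qed

text \<open>Below -1 the ramp vanishes, so X is constant there; the third bound, independent of a,
  is the point of replacing a constant perturbation by a ramp.\<close>

lemma X_bounds: "a \<le> b \<Longrightarrow> 0 \<le> X b - X a" "a \<le> b \<Longrightarrow> X b - X a \<le> b - a" "-1 \<le> b \<Longrightarrow> a \<le> b \<Longrightarrow> X b - X a \<le> b + 1"
proof -
  show A: "0 \<le> X b - X a" if "a \<le> b" for a b
    using DERIV_nonneg_imp_nondecreasing[OF that, of X] dX ramp_bounds(1) by force
  have B: "X b - X a \<le> b - a" if "a \<le> b" for a b
  proof -
    have "b - X b \<ge> a - X a"
    proof (rule DERIV_nonneg_imp_nondecreasing[OF that, of "\<lambda>s. s - X s"])
      fix s show "\<exists>y. ((\<lambda>s. s - X s) has_real_derivative y) (at s) \<and> 0 \<le> y"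
        by (rule exI[of _ "1 - ramp s"]) (auto intro!: derivative_eq_intros dX simp: ramp_bounds)
    qed
    then show ?thesis by linarith
  qed
  then show "a \<le> b \<Longrightarrow> X b - X a \<le> b - a" .
  assume ab: "-1 \<le> b" "a \<le> b"
  have C: "X (-1) - X a \<le> 0" if "a \<le> -1" for a
  proof -
    have "X (-1) \<le> X a"
    proof (rule DERIV_nonpos_imp_nonincreasing[OF that, of X])
      fix s :: real assume "s \<le> -1"
      then show "\<exists>y. (X has_real_derivative y) (at s) \<and> y \<le> 0" using dX[of s] ramp_bounds(4)[of s] by auto
    qed
    then show ?thesis by linarith
  qed
  show "X b - X a \<le> b + 1"
  proof (cases "a \<le> -1")
    case True then show ?thesis using C[OF True] B[OF ab(1)] by linarith
  next
    case False then show ?thesis using B[OF ab(2)] by linarith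
  qed
qed

lemma H_diff: "a \<le> b \<Longrightarrow> (\<And>s. a < s \<Longrightarrow> s < b \<Longrightarrow> g' s \<le> M) \<Longrightarrow> H b - H a \<le> M * (b - a)"
  and H_diff': "a \<le> b \<Longrightarrow> (\<And>s. a < s \<Longrightarrow> s < b \<Longrightarrow> M \<le> g' s) \<Longrightarrow> M * (b - a) \<le> H b - H a"
proof -
  have e: "\<exists>s. a < s \<and> s < b \<and> H b - H a = (b - a) * g' s" if "a < b"
    using MVT2[OF that, of H g'] dH by blast
  show "H b - H a \<le> M * (b - a)" if ab: "a \<le> b" "\<And>s. a < s \<Longrightarrow> s < b \<Longrightarrow> g' s \<le> M"
  proof (cases "a < b")
    case True
    then obtain s where "a < s" "s < b" "H b - H a = (b - a) * g' s" using e by blast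
    then show ?thesis using mult_left_mono[OF ab(2)[of s], of "b - a"] ab(1) by (simp add: mult.commute)
  qed (use ab in simp)
  show "M * (b - a) \<le> H b - H a" if ab: "a \<le> b" "\<And>s. a < s \<Longrightarrow> s < b \<Longrightarrow> M \<le> g' s"
  proof (cases "a < b")
    case True
    then obtain s where "a < s" "s < b" "H b - H a = (b - a) * g' s" using e by blast
    then show ?thesis using mult_left_mono[OF ab(2)[of s], of "b - a"] ab(1) by (simp add: mult.commute)
  qed (use ab in simp)
qed

lemma ext_nonneg: "s \<le> 1 \<Longrightarrow> 0 \<le> g' s"
  using gpos[of s] g0 g1 by (cases "s \<le> 0"; cases "s = 1") (auto simp: ext_def)

lemma ext_pos: "0 < s \<Longrightarrow> s < 1 \<Longrightarrow> 0 < g' s"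
  using gpos[of s] by (simp add: ext_def)

lemma ext_nonpos: "1 \<le> s \<Longrightarrow> g' s \<le> 0"
  using gneg[of s] g1 by (cases "s = 1") (auto simp: ext_def)

lemma H_mono: "a \<le> b \<Longrightarrow> b \<le> 1 \<Longrightarrow> H a \<le> H b"
  using H_diff'[of a b 0] ext_nonneg by force

lemma H_antimono: "1 \<le> a \<Longrightarrow> a \<le> b \<Longrightarrow> H b \<le> H a"
  using H_diff[of a b 0] ext_nonpos by force

lemma H_strict: "0 \<le> a \<Longrightarrow> a < b \<Longrightarrow> b \<le> 1 \<Longrightarrow> H a < H b"
proof -
  assume a: "0 \<le> a" "a < b" "b \<le> 1"
  obtain s where "a < s" "s < b" "H b - H a = (b - a) * g' s" using MVT2[OF a(2), of H g'] dH by blast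
  moreover have "0 < (b - a) * g' s" using ext_pos[of s] a calculation by auto
  ultimately show ?thesis by linarith
qed

lemma H_le1: "H s \<le> H 1"
  using H_mono[of s 1] H_antimono[of 1 s] by (cases "s \<le> 1") auto

lemma H_lt1: "s < 1 \<Longrightarrow> H s < H 1"
  using H_mono[of s "max s 0"] H_strict[of "max s 0" 1] by (cases "s < 0") auto

text \<open>On the separatrix (D W')^2 = 2 D (H 1 - H W), so the equation is the squared Robin
  condition at the level \<theta>. At 0 the energy side is larger, at 1 it vanishes, and the
  intermediate value theorem applies.\<close>

lemma theta_exists: obtains \<theta> where "0 < \<theta>" "\<theta> < 1" "2 * D * (H 1 - H \<theta>) = \<kappa>\<^sup>2 * \<theta>\<^sup>2"
proof -
  define Q where "Q s = \<kappa>\<^sup>2 * s\<^sup>2 - 2 * D * (H 1 - H s)" for s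
  have Qc: "isCont Q s" for s unfolding Q_def by (intro continuous_intros DERIV_isCont[OF dH])
  have Q0: "Q 0 < 0" using H_lt1[of 0] D by (simp add: Q_def)
  have Q1: "Q 1 > 0" using \<kappa> by (simp add: Q_def)
  obtain s where s: "0 \<le> s" "s \<le> 1" "Q s = 0" using IVT[of Q 0 0 1] Qc Q0 Q1 by auto
  have "s \<noteq> 0" "s \<noteq> 1" using s Q0 Q1 by auto
  then show ?thesis using that[of s] s by (auto simp: Q_def)
qed

definition \<theta> :: real where "\<theta> = (SOME \<theta>. 0 < \<theta> \<and> \<theta> < 1 \<and> 2 * D * (H 1 - H \<theta>) = \<kappa>\<^sup>2 * \<theta>\<^sup>2)"

lemma theta: "0 < \<theta>" "\<theta> < 1" "2 * D * (H 1 - H \<theta>) = \<kappa>\<^sup>2 * \<theta>\<^sup>2"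
proof -
  have "\<exists>\<theta>. 0 < \<theta> \<and> \<theta> < 1 \<and> 2 * D * (H 1 - H \<theta>) = \<kappa>\<^sup>2 * \<theta>\<^sup>2" using theta_exists by metis
  from someI_ex[OF this] show "0 < \<theta>" "\<theta> < 1" "2 * D * (H 1 - H \<theta>) = \<kappa>\<^sup>2 * \<theta>\<^sup>2" by (simp_all add: \<theta>_def)
qed

text \<open>The Lipschitz bounds of \<open>ext g\<close> and \<open>ramp\<close>, with
  \<open>\<bar>m\<bar> \<le> 1\<close>, give the linear control at the zero z that
  \<open>profile_exists\<close> asks for.\<close>

lemma perturbed_profile:
  assumes m: "\<bar>m\<bar> \<le> 1" and z: "0 < z" "z \<le> 2" and zero: "g' z + m * ramp z = 0" and a: "a < z"
    and pos: "\<And>s. s < z \<Longrightarrow> H s + m * X s < H z + m * X z"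
  obtains W W' where "profile D (\<lambda>s. g' s + m * ramp s) z W W'" "W 0 = a"
    "\<And>t. (D * W' t)\<^sup>2 = 2 * D * ((H z + m * X z) - (H (W t) + m * X (W t)))"
proof -
  obtain L where L: "0 < L" "\<And>a b. a \<le> 2 \<Longrightarrow> b \<le> 2 \<Longrightarrow> \<bar>g' a - g' b\<bar> \<le> L * \<bar>a - b\<bar>"
    "\<And>a. a \<le> 2 \<Longrightarrow> \<bar>g' a\<bar> \<le> 2 * L" by (rule ext_lipschitz) auto
  have dd: "((\<lambda>s. H s + m * X s) has_real_derivative g' s + m * ramp s) (at s)" for s
    by (auto intro!: derivative_eq_intros dH dX)
  have qu: "g' s + m * ramp s \<le> (L + 1) * (z - s)" if "s \<le> z" for s
  proof -
    have "g' s + m * ramp s = (g' s - g' z) + m * (ramp s - ramp z)" using zero by (simp add: algebra_simps)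
    also have "\<dots> \<le> \<bar>g' s - g' z\<bar> + \<bar>m\<bar> * \<bar>ramp s - ramp z\<bar>" by (metis abs_ge_self abs_mult add_mono)
    also have "\<dots> \<le> L * \<bar>s - z\<bar> + 1 * \<bar>s - z\<bar>"
      using L(2)[of s z] ramp_lipschitz[of s z] m that z by (intro add_mono mult_mono) auto
    also have "\<dots> = (L + 1) * (z - s)" using that by (simp add: algebra_simps)
    finally show ?thesis .
  qed
  show ?thesis
    by (rule profile_exists[OF D dd a pos qu], assumption, assumption, rule that)
qed

lemma base_profile:
  obtains W W' where "profile D g' 1 W W'" "W 0 = \<theta>" "D * W' 0 = \<kappa> * \<theta>"
proof -
  obtain W W' where W: "profile D (\<lambda>s. g' s + 0 * ramp s) 1 W W'" "W 0 = \<theta>"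
    "\<And>t. (D * W' t)\<^sup>2 = 2 * D * ((H 1 + 0 * X 1) - (H (W t) + 0 * X (W t)))"
    by (rule perturbed_profile[of 0 1 \<theta>]) (use theta H_lt1 g1 in \<open>auto simp: ext_def\<close>)
  \<comment> \<open>Only squares can be compared through the energy; positivity of both sides
    selects the root.\<close>
  have "(D * W' 0)\<^sup>2 = (\<kappa> * \<theta>)\<^sup>2" using W(3)[of 0] W(2) theta(3) by (simp add: power_mult_distrib)
  moreover have "0 < D * W' 0" using W(1) D by (simp add: profile_def)
  ultimately have "D * W' 0 = \<kappa> * \<theta>" using theta \<kappa> by (simp add: power2_eq_iff_nonneg)
  then show ?thesis using that W by simp
qed

text \<open>\<open>1 - \<eta> < z < 1 + \<eta>\<close> and \<open>\<theta> - \<eta> < a < \<theta> + \<eta>\<close> keep the initial data of the two profiles, hence by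
  Gronwall the profiles themselves, close on \<open>{0..R}\<close>.\<close>

lemma profile_close:
  assumes e: "0 < e" and R: "0 \<le> R"
    and P0: "profile D g' 1 W0 W0'" "W0 0 = \<theta>" "D * W0' 0 = \<kappa> * \<theta>"
  obtains \<eta> where "0 < \<eta>" "\<eta> \<le> 1"
    "\<And>m z W W' t. \<bar>m\<bar> \<le> \<eta> \<Longrightarrow> \<bar>z - 1\<bar> \<le> \<eta> \<Longrightarrow> \<bar>W 0 - \<theta>\<bar> \<le> \<eta> \<Longrightarrow> 0 \<le> W 0 \<Longrightarrow>
       profile D (\<lambda>s. g' s + m * ramp s) z W W' \<Longrightarrow>
       (D * W' 0)\<^sup>2 = 2 * D * ((H z + m * X z) - (H (W 0) + m * X (W 0))) \<Longrightarrow>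
       0 \<le> t \<Longrightarrow> t \<le> R \<Longrightarrow> \<bar>W t - W0 t\<bar> \<le> e"
proof -
  obtain L where L: "0 < L" "\<And>a b. a \<le> 2 \<Longrightarrow> b \<le> 2 \<Longrightarrow> \<bar>g' a - g' b\<bar> \<le> L * \<bar>a - b\<bar>"
    "\<And>a. a \<le> 2 \<Longrightarrow> \<bar>g' a\<bar> \<le> 2 * L" by (rule ext_lipschitz) auto
  define K where "K = 2 + L / D"
  have K0: "K > 0" using L D by (simp add: K_def add_pos_pos)
  \<comment> \<open>The three summands bound the squared initial differences of W and of W', and
    \<open>(m / D)\<^sup>2\<close>, each as a multiple of \<eta>.\<close>
  define C where "C = 1 + 2 / D * (4 * L + 2) + 1 / D\<^sup>2"
  have C0: "C > 0" using L D by (simp add: C_def add_pos_pos)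
  define \<eta> where "\<eta> = min 1 (e\<^sup>2 * exp (- (K * R)) / C)"
  have \<eta>: "0 < \<eta>" "\<eta> \<le> 1" "C * \<eta> \<le> e\<^sup>2 * exp (- (K * R))"
    using e C0 by (auto simp: \<eta>_def min_def field_simps)
  have HL: "\<bar>H b - H a\<bar> \<le> 2 * L * \<bar>b - a\<bar>" if "a \<le> 2" "b \<le> 2" for a b
  proof -
    have 1: "\<bar>H b - H a\<bar> \<le> 2 * L * (b - a)" if "a \<le> b" "b \<le> 2" for a b
    proof -
      have "H b - H a \<le> 2 * L * (b - a)" using L(3) that by (intro H_diff) (auto simp: abs_le_iff)
      moreover have "- (2 * L) * (b - a) \<le> H b - H a"
      proof (rule H_diff')
        fix s assume "a < s" "s < b"
        then show "- (2 * L) \<le> g' s" using L(3)[of s] that by linarith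
      qed (use that in simp)
      ultimately show ?thesis by (simp add: abs_le_iff)
    qed
    show ?thesis using 1[of a b] 1[of b a] that by (cases "a \<le> b") (auto simp: abs_minus_commute)
  qed
  show ?thesis
  proof (rule that[OF \<eta>(1,2)])
    fix m z W W' t
    assume m: "\<bar>m\<bar> \<le> \<eta>" and z: "\<bar>z - 1\<bar> \<le> \<eta>" and w: "\<bar>W 0 - \<theta>\<bar> \<le> \<eta>" "0 \<le> W 0"
      and P: "profile D (\<lambda>s. g' s + m * ramp s) z W W'"
      and E: "(D * W' 0)\<^sup>2 = 2 * D * ((H z + m * X z) - (H (W 0) + m * X (W 0)))" and t: "0 \<le> t" "t \<le> R"
    have z2: "z \<le> 2" using z \<eta> by (simp add: abs_le_iff)
    have Wz: "W s < z" for s using P by (simp add: profile_def)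
    have W0z: "W0 s < 1" for s using P0 by (simp add: profile_def)
    have "(W t - W0 t)\<^sup>2 \<le> ((W 0 - W0 0)\<^sup>2 + (W' 0 - W0' 0)\<^sup>2 + (\<bar>m\<bar> / D)\<^sup>2) * exp ((2 + L / D) * t)"
    proof (rule profile_gronwall[OF D P P0(1) _ _ _ t(1)])
      fix s :: real assume "0 \<le> s"
      have "\<bar>g' (W s) + m * ramp (W s) - g' (W0 s)\<bar> \<le> \<bar>g' (W s) - g' (W0 s)\<bar> + \<bar>m * ramp (W s)\<bar>" by linarith
      also have "\<dots> \<le> L * \<bar>W s - W0 s\<bar> + \<bar>m\<bar> * 1"
        unfolding abs_mult using ramp_bounds[of "W s"] Wz[of s] W0z[of s] z2
        by (intro add_mono L(2) mult_left_mono) auto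
      finally show "\<bar>g' (W s) + m * ramp (W s) - g' (W0 s)\<bar> \<le> L * \<bar>W s - W0 s\<bar> + \<bar>m\<bar>" by simp
    qed (use L in auto)
    also have "\<dots> \<le> (C * \<eta>) * exp (K * R)"
    proof (rule mult_mono)
      have p1: "(W 0 - W0 0)\<^sup>2 \<le> \<eta>"
      proof -
        have "\<bar>W 0 - W0 0\<bar>\<^sup>2 \<le> \<eta>\<^sup>2" using w P0 by (intro power_mono) auto
        also have "\<dots> \<le> \<eta>" using \<eta> by (simp add: power2_eq_square mult_le_cancel_left1)
        finally show ?thesis by simp
      qed
      have p3: "(\<bar>m\<bar> / D)\<^sup>2 \<le> 1 / D\<^sup>2 * \<eta>"
      proof -
        have "\<bar>m\<bar>\<^sup>2 \<le> \<eta>\<^sup>2" using m by (intro power_mono) auto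
        also have "\<dots> \<le> \<eta>" using \<eta> by (simp add: power2_eq_square mult_le_cancel_left1)
        finally show ?thesis using D by (simp add: power_divide divide_right_mono)
      qed
      have p2: "(W' 0 - W0' 0)\<^sup>2 \<le> 2 / D * (4 * L + 2) * \<eta>"
      proof -
        define p where "p = D * W' 0" define p0 where "p0 = D * W0' 0"
        have pp: "p > 0" "p0 > 0" using P D theta \<kappa> P0(3) by (auto simp: p_def p0_def profile_def)
        have "p0\<^sup>2 = 2 * D * (H 1 - H \<theta>)" using P0(3) theta(3) by (simp add: p0_def power_mult_distrib)
        then have d: "p\<^sup>2 - p0\<^sup>2 = 2 * D * ((H z - H 1) - (H (W 0) - H \<theta>) + m * (X z - X (W 0)))"
          using E by (simp add: p_def algebra_simps)
        have "\<bar>(H z - H 1) - (H (W 0) - H \<theta>) + m * (X z - X (W 0))\<bar>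
            \<le> \<bar>H z - H 1\<bar> + \<bar>H (W 0) - H \<theta>\<bar> + \<bar>m\<bar> * \<bar>X z - X (W 0)\<bar>"
          by (simp add: abs_mult[symmetric])
        also have "\<dots> \<le> 2 * L * \<eta> + 2 * L * \<eta> + \<eta> * 2"
        proof (intro add_mono mult_mono)
          show "\<bar>H z - H 1\<bar> \<le> 2 * L * \<eta>" by (rule order_trans[OF HL[of 1 z]]) (use z2 z L(1) in auto)
          show "\<bar>H (W 0) - H \<theta>\<bar> \<le> 2 * L * \<eta>"
            by (rule order_trans[OF HL[of \<theta> "W 0"]]) (use z2 Wz[of 0] theta w(1) L(1) in auto)
          show "\<bar>X z - X (W 0)\<bar> \<le> 2" using X_bounds(1,2)[of "W 0" z] Wz[of 0] z2 w by simp
        qed (use m \<eta> in auto)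
        finally have "\<bar>(H z - H 1) - (H (W 0) - H \<theta>) + m * (X z - X (W 0))\<bar> \<le> (4 * L + 2) * \<eta>"
          by (simp add: algebra_simps)
        from mult_left_mono[OF this, of "2 * D"] have "\<bar>p\<^sup>2 - p0\<^sup>2\<bar> \<le> 2 * D * ((4 * L + 2) * \<eta>)"
          unfolding d abs_mult using D by simp
        \<comment> \<open>Both slopes are positive, so
          \<open>\<bar>p - p0\<bar> \<le> p + p0\<close>. The energies control only the difference
          of squares, which is why the square of the error, and not the error, is linear in
          \<eta>.\<close>
        moreover have "(p - p0)\<^sup>2 \<le> \<bar>p\<^sup>2 - p0\<^sup>2\<bar>"
        proof -
          have "(p - p0)\<^sup>2 = \<bar>p - p0\<bar> * \<bar>p - p0\<bar>" by (simp add: power2_eq_square)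
          also have "\<dots> \<le> \<bar>p - p0\<bar> * \<bar>p + p0\<bar>" using pp by (intro mult_left_mono) auto
          also have "\<dots> = \<bar>p\<^sup>2 - p0\<^sup>2\<bar>" by (simp add: abs_mult[symmetric] power2_eq_square algebra_simps)
          finally show ?thesis .
        qed
        moreover have "(p - p0)\<^sup>2 = D\<^sup>2 * (W' 0 - W0' 0)\<^sup>2" by (simp add: p_def p0_def power_mult_distrib[symmetric] algebra_simps)
        ultimately have "D\<^sup>2 * (W' 0 - W0' 0)\<^sup>2 \<le> 2 * D * ((4 * L + 2) * \<eta>)" by linarith
        also have "2 * D * ((4 * L + 2) * \<eta>) = D\<^sup>2 * (2 / D * (4 * L + 2) * \<eta>)" using D
          by (simp add: power2_eq_square)
        finally show ?thesis by (rule mult_left_le_imp_le) (use D in simp)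
      qed
      show "(W 0 - W0 0)\<^sup>2 + (W' 0 - W0' 0)\<^sup>2 + (\<bar>m\<bar> / D)\<^sup>2 \<le> C * \<eta>"
        using p1 p2 p3 by (simp add: C_def algebra_simps)
      show "exp ((2 + L / D) * t) \<le> exp (K * R)" using t K0 by (simp add: K_def mult_left_mono)
      show "0 \<le> C * \<eta>" using C0 \<eta> by simp
    qed simp
    also have "\<dots> \<le> e\<^sup>2 * exp (- (K * R)) * exp (K * R)" using \<eta> by (intro mult_right_mono) auto
    also have "\<dots> = e\<^sup>2" unfolding mult.assoc exp_add[symmetric] by simp
    finally show "\<bar>W t - W0 t\<bar> \<le> e" using e by (simp add: abs_le_square_iff[symmetric])
  qed
qed


text \<open>B bounds the errors created when a profile is shifted in time or bent along the
  interface: they carry a factor W' or the reaction term, and the energy identity controls W'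
  wherever the profile is nonnegative.\<close>

lemma speed_bound:
  assumes P: "profile D (\<lambda>s. g' s + m * ramp s) z W W'" and m: "\<bar>m\<bar> \<le> 1" and z: "0 \<le> z" "z \<le> 2"
    and E: "\<And>t. (D * W' t)\<^sup>2 = 2 * D * ((H z + m * X z) - (H (W t) + m * X (W t)))"
  obtains B where "0 < B" "\<And>t. 0 \<le> W t \<Longrightarrow> W' t \<le> B" "\<And>s. 0 \<le> s \<Longrightarrow> s \<le> z \<Longrightarrow> \<bar>g' s + m * ramp s\<bar> \<le> B"
proof -
  obtain L where L: "0 < L" "\<And>a b. a \<le> 2 \<Longrightarrow> b \<le> 2 \<Longrightarrow> \<bar>g' a - g' b\<bar> \<le> L * \<bar>a - b\<bar>"
    "\<And>a. a \<le> 2 \<Longrightarrow> \<bar>g' a\<bar> \<le> 2 * L" by (rule ext_lipschitz) auto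
  define Q where "Q = 2 * D * (2 * (2 * L) + 2)"
  define B where "B = (Q + 1) / D + 2 * L + 1"
  have Q0: "Q > 0" using D L by (simp add: Q_def)
  show ?thesis
  proof (rule that[of B])
    show "0 < B" using Q0 D L by (simp add: B_def add_pos_pos)
    fix t assume t: "0 \<le> W t"
    have Wz: "W t < z" "0 < W' t" using P by (auto simp: profile_def)
    have "H z - H (W t) \<le> 2 * L * (z - W t)"
    proof (rule H_diff)
      fix s assume "W t < s" "s < z"
      then show "g' s \<le> 2 * L" using L(3)[of s] z by linarith
    qed (use Wz in simp)
    also have "\<dots> \<le> 2 * L * 2" using L t z by (intro mult_left_mono) auto
    finally have 1: "H z - H (W t) \<le> 2 * (2 * L)" by simp
    have "m * (X z - X (W t)) \<le> \<bar>m\<bar> * \<bar>X z - X (W t)\<bar>" by (metis abs_ge_self abs_mult)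
    also have "\<dots> \<le> 1 * 2" using m X_bounds(1,2)[of "W t" z] Wz z t by (intro mult_mono) auto
    finally have 2: "m * (X z - X (W t)) \<le> 2" by simp
    have "(D * W' t)\<^sup>2 = 2 * D * ((H z - H (W t)) + m * (X z - X (W t)))" unfolding E by (simp add: algebra_simps)
    also have "\<dots> \<le> Q" unfolding Q_def using 1 2 D by (intro mult_left_mono) auto
    also have "\<dots> \<le> (Q + 1)\<^sup>2" using Q0 by (simp add: power2_eq_square algebra_simps)
    finally have "D * W' t \<le> Q + 1" by (rule power2_le_imp_le) (use Q0 in simp)
    then have "W' t \<le> (Q + 1) / D" using D by (simp add: field_simps)
    then show "W' t \<le> B" using L by (simp add: B_def)
  next
    fix s assume s: "0 \<le> s" "s \<le> z"
    have "\<bar>g' s + m * ramp s\<bar> \<le> \<bar>g' s\<bar> + \<bar>m\<bar> * \<bar>ramp s\<bar>" by (simp add: abs_mult[symmetric])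
    also have "\<dots> \<le> 2 * L + 1 * 1" using L(3)[of s] s z m ramp_bounds[of s] by (intro add_mono mult_mono) auto
    also have "\<dots> \<le> B" using Q0 D by (simp add: B_def)
    finally show "\<bar>g' s + m * ramp s\<bar> \<le> B" .
  qed
qed

section \<open>Strict profiles on either side of the steady state\<close>

lemma profile_mono: "profile D h z W W' \<Longrightarrow> s \<le> t \<Longrightarrow> W s \<le> W t"
  unfolding profile_def by (metis DERIV_nonneg_imp_nondecreasing less_imp_le)

text \<open>Raising g by m pushes its zero above 1 and gives strictness. Starting above \<theta>
  raises \<kappa> W, while the energy, and with it W', can rise only by O(m); for small m this
  leaves the margin b in the Robin inequality. As W increases, the margin persists for all t \<ge>
  0, so every forward shift of the profile is still a barrier.\<close>

lemma upper_profile: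
  assumes e: "0 < e" and R: "0 \<le> R"
    and P0: "profile D g' 1 W0 W0'" "W0 0 = \<theta>" "D * W0' 0 = \<kappa> * \<theta>"
  obtains m z W W' b where "0 < m" "m \<le> 1" "1 < z" "z \<le> 2" "0 < b" "profile D (\<lambda>s. g' s + m * ramp s) z W W'"
    "\<And>t. (D * W' t)\<^sup>2 = 2 * D * ((H z + m * X z) - (H (W t) + m * X (W t)))"
    "0 < W 0" "\<And>t. 0 \<le> t \<Longrightarrow> D * W' t \<le> \<kappa> * W t - b" "\<And>t. 0 \<le> t \<Longrightarrow> t \<le> R \<Longrightarrow> \<bar>W t - W0 t\<bar> \<le> e"
proof -
  obtain \<eta> where \<eta>: "0 < \<eta>" "\<eta> \<le> 1"
    "\<And>m z W W' t. \<bar>m\<bar> \<le> \<eta> \<Longrightarrow> \<bar>z - 1\<bar> \<le> \<eta> \<Longrightarrow> \<bar>W 0 - \<theta>\<bar> \<le> \<eta> \<Longrightarrow> 0 \<le> W 0 \<Longrightarrow>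
       profile D (\<lambda>s. g' s + m * ramp s) z W W' \<Longrightarrow>
       (D * W' 0)\<^sup>2 = 2 * D * ((H z + m * X z) - (H (W 0) + m * X (W 0))) \<Longrightarrow>
       0 \<le> t \<Longrightarrow> t \<le> R \<Longrightarrow> \<bar>W t - W0 t\<bar> \<le> e"
    by (rule profile_close[OF e R P0]) (rule that)
  define a where "a = \<theta> + min \<eta> (1 - \<theta>) / 2"
  have a: "\<theta> < a" "a < 1" "a - \<theta> \<le> \<eta>" using theta \<eta> by (auto simp: a_def min_def field_simps)
  \<comment> \<open>Room for the perturbation: D W' may rise from \<kappa> \<theta> to \<kappa>
    times the midpoint of \<theta> and a; the other half of the way to \<kappa> a becomes the margin
    b.\<close>
  define gap where "gap = (\<kappa> * (a + \<theta>) / 2)\<^sup>2 - (\<kappa> * \<theta>)\<^sup>2"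
  have gap: "gap > 0"
  proof -
    have "\<kappa> * \<theta> < \<kappa> * (a + \<theta>) / 2" using \<kappa> a by (simp add: field_simps)
    then have "(\<kappa> * \<theta>)\<^sup>2 < (\<kappa> * (a + \<theta>) / 2)\<^sup>2" using \<kappa> theta by (intro power_strict_mono) auto
    then show ?thesis by (simp add: gap_def)
  qed
  have g1e: "g (1 + \<eta>) < 0" using gneg \<eta> by simp
  \<comment> \<open>The three bounds serve \<open>profile_close\<close>, the energy gap (X varies by
    at most 2), and the existence of a zero of g + m before 1 + \<eta>.\<close>
  define m where "m = min (min \<eta> (gap / (4 * D))) (- g (1 + \<eta>) / 2)"
  have m: "0 < m" "m \<le> \<eta>" "m \<le> gap / (4 * D)" "m < - g (1 + \<eta>)"
    using \<eta> gap D g1e by (auto simp: m_def min_def)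
  have m4: "4 * D * m \<le> gap" using m(3) D by (simp add: field_simps)
  \<comment> \<open>z will be the first zero of g + m beyond 1; taking the first one makes the
    primitive strictly increasing on \<open>{0..z}\<close>.\<close>
  define S where "S = {s \<in> {1..1+\<eta>}. g s + m \<le> 0}"
  have "S = {1..1+\<eta>} \<inter> (\<lambda>s. g s + m) -` {..0}" by (auto simp: S_def)
  moreover have "continuous_on {1..1+\<eta>} (\<lambda>s. g s + m)"
    by (intro continuous_intros continuous_at_imp_continuous_on ballI g_cont)
  ultimately have clS: "closed S" by (simp only:) (rule continuous_closed_preimage, auto)
  have bb: "bdd_below S" by (rule bdd_belowI[of _ 1]) (simp add: S_def)
  have Sne: "1 + \<eta> \<in> S" using m \<eta> by (simp add: S_def)
  have zS: "Inf S \<in> S" by (rule closed_contains_Inf[OF _ bb clS]) (use Sne in blast)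
  define z where "z = Inf S"
  have z1: "1 \<le> z" "z \<le> 1 + \<eta>" "g z + m \<le> 0" using zS by (auto simp: z_def S_def)
  have below: "g s + m > 0" if "0 \<le> s" "s < z" for s
  proof (cases "s \<le> 1")
    case True then show ?thesis using ext_nonneg[of s] that m by (simp add: ext_def)
  next
    case False
    have "s \<notin> S" using cInf_lower[OF _ bb, of s] that by (auto simp: z_def)
    then show ?thesis using False that z1 by (auto simp: S_def)
  qed
  have z1': "1 < z" using z1 g1 m by (cases "z = 1") auto
  have gz: "g z + m = 0"
  proof (rule ccontr)
    assume "g z + m \<noteq> 0"
    then have "g z + m < 0" using z1 by simp
    then obtain s where "1 \<le> s" "s \<le> z" "g s + m = 0"
      using IVT2[of "\<lambda>s. g s + m" z 0 1] z1 m g1 g_cont by (auto intro!: continuous_intros)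
    then show False using below[of s] \<open>g z + m < 0\<close> by (cases "s = z") auto
  qed
  have dm: "((\<lambda>s. H s + m * X s) has_real_derivative g' s + m * ramp s) (at s)" for s
    by (auto intro!: derivative_eq_intros dH dX)
  have pos: "H s + m * X s < H z + m * X z" if "s < z" for s
  proof -
    \<comment> \<open>Below 0 mere monotonicity is enough; strictness comes from the part above
      0.\<close>
    define s' where "s' = max s 0"
    have s': "0 \<le> s'" "s' < z" "s \<le> s'" using that z1 by (auto simp: s'_def)
    have "H s + m * X s \<le> H s' + m * X s'"
    proof (rule DERIV_nonneg_imp_nondecreasing[OF s'(3), of "\<lambda>s. H s + m * X s"])
      fix x assume "s \<le> x" "x \<le> s'"
      then have "g' x \<ge> 0 \<or> 0 \<le> x" using g0 by (auto simp: ext_def max_def)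
      then have "0 \<le> g' x + m * ramp x"
      proof
        assume "0 \<le> g' x" then show ?thesis using m ramp_bounds[of x] by simp
      next
        assume "0 \<le> x"
        then show ?thesis using below[of x] \<open>x \<le> s'\<close> s' ramp_bounds(3)[of x] by (simp add: ext_def)
      qed
      then show "\<exists>y. ((\<lambda>s. H s + m * X s) has_real_derivative y) (at x) \<and> 0 \<le> y" using dm by blast
    qed
    also have "\<dots> < H z + m * X z"
    proof (rule DERIV_pos_imp_increasing_open[OF s'(2), of "\<lambda>s. H s + m * X s"])
      fix x assume "s' < x" "x < z"
      then have "0 < g' x + m * ramp x" using below[of x] s' ramp_bounds(3)[of x] by (simp add: ext_def)
      then show "\<exists>y. ((\<lambda>s. H s + m * X s) has_real_derivative y) (at x) \<and> 0 < y" using dm by blast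
    qed (auto intro!: continuous_at_imp_continuous_on DERIV_isCont[OF dm])
    finally show ?thesis .
  qed
  obtain W W' where W: "profile D (\<lambda>s. g' s + m * ramp s) z W W'" "W 0 = a"
    "\<And>t. (D * W' t)\<^sup>2 = 2 * D * ((H z + m * X z) - (H (W t) + m * X (W t)))"
    by (rule perturbed_profile[of m z a]) (use m \<eta> z1 gz a pos ramp_bounds(3)[of z] in \<open>auto simp: ext_def\<close>)
  have z2: "z \<le> 2" using z1 \<eta> by simp
  show ?thesis
  proof (rule that[OF m(1) _ z1' z2 _ W(1) W(3)])
    show "m \<le> 1" using m \<eta> by simp
    show "0 < \<kappa> * (a - \<theta>) / 2" using \<kappa> a by simp
    show "0 < W 0" using W theta a by simp
    fix t :: real assume t: "0 \<le> t"
    have Wt: "a \<le> W t" using profile_mono[OF W(1) t] W(2) by simp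
    have Wz: "W t < z" using W(1) by (simp add: profile_def)
    have 1: "H z - H (W t) \<le> H 1 - H \<theta>"
    proof (cases "W t \<le> 1")
      case True
      then show ?thesis using H_le1[of z] H_mono[of \<theta> "W t"] Wt a by simp
    next
      case False
      then show ?thesis using H_antimono[of "W t" z] H_le1[of \<theta>] Wz by simp
    qed
    have "X z - X (W t) \<le> 2" using X_bounds(2)[of "W t" z] Wz Wt z2 a theta by simp
    then have 2: "m * (X z - X (W t)) \<le> m * 2" using m by (intro mult_left_mono) auto
    have "(D * W' t)\<^sup>2 = 2 * D * ((H z - H (W t)) + m * (X z - X (W t)))" unfolding W(3) by (simp add: algebra_simps)
    also have "\<dots> \<le> 2 * D * ((H 1 - H \<theta>) + m * 2)" using 1 2 D by (intro mult_left_mono) auto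
    also have "\<dots> = (\<kappa> * \<theta>)\<^sup>2 + 4 * D * m" using theta(3) by (simp add: algebra_simps power_mult_distrib)
    also have "\<dots> \<le> (\<kappa> * (a + \<theta>) / 2)\<^sup>2" using m4 by (simp add: gap_def)
    finally have "D * W' t \<le> \<kappa> * (a + \<theta>) / 2" by (rule power2_le_imp_le) (use \<kappa> a theta in simp)
    also have "\<dots> = \<kappa> * a - \<kappa> * (a - \<theta>) / 2" by (simp add: field_simps)
    also have "\<dots> \<le> \<kappa> * W t - \<kappa> * (a - \<theta>) / 2" using Wt \<kappa> by simp
    finally show "D * W' t \<le> \<kappa> * W t - \<kappa> * (a - \<theta>) / 2" .
    assume tR: "t \<le> R"
    show "\<bar>W t - W0 t\<bar> \<le> e"
      by (rule \<eta>(3)[OF _ _ _ _ W(1) W(3) t tR]) (use m z1 a W theta in auto)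
  qed
qed

text \<open>The counterpart of \<open>upper_profile\<close>, with one obstacle: g - m is negative
  near 0, so its primitive is not monotone and could exceed its value at z far to the left. Thanks
  to the ramp, X varies by at most 2 up to z, and 2 m is less than what H gains between \<theta> and
  z. The Robin margin is needed only for t \<le> 0 with W \<ge> 0, where the barrier can pass a
  nonnegative solution.\<close>

lemma lower_profile:
  assumes e: "0 < e" and R: "0 \<le> R"
    and P0: "profile D g' 1 W0 W0'" "W0 0 = \<theta>" "D * W0' 0 = \<kappa> * \<theta>"
  obtains m z W W' b where "0 < m" "m \<le> 1" "0 < z" "z < 1" "0 < b" "profile D (\<lambda>s. g' s + (- m) * ramp s) z W W'"
    "\<And>t. (D * W' t)\<^sup>2 = 2 * D * ((H z + (- m) * X z) - (H (W t) + (- m) * X (W t)))"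
    "0 < W 0" "\<And>t. t \<le> 0 \<Longrightarrow> 0 \<le> W t \<Longrightarrow> \<kappa> * W t + b \<le> D * W' t" "\<And>t. 0 \<le> t \<Longrightarrow> t \<le> R \<Longrightarrow> \<bar>W t - W0 t\<bar> \<le> e"
proof -
  obtain \<eta> where \<eta>: "0 < \<eta>" "\<eta> \<le> 1"
    "\<And>m z W W' t. \<bar>m\<bar> \<le> \<eta> \<Longrightarrow> \<bar>z - 1\<bar> \<le> \<eta> \<Longrightarrow> \<bar>W 0 - \<theta>\<bar> \<le> \<eta> \<Longrightarrow> 0 \<le> W 0 \<Longrightarrow>
       profile D (\<lambda>s. g' s + m * ramp s) z W W' \<Longrightarrow>
       (D * W' 0)\<^sup>2 = 2 * D * ((H z + m * X z) - (H (W 0) + m * X (W 0))) \<Longrightarrow>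
       0 \<le> t \<Longrightarrow> t \<le> R \<Longrightarrow> \<bar>W t - W0 t\<bar> \<le> e"
    by (rule profile_close[OF e R P0]) (rule that)
  obtain L where L: "0 < L" "\<And>a b. a \<le> 2 \<Longrightarrow> b \<le> 2 \<Longrightarrow> \<bar>g' a - g' b\<bar> \<le> L * \<bar>a - b\<bar>"
    "\<And>a. a \<le> 2 \<Longrightarrow> \<bar>g' a\<bar> \<le> 2 * L" by (rule ext_lipschitz) auto
  define a where "a = \<theta> - min \<eta> \<theta> / 2"
  have a: "0 < a" "a < \<theta>" "\<theta> - a \<le> \<eta>" using theta \<eta> by (auto simp: a_def min_def field_simps)
  define gap where "gap = (\<kappa> * \<theta>)\<^sup>2 - (\<kappa> * (a + \<theta>) / 2)\<^sup>2"
  have gap: "gap > 0"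
  proof -
    have "\<kappa> * (a + \<theta>) / 2 < \<kappa> * \<theta>" using \<kappa> a by (simp add: field_simps)
    then have "(\<kappa> * (a + \<theta>) / 2)\<^sup>2 < (\<kappa> * \<theta>)\<^sup>2" using \<kappa> theta a by (intro power_strict_mono) auto
    then show ?thesis by (simp add: gap_def)
  qed
  \<comment> \<open>The allowed distance of z from 1: it lowers the energy by at most
    \<open>2 * L * \<zeta>\<close>, which after multiplication by 2 D is half of the gap; the other
    half is for m.\<close>
  define \<zeta> where "\<zeta> = min (min \<eta> ((1 - \<theta>) / 2)) (gap / (8 * D * L))"
  have \<zeta>: "0 < \<zeta>" "\<zeta> \<le> \<eta>" "\<zeta> \<le> (1 - \<theta>) / 2" "\<zeta> \<le> gap / (8 * D * L)"
  proof -
    show "0 < \<zeta>" using \<eta> theta gap D L by (simp add: \<zeta>_def)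
    have "\<zeta> \<le> min \<eta> ((1 - \<theta>) / 2)" unfolding \<zeta>_def by (rule min.cobounded1)
    then show "\<zeta> \<le> \<eta>" "\<zeta> \<le> (1 - \<theta>) / 2" by (simp_all only: min.bounded_iff)
    show "\<zeta> \<le> gap / (8 * D * L)" unfolding \<zeta>_def by (rule min.cobounded2)
  qed
  have \<zeta>1: "\<theta> < 1 - \<zeta>" using \<zeta>(3) theta by (simp add: field_simps)
  have \<zeta>2: "2 * D * (2 * L * \<zeta>) \<le> gap / 2" using \<zeta>(4) D L by (simp add: field_simps)
  obtain s1 where s1: "s1 \<in> {\<theta>..1-\<zeta>}" "\<And>s. s \<in> {\<theta>..1-\<zeta>} \<Longrightarrow> g s1 \<le> g s"
  proof -
    have "continuous_on {\<theta>..1-\<zeta>} g" by (intro continuous_at_imp_continuous_on ballI g_cont)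
    moreover have "{\<theta>..1-\<zeta>} \<noteq> {}" using \<zeta>1 by simp
    ultimately have "\<exists>x\<in>{\<theta>..1-\<zeta>}. \<forall>y\<in>{\<theta>..1-\<zeta>}. g x \<le> g y"
      by (intro continuous_attains_inf compact_Icc)
    then show ?thesis using that by blast
  qed
  have gs1: "0 < g s1" using s1 theta \<zeta> by (intro gpos) auto
  have Hd: "0 < H (1 - \<zeta>) - H \<theta>" using H_strict[of \<theta> "1 - \<zeta>"] theta \<zeta> \<zeta>1 by simp
  \<comment> \<open>\<open>m < g s1\<close>, the minimum of g on
    \<open>{\<theta>..1-\<zeta>}\<close>, forces the zero of g - m past 1 - \<zeta>; the last bound
    defeats the excess of the primitive on the left.\<close>
  define m where "m = min (min \<eta> (gap / (8 * D))) (min (g s1 / 2) ((H (1 - \<zeta>) - H \<theta>) / 4))"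
  have m: "0 < m" "m \<le> \<eta>" "m \<le> gap / (8 * D)" "m < g s1" "m \<le> (H (1 - \<zeta>) - H \<theta>) / 4"
    using \<eta> gap D gs1 Hd by (auto simp: m_def min_def)
  have m4: "4 * D * m \<le> gap / 2" using m(3) D by (simp add: field_simps)
  define S where "S = {s \<in> {\<theta>..1}. g s \<le> m}"
  have "S = {\<theta>..1} \<inter> g -` {..m}" by (auto simp: S_def)
  moreover have "continuous_on {\<theta>..1} g"
    by (intro continuous_at_imp_continuous_on ballI g_cont)
  ultimately have clS: "closed S" by (simp only:) (rule continuous_closed_preimage, auto)
  have bb: "bdd_below S" by (rule bdd_belowI[of _ \<theta>]) (simp add: S_def)
  have Sne: "1 \<in> S" using m g1 theta by (simp add: S_def)
  have zS: "Inf S \<in> S" by (rule closed_contains_Inf[OF _ bb clS]) (use Sne in blast)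
  define z where "z = Inf S"
  have z1: "\<theta> \<le> z" "z \<le> 1" "g z \<le> m" using zS by (auto simp: z_def S_def)
  have below: "m < g s" if "\<theta> \<le> s" "s < z" for s
  proof -
    have "s \<notin> S" using cInf_lower[OF _ bb, of s] that by (auto simp: z_def)
    then show ?thesis using that z1 by (auto simp: S_def)
  qed
  have z2: "1 - \<zeta> < z"
  proof (rule ccontr)
    assume "\<not> 1 - \<zeta> < z"
    then show False using s1(2)[of z] z1 m(4) by simp
  qed
  have gz: "g z = m"
  proof (rule ccontr)
    assume "g z \<noteq> m"
    then have gz: "g z < m" using z1 by simp
    have "m \<le> g \<theta>" using s1(2)[of \<theta>] \<zeta>1 m(4) by simp
    then obtain s where "\<theta> \<le> s" "s \<le> z" "g s = m"
      using IVT2[of g z m \<theta>] z1 gz g_cont by auto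
    then show False using below[of s] gz by (cases "s = z") auto
  qed
  have z3: "z < 1" using gz g1 m z1 by (cases "z = 1") auto
  have dm: "((\<lambda>s. H s + (- m) * X s) has_real_derivative g' s + (- m) * ramp s) (at s)" for s
    by (rule DERIV_add[OF dH DERIV_cmult[OF dX]])
  have Hz: "H (1 - \<zeta>) \<le> H z" using H_mono z2 z1 by simp
  have pos: "H s + (- m) * X s < H z + (- m) * X z" if "s < z" for s
  proof (cases "\<theta> \<le> s")
    case True
    show ?thesis
    proof (rule DERIV_pos_imp_increasing_open[OF that, of "\<lambda>s. H s + (- m) * X s"])
      fix x assume "s < x" "x < z"
      then have "0 < g' x + (- m) * ramp x" using below[of x] True theta ramp_bounds(3)[of x] by (simp add: ext_def)
      then show "\<exists>y. ((\<lambda>s. H s + (- m) * X s) has_real_derivative y) (at x) \<and> 0 < y" using dm by blast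
    qed (intro continuous_at_imp_continuous_on ballI DERIV_isCont[OF dm])
  next
    case False
    have "X z - X s \<le> 2" using X_bounds(3)[of z s] z1 theta that by simp
    then have "m * (X z - X s) \<le> m * 2" using m by (intro mult_left_mono) auto
    moreover have "4 * m \<le> H (1 - \<zeta>) - H \<theta>" using m(5) by simp
    moreover have "H s \<le> H \<theta>" using H_mono False theta by simp
    ultimately have "m * (X z - X s) < H z - H s" using Hz m(1) by linarith
    then show ?thesis by (simp add: algebra_simps)
  qed
  have z0: "0 < z" using z1 theta by simp
  obtain W W' where W: "profile D (\<lambda>s. g' s + (- m) * ramp s) z W W'" "W 0 = a"
    "\<And>t. (D * W' t)\<^sup>2 = 2 * D * ((H z + (- m) * X z) - (H (W t) + (- m) * X (W t)))"
    by (rule perturbed_profile[of "- m" z a])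
       (use m \<eta> z1 z0 gz a pos ramp_bounds(3)[of z] in \<open>auto simp: ext_def\<close>)
  show ?thesis
  proof (rule that[OF m(1) _ z0 z3 _ W(1) W(3)])
    show "m \<le> 1" using m \<eta> by simp
    show "0 < \<kappa> * (\<theta> - a) / 2" using \<kappa> a by simp
    show "0 < W 0" using W a by simp
    show "\<kappa> * W t + \<kappa> * (\<theta> - a) / 2 \<le> D * W' t" if t: "t \<le> 0" "0 \<le> W t" for t
    proof -
      have Wt: "W t \<le> a" using profile_mono[OF W(1) t(1)] W(2) by simp
      have Wz: "W t < z" "0 < W' t" using W(1) by (auto simp: profile_def)
      have 1: "H \<theta> \<ge> H (W t)" using H_mono[of "W t" \<theta>] Wt a theta by simp
      have "H 1 - H z \<le> 2 * L * (1 - z)"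
      proof (rule H_diff)
        fix s assume "z < s" "s < 1"
        then show "g' s \<le> 2 * L" using L(3)[of s] by linarith
      qed (use z1 in simp)
      also have "\<dots> \<le> 2 * L * \<zeta>" using z2 L by (intro mult_left_mono) auto
      finally have 2: "H 1 - H z \<le> 2 * L * \<zeta>" .
      have "X z - X (W t) \<le> 2" using X_bounds(2)[of "W t" z] Wz t z1 by simp
      then have 3: "m * (X z - X (W t)) \<le> m * 2" using m by (intro mult_left_mono) auto
      have "(\<kappa> * (a + \<theta>) / 2)\<^sup>2 = (\<kappa> * \<theta>)\<^sup>2 - gap" by (simp add: gap_def)
      also have "\<dots> \<le> (\<kappa> * \<theta>)\<^sup>2 - 2 * D * (2 * L * \<zeta>) - 4 * D * m" using m4 \<zeta>2 by linarith
      also have "\<dots> = 2 * D * ((H 1 - H \<theta>) - 2 * L * \<zeta> - m * 2)"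
        using theta(3) by (simp add: algebra_simps power_mult_distrib)
      also have "\<dots> \<le> 2 * D * ((H z - H (W t)) - m * (X z - X (W t)))" using 1 2 3 D by (intro mult_left_mono) auto
      also have "\<dots> = (D * W' t)\<^sup>2" unfolding W(3) by (simp add: algebra_simps)
      finally have "\<kappa> * (a + \<theta>) / 2 \<le> D * W' t" by (rule power2_le_imp_le) (use D Wz in simp)
      moreover have "\<kappa> * (a + \<theta>) / 2 = \<kappa> * a + \<kappa> * (\<theta> - a) / 2" by (simp add: field_simps)
      moreover have "\<kappa> * W t \<le> \<kappa> * a" using Wt \<kappa> by simp
      ultimately show ?thesis by linarith
    qed
    fix t :: real assume t: "0 \<le> t" "t \<le> R"
    show "\<bar>W t - W0 t\<bar> \<le> e"
      by (rule \<eta>(3)[OF _ _ _ _ W(1) W(3) t]) (use m z1 z2 \<zeta> a W theta in auto)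
  qed
qed

end

section \<open>The system (HM): decay and upper bounds\<close>

locale hm_system =
  fixes D d \<mu> \<nu> \<rho> :: real and g :: "real \<Rightarrow> real" and k :: "'n::finite" and f :: "bool \<Rightarrow> real^'n \<Rightarrow> real \<Rightarrow> real"
  assumes D: "0 < D" and d: "0 < d" and \<mu>: "0 < \<mu>" and \<nu>: "0 < \<nu>" and \<rho>: "0 < \<rho>" and kpp: "KPP g"
    and cpl: "coupled (\<lambda>b. if b then D else d) (\<lambda>b. if b then \<mu> else \<nu>) (\<lambda>b s. if b then g s else - \<rho> * s) k f"
    and init: "x$k \<le> 0 \<Longrightarrow> 0 \<le> f b x 0"
begin

sublocale C: coupled "\<lambda>b. if b then D else d" "\<lambda>b. if b then \<mu> else \<nu>" "\<lambda>b s. if b then g s else - \<rho> * s" k f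
  by (rule cpl)

text \<open>Eliminating the bounded stationary \<open>V y = c1 * U 0 * exp (- lam * y)\<close> turns the exchange
  conditions into the Robin condition \<open>D * U' 0 = - kap * U 0\<close>.\<close>

definition lam :: real where "lam = sqrt (\<rho> / d)"
definition c1 :: real where "c1 = \<mu> / (\<nu> + d * lam)"
definition kap :: real where "kap = \<mu> * (d * lam) / (\<nu> + d * lam)"

lemma lam: "0 < lam" "d * lam\<^sup>2 = \<rho>"
  using d \<rho> by (auto simp: lam_def)

lemma c1: "0 < c1" "\<nu> * c1 + d * lam * c1 = \<mu>" "\<mu> - \<nu> * c1 = kap" "0 < kap" "d * lam * c1 = kap"
proof -
  have p: "0 < \<nu> + d * lam" using \<nu> d lam by (simp add: add_pos_pos)
  show "0 < c1" "0 < kap" using p \<mu> d lam by (auto simp: c1_def kap_def)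
  have "(\<nu> + d * lam) * c1 = \<mu>" using p by (simp add: c1_def)
  then show e: "\<nu> * c1 + d * lam * c1 = \<mu>" by (simp add: algebra_simps)
  show k: "d * lam * c1 = kap" by (simp add: c1_def kap_def)
  show "\<mu> - \<nu> * c1 = kap" using e k by simp
qed

sublocale P: kpp_profile g D kap
  by unfold_locales (use kpp D c1 in auto)

lemma f_nonneg: "x$k \<le> 0 \<Longrightarrow> 0 \<le> t \<Longrightarrow> 0 \<le> f b x t"
  by (rule C.nonneg) (use init P.g0 in auto)

section \<open>The critical speed and decay ahead of it\<close>

lemma deriv_pos: "0 < deriv g 0"
proof -
  have "\<forall>s. 0 < s \<and> s < 1 \<longrightarrow> 0 < g s \<and> g s \<le> deriv g 0 * s" using kpp unfolding KPP_def by blast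
  from this[rule_format, of "1/2"] show ?thesis by simp
qed

lemma g_le: "0 \<le> s \<Longrightarrow> g s \<le> deriv g 0 * s"
proof -
  assume s: "0 \<le> s"
  consider "s = 0" | "0 < s" "s < 1" | "s = 1" | "1 < s" using s by linarith
  then show ?thesis
  proof cases
    case 2 then show ?thesis using kpp unfolding KPP_def by auto
  next
    case 4
    have "0 \<le> deriv g 0 * s" using deriv_pos s by simp
    then show ?thesis using P.gneg[OF 4] by linarith
  qed (use P.g0 P.g1 deriv_pos in auto)
qed

lemma g_nonpos: "1 \<le> s \<Longrightarrow> g s \<le> 0"
  using P.gneg[of s] P.g1 by (cases "s = 1") auto

text \<open>In the second regime \<alpha> is the exponent at which the speeds (D \<alpha>^2 + g'(0))
  / \<alpha> and (d \<alpha>^2 - \<rho>) / \<alpha> coincide. The last two inequalities say that the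
  first speed is still decreasing there and the second increasing, so that no other exponent does
  better.\<close>

lemma cstar_cases:
  obtains "cstar D d \<rho> g = 2 * sqrt (D * deriv g 0)" "d / D \<le> 2 + \<rho> / deriv g 0"
  | \<alpha> where "0 < \<alpha>" "cstar D d \<rho> g * \<alpha> = D * \<alpha>\<^sup>2 + deriv g 0" "cstar D d \<rho> g * \<alpha> = d * \<alpha>\<^sup>2 - \<rho>"
      "2 * D * \<alpha> < cstar D d \<rho> g" "cstar D d \<rho> g < 2 * d * \<alpha>"
proof (cases "d / D \<le> 2 + \<rho> / deriv g 0")
  case True then show ?thesis using that(1) by (simp add: cstar_def c_g_def)
next
  case False
  define G where "G = deriv g 0"
  have G: "G > 0" using deriv_pos by (simp add: G_def)
  have "2 + \<rho> / G < d / D" using False by (simp add: G_def)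
  then have "D * (G * (2 + \<rho> / G)) < D * (G * (d / D))" using D G by (intro mult_strict_left_mono) auto
  moreover have "G * (2 + \<rho> / G) = 2 * G + \<rho>" using G by (simp add: distrib_left)
  \<comment> \<open>The regime condition cleared of denominators; it yields both d > D and D
    \<alpha>^2 < g'(0).\<close>
  ultimately have h: "D * (2 * G + \<rho>) < d * G" using D by (simp add: mult.commute)
  then have "D * G < d * G" using D G \<rho> by (smt (verit) mult_pos_pos distrib_left)
  then have dD: "0 < d - D" using G by simp
  define \<alpha> where "\<alpha> = sqrt ((\<rho> + G) / (d - D))"
  have pG: "0 < \<rho> + G" using \<rho> G by simp
  have a0: "0 < \<alpha>" using dD pG by (simp add: \<alpha>_def)
  have a2: "(d - D) * \<alpha>\<^sup>2 = \<rho> + G" using dD pG by (simp add: \<alpha>_def)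
  have cs: "cstar D d \<rho> g = (D * \<rho> + d * G) / sqrt ((d - D) * (\<rho> + G))" using False by (simp add: cstar_def G_def)
  have sq: "sqrt ((d - D) * (\<rho> + G)) = (d - D) * \<alpha>"
  proof -
    have "(d - D) * (\<rho> + G) = ((d - D) * \<alpha>)\<^sup>2" by (simp add: a2[symmetric] power2_eq_square)
    then show ?thesis using dD a0 by (simp add: real_sqrt_abs)
  qed
  have ca: "cstar D d \<rho> g * \<alpha> = (D * \<rho> + d * G) / (d - D)"
    unfolding cs sq using a0 by simp
  have e1: "cstar D d \<rho> g * \<alpha> = D * \<alpha>\<^sup>2 + G"
  proof -
    have "(D * \<alpha>\<^sup>2 + G) * (d - D) = D * ((d - D) * \<alpha>\<^sup>2) + G * (d - D)" by (simp add: algebra_simps)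
    also have "\<dots> = D * \<rho> + d * G" unfolding a2 by (simp add: algebra_simps)
    finally show ?thesis unfolding ca using dD by (simp add: divide_eq_eq)
  qed
  have e2: "cstar D d \<rho> g * \<alpha> = d * \<alpha>\<^sup>2 - \<rho>" using e1 a2 by (simp add: algebra_simps)
  have "D * ((d - D) * \<alpha>\<^sup>2) < (d - D) * G" unfolding a2 using h by (simp add: algebra_simps)
  then have "(d - D) * (D * \<alpha>\<^sup>2) < (d - D) * G" by (simp add: algebra_simps)
  then have lt: "D * \<alpha>\<^sup>2 < G" using dD by simp
  have "(2 * D * \<alpha>) * \<alpha> < cstar D d \<rho> g * \<alpha>" unfolding e1 using lt by (simp add: power2_eq_square algebra_simps)
  then have l1: "2 * D * \<alpha> < cstar D d \<rho> g" using a0 by (simp add: mult_less_cancel_right_pos)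
  have "0 < d * \<alpha>\<^sup>2" using d a0 by simp
  then have "cstar D d \<rho> g * \<alpha> < (2 * d * \<alpha>) * \<alpha>" unfolding e2 using \<rho> by (simp add: power2_eq_square algebra_simps)
  then have l2: "cstar D d \<rho> g < 2 * d * \<alpha>" using a0 by (simp add: mult_less_cancel_right_pos)
  show ?thesis by (rule that(2)[OF a0 _ e2 l1 l2]) (use e1 in \<open>simp add: G_def\<close>)
qed

text \<open>In the first regime \<alpha> minimises (D \<alpha>^2 + g'(0)) / \<alpha>, and the
  inequality for the second field at this \<alpha> is exactly the regime condition d / D \<le> 2 +
  \<rho> / g'(0).\<close>

lemma cstar_exponent:
  obtains \<alpha> where "0 < \<alpha>" "D * \<alpha>\<^sup>2 + deriv g 0 \<le> cstar D d \<rho> g * \<alpha>" "d * \<alpha>\<^sup>2 - \<rho> \<le> cstar D d \<rho> g * \<alpha>"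
proof (cases rule: cstar_cases)
  case 1
  define G where "G = deriv g 0"
  have G: "G > 0" using deriv_pos by (simp add: G_def)
  define \<alpha> where "\<alpha> = sqrt (G / D)"
  have a: "0 < \<alpha>" "\<alpha>\<^sup>2 = G / D" using G D by (auto simp: \<alpha>_def)
  have "sqrt (D * G) * \<alpha> = sqrt (G * G)" unfolding \<alpha>_def real_sqrt_mult[symmetric] using D by simp
  then have c: "cstar D d \<rho> g * \<alpha> = 2 * G" using 1 G by (simp add: G_def[symmetric])
  have "(d / D) * G \<le> (2 + \<rho> / G) * G" using 1(2) G by (intro mult_right_mono) (auto simp: G_def)
  moreover have "(2 + \<rho> / G) * G = 2 * G + \<rho>" using G by (simp add: distrib_right)
  ultimately have "d * (G / D) \<le> 2 * G + \<rho>" by simp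
  then have "d * \<alpha>\<^sup>2 - \<rho> \<le> cstar D d \<rho> g * \<alpha>" unfolding c a by simp
  moreover have "D * \<alpha>\<^sup>2 + deriv g 0 \<le> cstar D d \<rho> g * \<alpha>" unfolding c a using D by (simp add: G_def)
  ultimately show ?thesis using that a by blast
next
  case (2 \<alpha>)
  then show ?thesis using that[of \<alpha>] by simp
qed

theorem decay_ahead:
  assumes ik: "i \<noteq> k" and supp: "\<And>b x. x$k \<le> 0 \<Longrightarrow> R < norm x \<Longrightarrow> f b x 0 = 0"
    and c: "cstar D d \<rho> g < c" and \<epsilon>: "0 < \<epsilon>"
  obtains T where "0 \<le> T" "\<And>t x b. T \<le> t \<Longrightarrow> x$k \<le> 0 \<Longrightarrow> c * t \<le> \<bar>x$i\<bar> \<Longrightarrow> f b x t < \<epsilon>"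
proof -
  obtain \<alpha> where \<alpha>: "0 < \<alpha>" "D * \<alpha>\<^sup>2 + deriv g 0 \<le> cstar D d \<rho> g * \<alpha>" "d * \<alpha>\<^sup>2 - \<rho> \<le> cstar D d \<rho> g * \<alpha>"
    by (rule cstar_exponent) (rule that)
  define c0 where "c0 = cstar D d \<rho> g"
  obtain M where M: "\<And>b x. x$k \<le> 0 \<Longrightarrow> \<bar>f b x 0\<bar> \<le> M" using C.bdd[of 0] by auto
  define mm where "mm = min \<mu> \<nu>"
  have mm: "0 < mm" using \<mu> \<nu> by (simp add: mm_def)
  \<comment> \<open>Makes both components dominate the initial data on the ball of radius R, where
    the exponential is at least \<open>exp (- \<alpha> * \<bar>R\<bar>)\<close>.\<close>
  define K where "K = (\<bar>M\<bar> + 1) * exp (\<alpha> * \<bar>R\<bar>) / mm"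
  have K: "0 < K" using mm by (simp add: K_def)
  define mu' where "mu' b = (if b then \<nu> else \<mu>)" for b
  have mu': "0 < mu' b" "mm \<le> mu' b" "mu' b \<le> \<mu> + \<nu>" for b using \<mu> \<nu> by (auto simp: mu'_def mm_def)
  \<comment> \<open>The two signs of \<sigma> give waves running in the two directions of the
    i-axis.\<close>
  have bound: "f b x t \<le> mu' b * (K * exp (- \<alpha> * (\<sigma> * x$i) + \<alpha> * c0 * t))"
    if \<sigma>: "\<bar>\<sigma>\<bar> = 1" and xt: "x$k \<le> 0" "0 \<le> t" for \<sigma> x t b
  proof -
    define w where "w b x t = mu' b * (K * exp (- \<alpha> * (\<sigma> * x$i) + \<alpha> * c0 * t))" for b and x :: "real^'n" and t
    have w0: "0 < w b x t" for b x t using mu' K by (simp add: w_def)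
    have "f b x t \<le> w b x t"
    proof (rule C.comparison_super[where w=w and B=0 and ?t0.0=0 and ?t1.0=t])
      fix b show "continuous_on ({x. x$k \<le> 0} \<times> {0..t}) (\<lambda>(x,t). w b x t)"
        unfolding w_def case_prod_unfold by (intro continuous_intros)
      fix x :: "real^'n" and t show "0 \<le> w b x t" using w0[of b x t] by simp
    next
      fix b and x :: "real^'n" assume xk: "x$k \<le> 0"
      show "f b x 0 \<le> w b x 0"
      proof (cases "R < norm x")
        case True then show ?thesis using supp[OF xk True] w0[of b x 0] by simp
      next
        case False
        have "\<bar>\<sigma> * x$i\<bar> \<le> \<bar>R\<bar>" using component_le_norm_cart[of x i] False \<sigma> by (simp add: abs_mult)
        then have "\<alpha> * (\<sigma> * x$i) \<le> \<alpha> * \<bar>R\<bar>" using \<alpha> by (intro mult_left_mono) auto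
        then have e: "1 \<le> exp (\<alpha> * \<bar>R\<bar>) * exp (- \<alpha> * (\<sigma> * x$i))" unfolding exp_add[symmetric] by simp
        have "f b x 0 \<le> \<bar>M\<bar> + 1" using M[OF xk, of b] by linarith
        also have "\<dots> \<le> (\<bar>M\<bar> + 1) * (exp (\<alpha> * \<bar>R\<bar>) * exp (- \<alpha> * (\<sigma> * x$i)))"
          using mult_left_mono[OF e, of "\<bar>M\<bar> + 1"] by simp
        also have "\<dots> = mm * (K * exp (- \<alpha> * (\<sigma> * x$i)))" using mm by (simp add: K_def)
        also have "\<dots> \<le> mu' b * (K * exp (- \<alpha> * (\<sigma> * x$i)))" using mu' K by (intro mult_right_mono) auto
        finally show ?thesis by (simp add: w_def)
      qed
    next
      fix b and x :: "real^'n" and s assume h: "x$k \<le> 0" "w b x s < f b x s"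
      have j1: "jetg (\<lambda>x t. - \<alpha> * (\<sigma> * x$i) + \<alpha> * c0 * t) x s (\<alpha> * c0) (\<lambda>j. - \<alpha> * \<sigma> * (if j = i then 1 else 0)) (\<lambda>j. 0)"
      proof -
        have t: "jetg (\<lambda>(x::real^'n) t. \<alpha> * c0 * t) x s (\<alpha> * c0) (\<lambda>j. 0) (\<lambda>j. 0)"
          by (rule jetg_time) (auto intro!: derivative_eq_intros)
        show ?thesis
          by (rule jetg_cong[OF jetg_add[OF jetg_cmult[OF jetg_cmult[OF jetg_coord]] t]]) auto
      qed
      have jw: "jetg (w b) x s (w b x s * (\<alpha> * c0)) (\<lambda>j. if j = i then w b x s * (- \<alpha> * \<sigma>) else 0)
           (\<lambda>j. if j = i then w b x s * \<alpha>\<^sup>2 else 0)"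
        unfolding w_def
        by (rule jetg_cong[OF jetg_cmult[OF jetg_cmult[OF jetg_exp[OF j1]]]])
           (use \<sigma> in \<open>auto simp: power_mult_distrib abs_square_eq_1\<close>)
      have "\<alpha> * c0 - (if b then D else d) * \<alpha>\<^sup>2 \<ge> (if b then deriv g 0 else - \<rho>)"
        using \<alpha> by (simp add: c0_def mult.commute)
      from mult_left_mono[OF this less_imp_le[OF w0[of b x s]]]
      have ii: "(if b then g (w b x s) else - \<rho> * w b x s)
          \<le> w b x s * (\<alpha> * c0) - (if b then D else d) * (w b x s * \<alpha>\<^sup>2)"
        using g_le[of "w b x s"] w0[of b x s] by (cases b) (auto simp: algebra_simps)
      show "\<exists>a \<gamma> q. jetg (w b) x s a \<gamma> q \<and>
         (x$k < 0 \<longrightarrow> (if b then g (w b x s) else - \<rho> * w b x s) \<le> a - (if b then D else d) * (\<Sum>j\<in>UNIV. q j)) \<and>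
         (x$k = 0 \<longrightarrow> (if \<not> b then \<mu> else \<nu>) * w (\<not> b) x s - (if b then \<mu> else \<nu>) * w b x s \<le> (if b then D else d) * \<gamma> k)"
        by (intro exI conjI impI, rule jw) (use ii ik in \<open>auto simp: w_def mu'_def\<close>)
    qed (use xt in auto)
    then show ?thesis by (simp add: w_def)
  qed
  define Q where "Q = (\<mu> + \<nu>) * K"
  define q where "q = \<alpha> * (c - c0)"
  have q: "0 < q" using \<alpha> c by (simp add: q_def c0_def)
  have Q: "0 < Q" using K \<mu> \<nu> by (simp add: Q_def)
  show ?thesis
  \<comment> \<open>As \<open>exp (q * t) > q * t\<close>, the bound Q exp (- q t) is below
    \<epsilon> once q t \<ge> Q / \<epsilon>.\<close>
  proof (rule that[of "Q / (q * \<epsilon>)"])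
    show "0 \<le> Q / (q * \<epsilon>)" using Q q \<epsilon> by simp
    fix t b and x :: "real^'n" assume t: "Q / (q * \<epsilon>) \<le> t" and x: "x$k \<le> 0" "c * t \<le> \<bar>x$i\<bar>"
    have t0: "0 \<le> t" using t Q q \<epsilon> by (meson divide_nonneg_pos less_imp_le mult_pos_pos order_trans)
    define \<sigma> where "\<sigma> = (if x$i \<ge> 0 then 1 else - 1 :: real)"
    have \<sigma>: "\<bar>\<sigma>\<bar> = 1" "\<sigma> * x$i = \<bar>x$i\<bar>" by (auto simp: \<sigma>_def)
    have "\<alpha> * (c * t) \<le> \<alpha> * \<bar>x$i\<bar>" using x \<alpha> by (intro mult_left_mono) auto
    then have e: "- \<alpha> * (\<sigma> * x$i) + \<alpha> * c0 * t \<le> - (q * t)" unfolding \<sigma>(2) by (simp add: q_def algebra_simps)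
    have "f b x t \<le> mu' b * (K * exp (- \<alpha> * (\<sigma> * x$i) + \<alpha> * c0 * t))" by (rule bound[OF \<sigma>(1) x(1) t0])
    also have "\<dots> \<le> (\<mu> + \<nu>) * (K * exp (- (q * t)))" using mu' K e \<mu> \<nu> by (intro mult_mono) auto
    also have "\<dots> = Q * exp (- (q * t))" by (simp add: Q_def)
    also have "\<dots> < \<epsilon>"
    proof -
      have "Q \<le> \<epsilon> * (q * t)" using t q \<epsilon> by (simp add: field_simps)
      also have "\<dots> < \<epsilon> * exp (q * t)" using exp_ge_add_one_self[of "q * t"] \<epsilon> by (intro mult_strict_left_mono) linarith+
      finally have "Q * exp (- (q * t)) < \<epsilon> * exp (q * t) * exp (- (q * t))" by simp
      then show ?thesis unfolding mult.assoc exp_add[symmetric] by simp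
    qed
    finally show "f b x t < \<epsilon>" .
  qed
qed

text \<open>For constants proportional to (\<nu>, \<mu>) the exchange vanishes, and where the first
  one is at least 1 the reaction is nonpositive. The parameter z lets M be taken as large as the
  next step needs.\<close>

lemma global_bound:
  obtains M where "z \<le> M * \<nu>" "1 \<le> M * \<nu>" "0 < M" "\<And>b x t. x$k \<le> 0 \<Longrightarrow> 0 \<le> t \<Longrightarrow> f b x t \<le> M * (if b then \<nu> else \<mu>)"
proof -
  obtain M0 where M0: "\<And>b x. x$k \<le> 0 \<Longrightarrow> \<bar>f b x 0\<bar> \<le> M0" using C.bdd[of 0] by auto
  define M where "M = (\<bar>M0\<bar> + 1) / min \<mu> \<nu> + (\<bar>z\<bar> + 1) / \<nu>"
  have mm: "0 < min \<mu> \<nu>" using \<mu> \<nu> by simp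
  have p: "0 \<le> (\<bar>M0\<bar> + 1) / min \<mu> \<nu>" "0 < (\<bar>z\<bar> + 1) / \<nu>" using mm \<nu> by auto
  have "(\<bar>z\<bar> + 1) / \<nu> * \<nu> \<le> M * \<nu>" using p \<nu> by (intro mult_right_mono) (auto simp: M_def)
  then have Mz: "\<bar>z\<bar> + 1 \<le> M * \<nu>" using \<nu> by simp
  have M0': "0 < M" using p by (simp add: M_def)
  have st: "\<bar>M0\<bar> + 1 \<le> M * (if b then \<nu> else \<mu>)" for b
  proof -
    have "(\<bar>M0\<bar> + 1) / min \<mu> \<nu> * min \<mu> \<nu> \<le> M * (if b then \<nu> else \<mu>)"
      using p mm M0' by (intro mult_mono) (auto simp: M_def)
    then show ?thesis using mm by simp
  qed
  show ?thesis
  proof (rule that[of M])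
    show "z \<le> M * \<nu>" "1 \<le> M * \<nu>" "0 < M" using Mz M0' by auto
    fix b and t :: real and x :: "real^'n" assume x: "x$k \<le> 0" "0 \<le> t"
    show "f b x t \<le> M * (if b then \<nu> else \<mu>)"
    proof (rule C.comparison_super[where w="\<lambda>b x t. M * (if b then \<nu> else \<mu>)" and B=0 and ?t0.0=0 and ?t1.0=t])
      fix b and x :: "real^'n" assume "x$k \<le> 0"
      then show "f b x 0 \<le> M * (if b then \<nu> else \<mu>)" using M0[of x b] st[of b] by linarith
    next
      fix b and x :: "real^'n" and s
      show "\<exists>a \<gamma> q. jetg (\<lambda>x t. M * (if b then \<nu> else \<mu>)) x s a \<gamma> q \<and>
         (x$k < 0 \<longrightarrow> (if b then g (M * (if b then \<nu> else \<mu>)) else - \<rho> * (M * (if b then \<nu> else \<mu>)))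
             \<le> a - (if b then D else d) * (\<Sum>j\<in>UNIV. q j)) \<and>
         (x$k = 0 \<longrightarrow> (if \<not> b then \<mu> else \<nu>) * (M * (if \<not> b then \<nu> else \<mu>)) - (if b then \<mu> else \<nu>) * (M * (if b then \<nu> else \<mu>))
             \<le> (if b then D else d) * \<gamma> k)"
        by (intro exI conjI impI, rule jetg_const)
           (use g_nonpos[of "M * \<nu>"] Mz M0' \<rho> \<mu> in \<open>auto simp: mult_nonneg_nonneg\<close>)
    qed (use x M0' \<mu> \<nu> in \<open>auto intro!: continuous_intros\<close>)
  qed
qed

text \<open>The balanced pair (\<nu>, \<mu>) is lowered linearly in time. On
  \<open>{z..M * \<nu>}\<close> the reaction is bounded away from 0 and the second field is absorbed
  at rate \<rho>, so a small speed \<omega> is allowed all the way down to z.\<close>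

lemma upper_first:
  assumes z: "1 < z"
  obtains T M where "0 \<le> T" "0 < M" "\<And>x t. x$k \<le> 0 \<Longrightarrow> T \<le> t \<Longrightarrow> f True x t \<le> z"
    "\<And>x t. x$k \<le> 0 \<Longrightarrow> 0 \<le> t \<Longrightarrow> f False x t \<le> M"
proof -
  obtain M where M: "z \<le> M * \<nu>" "1 \<le> M * \<nu>" "0 < M" "\<And>b x t. x$k \<le> 0 \<Longrightarrow> 0 \<le> t \<Longrightarrow> f b x t \<le> M * (if b then \<nu> else \<mu>)"
    by (rule global_bound[of z]) (rule that)
  have "continuous_on {z..M * \<nu>} g" by (intro continuous_at_imp_continuous_on ballI P.g_cont)
  moreover have "{z..M * \<nu>} \<noteq> {}" using M by simp
  ultimately have "\<exists>x\<in>{z..M * \<nu>}. \<forall>y\<in>{z..M * \<nu>}. g y \<le> g x" by (intro continuous_attains_sup compact_Icc)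
  then obtain s1 where s1: "s1 \<in> {z..M * \<nu>}" "\<And>y. y \<in> {z..M * \<nu>} \<Longrightarrow> g y \<le> g s1" by blast
  have g1: "g s1 < 0" using s1 z by (intro P.gneg) auto
  define \<omega> where "\<omega> = min (- g s1 / \<nu>) (\<rho> * z / \<nu>)"
  have \<omega>: "0 < \<omega>" "\<omega> * \<nu> \<le> - g s1" "\<omega> * \<nu> \<le> \<rho> * z"
    using g1 \<nu> \<rho> z by (auto simp: \<omega>_def min_def field_simps)
  define \<tau> where "\<tau> = (M - z / \<nu>) / \<omega>"
  have zM: "z / \<nu> \<le> M" using M(1) \<nu> by (simp add: field_simps)
  have \<tau>: "0 \<le> \<tau>" "\<omega> * \<tau> = M - z / \<nu>" using zM \<omega> by (auto simp: \<tau>_def)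
  show ?thesis
  proof (rule that[of \<tau> "M * \<mu>"])
    show "0 \<le> \<tau>" "0 < M * \<mu>" using \<tau> M \<mu> by auto
    show "f False x t \<le> M * \<mu>" if "x$k \<le> 0" "0 \<le> t" for x t using M(4)[OF that, of False] by simp
    fix x0 :: "real^'n" and t assume x0: "x0$k \<le> 0" and t: "\<tau> \<le> t"
    \<comment> \<open>For each t separately the descent is started at t - \<tau>, so that it ends
      exactly at t.\<close>
    define \<phi> where "\<phi> s = M - \<omega> * (s - (t - \<tau>))" for s
    have ph: "z / \<nu> \<le> \<phi> s" "\<phi> s \<le> M" if "t - \<tau> \<le> s" "s \<le> t" for s
    proof -
      have "\<omega> * (s - (t - \<tau>)) \<le> \<omega> * \<tau>" using that \<omega> by (intro mult_left_mono) auto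
      then show "z / \<nu> \<le> \<phi> s" unfolding \<phi>_def \<tau>(2) by simp
      show "\<phi> s \<le> M" using that \<omega> by (simp add: \<phi>_def)
    qed
    define w where "w b x s = (if b then \<nu> else \<mu>) * \<phi> s" for b and x :: "real^'n" and s
    have "f True x0 t \<le> w True x0 t"
    proof (rule C.comparison_super[where w=w and B=0 and ?t0.0="t - \<tau>" and ?t1.0=t])
      fix b show "continuous_on ({x. x$k \<le> 0} \<times> {t - \<tau>..t}) (\<lambda>(x,t). w b x t)"
        unfolding w_def \<phi>_def case_prod_unfold by (intro continuous_intros)
    next
      fix b and x :: "real^'n" and s assume "t - \<tau> \<le> s" "s \<le> t"
      then have "0 \<le> \<phi> s" using ph(1)[of s] z \<nu> by (meson divide_pos_pos less_imp_le less_trans order_trans zero_less_one)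
      then show "0 \<le> w b x s" using \<mu> \<nu> by (simp add: w_def)
    next
      fix b and x :: "real^'n" assume "x$k \<le> 0"
      then show "f b x (t - \<tau>) \<le> w b x (t - \<tau>)" using M(4)[of x "t - \<tau>" b] t by (simp add: w_def \<phi>_def mult.commute split: if_splits)
    next
      fix b and x :: "real^'n" and s assume s: "t - \<tau> < s" "s \<le> t"
      have j: "jetg (w b) x s ((if b then \<nu> else \<mu>) * - \<omega>) (\<lambda>j. 0) (\<lambda>j. 0)"
        unfolding w_def \<phi>_def by (rule jetg_time) (auto intro!: derivative_eq_intros)
      have p: "z \<le> \<nu> * \<phi> s" "\<nu> * \<phi> s \<le> M * \<nu>" using ph[of s] s \<nu> by (auto simp: field_simps)
      have "g (\<nu> * \<phi> s) \<le> g s1" using s1(2) p by auto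
      then have i1: "g (\<nu> * \<phi> s) \<le> \<nu> * - \<omega>" using \<omega> by (simp add: mult.commute)
      have "\<nu> * \<omega> \<le> \<nu> * (\<rho> * \<phi> s)" using \<omega>(3) mult_left_mono[OF p(1) less_imp_le[OF \<rho>]] by (simp add: algebra_simps)
      then have i2: "\<omega> \<le> \<rho> * \<phi> s" using \<nu> by simp
      have i3: "- \<rho> * (\<mu> * \<phi> s) \<le> \<mu> * - \<omega>" using mult_left_mono[OF i2 less_imp_le[OF \<mu>]] by (simp add: algebra_simps)
      show "\<exists>a \<gamma> q. jetg (w b) x s a \<gamma> q \<and>
         (x$k < 0 \<longrightarrow> (if b then g (w b x s) else - \<rho> * w b x s) \<le> a - (if b then D else d) * (\<Sum>j\<in>UNIV. q j)) \<and>
         (x$k = 0 \<longrightarrow> (if \<not> b then \<mu> else \<nu>) * w (\<not> b) x s - (if b then \<mu> else \<nu>) * w b x s \<le> (if b then D else d) * \<gamma> k)"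
        by (intro exI conjI impI, rule j) (use i1 i3 in \<open>auto simp: w_def\<close>)
    qed (use t \<tau> x0 in auto)
    also have "\<phi> t = z / \<nu>" unfolding \<phi>_def using \<tau>(2) by simp
    then have "w True x0 t = z" using \<nu> by (simp add: w_def)
    finally show "f True x0 t \<le> z" .
  qed
qed

text \<open>With the first field below z, the second is dominated by the stationary response to the
  constant z plus a spatially constant decaying term that covers its initial size.\<close>

lemma upper_second:
  assumes z: "1 < z" and b: "0 < \<beta>"
  obtains T where "0 \<le> T" "\<And>x t. x$k \<le> 0 \<Longrightarrow> T \<le> t \<Longrightarrow> f True x t \<le> z"
    "\<And>x t. x$k \<le> 0 \<Longrightarrow> T \<le> t \<Longrightarrow> f False x t \<le> c1 * z * exp (lam * x$k) + \<beta>"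
proof -
  obtain T M where T: "0 \<le> T" "0 < M" "\<And>x t. x$k \<le> 0 \<Longrightarrow> T \<le> t \<Longrightarrow> f True x t \<le> z"
    "\<And>x t. x$k \<le> 0 \<Longrightarrow> 0 \<le> t \<Longrightarrow> f False x t \<le> M" by (rule upper_first[OF z]) (rule that)
  define \<tau> where "\<tau> = M / (\<rho> * \<beta>)"
  have \<tau>: "0 < \<tau>" using T b \<rho> by (simp add: \<tau>_def)
  have end1: "M * exp (- \<rho> * \<tau>) \<le> \<beta>"
  proof -
    have "M = \<beta> * (\<rho> * \<tau>)" using b \<rho> by (simp add: \<tau>_def)
    also have "\<dots> \<le> \<beta> * exp (\<rho> * \<tau>)" using exp_ge_add_one_self[of "\<rho> * \<tau>"] b by (intro mult_left_mono) linarith+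
    finally have "M * exp (- \<rho> * \<tau>) \<le> \<beta> * exp (\<rho> * \<tau>) * exp (- \<rho> * \<tau>)" by simp
    then show ?thesis unfolding mult.assoc exp_add[symmetric] by simp
  qed
  show ?thesis
  proof (rule that[of "T + \<tau>"])
    show "0 \<le> T + \<tau>" using T \<tau> by simp
    show "f True x t \<le> z" if "x$k \<le> 0" "T + \<tau> \<le> t" for x t using T(3)[OF that(1)] that \<tau> by simp
    fix x0 :: "real^'n" and t assume x0: "x0$k \<le> 0" and t: "T + \<tau> \<le> t"
    define w where "w b x s = (if b then z else c1 * z * exp (lam * x$k) + M * exp (- \<rho> * (s - (t - \<tau>))))"
      for b and x :: "real^'n" and s
    have "f False x0 t \<le> w False x0 t"
    proof (rule C.comparison_super[where w=w and B=0 and ?t0.0="t - \<tau>" and ?t1.0=t])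
      fix b show "continuous_on ({x. x$k \<le> 0} \<times> {t - \<tau>..t}) (\<lambda>(x,t). w b x t)"
        unfolding w_def case_prod_unfold by (cases b) (auto intro!: continuous_intros)
    next
      fix b and x :: "real^'n" and s
      show "0 \<le> w b x s" using z c1 T by (simp add: w_def)
    next
      fix b and x :: "real^'n" assume x: "x$k \<le> 0"
      have "0 \<le> c1 * z * exp (lam * x$k)" using z c1 by simp
      then show "f b x (t - \<tau>) \<le> w b x (t - \<tau>)" using T(3)[OF x, of "t - \<tau>"] T(4)[OF x, of "t - \<tau>"] T(1) t \<tau>
        by (cases b) (auto simp: w_def intro: order_trans)
    next
      fix b and x :: "real^'n" and s assume s: "x$k \<le> 0" "t - \<tau> < s" "s \<le> t" "w b x s < f b x s"
      \<comment> \<open>The level z need not be verified as a barrier for the first field: that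
        bound is known, so no contact occurs there.\<close>
      have bF: "b = False" using T(3)[OF s(1), of s] s t by (cases b) (auto simp: w_def)
      define e where "e = M * exp (- \<rho> * (s - (t - \<tau>)))"
      have e0: "0 \<le> e" using T by (simp add: e_def)
      have j1: "jetg (\<lambda>(x::real^'n) s. M * exp (- \<rho> * (s - (t - \<tau>)))) x s (- \<rho> * e) (\<lambda>j. 0) (\<lambda>j. 0)"
        unfolding e_def by (rule jetg_time) (auto intro!: derivative_eq_intros)
      have jj: "jetg (w False) x s (- \<rho> * e) (\<lambda>j. if j = k then c1 * z * (exp (lam * x$k) * lam) else 0)
           (\<lambda>j. if j = k then c1 * z * (exp (lam * x$k) * lam\<^sup>2) else 0)"
      proof -
        have wF: "w False = (\<lambda>x s. c1 * z * exp (lam * x$k) + M * exp (- \<rho> * (s - (t - \<tau>))))"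
          by (intro ext) (simp add: w_def)
        show ?thesis unfolding wF
          by (rule jetg_cong[OF jetg_add[OF jetg_cmult[OF jetg_exp[OF jetg_cmult[OF jetg_coord]]] j1]])
             (auto simp: power2_eq_square)
      qed
      have i1: "- \<rho> * w False x s = - \<rho> * e - d * (c1 * z * (exp (lam * x$k) * lam\<^sup>2))"
      proof -
        have "d * (c1 * z * (exp (lam * x$k) * lam\<^sup>2)) = (d * lam\<^sup>2) * (c1 * z * exp (lam * x$k))"
          by (simp add: algebra_simps)
        then show ?thesis unfolding lam(2) by (simp add: w_def e_def algebra_simps)
      qed
      have i2: "\<mu> * z - \<nu> * (c1 * z + e) \<le> d * (c1 * z * lam)"
      proof -
        have "\<mu> * z - \<nu> * (c1 * z + e) = (\<mu> - \<nu> * c1) * z - \<nu> * e" by (simp add: algebra_simps)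
        also have "\<dots> \<le> (d * lam * c1) * z" using c1 e0 \<nu> by simp
        finally show ?thesis by (simp add: algebra_simps)
      qed
      show "\<exists>a \<gamma> q. jetg (w b) x s a \<gamma> q \<and>
         (x$k < 0 \<longrightarrow> (if b then g (w b x s) else - \<rho> * w b x s) \<le> a - (if b then D else d) * (\<Sum>j\<in>UNIV. q j)) \<and>
         (x$k = 0 \<longrightarrow> (if \<not> b then \<mu> else \<nu>) * w (\<not> b) x s - (if b then \<mu> else \<nu>) * w b x s \<le> (if b then D else d) * \<gamma> k)"
        unfolding bF
        by (intro exI conjI impI, rule jj) (use i1 i2 in \<open>auto simp: w_def e_def\<close>)
    qed (use T t \<tau> x0 in auto)
    also have "w False x0 t \<le> c1 * z * exp (lam * x0$k) + \<beta>" using end1 by (simp add: w_def)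
    finally show "f False x0 t \<le> c1 * z * exp (lam * x0$k) + \<beta>" .
  qed
qed

end

text \<open>Made for the folded lower barrier, which agrees with a smooth function only in a
  neighbourhood of the contact point.\<close>

lemma jetg_local:
  assumes J: "jetg w' x t a \<gamma> q" and S: "open S" "x \<in> S" and eq: "\<And>y s. y \<in> S \<Longrightarrow> w y s = w' y s"
  shows "jetg w x t a \<gamma> q"
  unfolding jetg_def
proof (intro conjI allI)
  have "w x = w' x" using eq S by (intro ext) auto
  then show "(w x has_real_derivative a) (at t)" using J by (simp add: jetg_def)
  fix j
  obtain p where p: "\<forall>\<^sub>F s in nhds 0. ((\<lambda>r. w' (x + r *\<^sub>R axis j 1) t) has_real_derivative p s) (at s)" "p 0 = \<gamma> j"
      "(p has_real_derivative q j) (at 0)" by (rule jetg_line[OF J])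
  define V where "V = (\<lambda>r::real. x + r *\<^sub>R axis j 1) -` S"
  have V: "open V" unfolding V_def using S(1)
    by (intro open_vimage) (auto intro!: continuous_intros)
  have "0 \<in> V" using S by (simp add: V_def)
  then have "\<forall>\<^sub>F s in nhds 0. s \<in> V" using V by (rule eventually_nhds_in_open[rotated])
  with p(1) have "\<forall>\<^sub>F s in nhds 0. ((\<lambda>r. w (x + r *\<^sub>R axis j 1) t) has_real_derivative p s) (at s)"
  proof (rule eventually_elim2)
    fix s assume "((\<lambda>r. w' (x + r *\<^sub>R axis j 1) t) has_real_derivative p s) (at s)" "s \<in> V"
    then show "((\<lambda>r. w (x + r *\<^sub>R axis j 1) t) has_real_derivative p s) (at s)"
      by (rule has_field_derivative_transform_within_open[OF _ V]) (simp add: V_def eq)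
  qed
  then show "\<exists>p. (\<forall>\<^sub>F s in nhds 0. ((\<lambda>r. w (x + r *\<^sub>R axis j 1) t) has_real_derivative p s) (at s)) \<and>
      p 0 = \<gamma> j \<and> (p has_real_derivative q j) (at 0)" using p by blast
qed

lemma jetg_profile:
  assumes J: "jetg w x t a \<gamma> q" and P: "profile D h z W W'"
  shows "jetg (\<lambda>x s. W (w x s)) x t (W' (w x t) * a) (\<lambda>j. W' (w x t) * \<gamma> j)
     (\<lambda>j. - h (W (w x t)) / D * (\<gamma> j)\<^sup>2 + W' (w x t) * q j)"
  by (rule jetg_compose[OF J]) (use P in \<open>auto simp: profile_def\<close>)

lemma profile_cont: "profile D h z W W' \<Longrightarrow> continuous_on S W"
  unfolding profile_def by (meson DERIV_isCont continuous_at_imp_continuous_on)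

section \<open>Sweeping the upper barrier down to the steady state\<close>

context hm_system
begin

text \<open>The profile starts shifted so far that it lies above the bound of
  \<open>upper_second\<close>, and the shift then shrinks to 0. The second field uses the stationary
  response to the current boundary value; the added constant \<beta> pays for the time derivative
  through the absorption \<rho> \<beta>, and is itself paid for by the Robin margin, since \<nu>
  \<beta> \<le> bb.\<close>

theorem upper_limit:
  assumes e: "0 < e" and R: "0 \<le> R"
    and P0: "profile D (ext g) 1 W0 W0'" "W0 0 = P.\<theta>" "D * W0' 0 = kap * P.\<theta>"
  obtains T where "0 \<le> T" "\<And>x t. T \<le> t \<Longrightarrow> x$k \<le> 0 \<Longrightarrow> - R \<le> x$k \<Longrightarrow> f True x t \<le> W0 (- x$k) + e"
    "\<And>x t. T \<le> t \<Longrightarrow> x$k \<le> 0 \<Longrightarrow> f False x t \<le> c1 * P.\<theta> * exp (lam * x$k) + e"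
proof -
  \<comment> \<open>In the second field the error is at most \<open>c1 * e'\<close> from the
    boundary value and e' from \<beta>.\<close>
  define e' where "e' = e / (c1 + 1)"
  have e': "0 < e'" "c1 * e' + e' = e" "e' \<le> e"
  proof -
    show "0 < e'" using e c1(1) by (simp add: e'_def)
    show e2: "c1 * e' + e' = e" using c1(1) by (simp add: e'_def add_divide_distrib[symmetric] distrib_right[symmetric] field_simps)
    have "0 \<le> c1 * e'" using \<open>0 < e'\<close> c1(1) by simp
    then show "e' \<le> e" using e2 by linarith
  qed
  obtain m z W W' bb where W: "0 < m" "m \<le> 1" "1 < z" "z \<le> 2" "0 < bb" "profile D (\<lambda>s. ext g s + m * ramp s) z W W'"
    "\<And>t. (D * W' t)\<^sup>2 = 2 * D * ((P.H z + m * P.X z) - (P.H (W t) + m * P.X (W t)))"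
    "0 < W 0" "\<And>t. 0 \<le> t \<Longrightarrow> D * W' t \<le> kap * W t - bb" "\<And>t. 0 \<le> t \<Longrightarrow> t \<le> R \<Longrightarrow> \<bar>W t - W0 t\<bar> \<le> e'"
    by (rule P.upper_profile[OF e'(1) R P0]) (rule that)
  obtain B where B: "0 < B" "\<And>t. 0 \<le> W t \<Longrightarrow> W' t \<le> B" "\<And>s. 0 \<le> s \<Longrightarrow> s \<le> z \<Longrightarrow> \<bar>ext g s + m * ramp s\<bar> \<le> B"
    by (rule P.speed_bound[OF W(6) _ _ W(4) W(7)]) (use W in auto)
  have Wz: "W t < z" "0 < W' t" for t using W(6) by (auto simp: profile_def)
  have Wm: "W s \<le> W t" if "s \<le> t" for s t by (rule P.profile_mono[OF W(6) that])
  define \<beta> where "\<beta> = min e' (bb / \<nu>)"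
  have \<beta>: "0 < \<beta>" "\<beta> \<le> e'" "\<nu> * \<beta> \<le> bb" using e' W \<nu> by (auto simp: \<beta>_def min_def field_simps)
  \<comment> \<open>Strictly between 1 and z: above 1 the bound z' eventually holds, and below z the
    profile reaches it after a finite shift.\<close>
  define z' where "z' = (1 + z) / 2"
  have z': "1 < z'" "z' < z" using W by (auto simp: z'_def)
  obtain T where T: "0 \<le> T" "\<And>x t. x$k \<le> 0 \<Longrightarrow> T \<le> t \<Longrightarrow> f True x t \<le> z'"
    "\<And>x t. x$k \<le> 0 \<Longrightarrow> T \<le> t \<Longrightarrow> f False x t \<le> c1 * z' * exp (lam * x$k) + \<beta>"
    by (rule upper_second[OF z'(1) \<beta>(1)]) (rule that)
  obtain tz where tz: "W tz = z'" using W(6) z' unfolding profile_def by blast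
  define S0 where "S0 = \<bar>tz\<bar>"
  have S0: "0 \<le> S0" "z' \<le> W S0" using Wm[of tz S0] tz by (auto simp: S0_def)
  \<comment> \<open>Slow enough for the time derivative to be covered by the perturbation m in the
    first field and by \<open>\<rho> * \<beta>\<close> in the second.\<close>
  define \<omega> where "\<omega> = min (m / B) (\<rho> * \<beta> / (c1 * B))"
  have \<omega>: "0 < \<omega>" "\<omega> * B \<le> m" "\<omega> * (c1 * B) \<le> \<rho> * \<beta>"
    using W B c1(1) \<rho> \<beta> by (auto simp: \<omega>_def min_def field_simps)
  define \<tau> where "\<tau> = S0 / \<omega>"
  have \<tau>: "0 \<le> \<tau>" "\<omega> * \<tau> = S0" using S0 \<omega> by (auto simp: \<tau>_def)
  have main: "f b x0 t \<le> (if b then W (- x0$k) else c1 * W 0 * exp (lam * x0$k) + \<beta>)"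
    if x0: "x0$k \<le> 0" and t: "T + \<tau> \<le> t" for b x0 t
  proof -
    define \<phi> where "\<phi> s = S0 - \<omega> * (s - (t - \<tau>))" for s
    have ph: "0 \<le> \<phi> s" if "s \<le> t" for s
    proof -
      have "\<omega> * (s - (t - \<tau>)) \<le> \<omega> * \<tau>" using that \<omega> by (intro mult_left_mono) auto
      then show ?thesis by (simp add: \<phi>_def \<tau>(2))
    qed
    have ph0: "\<phi> t = 0" using \<tau>(2) by (simp add: \<phi>_def)
    define w where "w b x s = (if b then W (- x$k + \<phi> s) else c1 * (W (\<phi> s) * exp (lam * x$k)) + \<beta>)"
      for b and x :: "real^'n" and s
    have wpos: "0 \<le> w b x s" if "x$k \<le> 0" "s \<le> t" for b x s
    proof -
      have "0 \<le> W (- x$k + \<phi> s)" using Wm[of 0 "- x$k + \<phi> s"] ph[OF that(2)] that W(8) by simp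
      moreover have "0 \<le> W (\<phi> s)" using Wm[of 0 "\<phi> s"] ph[OF that(2)] W(8) by simp
      ultimately show ?thesis using c1(1) \<beta> by (auto simp: w_def intro!: add_nonneg_nonneg)
    qed
    have "f b x0 t \<le> w b x0 t"
    proof (rule C.comparison_super[where w=w and B=0 and ?t0.0="t - \<tau>" and ?t1.0=t])
      fix b
      have "continuous_on ({x. x$k \<le> 0} \<times> {t - \<tau>..t}) (\<lambda>p::(real^'n) \<times> real. W (- (fst p)$k + \<phi> (snd p)))"
           "continuous_on ({x. x$k \<le> 0} \<times> {t - \<tau>..t}) (\<lambda>p::(real^'n) \<times> real. W (\<phi> (snd p)))"
        unfolding \<phi>_def by (rule continuous_on_compose2[OF profile_cont[OF W(6), of UNIV]]; auto intro!: continuous_intros)+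
      then show "continuous_on ({x. x$k \<le> 0} \<times> {t - \<tau>..t}) (\<lambda>(x,t). w b x t)"
        unfolding w_def case_prod_unfold by (cases b) (auto intro!: continuous_intros)
    next
      fix b and x :: "real^'n" and s assume "x$k \<le> 0" "t - \<tau> \<le> s" "s \<le> t"
      then show "0 \<le> w b x s" by (intro wpos)
    next
      fix b and x :: "real^'n" assume x: "x$k \<le> 0"
      have TT: "T \<le> t - \<tau>" using t by simp
      have "W S0 \<le> W (- x$k + S0)" using x by (intro Wm) simp
      moreover have "c1 * z' * exp (lam * x$k) \<le> c1 * (W S0 * exp (lam * x$k))" using S0 c1(1) by simp
      ultimately show "f b x (t - \<tau>) \<le> w b x (t - \<tau>)"
        using T(2)[OF x TT] T(3)[OF x TT] S0 by (cases b) (auto simp: w_def \<phi>_def)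
    next
      fix b and x :: "real^'n" and s assume s: "x$k \<le> 0" "t - \<tau> < s" "s \<le> t" "w b x s < f b x s"
      have jph: "jetg (\<lambda>(x::real^'n) s. \<phi> s) x s (- \<omega>) (\<lambda>j. 0) (\<lambda>j. 0)"
        unfolding \<phi>_def by (rule jetg_time) (auto intro!: derivative_eq_intros)
      define u where "u = - x$k + \<phi> s"
      have Wu: "0 < W u" using Wm[of 0 u] ph[OF s(3)] s(1) W(8) by (simp add: u_def)
      have Wp: "0 < W (\<phi> s)" using Wm[of 0 "\<phi> s"] ph[OF s(3)] W(8) by simp
      have "jetg (\<lambda>(x::real^'n) s. - x$k + \<phi> s) x s (- \<omega>) (\<lambda>j. if j = k then - 1 else 0) (\<lambda>j. 0)"
        by (rule jetg_cong[OF jetg_add[OF jetg_uminus[OF jetg_coord] jph]]) auto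
      note jT0 = jetg_profile[OF this W(6)]
      have jT: "jetg (w True) x s (W' u * - \<omega>) (\<lambda>j. if j = k then - W' u else 0)
           (\<lambda>j. if j = k then - (ext g (W u) + m * ramp (W u)) / D else 0)"
      proof -
        have wT: "w True = (\<lambda>x s. W (- x$k + \<phi> s))" by (intro ext) (simp add: w_def)
        show ?thesis unfolding wT by (rule jetg_cong[OF jT0]) (auto simp: u_def)
      qed
      have jF: "jetg (w False) x s (c1 * (W' (\<phi> s) * - \<omega> * exp (lam * x$k)))
           (\<lambda>j. if j = k then c1 * (W (\<phi> s) * (exp (lam * x$k) * lam)) else 0)
           (\<lambda>j. if j = k then c1 * (W (\<phi> s) * (exp (lam * x$k) * lam\<^sup>2)) else 0)"
      proof -
        have wF: "w False = (\<lambda>x s. c1 * (W (\<phi> s) * exp (lam * x$k)) + \<beta>)" by (intro ext) (simp add: w_def)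
        show ?thesis unfolding wF
          by (rule jetg_cong[OF jetg_add[OF jetg_cmult[OF jetg_mult[OF jetg_profile[OF jph W(6)]
               jetg_exp[OF jetg_cmult[OF jetg_coord]]]] jetg_const]]) (auto simp: power2_eq_square)
      qed
      have i1: "g (W u) \<le> W' u * - \<omega> - D * (- (ext g (W u) + m * ramp (W u)) / D)"
      proof -
        have "\<omega> * W' u \<le> \<omega> * B" using B(2)[of u] Wu \<omega> by (intro mult_left_mono) auto
        then have "\<omega> * W' u \<le> m" using \<omega> by linarith
        then show ?thesis using D Wu ramp_bounds(3)[of "W u"] by (simp add: ext_def mult.commute)
      qed
      have i2: "- \<rho> * (c1 * (W (\<phi> s) * exp (lam * x$k)) + \<beta>)
          \<le> c1 * (W' (\<phi> s) * - \<omega> * exp (lam * x$k)) - d * (c1 * (W (\<phi> s) * (exp (lam * x$k) * lam\<^sup>2)))"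
      proof -
        have "W' (\<phi> s) * exp (lam * x$k) \<le> B * 1"
          using B(2)[of "\<phi> s"] Wp lam(1) s(1) Wz(2)[of "\<phi> s"] B(1) by (intro mult_mono) (auto simp: mult_nonneg_nonpos)
        then have "\<omega> * (c1 * (W' (\<phi> s) * exp (lam * x$k))) \<le> \<omega> * (c1 * B)"
          using \<omega> c1(1) by (intro mult_left_mono) auto
        then have "\<omega> * (c1 * (W' (\<phi> s) * exp (lam * x$k))) \<le> \<rho> * \<beta>" using \<omega> by linarith
        moreover have "d * (c1 * (W (\<phi> s) * (exp (lam * x$k) * lam\<^sup>2))) = \<rho> * (c1 * (W (\<phi> s) * exp (lam * x$k)))"
        proof -
          have "d * (c1 * (W (\<phi> s) * (exp (lam * x$k) * lam\<^sup>2))) = (d * lam\<^sup>2) * (c1 * (W (\<phi> s) * exp (lam * x$k)))"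
            by (simp add: algebra_simps)
          then show ?thesis unfolding lam(2) .
        qed
        moreover have "c1 * (W' (\<phi> s) * - \<omega> * exp (lam * x$k)) = - (\<omega> * (c1 * (W' (\<phi> s) * exp (lam * x$k))))" by simp
        moreover have "- \<rho> * (c1 * (W (\<phi> s) * exp (lam * x$k)) + \<beta>) = - (\<rho> * (c1 * (W (\<phi> s) * exp (lam * x$k)))) - \<rho> * \<beta>"
          by (simp add: algebra_simps)
        ultimately show ?thesis by linarith
      qed
      have i3: "\<nu> * (c1 * (W (\<phi> s) * exp (lam * x$k)) + \<beta>) - \<mu> * W u \<le> D * - W' u" if "x$k = 0"
      proof -
        have u: "u = \<phi> s" using that by (simp add: u_def)
        have "D * W' u \<le> kap * W u - bb" using W(9)[of u] ph[OF s(3)] u by simp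
        moreover have "kap * W u = \<mu> * W u - \<nu> * (c1 * W u)" unfolding c1(3)[symmetric] by (simp add: algebra_simps)
        moreover have "\<nu> * (c1 * (W (\<phi> s) * exp (lam * x$k)) + \<beta>) = \<nu> * (c1 * W u) + \<nu> * \<beta>"
          using that u by (simp add: algebra_simps)
        ultimately show ?thesis using \<beta>(3) by simp
      qed
      have i4: "\<mu> * W u - \<nu> * (c1 * (W (\<phi> s) * exp (lam * x$k)) + \<beta>) \<le> d * (c1 * (W (\<phi> s) * (exp (lam * x$k) * lam)))"
        if "x$k = 0"
      proof -
        have u: "u = \<phi> s" using that by (simp add: u_def)
        have "\<mu> * W u = (\<nu> * c1 + d * lam * c1) * W u" by (simp only: c1(2))
        then have "\<mu> * W u = \<nu> * (c1 * W u) + d * (c1 * (W u * lam))" by (simp add: algebra_simps)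
        moreover have "0 \<le> \<nu> * \<beta>" using \<nu> \<beta> by simp
        moreover have "\<nu> * (c1 * (W (\<phi> s) * exp (lam * x$k)) + \<beta>) = \<nu> * (c1 * W u) + \<nu> * \<beta>"
          using that u by (simp add: algebra_simps)
        ultimately show ?thesis using that u by simp
      qed
      have wu: "w True x s = W u" "w False x s = c1 * (W (\<phi> s) * exp (lam * x$k)) + \<beta>" by (auto simp: w_def u_def)
      show "\<exists>a \<gamma> q. jetg (w b) x s a \<gamma> q \<and>
         (x$k < 0 \<longrightarrow> (if b then g (w b x s) else - \<rho> * w b x s) \<le> a - (if b then D else d) * (\<Sum>j\<in>UNIV. q j)) \<and>
         (x$k = 0 \<longrightarrow> (if \<not> b then \<mu> else \<nu>) * w (\<not> b) x s - (if b then \<mu> else \<nu>) * w b x s \<le> (if b then D else d) * \<gamma> k)"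
      proof (cases b)
        case True
        then have bT: "b = True" by simp
        show ?thesis unfolding bT
          by (intro exI conjI impI, rule jT) (use i1 i3 wu in auto)
      next
        case False
        then have bF: "b = False" by simp
        show ?thesis unfolding bF
          by (intro exI conjI impI, rule jF) (use i2 i4 wu in auto)
      qed
    qed (use T t \<tau> x0 in auto)
    then show ?thesis unfolding w_def ph0 by (cases b) (simp_all add: mult.assoc)
  qed
  have W0c: "\<bar>W 0 - P.\<theta>\<bar> \<le> e'" using W(10)[of 0] R P0(2) by simp
  show ?thesis
  proof (rule that[of "T + \<tau>"])
    show "0 \<le> T + \<tau>" using T \<tau> by simp
    fix x :: "real^'n" and t assume t: "T + \<tau> \<le> t" and x: "x$k \<le> 0"
    show "f True x t \<le> W0 (- x$k) + e" if "- R \<le> x$k"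
      using main[OF x t, of True] W(10)[of "- x$k"] x that e' by simp
    have ex: "exp (lam * x$k) \<le> 1" using lam x by (simp add: mult_nonneg_nonpos)
    have "c1 * W 0 * exp (lam * x$k) \<le> c1 * (P.\<theta> + e') * exp (lam * x$k)"
      using W0c c1(1) by (intro mult_right_mono mult_left_mono) auto
    also have "\<dots> = c1 * P.\<theta> * exp (lam * x$k) + (c1 * e') * exp (lam * x$k)" by (simp add: algebra_simps)
    also have "\<dots> \<le> c1 * P.\<theta> * exp (lam * x$k) + (c1 * e') * 1"
      using ex c1(1) e' by (intro add_left_mono mult_left_mono) auto
    finally show "f False x t \<le> c1 * P.\<theta> * exp (lam * x$k) + e"
      using main[OF x t, of False] \<beta>(2) e' by simp
  qed
qed

end

section \<open>Lower bounds\<close>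

context hm_system
begin

lemma g_linear_lower:
  assumes "0 < \<eta>"
  obtains s0 where "0 < s0" "\<And>s. 0 \<le> s \<Longrightarrow> s \<le> s0 \<Longrightarrow> (deriv g 0 - \<eta>) * s \<le> g s"
proof -
  have "(g has_field_derivative deriv g 0) (at 0)"
    using kpp unfolding KPP_def by (metis DERIV_deriv_iff_real_differentiable)
  then have "((\<lambda>y. (g y - g 0) / (y - 0)) \<longlongrightarrow> deriv g 0) (at 0)" by (simp add: has_field_derivative_iff)
  then have "\<forall>\<^sub>F y in at 0. deriv g 0 - \<eta> < (g y - g 0) / (y - 0)"
    using assms by (intro order_tendstoD(1)) auto
  then obtain r where r: "r > 0" "\<And>y. y \<noteq> 0 \<Longrightarrow> \<bar>y\<bar> < r \<Longrightarrow> deriv g 0 - \<eta> < g y / y"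
    unfolding eventually_at dist_real_def using P.g0 by auto
  show ?thesis
  proof (rule that[of "r / 2"])
    show "0 < r / 2" using r by simp
    fix s assume s: "0 \<le> s" "s \<le> r / 2"
    show "(deriv g 0 - \<eta>) * s \<le> g s"
    proof (cases "s = 0")
      case True then show ?thesis using P.g0 by simp
    next
      case False
      then have "s > 0" using s by simp
      moreover have "s < r" using s r by simp
      ultimately have "deriv g 0 - \<eta> < g s / s" using r(2)[of s] by simp
      then show ?thesis using \<open>s > 0\<close> by (simp add: less_divide_eq less_imp_le)
    qed
  qed
qed

text \<open>The margin \<delta> is split: a quarter for replacing g by its linearisation, a quarter
  for confinement in both fields through a large radius. The losses are written out because
  \<open>loss\<close> belongs to the locale whose instance is being produced.\<close>

lemma linear_rates:
  assumes \<delta>: "0 < \<delta>" "\<delta> \<le> deriv g 0"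
  obtains s0 r \<eta> where "1 \<le> r"
    "coupled_low (\<lambda>b. if b then D else d) (\<lambda>b. if b then \<mu> else \<nu>) (\<lambda>b s. if b then g s else - \<rho> * s) k f
       (\<lambda>b. if b then deriv g 0 - \<eta> else - \<rho>) s0" "0 < \<eta>"
    "\<eta> + (4 * real CARD('n) * (real CARD('n) / 2 + 1) * D / r\<^sup>2 + 4 * real CARD('n) * (real CARD('n) / 2 + 1) * d / r\<^sup>2) < \<delta>"
proof -
  obtain s0 where s0: "0 < s0" "\<And>s. 0 \<le> s \<Longrightarrow> s \<le> s0 \<Longrightarrow> (deriv g 0 - \<delta> / 4) * s \<le> g s"
    by (rule g_linear_lower[of "\<delta> / 4"]) (use \<delta> in auto)
  define K where "K = 4 * real CARD('n) * (real CARD('n) / 2 + 1) * (D + d)"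
  have K: "0 < K" using D d by (simp add: K_def add_pos_pos)
  define r where "r = max 1 (4 * K / \<delta>)"
  have r: "1 \<le> r" "4 * K / \<delta> \<le> r" by (auto simp: r_def)
  have "r * 1 \<le> r * r" using r(1) by (intro mult_left_mono) auto
  then have "4 * K / \<delta> \<le> r\<^sup>2" using r(2) by (simp add: power2_eq_square)
  then have Kr: "K / r\<^sup>2 \<le> \<delta> / 4" using \<delta> r(1) by (simp add: field_simps)
  have sum: "4 * real CARD('n) * (real CARD('n) / 2 + 1) * D / r\<^sup>2 + 4 * real CARD('n) * (real CARD('n) / 2 + 1) * d / r\<^sup>2 = K / r\<^sup>2"
    by (simp add: K_def add_divide_distrib[symmetric] distrib_left)
  have "\<delta> / 4 + \<delta> / 4 < \<delta>" using \<delta> by simp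
  then have lt: "\<delta> / 4 + K / r\<^sup>2 < \<delta>" using Kr by linarith
  show ?thesis
  proof (rule that[OF r(1)])
    show "coupled_low (\<lambda>b. if b then D else d) (\<lambda>b. if b then \<mu> else \<nu>) (\<lambda>b s. if b then g s else - \<rho> * s) k f
       (\<lambda>b. if b then deriv g 0 - \<delta> / 4 else - \<rho>) s0"
    proof unfold_locales
      show "0 \<le> f b x t" if "x$k \<le> 0" "0 \<le> t" for x b t using f_nonneg that by simp
      show "(if b then deriv g 0 - \<delta> / 4 else - \<rho>) * s \<le> (if b then g s else - \<rho> * s)" if "0 \<le> s" "s \<le> s0" for s b
        using s0(2)[OF that] by simp
      show "0 < s0" by (rule s0(1))
    qed
    show "0 < \<delta> / 4" using \<delta> by simp
    show "\<delta> / 4 + (4 * real CARD('n) * (real CARD('n) / 2 + 1) * D / r\<^sup>2 + 4 * real CARD('n) * (real CARD('n) / 2 + 1) * d / r\<^sup>2) < \<delta>"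
      unfolding sum by (rule lt)
  qed
qed

theorem spreading:
  assumes ik: "i \<noteq> k" and c: "0 < c" "c < cstar D d \<rho> g" and x: "x$k \<le> 0" "0 < f b x 0"
  obtains \<epsilon> r where "0 < \<epsilon>" "1 \<le> r"
    "\<And>R. \<exists>t1. \<forall>t\<ge>t1. \<forall>y. \<bar>y$i\<bar> \<le> c * t \<longrightarrow> (\<forall>j. j \<noteq> i \<longrightarrow> \<bar>y$j\<bar> \<le> R) \<longrightarrow> y$k \<le> - 2 * r \<longrightarrow> \<epsilon> \<le> f True y t"
proof -
  define cs where "cs = cstar D d \<rho> g"
  define c' where "c' = (c + cs) / 2"
  have c': "c < c'" "c' < cs" "0 < c'" using c by (auto simp: c'_def cs_def)
  show ?thesis
  proof (cases rule: cstar_cases)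
    case 1
    \<comment> \<open>The growth rate of the first field at speed c', positive because c' is below 2
      sqrt (D g'(0)).\<close>
    define \<delta> where "\<delta> = deriv g 0 - c'\<^sup>2 / (4 * D)"
    have "c'\<^sup>2 < (2 * sqrt (D * deriv g 0))\<^sup>2" using c' 1(1) by (intro power_strict_mono) (auto simp: cs_def)
    then have "c'\<^sup>2 < 4 * D * deriv g 0" using D deriv_pos by (simp add: power_mult_distrib)
    then have d0: "0 < \<delta>" using D by (simp add: \<delta>_def field_simps)
    have d1: "\<delta> \<le> deriv g 0" using D by (simp add: \<delta>_def)
    obtain s0 r \<eta> where L: "1 \<le> r"
      "coupled_low (\<lambda>b. if b then D else d) (\<lambda>b. if b then \<mu> else \<nu>) (\<lambda>b s. if b then g s else - \<rho> * s) k f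
         (\<lambda>b. if b then deriv g 0 - \<eta> else - \<rho>) s0" "0 < \<eta>"
      "\<eta> + (4 * real CARD('n) * (real CARD('n) / 2 + 1) * D / r\<^sup>2 + 4 * real CARD('n) * (real CARD('n) / 2 + 1) * d / r\<^sup>2) < \<delta>"
      by (rule linear_rates[OF d0 d1]) (rule that)
    interpret L: coupled_low "\<lambda>b. if b then D else d" "\<lambda>b. if b then \<mu> else \<nu>" "\<lambda>b s. if b then g s else - \<rho> * s" k f
      "\<lambda>b. if b then deriv g 0 - \<eta> else - \<rho>" s0 by (rule L(2))
    have ls: "\<eta> + (L.loss True r + L.loss False r) < \<delta>" using L(4) by (simp add: L.loss_def)
    have l0: "0 \<le> L.loss True r" "0 \<le> L.loss False r" using L.loss_nonneg by auto
    have r0: "0 < r" using L(1) by simp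
    have rt: "0 < (if True then deriv g 0 - \<eta> else - \<rho>) - L.loss True r" using ls l0 d1 by simp
    have tr: "L.travels i r c'"
      by (rule L.travels_single[OF r0 _ ik]) (use c' ls l0 in \<open>auto simp: \<delta>_def\<close>)
    show ?thesis
      by (rule L.spreading_lower_bound[OF L(1) ik rt tr c(1) c'(1) x]) (rule that[OF _ L(1)])
  next
    case (2 \<alpha>)
    have cs0: "0 < cs" using c by (simp add: cs_def)
    \<comment> \<open>c' is the speed of travel to be established, c'' the mean velocity inside the
      fields; their difference pays for the crossing times.\<close>
    define c'' where "c'' = (c' + cs) / 2"
    have c'': "c' < c''" "c'' < cs" "0 < c''" using c' by (auto simp: c''_def)
    define s where "s = c'' / cs"
    have s: "0 < s" "s < 1" "s * cs = c''" using c'' cs0 by (auto simp: s_def)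
    define den where "den = 2 * d * \<alpha> - 2 * D * \<alpha>"
    have den: "0 < den" using 2(4,5) unfolding den_def by linarith
    \<comment> \<open>The fraction of time in the first field for which the unscaled velocities 2 D
      \<alpha> and 2 d \<alpha> average to cs.\<close>
    define \<theta> where "\<theta> = (2 * d * \<alpha> - cs) / den"
    have \<theta>: "0 < \<theta>" "\<theta> < 1"
    proof -
      show "0 < \<theta>" using 2 den by (simp add: \<theta>_def cs_def)
      have "2 * d * \<alpha> - cs < den" using 2 by (simp add: den_def cs_def)
      then show "\<theta> < 1" using den by (simp add: \<theta>_def)
    qed
    have \<theta>den: "\<theta> * den = 2 * d * \<alpha> - cs" using den by (simp add: \<theta>_def)
    have mix: "\<theta> * (2 * D * \<alpha>) + (1 - \<theta>) * (2 * d * \<alpha>) = cs"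
    proof -
      have "\<theta> * (2 * D * \<alpha>) + (1 - \<theta>) * (2 * d * \<alpha>) = 2 * d * \<alpha> - \<theta> * den" by (simp add: den_def algebra_simps)
      then show ?thesis unfolding \<theta>den by simp
    qed
    define a where "a = s * (2 * D * \<alpha>)"
    define a' where "a' = s * (2 * d * \<alpha>)"
    have a: "0 \<le> a" "0 \<le> a'" using s D d 2 by (auto simp: a_def a'_def)
    have v: "\<theta> * a + (1 - \<theta>) * a' = c''"
    proof -
      have "\<theta> * a + (1 - \<theta>) * a' = s * (\<theta> * (2 * D * \<alpha>) + (1 - \<theta>) * (2 * d * \<alpha>))" by (simp add: a_def a'_def algebra_simps)
      then show ?thesis unfolding mix s(3) .
    qed
    \<comment> \<open>The mean growth before linearisation and confinement are charged; it is
      positive because s < 1.\<close>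
    define \<delta>0 where "\<delta>0 = cs * \<alpha> * (1 - s\<^sup>2) / 2"
    have "s\<^sup>2 < 1" using s by (simp add: power_less_one_iff)
    then have d00: "0 < \<delta>0" using cs0 2 by (simp add: \<delta>0_def)
    have aa: "a\<^sup>2 / (4 * D) = s\<^sup>2 * (D * \<alpha>\<^sup>2)" "a'\<^sup>2 / (4 * d) = s\<^sup>2 * (d * \<alpha>\<^sup>2)"
      using D d by (auto simp: a_def a'_def power_mult_distrib power2_eq_square)
    have mix2: "\<theta> * (D * \<alpha>\<^sup>2) + (1 - \<theta>) * (d * \<alpha>\<^sup>2) = cs * \<alpha> / 2"
    proof -
      have "(\<theta> * (2 * D * \<alpha>) + (1 - \<theta>) * (2 * d * \<alpha>)) * \<alpha> = cs * \<alpha>" unfolding mix ..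
      then show ?thesis by (simp add: algebra_simps power2_eq_square)
    qed
    have g0: "deriv g 0 = cs * \<alpha> - D * \<alpha>\<^sup>2" and r0: "- \<rho> = cs * \<alpha> - d * \<alpha>\<^sup>2" using 2 by (auto simp: cs_def)
    have rate0: "\<theta> * (deriv g 0 - a\<^sup>2 / (4 * D)) + (1 - \<theta>) * (- \<rho> - a'\<^sup>2 / (4 * d)) = \<delta>0"
    proof -
      have "\<theta> * (deriv g 0 - a\<^sup>2 / (4 * D)) + (1 - \<theta>) * (- \<rho> - a'\<^sup>2 / (4 * d))
          = cs * \<alpha> - (1 + s\<^sup>2) * (\<theta> * (D * \<alpha>\<^sup>2) + (1 - \<theta>) * (d * \<alpha>\<^sup>2))"
        unfolding aa g0 r0 by (simp add: algebra_simps)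
      also have "\<dots> = cs * \<alpha> - (1 + s\<^sup>2) * (cs * \<alpha> / 2)" unfolding mix2 ..
      also have "\<dots> = \<delta>0" by (simp add: \<delta>0_def field_simps)
      finally show ?thesis .
    qed
    define \<delta> where "\<delta> = min \<delta>0 (deriv g 0)"
    have d0: "0 < \<delta>" "\<delta> \<le> deriv g 0" "\<delta> \<le> \<delta>0" using d00 deriv_pos by (auto simp: \<delta>_def)
    obtain s0 r \<eta> where L: "1 \<le> r"
      "coupled_low (\<lambda>b. if b then D else d) (\<lambda>b. if b then \<mu> else \<nu>) (\<lambda>b s. if b then g s else - \<rho> * s) k f
         (\<lambda>b. if b then deriv g 0 - \<eta> else - \<rho>) s0" "0 < \<eta>"
      "\<eta> + (4 * real CARD('n) * (real CARD('n) / 2 + 1) * D / r\<^sup>2 + 4 * real CARD('n) * (real CARD('n) / 2 + 1) * d / r\<^sup>2) < \<delta>"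
      by (rule linear_rates[OF d0(1,2)]) (rule that)
    interpret L: coupled_low "\<lambda>b. if b then D else d" "\<lambda>b. if b then \<mu> else \<nu>" "\<lambda>b s. if b then g s else - \<rho> * s" k f
      "\<lambda>b. if b then deriv g 0 - \<eta> else - \<rho>" s0 by (rule L(2))
    have ls: "\<eta> + (L.loss True r + L.loss False r) < \<delta>" using L(4) by (simp add: L.loss_def)
    have l0: "0 \<le> L.loss True r" "0 \<le> L.loss False r" using L.loss_nonneg by auto
    have rt: "0 < (if True then deriv g 0 - \<eta> else - \<rho>) - L.loss True r" using ls l0 d0 by simp
    have "\<theta> * (\<eta> + L.loss True r) + (1 - \<theta>) * L.loss False r \<le> 1 * (\<eta> + L.loss True r) + 1 * L.loss False r"
      using \<theta> l0 L(3) by (intro add_mono mult_right_mono) auto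
    also have "1 * (\<eta> + L.loss True r) + 1 * L.loss False r < \<delta>0" using ls d0(3) by simp
    finally have "\<theta> * (\<eta> + L.loss True r) + (1 - \<theta>) * L.loss False r < \<delta>0" .
    then have rate: "0 < \<theta> * (deriv g 0 - \<eta> - L.loss True r - a\<^sup>2 / (4 * D)) + (1 - \<theta>) * (- \<rho> - L.loss False r - a'\<^sup>2 / (4 * d))"
      unfolding rate0[symmetric] by (simp add: algebra_simps)
    have tr: "L.travels i r c'"
      by (rule L.travels_double[OF L(1) ik a \<theta>]) (use rate c' c'' v in auto)
    show ?thesis
      by (rule L.spreading_lower_bound[OF L(1) ik rt tr c(1) c'(1) x]) (rule that[OF _ L(1)])
  qed
qed

text \<open>Once \<open>u \<ge> \<epsilon>\<close> on large balls, the paraboloid \<open>\<phi> t - \<delta> norm (x - y) ^ 2\<close> with slowly increasing \<open>\<phi>\<close>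
  is a subsolution as long as its values stay in \<open>[\<epsilon>, z]\<close>, where \<open>g\<close> is bounded away from \<open>0\<close>.\<close>

lemma deep:
  assumes ik: "i \<noteq> k" and c: "0 < c" "c < cstar D d \<rho> g" and x: "x$k \<le> 0" "0 < f b x 0" and z: "0 < z" "z < 1"
  obtains r1 where "0 < r1"
    "\<And>R. \<exists>t1. \<forall>t\<ge>t1. \<forall>y. \<bar>y$i\<bar> \<le> c * t \<longrightarrow> (\<forall>j. j \<noteq> i \<longrightarrow> \<bar>y$j\<bar> \<le> R) \<longrightarrow> y$k \<le> - r1 \<longrightarrow> z \<le> f True y t"
proof -
  define c' where "c' = (c + cstar D d \<rho> g) / 2"
  have c': "c < c'" "c' < cstar D d \<rho> g" "0 < c'" using c by (auto simp: c'_def)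
  obtain \<epsilon>0 r where sp: "0 < \<epsilon>0" "1 \<le> r"
    "\<And>R. \<exists>t1. \<forall>t\<ge>t1. \<forall>y. \<bar>y$i\<bar> \<le> c' * t \<longrightarrow> (\<forall>j. j \<noteq> i \<longrightarrow> \<bar>y$j\<bar> \<le> R) \<longrightarrow> y$k \<le> - 2 * r \<longrightarrow> \<epsilon>0 \<le> f True y t"
    by (rule spreading[OF ik c'(3,2) x]) (rule that)
  define \<epsilon> where "\<epsilon> = min \<epsilon>0 (z / 2)"
  have \<epsilon>: "0 < \<epsilon>" "\<epsilon> \<le> \<epsilon>0" "\<epsilon> < z" using sp z by (auto simp: \<epsilon>_def)
  have "continuous_on {\<epsilon>..z} g" by (intro continuous_at_imp_continuous_on ballI P.g_cont)
  moreover have "{\<epsilon>..z} \<noteq> {}" using \<epsilon> by simp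
  ultimately have "\<exists>x\<in>{\<epsilon>..z}. \<forall>y\<in>{\<epsilon>..z}. g x \<le> g y" by (intro continuous_attains_inf compact_Icc)
  then obtain s1 where s1: "s1 \<in> {\<epsilon>..z}" "\<And>y. y \<in> {\<epsilon>..z} \<Longrightarrow> g s1 \<le> g y" by blast
  define m where "m = g s1"
  have m: "0 < m" unfolding m_def using s1 \<epsilon> z by (intro P.gpos) auto
  define N where "N = real CARD('n)"
  have N: "0 < N" by (simp add: N_def)
  \<comment> \<open>The minimum m of g on \<open>{\<epsilon>..z}\<close> is split: half balances the
    Laplacian of the paraboloid, half drives its rise.\<close>
  define \<delta> where "\<delta> = m / (4 * N * D)"
  have \<delta>: "0 < \<delta>" "2 * D * \<delta> * N = m / 2" using m N D by (auto simp: \<delta>_def)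
  define \<tau> where "\<tau> = (z - \<epsilon>) / (m / 2)"
  have \<tau>: "0 < \<tau>" "m / 2 * \<tau> = z - \<epsilon>" using \<epsilon> m by (auto simp: \<tau>_def)
  \<comment> \<open>At distances from lr on, \<open>\<delta> * a\<^sup>2 \<ge> 1 > z\<close>, so the
    barrier is nonnegative only inside a ball of this radius.\<close>
  define lr where "lr = 1 / \<delta> + 1"
  have lr: "0 < lr" using \<delta> by (simp add: lr_def add_pos_pos)
  have far: "1 \<le> \<delta> * a\<^sup>2" if "lr \<le> a" for a
  proof -
    have "1 \<le> a" "1 / \<delta> \<le> a" using that \<delta> by (auto simp: lr_def intro: order_trans[rotated])
    then have "1 / \<delta> * 1 \<le> a * a" by (intro mult_mono) (use \<delta> in auto)
    then show ?thesis using \<delta> by (simp add: field_simps power2_eq_square)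
  qed
  show ?thesis
  proof (rule that[of "2 * r + lr"])
    show "0 < 2 * r + lr" using sp lr by simp
    fix R :: real
    obtain t1 where t1: "\<And>t y. t1 \<le> t \<Longrightarrow> \<bar>y$i\<bar> \<le> c' * t \<Longrightarrow> (\<And>j. j \<noteq> i \<Longrightarrow> \<bar>y$j\<bar> \<le> R + lr) \<Longrightarrow> y$k \<le> - 2 * r \<Longrightarrow> \<epsilon>0 \<le> f True y t"
      using sp(3)[of "R + lr"] by blast
    \<comment> \<open>After T the cone of speed c', taken at time t - \<tau>, contains that of speed
      c at time t with room lr to spare; so the barrier lives where \<epsilon>0 is already
      reached.\<close>
    define T where "T = max (\<tau> + max t1 0) ((lr + c' * \<tau>) / (c' - c))"
    show "\<exists>t1. \<forall>t\<ge>t1. \<forall>y. \<bar>y$i\<bar> \<le> c * t \<longrightarrow> (\<forall>j. j \<noteq> i \<longrightarrow> \<bar>y$j\<bar> \<le> R) \<longrightarrow> y$k \<le> - (2 * r + lr) \<longrightarrow> z \<le> f True y t"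
    proof (intro exI[of _ T] allI impI)
      fix t and y :: "real^'n"
      assume t: "T \<le> t" and y: "\<bar>y$i\<bar> \<le> c * t" "\<forall>j. j \<noteq> i \<longrightarrow> \<bar>y$j\<bar> \<le> R" "y$k \<le> - (2 * r + lr)"
      have tt: "t1 \<le> t - \<tau>" "0 \<le> t - \<tau>" using t by (auto simp: T_def)
      have "(lr + c' * \<tau>) / (c' - c) \<le> t" using t by (simp add: T_def)
      then have "lr + c' * \<tau> \<le> t * (c' - c)" using c' by (simp add: pos_divide_le_eq)
      then have ct: "c * t + lr \<le> c' * (t - \<tau>)" by (simp add: algebra_simps)
      define \<phi> where "\<phi> s = \<epsilon> + m / 2 * (s - (t - \<tau>))" for s
      have ph: "\<phi> s \<le> z" if "s \<le> t" for s
      proof -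
        have "m / 2 * (s - (t - \<tau>)) \<le> m / 2 * \<tau>" using that m by (intro mult_left_mono) auto
        then show ?thesis using \<tau>(2) by (simp add: \<phi>_def)
      qed
      define w where "w b x s = (if b then \<phi> s - \<delta> * (norm (x - y))\<^sup>2 else 0)" for b and x :: "real^'n" and s
      have near: "\<epsilon> \<le> f True x s \<and> x$k < 0" if w: "0 \<le> w True x s" and s: "t - \<tau> \<le> s" "s \<le> t" for x s
      proof -
        have "\<delta> * (norm (x - y))\<^sup>2 \<le> z" using w ph[OF s(2)] by (simp add: w_def)
        then have n: "norm (x - y) < lr" using far[of "norm (x - y)"] z by linarith
        have co: "\<bar>x$j - y$j\<bar> < lr" for j using n component_le_norm_cart[of "x - y" j] by simp
        have xk: "x$k \<le> - 2 * r" using co[of k] y(3) by linarith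
        have "\<epsilon>0 \<le> f True x s"
        proof (rule t1)
          show "t1 \<le> s" using tt s by linarith
          have "c' * (t - \<tau>) \<le> c' * s" using s c' by (intro mult_left_mono) auto
          then show "\<bar>x$i\<bar> \<le> c' * s" using co[of i] y(1) ct by linarith
          show "\<bar>x$j\<bar> \<le> R + lr" if "j \<noteq> i" for j
          proof -
            have "\<bar>y$j\<bar> \<le> R" using y(2) that by blast
            then show ?thesis using co[of j] by linarith
          qed
        qed (rule xk)
        then show ?thesis using \<epsilon> xk sp(2) by linarith
      qed
      have "w True y t \<le> f True y t"
      proof (rule C.comparison_sub[where w=w and B=z and ?t0.0="t - \<tau>" and ?t1.0=t])
        show "0 \<le> t - \<tau>" by (rule tt)
        fix b show "continuous_on ({x. x$k \<le> 0} \<times> {t - \<tau>..t}) (\<lambda>(x,t). w b x t)"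
          unfolding w_def \<phi>_def case_prod_unfold by (cases b) (auto intro!: continuous_intros)
      next
        fix b and x :: "real^'n" and s assume "s \<le> t"
        then have "\<phi> s \<le> z" by (rule ph)
        moreover have "0 \<le> \<delta> * (norm (x - y))\<^sup>2" using \<delta> by simp
        ultimately show "w b x s \<le> z" using z by (cases b) (auto simp: w_def)
      next
        fix b and x :: "real^'n" assume xk: "x$k \<le> 0"
        have fn: "0 \<le> f b x (t - \<tau>)" using f_nonneg xk tt by simp
        show "w b x (t - \<tau>) \<le> f b x (t - \<tau>)"
        proof (cases "b \<and> 0 \<le> w True x (t - \<tau>)")
          case True
          have "0 \<le> \<delta> * (norm (x - y))\<^sup>2" using \<delta> by simp
          then have "w True x (t - \<tau>) \<le> \<epsilon>" by (simp add: w_def \<phi>_def)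
          then show ?thesis using near[of x "t - \<tau>"] True \<tau> by auto
        next
          case False
          then show ?thesis using fn by (cases b) (auto simp: w_def)
        qed
      next
        fix b and x :: "real^'n" and s assume s: "x$k \<le> 0" "t - \<tau> < s" "s \<le> t" "f b x s < w b x s"
        have fn: "0 \<le> f b x s" using f_nonneg s tt by simp
        then have b: "b = True" using s(4) by (cases b) (auto simp: w_def)
        have nr: "\<epsilon> \<le> f True x s" "x$k < 0" using near[of x s] s fn b by auto
        have wr: "\<epsilon> \<le> w True x s" "w True x s \<le> z"
        proof -
          show "\<epsilon> \<le> w True x s" using nr s b by simp
          have "0 \<le> \<delta> * (norm (x - y))\<^sup>2" using \<delta> by simp
          then show "w True x s \<le> z" using ph[OF s(3)] by (simp add: w_def)
        qed
        have jph: "jetg (\<lambda>(x::real^'n) s. \<phi> s) x s (m / 2) (\<lambda>j. 0) (\<lambda>j. 0)"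
          unfolding \<phi>_def by (rule jetg_time) (auto intro!: derivative_eq_intros)
        have wT: "w True = (\<lambda>x s. \<phi> s - \<delta> * (norm (x - y))\<^sup>2)" by (intro ext) (simp add: w_def)
        have jw: "jetg (w True) x s (m / 2) (\<lambda>j. - (\<delta> * (2 * (x - y)$j))) (\<lambda>j. - (\<delta> * 2))"
          unfolding wT by (rule jetg_cong[OF jetg_diff[OF jph jetg_cmult[OF jetg_sqdist]]]) auto
        have "m \<le> g (w True x s)" unfolding m_def using s1(2) wr by simp
        moreover have "m / 2 - D * (\<Sum>j\<in>(UNIV::'n set). - (\<delta> * 2)) = m"
        proof -
          have "D * (\<Sum>j\<in>(UNIV::'n set). - (\<delta> * 2)) = - (2 * D * \<delta> * N)" by (simp add: N_def)
          then show ?thesis unfolding \<delta>(2) by simp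
        qed
        ultimately have i1: "m / 2 - D * (\<Sum>j\<in>(UNIV::'n set). - (\<delta> * 2)) \<le> g (w True x s)" by simp
        show "\<exists>a \<gamma> q. jetg (w b) x s a \<gamma> q \<and>
         (x$k < 0 \<longrightarrow> a - (if b then D else d) * (\<Sum>j\<in>UNIV. q j) \<le> (if b then g (w b x s) else - \<rho> * w b x s)) \<and>
         (x$k = 0 \<longrightarrow> (if b then D else d) * \<gamma> k \<le> (if \<not> b then \<mu> else \<nu>) * w (\<not> b) x s - (if b then \<mu> else \<nu>) * w b x s)"
          unfolding b by (intro exI conjI impI, rule jw) (use i1 nr in auto)
      next
        show "y$k \<le> 0" using y(3) sp(2) lr by linarith
      qed (use \<tau> in auto)
      moreover have "w True y t = \<epsilon> + m / 2 * \<tau>" by (simp add: w_def \<phi>_def)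
      then have "w True y t = z" unfolding \<tau>(2) by simp
      ultimately show "z \<le> f True y t" by simp
    qed
  qed
qed

text \<open>The lower barrier is the shifted profile \<open>W (- x$k - S t - \<delta> q x)\<close> with \<open>S\<close> decreasing slowly to \<open>0\<close>
  and \<open>q\<close> the squared distance along the interface to the target point; it is folded at depth \<open>r1\<close>,
  below which the bound of \<open>deep\<close> takes over.\<close>

theorem lower_limit:
  assumes ik: "i \<noteq> k" and c: "0 < c" "c < cstar D d \<rho> g" and x1: "x1$k \<le> 0" "0 < f b1 x1 0"
    and e: "0 < e" and R: "0 \<le> R"
    and P0: "profile D (ext g) 1 W0 W0'" "W0 0 = P.\<theta>" "D * W0' 0 = kap * P.\<theta>"
  obtains T where "0 \<le> T"
    "\<And>y t. T \<le> t \<Longrightarrow> y$k \<le> 0 \<Longrightarrow> \<bar>y$i\<bar> \<le> c * t \<Longrightarrow> (\<forall>j. j \<noteq> i \<longrightarrow> \<bar>y$j\<bar> \<le> R) \<Longrightarrow> W0 (- y$k) - e \<le> f True y t"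
    "\<And>y t. T \<le> t \<Longrightarrow> y$k \<le> 0 \<Longrightarrow> \<bar>y$i\<bar> \<le> c * t \<Longrightarrow> (\<forall>j. j \<noteq> i \<longrightarrow> \<bar>y$j\<bar> \<le> R) \<Longrightarrow>
       c1 * P.\<theta> * exp (lam * y$k) - e \<le> f False y t"
proof -
  define e' where "e' = e / (c1 + 1)"
  have e': "0 < e'" "c1 * e' + e' = e" "e' \<le> e"
  proof -
    show "0 < e'" using e c1(1) by (simp add: e'_def)
    show e2: "c1 * e' + e' = e" using c1(1) by (simp add: e'_def add_divide_distrib[symmetric] distrib_right[symmetric] field_simps)
    have "0 \<le> c1 * e'" using \<open>0 < e'\<close> c1(1) by simp
    then show "e' \<le> e" using e2 by linarith
  qed
  obtain m z W W' bb where W: "0 < m" "m \<le> 1" "0 < z" "z < 1" "0 < bb" "profile D (\<lambda>s. ext g s + (- m) * ramp s) z W W'"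
    "\<And>t. (D * W' t)\<^sup>2 = 2 * D * ((P.H z + (- m) * P.X z) - (P.H (W t) + (- m) * P.X (W t)))"
    "0 < W 0" "\<And>t. t \<le> 0 \<Longrightarrow> 0 \<le> W t \<Longrightarrow> kap * W t + bb \<le> D * W' t" "\<And>t. 0 \<le> t \<Longrightarrow> t \<le> R \<Longrightarrow> \<bar>W t - W0 t\<bar> \<le> e'"
    by (rule P.lower_profile[OF e'(1) R P0]) (rule that)
  obtain B where B: "0 < B" "\<And>t. 0 \<le> W t \<Longrightarrow> W' t \<le> B" "\<And>s. 0 \<le> s \<Longrightarrow> s \<le> z \<Longrightarrow> \<bar>ext g s + (- m) * ramp s\<bar> \<le> B"
    by (rule P.speed_bound[OF W(6) _ _ _ W(7)]) (use W in auto)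
  have Wz: "W t < z" "0 < W' t" for t using W(6) by (auto simp: profile_def)
  have Wm: "W s \<le> W t" if "s \<le> t" for s t by (rule P.profile_mono[OF W(6) that])
  define \<beta> where "\<beta> = min e' (bb / \<nu>)"
  have \<beta>: "0 < \<beta>" "\<beta> \<le> e'" "\<nu> * \<beta> \<le> bb" using e' W \<nu> by (auto simp: \<beta>_def min_def field_simps)
  define c2 where "c2 = (c + cstar D d \<rho> g) / 2"
  have c2: "c < c2" "c2 < cstar D d \<rho> g" "0 < c2" using c by (auto simp: c2_def)
  obtain r0 where r0: "0 < r0"
    "\<And>R. \<exists>t1. \<forall>t\<ge>t1. \<forall>y. \<bar>y$i\<bar> \<le> c2 * t \<longrightarrow> (\<forall>j. j \<noteq> i \<longrightarrow> \<bar>y$j\<bar> \<le> R) \<longrightarrow> y$k \<le> - r0 \<longrightarrow> z \<le> f True y t"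
    by (rule deep[OF ik c2(3,2) x1 W(3,4)]) (rule that)
  define r1 where "r1 = max r0 R"
  have r1: "0 < r1" "r0 \<le> r1" "R \<le> r1" using r0(1) by (auto simp: r1_def)
  obtain tz where tz: "W tz = 0" using W(6,3) unfolding profile_def by blast
  \<comment> \<open>A shift by Q puts even the fold, at depth r1, at or below the zero tz of the
    profile, so the barrier starts nonpositive.\<close>
  define Q where "Q = r1 + \<bar>tz\<bar>"
  have Q: "0 < Q" using r1 by (simp add: Q_def)
  define N where "N = real CARD('n)"
  have N: "0 < N" by (simp add: N_def)
  \<comment> \<open>The three summands bound, per unit of \<delta>, the time derivative, the
    Laplacian of q, and the squared tangential gradient
    \<open>4 * \<delta> * (\<delta> * q x)\<close> times the reaction term.\<close>
  define K1 where "K1 = B * (1 + 2 * D * N + 4 * Q)"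
  define K2 where "K2 = c1 * (B * (1 + 2 * d * N + 4 * (d / D) * Q))"
  have K: "0 < K1" "0 < K2" using B(1) D d N Q c1(1) by (auto simp: K1_def K2_def add_pos_pos)
  define \<delta> where "\<delta> = min (m / K1) (\<rho> * \<beta> / K2)"
  have \<delta>: "0 < \<delta>" "\<delta> * K1 \<le> m" "\<delta> * K2 \<le> \<rho> * \<beta>"
    using W K \<rho> \<beta> by (auto simp: \<delta>_def min_def field_simps)
  define \<tau> where "\<tau> = Q / \<delta>"
  have \<tau>: "0 < \<tau>" "\<delta> * \<tau> = Q" using Q \<delta> by (auto simp: \<tau>_def)
  define lr where "lr = Q / \<delta> + 1"
  have lr: "0 < lr" using \<tau> by (simp add: lr_def \<tau>_def)
  \<comment> \<open>Large enough for every coordinate of a possible contact point: tangential ones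
    differ from those of y by at most lr, and the folded profile is positive only to a bounded
    depth.\<close>
  define R' where "R' = R + lr + 2 * r1 + \<bar>tz\<bar>"
  obtain t1 where t1: "\<And>t y. t1 \<le> t \<Longrightarrow> \<bar>y$i\<bar> \<le> c2 * t \<Longrightarrow> (\<And>j. j \<noteq> i \<Longrightarrow> \<bar>y$j\<bar> \<le> R') \<Longrightarrow> y$k \<le> - r0 \<Longrightarrow> z \<le> f True y t"
    using r0(2)[of R'] by blast
  define T where "T = max (\<tau> + max t1 0) ((lr + c2 * \<tau>) / (c2 - c))"
  have main: "(if b then W (- y$k) else c1 * W 0 * exp (lam * y$k) - \<beta>) \<le> f b y t"
    if t: "T \<le> t" and yk: "y$k \<le> 0" and yi: "\<bar>y$i\<bar> \<le> c * t" and yj: "\<And>j. j \<noteq> i \<Longrightarrow> \<bar>y$j\<bar> \<le> R" for y t b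
  proof -
    have tt: "t1 \<le> t - \<tau>" "0 \<le> t - \<tau>" using t by (auto simp: T_def)
    have "(lr + c2 * \<tau>) / (c2 - c) \<le> t" using t by (simp add: T_def)
    then have "lr + c2 * \<tau> \<le> t * (c2 - c)" using c2 by (simp add: pos_divide_le_eq)
    then have ct: "c * t + lr \<le> c2 * (t - \<tau>)" by (simp add: algebra_simps)
    \<comment> \<open>The projection of y to the interface; q is then the squared tangential
      distance to y.\<close>
    define y0 where "y0 = y - (y$k) *\<^sub>R axis k (1::real)"
    have y0k: "y0$k = 0" by (simp add: y0_def)
    have y0j: "y0$j = y$j" if "j \<noteq> k" for j using that by (simp add: y0_def axis_def)
    define \<phi> where "\<phi> s = Q - \<delta> * (s - (t - \<tau>))" for s
    have ph: "0 \<le> \<phi> s" if "s \<le> t" for s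
    proof -
      have "\<delta> * (s - (t - \<tau>)) \<le> \<delta> * \<tau>" using that \<delta> by (intro mult_left_mono) auto
      then show ?thesis by (simp add: \<phi>_def \<tau>(2))
    qed
    have ph0: "\<phi> t = 0" using \<tau>(2) by (simp add: \<phi>_def)
    define q where "q x = (norm (x - y0))\<^sup>2 - x$k * x$k" for x
    have qsum: "q x = (\<Sum>j\<in>UNIV - {k}. ((x - y0)$j)\<^sup>2)" for x
      unfolding q_def norm_sq_sum using y0k by (simp add: sum.remove[of UNIV k] power2_eq_square)
    have q0: "0 \<le> q x" for x unfolding qsum by (intro sum_nonneg) auto
    have qge: "((x - y0)$j)\<^sup>2 \<le> q x" if "j \<noteq> k" for x j
      unfolding qsum by (rule member_le_sum) (use that in auto)
    define p where "p x s = \<phi> s + \<delta> * q x" for x s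
    have p0: "0 \<le> p x s" if "s \<le> t" for x s using ph[OF that] q0[of x] \<delta> by (simp add: p_def)
    \<comment> \<open>The minimum turns the profile down again below depth r1, so that the first
      component is positive neither far along the interface nor deep inside.\<close>
    define w where "w b x s = (if b then W (min (- x$k) (2 * r1 + x$k) - p x s)
         else c1 * (W (- p x s) * exp (lam * x$k)) - \<beta>)" for b and x :: "real^'n" and s
    have dq: "\<delta> * q x \<le> p x s" if "s \<le> t" for x s using ph[OF that] by (simp add: p_def)
    have "w b y t \<le> f b y t"
    proof (rule C.comparison_sub[where w=w and B="1 + c1" and ?t0.0="t - \<tau>" and ?t1.0=t])
      show "0 \<le> t - \<tau>" by (rule tt)
      fix b
      have "continuous_on ({x. x$k \<le> 0} \<times> {t - \<tau>..t}) (\<lambda>v::(real^'n) \<times> real. W (min (- (fst v)$k) (2 * r1 + (fst v)$k) - p (fst v) (snd v)))"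
           "continuous_on ({x. x$k \<le> 0} \<times> {t - \<tau>..t}) (\<lambda>v::(real^'n) \<times> real. W (- p (fst v) (snd v)))"
        unfolding p_def \<phi>_def q_def by (rule continuous_on_compose2[OF profile_cont[OF W(6), of UNIV]]; auto intro!: continuous_intros)+
      then show "continuous_on ({x. x$k \<le> 0} \<times> {t - \<tau>..t}) (\<lambda>(x,t). w b x t)"
        unfolding w_def case_prod_unfold by (cases b) (auto intro!: continuous_intros)
    next
      fix b and x :: "real^'n" and s assume s: "x$k \<le> 0" "s \<le> t"
      have E: "0 < exp (lam * x$k)" "exp (lam * x$k) \<le> 1" using lam s by (auto simp: mult_nonneg_nonpos)
      have "W (- p x s) \<le> 1" using Wz(1)[of "- p x s"] W(4) by simp
      then have "W (- p x s) * exp (lam * x$k) \<le> 1 * exp (lam * x$k)" using E by (intro mult_right_mono) auto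
      then have "W (- p x s) * exp (lam * x$k) \<le> 1" using E by linarith
      then have "c1 * (W (- p x s) * exp (lam * x$k)) \<le> c1 * 1" using c1(1) by (intro mult_left_mono) auto
      then have "c1 * (W (- p x s) * exp (lam * x$k)) - \<beta> \<le> 1 + c1" using \<beta>(1) by linarith
      moreover have "W (min (- x$k) (2 * r1 + x$k) - p x s) \<le> 1" using Wz(1) W(4) by (meson less_imp_le less_trans)
      then have "W (min (- x$k) (2 * r1 + x$k) - p x s) \<le> 1 + c1" using c1(1) by linarith
      ultimately show "w b x s \<le> 1 + c1" unfolding w_def by (cases b) simp_all
    next
      fix b and x :: "real^'n" assume x: "x$k \<le> 0"
      have fn: "0 \<le> f b x (t - \<tau>)" using f_nonneg x tt by simp
      have pQ: "Q \<le> p x (t - \<tau>)" using q0[of x] \<delta> by (simp add: p_def \<phi>_def)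
      have "min (- x$k) (2 * r1 + x$k) \<le> r1" by (simp add: min_le_iff_disj) linarith
      then have "W (min (- x$k) (2 * r1 + x$k) - p x (t - \<tau>)) \<le> W tz" using pQ by (intro Wm) (auto simp: Q_def)
      moreover have "W (- p x (t - \<tau>)) \<le> W tz" using pQ r1 by (intro Wm) (auto simp: Q_def)
      then have "c1 * (W (- p x (t - \<tau>)) * exp (lam * x$k)) \<le> 0" using tz c1(1) by (simp add: mult_le_0_iff)
      ultimately show "w b x (t - \<tau>) \<le> f b x (t - \<tau>)" using fn tz \<beta> by (cases b) (auto simp: w_def)
    next
      fix b and x :: "real^'n" and s assume s: "x$k \<le> 0" "t - \<tau> < s" "s \<le> t" "f b x s < w b x s"
      have fn: "0 \<le> f b x s" using f_nonneg s tt by simp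
      have jp: "jetg p x s (- \<delta>) (\<lambda>j. if j = k then 0 else \<delta> * (2 * (x - y0)$j)) (\<lambda>j. if j = k then 0 else 2 * \<delta>)"
      proof -
        have jph: "jetg (\<lambda>(x::real^'n) s. \<phi> s) x s (- \<delta>) (\<lambda>j. 0) (\<lambda>j. 0)"
          unfolding \<phi>_def by (rule jetg_time) (auto intro!: derivative_eq_intros)
        show ?thesis unfolding p_def q_def
          by (rule jetg_cong[OF jetg_add[OF jph jetg_cmult[OF jetg_diff[OF jetg_sqdist jetg_mult[OF jetg_coord jetg_coord]]]]])
             (auto simp: y0k)
      qed
      have sumg: "(\<Sum>j\<in>UNIV. (if j = k then 0 else \<delta> * (2 * (x - y0)$j))\<^sup>2) = 4 * \<delta> * (\<delta> * q x)"
      proof -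
        have "(\<Sum>j\<in>UNIV. (if j = k then 0 else \<delta> * (2 * (x - y0)$j))\<^sup>2)
           = (\<Sum>j\<in>UNIV - {k}. (if j = k then 0 else \<delta> * (2 * (x - y0)$j))\<^sup>2)" by (simp add: sum.remove[of UNIV k])
        also have "\<dots> = (\<Sum>j\<in>UNIV - {k}. 4 * \<delta>\<^sup>2 * ((x - y0)$j)\<^sup>2)"
        proof (rule sum.cong[OF refl])
          fix j assume "j \<in> UNIV - {k}"
          moreover have "(\<delta> * (2 * a))\<^sup>2 = 4 * \<delta>\<^sup>2 * a\<^sup>2" for a by (simp add: power2_eq_square)
          ultimately show "(if j = k then 0 else \<delta> * (2 * (x - y0)$j))\<^sup>2 = 4 * \<delta>\<^sup>2 * ((x - y0)$j)\<^sup>2"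
            by (simp del: vector_minus_component)
        qed
        also have "\<dots> = 4 * \<delta>\<^sup>2 * q x" unfolding qsum by (simp add: sum_distrib_left)
        finally show ?thesis by (simp add: power2_eq_square)
      qed
      have sumq: "(\<Sum>j\<in>UNIV. if j = k then 0 else 2 * \<delta>) \<le> 2 * \<delta> * N"
      proof -
        have "(\<Sum>j\<in>(UNIV::'n set). if j = k then 0 else 2 * \<delta>) \<le> (\<Sum>j\<in>(UNIV::'n set). 2 * \<delta>)"
          by (rule sum_mono) (use \<delta> in auto)
        then show ?thesis by (simp add: N_def mult.commute)
      qed
      let ?sq = "\<Sum>j\<in>(UNIV::'n set). if j = k then 0 else 2 * \<delta>"
      let ?sg = "4 * \<delta> * (\<delta> * q x)"
      show "\<exists>a \<gamma> q. jetg (w b) x s a \<gamma> q \<and>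
         (x$k < 0 \<longrightarrow> a - (if b then D else d) * (\<Sum>j\<in>UNIV. q j) \<le> (if b then g (w b x s) else - \<rho> * w b x s)) \<and>
         (x$k = 0 \<longrightarrow> (if b then D else d) * \<gamma> k \<le> (if \<not> b then \<mu> else \<nu>) * w (\<not> b) x s - (if b then \<mu> else \<nu>) * w b x s)"
      proof (cases b)
        case True
        then have bT: "b = True" by simp
        define u0 where "u0 = min (- x$k) (2 * r1 + x$k) - p x s"
        have Wu0: "0 < W u0" using s(4) fn True by (simp add: w_def u0_def)
        have u0: "tz < u0"
        proof (rule ccontr)
          assume "\<not> tz < u0"
          then have "W u0 \<le> W tz" by (intro Wm) simp
          then show False using Wu0 tz by simp
        qed
        have "min (- x$k) (2 * r1 + x$k) \<le> r1" by (simp add: min_le_iff_disj) linarith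
        then have pQ: "p x s \<le> Q" using u0 by (simp add: u0_def Q_def)
        then have dQ: "\<delta> * q x \<le> Q" using dq[OF s(3), of x] by linarith
        \<comment> \<open>Past the fold \<open>deep\<close> yields f \<ge> z, which the profile
          never reaches; a contact therefore happens where the minimum equals \<open>- x$k\<close>
          and the barrier is smooth.\<close>
        have xk: "- r1 < x$k"
        proof (rule ccontr)
          assume "\<not> - r1 < x$k"
          then have xk: "x$k \<le> - r1" by simp
          have qQ: "q x \<le> Q / \<delta>" using dQ \<delta> by (simp add: field_simps)
          have co: "\<bar>x$j - y$j\<bar> \<le> lr" if "j \<noteq> k" for j
          proof -
            have "(x$j - y$j)\<^sup>2 \<le> Q / \<delta>" using qge[OF that, of x] qQ y0j[OF that] by simp
            moreover have "0 \<le> Q / \<delta>" using Q \<delta> by simp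
            have gen: "a \<le> (a + 1)\<^sup>2" if "0 \<le> a" for a :: real using that by (simp add: power2_eq_square algebra_simps)
            have "Q / \<delta> \<le> (Q / \<delta> + 1)\<^sup>2" using \<open>0 \<le> Q / \<delta>\<close> by (rule gen)
            ultimately have "\<bar>x$j - y$j\<bar>\<^sup>2 \<le> (Q / \<delta> + 1)\<^sup>2" by simp
            then show ?thesis unfolding lr_def by (rule power2_le_imp_le) (use \<open>0 \<le> Q / \<delta>\<close> in simp)
          qed
          have "z \<le> f True x s"
          proof (rule t1)
            show "t1 \<le> s" using tt s by linarith
            have "c2 * (t - \<tau>) \<le> c2 * s" using s c2 by (intro mult_left_mono) auto
            then show "\<bar>x$i\<bar> \<le> c2 * s" using co[OF ik] yi ct by linarith
            show "x$k \<le> - r0" using xk r1 by linarith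
            show "\<bar>x$j\<bar> \<le> R'" if j: "j \<noteq> i" for j
            proof (cases "j = k")
              case True
              have "u0 \<le> 2 * r1 + x$k" using p0[OF s(3), of x] by (simp add: u0_def)
              then have "- (2 * r1 + \<bar>tz\<bar>) \<le> x$k" using u0 by linarith
              then have "\<bar>x$k\<bar> \<le> R + lr + 2 * r1 + \<bar>tz\<bar>" using s(1) R lr by linarith
              then show ?thesis unfolding R'_def True .
            next
              case False
              then show ?thesis using co[OF False] yj[OF j] r1 unfolding R'_def by linarith
            qed
          qed
          then show False using s(4) Wz(1) True by (smt (verit) w_def)
        qed
        define S where "S = {x::real^'n. - r1 < x$k}"
        have S: "open S" "x \<in> S" using xk by (auto simp: S_def open_halfspace_component_gt_cart)
        define u where "u = - x$k - p x s"
        have uu: "u0 = u" using xk by (simp add: u0_def u_def min_def)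
        have Wu: "0 < W u" using Wu0 uu by simp
        have ju: "jetg (\<lambda>(x::real^'n) s. - x$k - p x s) x s \<delta> (\<lambda>j. if j = k then - 1 else - (\<delta> * (2 * (x - y0)$j)))
            (\<lambda>j. - (if j = k then 0 else 2 * \<delta>))"
          by (rule jetg_cong[OF jetg_diff[OF jetg_uminus[OF jetg_coord] jp]]) auto
        define h where "h = ext g (W u) + (- m) * ramp (W u)"
        have jW: "jetg (w True) x s (W' u * \<delta>) (\<lambda>j. W' u * (if j = k then - 1 else - (\<delta> * (2 * (x - y0)$j))))
           (\<lambda>j. - h / D * (if j = k then - 1 else - (\<delta> * (2 * (x - y0)$j)))\<^sup>2 + W' u * - (if j = k then 0 else 2 * \<delta>))"
        proof (rule jetg_local[OF _ S])
          show "jetg (\<lambda>x s. W (- x$k - p x s)) x s (W' u * \<delta>) (\<lambda>j. W' u * (if j = k then - 1 else - (\<delta> * (2 * (x - y0)$j))))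
           (\<lambda>j. - h / D * (if j = k then - 1 else - (\<delta> * (2 * (x - y0)$j)))\<^sup>2 + W' u * - (if j = k then 0 else 2 * \<delta>))"
            by (rule jetg_cong[OF jetg_profile[OF ju W(6)]]) (auto simp: u_def h_def)
          fix y and s assume "y \<in> S"
          then have "min (- y$k) (2 * r1 + y$k) = - y$k" by (simp add: S_def min_def)
          then show "w True y s = W (- y$k - p y s)" by (simp add: w_def)
        qed
        have sg1: "(\<Sum>j\<in>UNIV. (if j = k then - 1 else - (\<delta> * (2 * (x - y0)$j)))\<^sup>2) = 1 + ?sg"
        proof -
          have "(\<Sum>j\<in>UNIV. (if j = k then - 1 else - (\<delta> * (2 * (x - y0)$j)))\<^sup>2)
              = (\<Sum>j\<in>UNIV. (if j = k then 1 else 0) + (if j = k then 0 else \<delta> * (2 * (x - y0)$j))\<^sup>2)"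
            by (rule sum.cong) auto
          also have "\<dots> = 1 + ?sg" unfolding sum.distrib sumg by simp
          finally show ?thesis .
        qed
        have tot: "(\<Sum>j\<in>UNIV. - h / D * (if j = k then - 1 else - (\<delta> * (2 * (x - y0)$j)))\<^sup>2 + W' u * - (if j = k then 0 else 2 * \<delta>))
            = - h / D * (1 + ?sg) - W' u * ?sq"
          unfolding sum.distrib sum_distrib_left[symmetric] sg1 sum_negf by simp
        have hB: "\<bar>h\<bar> \<le> B" unfolding h_def using Wu Wz(1)[of u] by (intro B(3)) auto
        have W'B: "W' u \<le> B" using Wu by (intro B(2)) simp
        have i1: "W' u * \<delta> - D * (- h / D * (1 + ?sg) - W' u * ?sq) \<le> g (W u)"
        proof -
          have "h * ?sg \<le> B * (4 * \<delta> * Q)" using hB dQ \<delta> B(1) q0[of x] by (intro mult_mono) auto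
          moreover have "W' u * \<delta> \<le> B * \<delta>" using W'B \<delta> by (intro mult_right_mono) auto
          moreover have "D * (W' u * ?sq) \<le> D * (B * (2 * \<delta> * N))"
            using W'B sumq D B(1) \<delta> by (intro mult_left_mono mult_mono) (auto intro!: sum_nonneg)
          moreover have "B * (4 * \<delta> * Q) + B * \<delta> + D * (B * (2 * \<delta> * N)) = \<delta> * K1" by (simp add: K1_def algebra_simps)
          moreover have "W' u * \<delta> - D * (- h / D * (1 + ?sg) - W' u * ?sq) = W' u * \<delta> + h + h * ?sg + D * (W' u * ?sq)"
            using D by (simp add: algebra_simps)
          moreover have "h = g (W u) - m" using Wu ramp_bounds(3)[of "W u"] by (simp add: h_def ext_def)
          ultimately show ?thesis using \<delta>(2) by linarith
        qed
        \<comment> \<open>On the interface the profile is evaluated at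
          \<open>- p x s \<le> 0\<close>, the range in which \<open>lower_profile\<close> provides
          its margin; the margin covers \<nu> \<beta>.\<close>
        have i2: "D * (W' u * - 1) \<le> \<nu> * w False x s - \<mu> * W u" if xk0: "x$k = 0"
        proof -
          have us: "u = - p x s" using xk0 by (simp add: u_def)
          have "kap * W u + bb \<le> D * W' u" by (rule W(9)) (use us p0[OF s(3), of x] Wu in auto)
          moreover have "\<nu> * w False x s = \<nu> * c1 * W u - \<nu> * \<beta>" using xk0 us by (simp add: w_def algebra_simps)
          moreover have "kap * W u = \<mu> * W u - \<nu> * c1 * W u" unfolding c1(3)[symmetric] by (simp add: algebra_simps)
          ultimately show ?thesis using \<beta>(3) by simp
        qed
        have wu: "w True x s = W u" using uu by (simp add: w_def u0_def)
        show ?thesis unfolding bT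
          by (intro exI conjI impI, rule jW) (unfold tot, use i1 i2 wu in auto)
      next
        case False
        then have bF: "b = False" by simp
        define E where "E = exp (lam * x$k)"
        have E: "0 < E" "E \<le> 1" using lam s by (auto simp: E_def mult_nonneg_nonpos)
        define u where "u = - p x s"
        have "0 < c1 * (W u * E)" using s(4) fn False \<beta> by (simp add: w_def u_def E_def)
        then have Wu: "0 < W u" using c1(1) E by (simp add: zero_less_mult_iff)
        have u0: "tz < u"
        proof (rule ccontr)
          assume "\<not> tz < u"
          then have "W u \<le> W tz" by (intro Wm) simp
          then show False using Wu tz by simp
        qed
        then have dQ: "\<delta> * q x \<le> Q" using dq[OF s(3), of x] r1 by (simp add: u_def Q_def)
        define h where "h = ext g (W u) + (- m) * ramp (W u)"
        have hB: "\<bar>h\<bar> \<le> B" unfolding h_def using Wu Wz(1)[of u] by (intro B(3)) auto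
        have W'B: "W' u \<le> B" using Wu by (intro B(2)) simp
        have jW: "jetg (\<lambda>x s. W (- p x s)) x s (W' u * \<delta>) (\<lambda>j. W' u * - (if j = k then 0 else \<delta> * (2 * (x - y0)$j)))
           (\<lambda>j. - h / D * (if j = k then 0 else \<delta> * (2 * (x - y0)$j))\<^sup>2 + W' u * - (if j = k then 0 else 2 * \<delta>))"
          by (rule jetg_cong[OF jetg_profile[OF jetg_uminus[OF jp] W(6)]]) (auto simp: u_def h_def)
        have jE: "jetg (\<lambda>(x::real^'n) s. exp (lam * x$k)) x s 0 (\<lambda>j. if j = k then E * lam else 0) (\<lambda>j. if j = k then E * lam\<^sup>2 else 0)"
          by (rule jetg_cong[OF jetg_exp[OF jetg_cmult[OF jetg_coord]]]) (auto simp: E_def power2_eq_square)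
        have wF: "w False = (\<lambda>x s. c1 * (W (- p x s) * exp (lam * x$k)) - \<beta>)" by (intro ext) (simp add: w_def)
        have jw: "jetg (w False) x s (c1 * (W' u * \<delta> * E)) (\<lambda>j. if j = k then c1 * (W u * (E * lam)) else
              c1 * (W' u * - (\<delta> * (2 * (x - y0)$j)) * E))
           (\<lambda>j. c1 * ((- h / D * (if j = k then 0 else \<delta> * (2 * (x - y0)$j))\<^sup>2 + W' u * - (if j = k then 0 else 2 * \<delta>)) * E
              + W u * (if j = k then E * lam\<^sup>2 else 0)))"
          unfolding wF
          by (rule jetg_cong[OF jetg_diff[OF jetg_cmult[OF jetg_mult[OF jW jE]] jetg_const]]) (auto simp: u_def E_def)
        have tot: "(\<Sum>j\<in>UNIV. c1 * ((- h / D * (if j = k then 0 else \<delta> * (2 * (x - y0)$j))\<^sup>2 + W' u * - (if j = k then 0 else 2 * \<delta>)) * E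
              + W u * (if j = k then E * lam\<^sup>2 else 0)))
            = c1 * ((- h / D * ?sg - W' u * ?sq) * E + W u * (E * lam\<^sup>2))"
          unfolding sum_distrib_left[symmetric] sum.distrib sum_distrib_right[symmetric] sumg sum_negf by simp
        \<comment> \<open>The exponential solves the stationary equation of the second field; all
          remaining errors carry a factor \<delta> and are absorbed by \<rho> \<beta>.\<close>
        have i1: "c1 * (W' u * \<delta> * E) - d * (c1 * ((- h / D * ?sg - W' u * ?sq) * E + W u * (E * lam\<^sup>2)))
            \<le> - \<rho> * (c1 * (W u * E) - \<beta>)"
        proof -
          have "h * ?sg \<le> B * (4 * \<delta> * Q)" using hB dQ \<delta> B(1) q0[of x] by (intro mult_mono) auto
          then have "(d / D) * (h * ?sg) \<le> (d / D) * (B * (4 * \<delta> * Q))" using d D by (intro mult_left_mono) auto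
          moreover have "W' u * \<delta> \<le> B * \<delta>" using W'B \<delta> by (intro mult_right_mono) auto
          moreover have "d * (W' u * ?sq) \<le> d * (B * (2 * \<delta> * N))"
            using W'B sumq d B(1) \<delta> by (intro mult_left_mono mult_mono) (auto intro!: sum_nonneg)
          moreover have "B * \<delta> + d * (B * (2 * \<delta> * N)) + (d / D) * (B * (4 * \<delta> * Q)) = B * \<delta> * (1 + 2 * d * N + 4 * (d / D) * Q)"
            by (simp add: algebra_simps)
          ultimately have X: "W' u * \<delta> + (d / D) * (h * ?sg) + d * (W' u * ?sq) \<le> B * \<delta> * (1 + 2 * d * N + 4 * (d / D) * Q)" (is "?X \<le> ?Y")
            by linarith
          have Y0: "0 \<le> ?Y" using B(1) \<delta> d D N Q by simp
          have "?X * E \<le> ?Y * E" using X E by (intro mult_right_mono) auto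
          also have "\<dots> \<le> ?Y * 1" using Y0 E by (intro mult_left_mono) auto
          finally have "c1 * (?X * E) \<le> c1 * ?Y" using c1(1) by simp
          also have "\<dots> = \<delta> * K2" by (simp add: K2_def algebra_simps)
          finally have X2: "c1 * (?X * E) \<le> \<rho> * \<beta>" using \<delta>(3) by linarith
          have "c1 * (W' u * \<delta> * E) - d * (c1 * ((- h / D * ?sg - W' u * ?sq) * E + W u * (E * lam\<^sup>2)))
              = c1 * (?X * E) - (d * lam\<^sup>2) * (c1 * (W u * E))"
            by (simp add: algebra_simps)
          also have "\<dots> \<le> \<rho> * \<beta> - \<rho> * (c1 * (W u * E))" unfolding lam(2) using X2 by simp
          finally show ?thesis by (simp add: algebra_simps)
        qed
        have i2: "d * (c1 * (W u * (E * lam))) \<le> \<mu> * w True x s - \<nu> * (c1 * (W u * E) - \<beta>)" if xk0: "x$k = 0"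
        proof -
          have "w True x s = W u" using xk0 r1 by (simp add: w_def u_def min_def)
          moreover have "\<mu> * W u = (\<nu> * c1 + d * lam * c1) * W u" by (simp only: c1(2))
          moreover have "0 \<le> \<nu> * \<beta>" using \<nu> \<beta> by simp
          moreover have "E = 1" using xk0 by (simp add: E_def)
          ultimately show ?thesis by (simp add: algebra_simps)
        qed
        have wu: "w False x s = c1 * (W u * E) - \<beta>" by (simp add: w_def u_def E_def)
        show ?thesis unfolding bF
          by (intro exI conjI impI, rule jw) (unfold tot, use i1 i2 wu in auto)
      qed
    qed (use \<tau> yk in auto)
    moreover have "q y = 0"
    proof -
      have "y - y0 = (y$k) *\<^sub>R axis k 1" by (simp add: y0_def)
      then show ?thesis by (simp add: q_def power2_eq_square)
    qed
    then have py: "p y t = 0" by (simp add: p_def ph0)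
    have "- y$k \<le> r1"
    proof -
      have "\<bar>y$k\<bar> \<le> R" by (rule yj) (use ik in auto)
      then show ?thesis using r1 by linarith
    qed
    then have "min (- y$k) (2 * r1 + y$k) = - y$k" by (simp add: min_def)
    ultimately show ?thesis using py by (cases b) (simp_all add: w_def mult.assoc)
  qed
  have W0c: "\<bar>W 0 - P.\<theta>\<bar> \<le> e'" using W(10)[of 0] R P0(2) by simp
  show ?thesis
  proof (rule that[of T])
    show "0 \<le> T" using \<tau> by (simp add: T_def max_def)
    fix y :: "real^'n" and t
    assume h': "T \<le> t" "y$k \<le> 0" "\<bar>y$i\<bar> \<le> c * t" "\<forall>j. j \<noteq> i \<longrightarrow> \<bar>y$j\<bar> \<le> R"
    note h = h'(1-3) h'(4)[rule_format]
    have "\<bar>y$k\<bar> \<le> R" by (rule h(4)) (use ik in auto)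
    then have "\<bar>W (- y$k) - W0 (- y$k)\<bar> \<le> e'" using h(2) by (intro W(10)) auto
    then have "W0 (- y$k) - e \<le> W (- y$k)" using e'(3) by linarith
    also have "W (- y$k) \<le> f True y t" using main[OF h, of True] by simp
    finally show "W0 (- y$k) - e \<le> f True y t" .
    have ex: "0 < exp (lam * y$k)" "exp (lam * y$k) \<le> 1" using lam h(2) by (auto simp: mult_nonneg_nonpos)
    have "c1 * P.\<theta> * exp (lam * y$k) - e \<le> c1 * W 0 * exp (lam * y$k) - \<beta>"
    proof -
      have "c1 * (P.\<theta> - W 0) * exp (lam * y$k) \<le> (c1 * e') * 1"
      proof -
        have "c1 * (P.\<theta> - W 0) \<le> c1 * e'" using W0c c1(1) by (intro mult_left_mono) auto
        then have "c1 * (P.\<theta> - W 0) * exp (lam * y$k) \<le> (c1 * e') * exp (lam * y$k)" using ex by (intro mult_right_mono) auto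
        also have "\<dots> \<le> (c1 * e') * 1" using ex c1(1) e' by (intro mult_left_mono) auto
        finally show ?thesis .
      qed
      then have "c1 * P.\<theta> * exp (lam * y$k) - c1 * W 0 * exp (lam * y$k) \<le> c1 * e'" by (simp add: algebra_simps)
      then show ?thesis using e'(2) \<beta>(2) by linarith
    qed
    also have "\<dots> \<le> f False y t" using main[OF h, of False] by simp
    finally show "c1 * P.\<theta> * exp (lam * y$k) - e \<le> f False y t" .
  qed
qed

end

section \<open>Steady states and the main theorem\<close>

definition reflect :: "'n::finite \<Rightarrow> real^'n \<Rightarrow> real^'n" where
  "reflect k x = (\<chi> j. if j = k then - x$j else x$j)"

lemma reflect_nth [simp]: "reflect k x $ j = (if j = k then - x$j else x$j)"
  by (simp add: reflect_def)

lemma reflect_reflect [simp]: "reflect k (reflect k x) = x"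
  by (simp add: vec_eq_iff)

lemma reflect_id: "x$k = 0 \<Longrightarrow> reflect k x = x"
  by (simp add: vec_eq_iff)

lemma norm_reflect [simp]: "norm (reflect k x) = norm x"
  unfolding norm_vec_def L2_set_def by (rule arg_cong[where f=sqrt], rule sum.cong) auto

lemma reflect_line: "reflect k (x + s *\<^sub>R axis j 1) = reflect k x + ((if j = k then - s else s)) *\<^sub>R axis j 1"
  by (auto simp: vec_eq_iff axis_def)

lemma continuous_reflect [continuous_intros]: "continuous_on S f \<Longrightarrow> continuous_on S (\<lambda>x. reflect k (f x))"
  unfolding reflect_def
proof (rule continuous_on_vec_lambda)
  fix j assume "continuous_on S f"
  then show "continuous_on S (\<lambda>x. if j = k then - f x $ j else f x $ j)"
    by (cases "j = k") (auto intro!: continuous_intros)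
qed

text \<open>Reflection reverses the line in direction k only: a first derivative changes sign there,
  a second derivative picks up the sign twice.\<close>

lemma jetg_reflect:
  assumes "jetg v (reflect k x) t a \<gamma> q"
  shows "jetg (\<lambda>x t. v (reflect k x) t) x t a (\<lambda>j. if j = k then - \<gamma> j else \<gamma> j) q"
  unfolding jetg_def
proof (intro conjI allI)
  show "(v (reflect k x) has_real_derivative a) (at t)" using assms by (simp add: jetg_def)
  fix j
  define \<sigma> where "\<sigma> = (if j = k then - 1 else 1 :: real)"
  obtain p where p: "\<forall>\<^sub>F s in nhds 0. ((\<lambda>r. v (reflect k x + r *\<^sub>R axis j 1) t) has_real_derivative p s) (at s)" "p 0 = \<gamma> j"
      "(p has_real_derivative q j) (at 0)" by (rule jetg_line[OF assms])
  have line: "v (reflect k (x + r *\<^sub>R axis j 1)) t = v (reflect k x + (\<sigma> * r) *\<^sub>R axis j 1) t" for r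
    by (simp add: reflect_line \<sigma>_def)
  have lim: "((\<lambda>s. \<sigma> * s) \<longlongrightarrow> 0) (nhds 0)"
  proof -
    have "isCont (\<lambda>s. \<sigma> * s) 0" by (intro continuous_intros)
    then show ?thesis by (simp add: isCont_def tendsto_nhds_iff)
  qed
  have "\<forall>\<^sub>F s in nhds 0. ((\<lambda>r. v (reflect k x + r *\<^sub>R axis j 1) t) has_real_derivative p (\<sigma> * s)) (at (\<sigma> * s))"
    using filterlim_iff[THEN iffD1, OF lim, rule_format, OF p(1)] by simp
  then have "\<forall>\<^sub>F s in nhds 0. ((\<lambda>r. v (reflect k (x + r *\<^sub>R axis j 1)) t) has_real_derivative \<sigma> * p (\<sigma> * s)) (at s)"
  proof (rule eventually_mono)
    fix s assume d: "((\<lambda>r. v (reflect k x + r *\<^sub>R axis j 1) t) has_real_derivative p (\<sigma> * s)) (at (\<sigma> * s))"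
    have "((\<lambda>r. \<sigma> * r) has_real_derivative \<sigma>) (at s)" by (auto intro!: derivative_eq_intros)
    from DERIV_chain2[OF d this]
    show "((\<lambda>r. v (reflect k (x + r *\<^sub>R axis j 1)) t) has_real_derivative \<sigma> * p (\<sigma> * s)) (at s)"
      unfolding line by (simp add: mult.commute)
  qed
  moreover have "((\<lambda>s. \<sigma> * p (\<sigma> * s)) has_real_derivative q j) (at 0)"
  proof -
    have d: "((\<lambda>r. \<sigma> * r) has_real_derivative \<sigma>) (at 0)" by (auto intro!: derivative_eq_intros)
    have "((\<lambda>s. p (\<sigma> * s)) has_real_derivative q j * \<sigma>) (at 0)"
      by (rule DERIV_chain2[where f=p, OF _ d]) (use p(3) in simp)
    from DERIV_cmult[OF this, of \<sigma>] show ?thesis by (simp add: \<sigma>_def split: if_splits)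
  qed
  ultimately show "\<exists>p. (\<forall>\<^sub>F s in nhds 0. ((\<lambda>r. v (reflect k (x + r *\<^sub>R axis j 1)) t) has_real_derivative p s) (at s)) \<and>
      p 0 = (if j = k then - \<gamma> j else \<gamma> j) \<and> (p has_real_derivative q j) (at 0)"
    using p(2) by (intro exI[of _ "\<lambda>s. \<sigma> * p (\<sigma> * s)"]) (auto simp: \<sigma>_def)
qed

text \<open>\<open>C21_on\<close> gives line derivatives only at parameter 0, but at every point of
  \<Omega>. Moving the base point along the line turns this into derivatives at all nearby
  parameters, which is what a jet asks for.\<close>

lemma jetg_C21:
  assumes C: "C21_on u \<Omega>" and S: "open \<Omega>" "x \<in> \<Omega>" and t: "0 < t"
  shows "jetg u x t (pdt u x t) (\<lambda>j. pdx (\<lambda>y. u y t) j x) (\<lambda>j. pdx (pdx (\<lambda>y. u y t) j) j x)"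
  unfolding jetg_def
proof (intro conjI allI)
  have C': "((\<lambda>s. u x s) has_real_derivative pdt u x t) (at t) \<and>
        (\<forall>j. ((\<lambda>s. u (x + s *\<^sub>R axis j 1) t) has_real_derivative pdx (\<lambda>y. u y t) j x) (at 0) \<and>
             ((\<lambda>s. pdx (\<lambda>y. u y t) j (x + s *\<^sub>R axis j 1)) has_real_derivative
                 pdx (pdx (\<lambda>y. u y t) j) j x) (at 0))" if "x \<in> \<Omega>" for x
    using C that t unfolding C21_on_def by blast
  show "(u x has_real_derivative pdt u x t) (at t)" using C'[OF S(2)] by simp
  fix j
  define V where "V = (\<lambda>r::real. x + r *\<^sub>R axis j 1) -` \<Omega>"
  have V: "open V" unfolding V_def using S(1) by (intro open_vimage) (auto intro!: continuous_intros)
  have "0 \<in> V" using S by (simp add: V_def)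
  then have "\<forall>\<^sub>F s in nhds 0. s \<in> V" using V by (rule eventually_nhds_in_open[rotated])
  then have "\<forall>\<^sub>F s in nhds 0. ((\<lambda>r. u (x + r *\<^sub>R axis j 1) t) has_real_derivative pdx (\<lambda>y. u y t) j (x + s *\<^sub>R axis j 1)) (at s)"
  proof (rule eventually_mono)
    fix s assume "s \<in> V"
    then have "((\<lambda>r. u (x + s *\<^sub>R axis j 1 + r *\<^sub>R axis j 1) t) has_real_derivative pdx (\<lambda>y. u y t) j (x + s *\<^sub>R axis j 1)) (at (s - s))"
      using C' by (simp add: V_def)
    moreover have "((\<lambda>r. r - s) has_real_derivative 1) (at s)" by (auto intro!: derivative_eq_intros)
    ultimately have "((\<lambda>r. u (x + s *\<^sub>R axis j 1 + (r - s) *\<^sub>R axis j 1) t) has_real_derivative pdx (\<lambda>y. u y t) j (x + s *\<^sub>R axis j 1) * 1) (at s)"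
      by (rule DERIV_chain2)
    moreover have "x + s *\<^sub>R axis j 1 + (r - s) *\<^sub>R axis j 1 = x + r *\<^sub>R axis j 1" for r
      by (simp add: algebra_simps)
    ultimately show "((\<lambda>r. u (x + r *\<^sub>R axis j 1) t) has_real_derivative pdx (\<lambda>y. u y t) j (x + s *\<^sub>R axis j 1)) (at s)" by simp
  qed
  then show "\<exists>p. (\<forall>\<^sub>F s in nhds 0. ((\<lambda>r. u (x + r *\<^sub>R axis j 1) t) has_real_derivative p s) (at s)) \<and>
      p 0 = pdx (\<lambda>y. u y t) j x \<and> (p has_real_derivative pdx (pdx (\<lambda>y. u y t) j) j x) (at 0)"
    using C'[OF S(2)] by (intro exI[of _ "\<lambda>s. pdx (\<lambda>y. u y t) j (x + s *\<^sub>R axis j 1)"]) simp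
qed

section \<open>Classical solutions, and functions of x_N alone, in the folded setting\<close>

lemma hm_system_of_sol:
  fixes u v :: "real^'n::finite \<Rightarrow> real \<Rightarrow> real"
  assumes pos: "0 < D" "0 < d" "0 < \<mu>" "0 < \<nu>" "0 < \<rho>" and kpp: "KPP g" and sol: "HM_sol D d \<mu> \<nu> \<rho> g k u v"
    and init: "\<And>x. x$k \<le> 0 \<Longrightarrow> 0 \<le> u x 0" "\<And>x. 0 \<le> x$k \<Longrightarrow> 0 \<le> v x 0"
  shows "hm_system D d \<mu> \<nu> \<rho> g k (\<lambda>b x t. if b then u x t else v (reflect k x) t)"
proof (rule hm_system.intro)
  show "0 < D" "0 < d" "0 < \<mu>" "0 < \<nu>" "0 < \<rho>" "KPP g" by (rule pos kpp)+
  show "0 \<le> (if b then u x 0 else v (reflect k x) 0)" if "x$k \<le> 0" for x b using init that by simp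
  have sc: "continuous_on ({x. x$k \<le> 0} \<times> {0..}) (\<lambda>(x,t). u x t)" "continuous_on ({x. x$k \<ge> 0} \<times> {0..}) (\<lambda>(x,t). v x t)"
    and C21: "C21_on u {x. x$k < 0}" "C21_on v {x. x$k > 0}"
    and equ: "\<And>x t. x$k < 0 \<Longrightarrow> t > 0 \<Longrightarrow> pdt u x t - D * lapx u x t = g (u x t)"
    and eqv: "\<And>x t. x$k > 0 \<Longrightarrow> t > 0 \<Longrightarrow> pdt v x t - d * lapx v x t = - \<rho> * v x t"
    and bd: "\<And>x t. x$k = 0 \<Longrightarrow> t > 0 \<Longrightarrow> \<exists>a b. ((\<lambda>s. u (x + s *\<^sub>R axis k 1) t) has_real_derivative a) (at_left 0) \<and>
               ((\<lambda>s. v (x + s *\<^sub>R axis k 1) t) has_real_derivative b) (at_right 0) \<and>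
               D * a = \<nu> * v x t - \<mu> * u x t \<and> - d * b = \<mu> * u x t - \<nu> * v x t"
    and bdd: "\<And>T. \<exists>M. \<forall>x t. 0 \<le> t \<and> t \<le> T \<longrightarrow> (x$k \<le> 0 \<longrightarrow> \<bar>u x t\<bar> \<le> M) \<and> (x$k \<ge> 0 \<longrightarrow> \<bar>v x t\<bar> \<le> M)"
    using sol unfolding HM_sol_def by blast+
  show "coupled (\<lambda>b. if b then D else d) (\<lambda>b. if b then \<mu> else \<nu>) (\<lambda>b s. if b then g s else - \<rho> * s) k
     (\<lambda>b x t. if b then u x t else v (reflect k x) t)"
  proof
    show "0 < (if b then D else d)" "0 < (if b then \<mu> else \<nu>)" for b using pos by auto
    show "\<exists>L. \<forall>p q. \<bar>p\<bar> \<le> R \<and> \<bar>q\<bar> \<le> R \<longrightarrow> \<bar>(if b then g p else - \<rho> * p) - (if b then g q else - \<rho> * q)\<bar> \<le> L * \<bar>p - q\<bar>" for R b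
    proof (cases b)
      case True then show ?thesis using kpp unfolding KPP_def by simp
    next
      case False
      have "\<bar>- \<rho> * p - - \<rho> * q\<bar> \<le> \<rho> * \<bar>p - q\<bar>" for p q
      proof -
        have "- \<rho> * p - - \<rho> * q = - \<rho> * (p - q)" by (simp add: algebra_simps)
        then show ?thesis using pos(5) by (simp add: abs_mult)
      qed
      then show ?thesis using False by (intro exI[of _ \<rho>]) simp
    qed
    show "continuous_on ({x. x$k \<le> 0} \<times> {0..}) (\<lambda>(x,t). if b then u x t else v (reflect k x) t)" for b
    proof (cases b)
      case True then show ?thesis using sc(1) by simp
    next
      case False
      have "continuous_on ({x. x$k \<le> 0} \<times> {0..}) (\<lambda>p. case (reflect k (fst p), snd p) of (x,t) \<Rightarrow> v x t)"
        by (rule continuous_on_compose2[OF sc(2)]) (auto intro!: continuous_intros)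
      then show ?thesis using False by (simp add: case_prod_unfold)
    qed
    show "\<exists>a \<gamma> q. jetg (\<lambda>x t. if b then u x t else v (reflect k x) t) x t a \<gamma> q \<and>
        a - (if b then D else d) * (\<Sum>j\<in>UNIV. q j) = (if b then g (if b then u x t else v (reflect k x) t)
           else - \<rho> * (if b then u x t else v (reflect k x) t))" if x: "x$k < 0" and t: "0 < t" for x t b
    proof (cases b)
      case True
      have "jetg u x t (pdt u x t) (\<lambda>j. pdx (\<lambda>y. u y t) j x) (\<lambda>j. pdx (pdx (\<lambda>y. u y t) j) j x)"
        by (rule jetg_C21[OF C21(1) _ _ t]) (use x in \<open>auto simp: open_halfspace_component_lt_cart\<close>)
      then show ?thesis using equ[OF x t] True unfolding lapx_def by auto
    next
      case False
      have rx: "reflect k x $ k > 0" using x by simp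
      have "jetg v (reflect k x) t (pdt v (reflect k x) t) (\<lambda>j. pdx (\<lambda>y. v y t) j (reflect k x)) (\<lambda>j. pdx (pdx (\<lambda>y. v y t) j) j (reflect k x))"
        by (rule jetg_C21[OF C21(2) _ _ t]) (use rx in \<open>auto simp: open_halfspace_component_gt_cart\<close>)
      note j = jetg_reflect[OF this]
      have bF: "b = False" using False by simp
      show ?thesis unfolding bF if_False
        by (intro exI conjI, rule j, rule eqv[OF rx t, unfolded lapx_def])
    qed
    show "((\<lambda>s. if b then u (x + s *\<^sub>R axis k 1) t else v (reflect k (x + s *\<^sub>R axis k 1)) t) has_real_derivative
        ((if \<not> b then \<mu> else \<nu>) * (if \<not> b then u x t else v (reflect k x) t) - (if b then \<mu> else \<nu>) * (if b then u x t else v (reflect k x) t))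
         / (if b then D else d)) (at_left 0)" if x: "x$k = 0" and t: "0 < t" for x t b
    proof -
      obtain a \<beta> where B: "((\<lambda>s. u (x + s *\<^sub>R axis k 1) t) has_real_derivative a) (at_left 0)"
         "((\<lambda>s. v (x + s *\<^sub>R axis k 1) t) has_real_derivative \<beta>) (at_right 0)"
         "D * a = \<nu> * v x t - \<mu> * u x t" "- d * \<beta> = \<mu> * u x t - \<nu> * v x t" using bd[OF x t] by blast
      show ?thesis
      proof (cases b)
        case True
        have "a = (\<nu> * v x t - \<mu> * u x t) / D" using B(3) pos by (simp add: field_simps)
        then show ?thesis using B(1) True x by (simp add: reflect_id)
      next
        case False
        \<comment> \<open>The interface condition for v is one-sided from the right; composing with
          negation turns it into the left-sided one of the folded field and flips its sign.\<close>
        have im: "uminus ` {..<0::real} = {0<..}" by (simp add: image_uminus_lessThan)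
        have "((\<lambda>s. v (x + s *\<^sub>R axis k 1) t) \<circ> uminus has_real_derivative \<beta> * - 1) (at 0 within {..<0})"
          by (rule DERIV_image_chain) (use B(2) im in \<open>auto intro!: derivative_eq_intros\<close>)
        then have "((\<lambda>s. v (x + (- s) *\<^sub>R axis k 1) t) has_real_derivative - \<beta>) (at_left 0)" by (simp add: o_def)
        moreover have "- \<beta> = (\<mu> * u x t - \<nu> * v x t) / d" using B(4) pos by (simp add: field_simps)
        ultimately show ?thesis using False x by (simp add: reflect_line reflect_id)
      qed
    qed
    show "\<exists>M. \<forall>b x t. 0 \<le> t \<and> t \<le> T \<and> x$k \<le> 0 \<longrightarrow> \<bar>if b then u x t else v (reflect k x) t\<bar> \<le> M" for T
    proof -
      obtain M where M: "\<And>x t. 0 \<le> t \<Longrightarrow> t \<le> T \<Longrightarrow> (x$k \<le> 0 \<longrightarrow> \<bar>u x t\<bar> \<le> M) \<and> (x$k \<ge> 0 \<longrightarrow> \<bar>v x t\<bar> \<le> M)"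
        using bdd[of T] by blast
      show ?thesis
      proof (intro exI[of _ M] allI impI)
        fix b t and x :: "real^'n" assume h: "0 \<le> t \<and> t \<le> T \<and> x$k \<le> 0"
        then show "\<bar>if b then u x t else v (reflect k x) t\<bar> \<le> M" using M[of t x] M[of t "reflect k x"] by simp
      qed
    qed
  qed
qed

lemma pdx_layer:
  fixes k :: "'n::finite"
  assumes "\<And>y. (F has_real_derivative F' y) (at y)"
  shows "((\<lambda>s. F ((x + s *\<^sub>R axis j 1) $ k)) has_real_derivative (if j = k then F' (x$k) else 0)) (at 0)"
    "pdx (\<lambda>x. F (x$k)) j = (\<lambda>x::real^'n. if j = k then F' (x$k) else 0)"
proof -
  show d: "((\<lambda>s. F ((x + s *\<^sub>R axis j 1) $ k)) has_real_derivative (if j = k then F' (x$k) else 0)) (at 0)" for x :: "real^'n"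
  proof -
    have 1: "((\<lambda>s. (x + s *\<^sub>R axis j 1) $ k) has_real_derivative (if j = k then 1 else 0)) (at 0)"
      by (auto simp: axis_def intro!: derivative_eq_intros)
    have "((\<lambda>s. F ((x + s *\<^sub>R axis j 1) $ k)) has_real_derivative F' (x$k) * (if j = k then 1 else 0)) (at 0)"
      by (rule DERIV_chain2[where f=F, OF _ 1]) (use assms[of "x$k"] in simp)
    then show ?thesis by (rule DERIV_cong) simp
  qed
  show "pdx (\<lambda>x. F (x$k)) j = (\<lambda>x::real^'n. if j = k then F' (x$k) else 0)"
    unfolding pdx_def by (intro ext DERIV_imp_deriv d)
qed

lemma layer_C21:
  fixes k :: "'n::finite"
  assumes F: "\<And>y. (F has_real_derivative F' y) (at y)" "\<And>y. (F' has_real_derivative F'' y) (at y)"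
    and c: "continuous_on UNIV F''"
  shows "C21_on (\<lambda>(x::real^'n) t. F (x$k)) \<Omega>" "pdt (\<lambda>(x::real^'n) t. F (x$k)) x t = 0"
    "lapx (\<lambda>(x::real^'n) t. F (x$k)) x t = F'' (x$k)"
proof -
  have c': "continuous_on UNIV F'" using F(2) by (meson DERIV_isCont continuous_at_imp_continuous_on)
  have p1: "pdx (\<lambda>x. F (x$k)) j = (\<lambda>x::real^'n. if j = k then F' (x$k) else 0)" for j
    by (rule pdx_layer(2)[OF F(1)])
  have p2: "pdx (\<lambda>x. if j = k then F' (x$k) else 0) j = (\<lambda>x::real^'n. if j = k then F'' (x$k) else 0)" for j
  proof (cases "j = k")
    case True
    then show ?thesis using pdx_layer(2)[OF F(2), of k k] by simp
  next
    case False
    then show ?thesis by (intro ext) (simp add: pdx_def)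
  qed
  have d2: "((\<lambda>s. if j = k then F' ((x + s *\<^sub>R axis j 1)$k) else 0) has_real_derivative (if j = k then F'' (x$k) else 0)) (at 0)"
    for j and x :: "real^'n"
    using pdx_layer(1)[OF F(2), of x j k] by (cases "j = k") auto
  show pt: "pdt (\<lambda>(x::real^'n) t. F (x$k)) x t = 0" for x t by (simp add: pdt_def)
  have cc: "continuous_on S (\<lambda>(x::real^'n,t::real). if j = k then F' (x$k) else 0)"
    "continuous_on S (\<lambda>(x::real^'n,t::real). if j = k then F'' (x$k) else 0)" for S j
    unfolding case_prod_unfold
    by (cases "j = k"; auto intro!: continuous_intros continuous_on_compose2[OF c'] continuous_on_compose2[OF c])+
  show "C21_on (\<lambda>(x::real^'n) t. F (x$k)) \<Omega>"
    unfolding C21_on_def p1 p2 pt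
    by (intro conjI ballI allI impI pdx_layer(1)[OF F(1)] d2 cc) auto
  show "lapx (\<lambda>(x::real^'n) t. F (x$k)) x t = F'' (x$k)" unfolding lapx_def p1 p2 by simp
qed

section \<open>The steady state and convergence to it\<close>

context hm_system
begin

text \<open>Profiles are functions of depth, hence the reflected argument; positivity on the
  half-line lets \<open>ext g\<close> be replaced by g. The Robin condition together with the choice
  of \<open>c1\<close> restores both exchange conditions.\<close>

theorem steady_state:
  assumes P0: "profile D (ext g) 1 W0 W0'" "W0 0 = P.\<theta>" "D * W0' 0 = kap * P.\<theta>"
  shows "HM_steady D d \<mu> \<nu> \<rho> g k (\<lambda>y. W0 (- y)) (\<lambda>y. c1 * P.\<theta> * exp (- lam * y))"
proof -
  define U where "U y = W0 (- y)" for y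
  define V where "V y = c1 * P.\<theta> * exp (- lam * y)" for y
  have cT: "0 < c1 * P.\<theta>" using c1(1) P.theta by simp
  have U0: "P.\<theta> \<le> U y" if "y \<le> 0" for y
    using P.profile_mono[OF P0(1), of 0 "- y"] that P0(2) by (simp add: U_def)
  have Upos: "0 < U y" if "y \<le> 0" for y using U0[OF that] P.theta by linarith
  have U1: "U y \<le> 1" for y using P0(1) by (simp add: profile_def U_def less_imp_le)
  have Vpos: "0 < V y" for y using cT by (simp add: V_def)
  have V1: "V y \<le> c1 * P.\<theta>" if "0 \<le> y" for y
  proof -
    have "exp (- lam * y) \<le> 1" using lam(1) that by simp
    then have "c1 * P.\<theta> * exp (- lam * y) \<le> c1 * P.\<theta> * 1" using cT by (intro mult_left_mono) auto
    then show ?thesis by (simp add: V_def)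
  qed
  have dU: "(U has_real_derivative - W0' (- y)) (at y)" for y
  proof -
    have w: "(W0 has_real_derivative W0' (- y)) (at (- y))" using P0(1) by (simp add: profile_def)
    have m: "(uminus has_real_derivative - 1) (at y)" by (auto intro!: derivative_eq_intros)
    show ?thesis unfolding U_def using DERIV_chain2[OF w m] by simp
  qed
  have dU': "((\<lambda>y. - W0' (- y)) has_real_derivative - ext g (U y) / D) (at y)" for y
  proof -
    have w: "(W0' has_real_derivative - ext g (W0 (- y)) / D) (at (- y))" using P0(1) by (simp add: profile_def)
    have m: "(uminus has_real_derivative - 1) (at y)" by (auto intro!: derivative_eq_intros)
    show ?thesis unfolding U_def using DERIV_minus[OF DERIV_chain2[OF w m]] by simp
  qed
  have dV: "(V has_real_derivative - lam * V y) (at y)" for y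
    unfolding V_def by (auto intro!: derivative_eq_intros)
  have dV': "((\<lambda>y. - lam * V y) has_real_derivative lam\<^sup>2 * V y) (at y)" for y
    using DERIV_cmult[OF dV[of y], of "- lam"] by (simp add: power2_eq_square mult.assoc)
  have Uc: "continuous_on S U" and Vc: "continuous_on S V" for S
    using dU dV by (meson DERIV_isCont continuous_at_imp_continuous_on)+
  have cU: "continuous_on UNIV (\<lambda>y. - ext g (U y) / D)"
    using D by (intro continuous_intros continuous_on_compose2[OF P.ext_cont] Uc) auto
  have cV: "continuous_on UNIV (\<lambda>y. lam\<^sup>2 * V y)" by (intro continuous_intros Vc)
  note LU = layer_C21[OF dU dU' cU, of k] and LV = layer_C21[OF dV dV' cV, of k]
  have "HM_sol D d \<mu> \<nu> \<rho> g k (\<lambda>x t. U (x$k)) (\<lambda>x t. V (x$k))"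
    unfolding HM_sol_def
  proof (intro conjI allI impI)
    show "continuous_on ({x. x$k \<le> 0} \<times> {0..}) (\<lambda>(x,t). U (x$k))" "continuous_on ({x. 0 \<le> x$k} \<times> {0..}) (\<lambda>(x,t). V (x$k))"
      unfolding case_prod_unfold
      by (auto intro!: continuous_on_compose2[OF Uc[of UNIV]] continuous_on_compose2[OF Vc[of UNIV]] continuous_intros)
    show "C21_on (\<lambda>x t. U (x$k)) {x. x$k < 0}" "C21_on (\<lambda>x t. V (x$k)) {x. 0 < x$k}" by (rule LU LV)+
    show "pdt (\<lambda>x t. U (x$k)) x t - D * lapx (\<lambda>x t. U (x$k)) x t = g (U (x$k))" if "x$k < 0" for x t
      unfolding LU using D Upos[of "x$k"] that by (simp add: ext_def)
    show "pdt (\<lambda>x t. V (x$k)) x t - d * lapx (\<lambda>x t. V (x$k)) x t = - \<rho> * V (x$k)" for x t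
      unfolding LV using lam(2) by (metis diff_0 mult.assoc mult_minus_left)
    show "\<exists>a b. ((\<lambda>s. U ((x + s *\<^sub>R axis k 1)$k)) has_real_derivative a) (at_left 0) \<and>
        ((\<lambda>s. V ((x + s *\<^sub>R axis k 1)$k)) has_real_derivative b) (at_right 0) \<and>
        D * a = \<nu> * V (x$k) - \<mu> * U (x$k) \<and> - d * b = \<mu> * U (x$k) - \<nu> * V (x$k)" if x: "x$k = 0" for x :: "real^'n" and t
    proof (intro exI conjI)
      show "((\<lambda>s. U ((x + s *\<^sub>R axis k 1)$k)) has_real_derivative - W0' 0) (at_left 0)"
        using pdx_layer(1)[OF dU, of x k k] x by (auto intro: has_field_derivative_at_within)
      show "((\<lambda>s. V ((x + s *\<^sub>R axis k 1)$k)) has_real_derivative - lam * V 0) (at_right 0)"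
        using pdx_layer(1)[OF dV, of x k k] x by (auto intro: has_field_derivative_at_within)
      have UV: "U 0 = P.\<theta>" "V 0 = c1 * P.\<theta>" using P0(2) by (auto simp: U_def V_def)
      have kT: "\<mu> * P.\<theta> - \<nu> * (c1 * P.\<theta>) = kap * P.\<theta>" unfolding c1(3)[symmetric] by (simp add: algebra_simps)
      show "D * - W0' 0 = \<nu> * V (x$k) - \<mu> * U (x$k)" using P0(3) kT UV x by simp
      have "- d * (- lam * V 0) = (d * lam * c1) * P.\<theta>" using UV by simp
      then show "- d * (- lam * V 0) = \<mu> * U (x$k) - \<nu> * V (x$k)" unfolding c1(5) using kT UV x by simp
    qed
    show "\<exists>M. \<forall>x t. 0 \<le> t \<and> t \<le> T \<longrightarrow> (x$k \<le> 0 \<longrightarrow> \<bar>U (x$k)\<bar> \<le> M) \<and> (0 \<le> x$k \<longrightarrow> \<bar>V (x$k)\<bar> \<le> M)" for T :: real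
    proof (intro exI[of _ "1 + c1 * P.\<theta>"] allI impI conjI)
      fix x :: "real^'n"
      show "\<bar>U (x$k)\<bar> \<le> 1 + c1 * P.\<theta>" if "x$k \<le> 0" using Upos[OF that] U1[of "x$k"] cT by simp
      show "\<bar>V (x$k)\<bar> \<le> 1 + c1 * P.\<theta>" if "0 \<le> x$k" using Vpos[of "x$k"] V1[OF that] by simp
    qed
  qed
  moreover have "\<exists>M. (\<forall>y\<le>0. U y \<le> M) \<and> (\<forall>y\<ge>0. V y \<le> M)"
  proof (intro exI[of _ "1 + c1 * P.\<theta>"] conjI allI impI)
    show "U y \<le> 1 + c1 * P.\<theta>" for y using U1[of y] cT by linarith
    show "V y \<le> 1 + c1 * P.\<theta>" if "0 \<le> y" for y using V1[OF that] by linarith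
  qed
  ultimately show ?thesis using Upos Vpos unfolding HM_steady_def U_def[symmetric] V_def[symmetric] by blast
qed

theorem convergence:
  assumes ik: "i \<noteq> k" and c: "0 < c" "c < cstar D d \<rho> g" and x1: "x1$k \<le> 0" "0 < f b1 x1 0" and e: "0 < e"
    and P0: "profile D (ext g) 1 W0 W0'" "W0 0 = P.\<theta>" "D * W0' 0 = kap * P.\<theta>"
  obtains T where "0 \<le> T" "\<And>x t. T \<le> t \<Longrightarrow> x$k \<le> 0 \<Longrightarrow> \<bar>x$i\<bar> \<le> c * t \<Longrightarrow> (\<forall>j. j \<noteq> i \<longrightarrow> \<bar>x$j\<bar> \<le> R) \<Longrightarrow>
      \<bar>f True x t - W0 (- x$k)\<bar> < e \<and> \<bar>f False x t - c1 * P.\<theta> * exp (lam * x$k)\<bar> < e"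
proof -
  have e2: "0 < e / 2" using e by simp
  have R: "0 \<le> \<bar>R\<bar>" by simp
  obtain T1 where T1: "0 \<le> T1" "\<And>x t. T1 \<le> t \<Longrightarrow> x$k \<le> 0 \<Longrightarrow> - \<bar>R\<bar> \<le> x$k \<Longrightarrow> f True x t \<le> W0 (- x$k) + e / 2"
    "\<And>x t. T1 \<le> t \<Longrightarrow> x$k \<le> 0 \<Longrightarrow> f False x t \<le> c1 * P.\<theta> * exp (lam * x$k) + e / 2"
    by (rule upper_limit[OF e2 R P0]) (rule that)
  obtain T2 where T2: "0 \<le> T2"
    "\<And>y t. T2 \<le> t \<Longrightarrow> y$k \<le> 0 \<Longrightarrow> \<bar>y$i\<bar> \<le> c * t \<Longrightarrow> (\<forall>j. j \<noteq> i \<longrightarrow> \<bar>y$j\<bar> \<le> \<bar>R\<bar>) \<Longrightarrow> W0 (- y$k) - e / 2 \<le> f True y t"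
    "\<And>y t. T2 \<le> t \<Longrightarrow> y$k \<le> 0 \<Longrightarrow> \<bar>y$i\<bar> \<le> c * t \<Longrightarrow> (\<forall>j. j \<noteq> i \<longrightarrow> \<bar>y$j\<bar> \<le> \<bar>R\<bar>) \<Longrightarrow>
       c1 * P.\<theta> * exp (lam * y$k) - e / 2 \<le> f False y t"
    by (rule lower_limit[OF ik c x1 e2 R P0]) (rule that)
  show ?thesis
  proof (rule that[of "max T1 T2"])
    show "0 \<le> max T1 T2" using T1(1) by simp
    fix x :: "real^'n" and t
    assume h: "max T1 T2 \<le> t" "x$k \<le> 0" "\<bar>x$i\<bar> \<le> c * t" "\<forall>j. j \<noteq> i \<longrightarrow> \<bar>x$j\<bar> \<le> R"
    have t: "T1 \<le> t" "T2 \<le> t" using h(1) by auto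
    have j: "\<forall>j. j \<noteq> i \<longrightarrow> \<bar>x$j\<bar> \<le> \<bar>R\<bar>" using h(4) by (meson abs_ge_self order_trans)
    \<comment> \<open>k is one of the coordinates j \<noteq> i, so the local uniformity also bounds
      the depth.\<close>
    then have "\<bar>x$k\<bar> \<le> \<bar>R\<bar>" using ik[symmetric] by blast
    then have k: "- \<bar>R\<bar> \<le> x$k" by (simp add: abs_le_iff)
    note a = T1(2)[OF t(1) h(2) k] T1(3)[OF t(1) h(2)] T2(2)[OF t(2) h(2,3) j] T2(3)[OF t(2) h(2,3) j]
    have "e / 2 < e" using e by simp
    then show "\<bar>f True x t - W0 (- x$k)\<bar> < e \<and> \<bar>f False x t - c1 * P.\<theta> * exp (lam * x$k)\<bar> < e"
      using a unfolding abs_less_iff by (intro conjI) linarith+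
  qed
qed

lemma cstar_pos: "0 < cstar D d \<rho> g"
proof (cases rule: cstar_cases)
  case 1 then show ?thesis using D deriv_pos by simp
next
  case (2 \<alpha>)
  then show ?thesis using D by (smt (verit) mult_pos_pos)
qed

end

theorem theorem4p2:
  fixes D d \<mu> \<nu> \<rho> :: real and g :: "real \<Rightarrow> real" and k i :: "'n::finite"
    and u0 v0 :: "real^'n \<Rightarrow> real"
    and u v :: "real^'n \<Rightarrow> real \<Rightarrow> real"
  assumes N2: "CARD('n) \<ge> 2"
    and pos: "D > 0" "d > 0" "\<mu> > 0" "\<nu> > 0" "\<rho> > 0"
    and kpp: "KPP g"
    and ik: "i \<noteq> k"
    and u0: "continuous_on {x. x$k \<le> 0} u0" "\<forall>x. x$k \<le> 0 \<longrightarrow> u0 x \<ge> 0"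
            "\<exists>M. \<forall>x. x$k \<le> 0 \<longrightarrow> u0 x \<le> M"
            "\<exists>R. \<forall>x. x$k \<le> 0 \<and> norm x > R \<longrightarrow> u0 x = 0"
    and v0: "continuous_on {x. x$k \<ge> 0} v0" "\<forall>x. x$k \<ge> 0 \<longrightarrow> v0 x \<ge> 0"
            "\<exists>M. \<forall>x. x$k \<ge> 0 \<longrightarrow> v0 x \<le> M"
            "\<exists>R. \<forall>x. x$k \<ge> 0 \<and> norm x > R \<longrightarrow> v0 x = 0"
    and nontriv: "\<exists>x. (x$k \<le> 0 \<and> u0 x \<noteq> 0) \<or> (x$k \<ge> 0 \<and> v0 x \<noteq> 0)"
    and sol: "HM_sol D d \<mu> \<nu> \<rho> g k u v"
    and init: "\<forall>x. x$k \<le> 0 \<longrightarrow> u x 0 = u0 x" "\<forall>x. x$k \<ge> 0 \<longrightarrow> v x 0 = v0 x"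
  shows "(\<forall>c > cstar D d \<rho> g. \<forall>\<epsilon>>0. \<exists>T. \<forall>t\<ge>T. \<forall>x. \<bar>x$i\<bar> \<ge> c * t \<longrightarrow>
            (x$k \<le> 0 \<longrightarrow> \<bar>u x t\<bar> < \<epsilon>) \<and> (x$k \<ge> 0 \<longrightarrow> \<bar>v x t\<bar> < \<epsilon>))
       \<and> (\<exists>U V. HM_steady D d \<mu> \<nu> \<rho> g k U V)
       \<and> (\<forall>U V. HM_steady D d \<mu> \<nu> \<rho> g k U V \<longrightarrow>
            (\<forall>c. 0 < c \<and> c < cstar D d \<rho> g \<longrightarrow> (\<forall>R. \<forall>\<epsilon>>0. \<exists>T. \<forall>t\<ge>T. \<forall>x.
               \<bar>x$i\<bar> \<le> c * t \<and> (\<forall>j. j \<noteq> i \<longrightarrow> \<bar>x$j\<bar> \<le> R) \<longrightarrow>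
               (x$k \<le> 0 \<longrightarrow> \<bar>u x t - U (x$k)\<bar> < \<epsilon>) \<and>
               (x$k \<ge> 0 \<longrightarrow> \<bar>v x t - V (x$k)\<bar> < \<epsilon>))))"
proof -
  define f where "f = (\<lambda>b x t. if b then u x t else v (reflect k x) t)"
  interpret S: hm_system D d \<mu> \<nu> \<rho> g k f
    unfolding f_def by (rule hm_system_of_sol[OF pos kpp sol]) (use u0(2) v0(2) init in auto)
  have fu: "f True x t = u x t" and fv: "f False (reflect k x) t = v x t" for x t by (auto simp: f_def)
  obtain W0 W0' where P0: "profile D (ext g) 1 W0 W0'" "W0 0 = S.P.\<theta>" "D * W0' 0 = S.kap * S.P.\<theta>"
    by (rule S.P.base_profile) (rule that)
  have decay: "\<exists>T. \<forall>t\<ge>T. \<forall>x. \<bar>x$i\<bar> \<ge> c * t \<longrightarrow> (x$k \<le> 0 \<longrightarrow> \<bar>u x t\<bar> < \<epsilon>) \<and> (x$k \<ge> 0 \<longrightarrow> \<bar>v x t\<bar> < \<epsilon>)"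
    if c: "cstar D d \<rho> g < c" and \<epsilon>: "0 < \<epsilon>" for c \<epsilon>
  proof -
    obtain R1 R2 where R: "\<And>x. x$k \<le> 0 \<Longrightarrow> R1 < norm x \<Longrightarrow> u0 x = 0" "\<And>x. x$k \<ge> 0 \<Longrightarrow> R2 < norm x \<Longrightarrow> v0 x = 0"
      using u0(4) v0(4) by blast
    have supp: "f b x 0 = 0" if "x$k \<le> 0" "max R1 R2 < norm x" for b x
      using R(1)[of x] R(2)[of "reflect k x"] that init by (simp add: f_def)
    obtain T where T: "0 \<le> T" "\<And>t x b. T \<le> t \<Longrightarrow> x$k \<le> 0 \<Longrightarrow> c * t \<le> \<bar>x$i\<bar> \<Longrightarrow> f b x t < \<epsilon>"
      by (rule S.decay_ahead[OF ik supp c \<epsilon>]) (assumption, assumption, rule that)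
    show ?thesis
    proof (intro exI[of _ T] allI impI conjI)
      fix t and x :: "real^'n" assume t: "T \<le> t" and x: "c * t \<le> \<bar>x$i\<bar>"
      have t0: "0 \<le> t" using t T(1) by simp
      show "\<bar>u x t\<bar> < \<epsilon>" if "x$k \<le> 0"
        using T(2)[OF t that x, of True] S.f_nonneg[OF that t0, of True] by (simp add: fu)
      show "\<bar>v x t\<bar> < \<epsilon>" if "0 \<le> x$k"
        using T(2)[OF t, of "reflect k x" False] S.f_nonneg[of "reflect k x" t False] that x ik t0 by (simp add: fv)
    qed
  qed
  \<comment> \<open>A steady state is itself a solution that starts nonzero, so
    \<open>convergence\<close> applies to it; being constant in time, it coincides with the
    limit.\<close>
  have unique: "U y = W0 (- y) \<and> V (- y) = S.c1 * S.P.\<theta> * exp (S.lam * y)"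
    if st: "HM_steady D d \<mu> \<nu> \<rho> g k U V" and y: "y \<le> 0" for U V y
  proof -
    define h where "h = (\<lambda>b (x::real^'n) (t::real). if b then U (x$k) else V (reflect k x $ k))"
    have st': "HM_sol D d \<mu> \<nu> \<rho> g k (\<lambda>x t. U (x$k)) (\<lambda>x t. V (x$k))" "\<And>y. y \<le> 0 \<Longrightarrow> 0 < U y" "\<And>y. 0 \<le> y \<Longrightarrow> 0 < V y"
      using st unfolding HM_steady_def by auto
    interpret Q: hm_system D d \<mu> \<nu> \<rho> g k h
      unfolding h_def by (rule hm_system_of_sol[OF pos kpp st'(1)]) (use st' in \<open>auto intro: less_imp_le\<close>)
    have c: "0 < cstar D d \<rho> g / 2" "cstar D d \<rho> g / 2 < cstar D d \<rho> g" using S.cstar_pos by auto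
    have x1: "(0::real^'n)$k \<le> 0" "0 < h True 0 0" using st' by (auto simp: h_def)
    \<comment> \<open>A point on the k-axis has \<open>x$i = 0\<close> and so lies in the cone at
      every time.\<close>
    define x where "x = y *\<^sub>R axis k (1::real)"
    have x: "x$k = y" "x$i = 0" "\<And>j. \<bar>x$j\<bar> \<le> \<bar>y\<bar>" using ik by (auto simp: x_def axis_def)
    have close: "\<bar>U y - W0 (- y)\<bar> < e \<and> \<bar>V (- y) - S.c1 * S.P.\<theta> * exp (S.lam * y)\<bar> < e" if e: "0 < e" for e
    proof -
      obtain T where T: "0 \<le> T" "\<And>x t. T \<le> t \<Longrightarrow> x$k \<le> 0 \<Longrightarrow> \<bar>x$i\<bar> \<le> cstar D d \<rho> g / 2 * t \<Longrightarrow> (\<forall>j. j \<noteq> i \<longrightarrow> \<bar>x$j\<bar> \<le> \<bar>y\<bar>) \<Longrightarrow>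
        \<bar>h True x t - W0 (- x$k)\<bar> < e \<and> \<bar>h False x t - S.c1 * S.P.\<theta> * exp (S.lam * x$k)\<bar> < e"
        by (rule Q.convergence[OF ik c x1 e P0, of "\<bar>y\<bar>"]) (rule that)
      have "\<bar>h True x T - W0 (- x$k)\<bar> < e \<and> \<bar>h False x T - S.c1 * S.P.\<theta> * exp (S.lam * x$k)\<bar> < e"
        by (rule T(2)) (use x y c T(1) in auto)
      then show ?thesis using x by (simp add: h_def)
    qed
    have "\<bar>U y - W0 (- y)\<bar> \<le> 0" by (rule field_le_epsilon) (use close in \<open>auto intro: less_imp_le\<close>)
    moreover have "\<bar>V (- y) - S.c1 * S.P.\<theta> * exp (S.lam * y)\<bar> \<le> 0"
      by (rule field_le_epsilon) (use close in \<open>auto intro: less_imp_le\<close>)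
    ultimately show ?thesis by simp
  qed
  obtain b1 x1 where x1: "x1$k \<le> 0" "0 < f b1 x1 0"
  proof -
    obtain x where "(x$k \<le> 0 \<and> u0 x \<noteq> 0) \<or> (x$k \<ge> 0 \<and> v0 x \<noteq> 0)" using nontriv by blast
    then show ?thesis
    proof
      assume h: "x$k \<le> 0 \<and> u0 x \<noteq> 0"
      then have "0 < u0 x" using u0(2) by (simp add: less_le)
      then show ?thesis using that[of x True] h init by (simp add: fu)
    next
      assume h: "x$k \<ge> 0 \<and> v0 x \<noteq> 0"
      then have "0 < v0 x" using v0(2) by (simp add: less_le)
      then show ?thesis using that[of "reflect k x" False] h init by (simp add: fv)
    qed
  qed
  have conv: "\<exists>T. \<forall>t\<ge>T. \<forall>x. \<bar>x$i\<bar> \<le> c * t \<and> (\<forall>j. j \<noteq> i \<longrightarrow> \<bar>x$j\<bar> \<le> R) \<longrightarrow>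
      (x$k \<le> 0 \<longrightarrow> \<bar>u x t - U (x$k)\<bar> < \<epsilon>) \<and> (x$k \<ge> 0 \<longrightarrow> \<bar>v x t - V (x$k)\<bar> < \<epsilon>)"
    if st: "HM_steady D d \<mu> \<nu> \<rho> g k U V" and c: "0 < c" "c < cstar D d \<rho> g" and \<epsilon>: "0 < \<epsilon>" for U V c R \<epsilon>
  proof -
    obtain T where T: "0 \<le> T" "\<And>x t. T \<le> t \<Longrightarrow> x$k \<le> 0 \<Longrightarrow> \<bar>x$i\<bar> \<le> c * t \<Longrightarrow> (\<forall>j. j \<noteq> i \<longrightarrow> \<bar>x$j\<bar> \<le> R) \<Longrightarrow>
      \<bar>f True x t - W0 (- x$k)\<bar> < \<epsilon> \<and> \<bar>f False x t - S.c1 * S.P.\<theta> * exp (S.lam * x$k)\<bar> < \<epsilon>"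
      by (rule S.convergence[OF ik c x1 \<epsilon> P0, of R]) (rule that)
    show ?thesis
    proof (intro exI[of _ T] allI impI conjI)
      fix t and x :: "real^'n" assume t: "T \<le> t" and x: "\<bar>x$i\<bar> \<le> c * t \<and> (\<forall>j. j \<noteq> i \<longrightarrow> \<bar>x$j\<bar> \<le> R)"
      show "\<bar>u x t - U (x$k)\<bar> < \<epsilon>" if xk: "x$k \<le> 0"
        using T(2)[OF t xk] x unique[OF st xk] by (simp add: fu)
      show "\<bar>v x t - V (x$k)\<bar> < \<epsilon>" if xk: "0 \<le> x$k"
      proof -
        have "\<bar>f False (reflect k x) t - S.c1 * S.P.\<theta> * exp (S.lam * reflect k x $ k)\<bar> < \<epsilon>"
        proof -
          have "\<forall>j. j \<noteq> i \<longrightarrow> \<bar>reflect k x $ j\<bar> \<le> R" using x by simp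
          then show ?thesis using T(2)[OF t, of "reflect k x"] x xk ik by (simp del: reflect_nth add: reflect_nth[of k x k] reflect_nth[of k x i])
        qed
        moreover have "V (x$k) = S.c1 * S.P.\<theta> * exp (S.lam * reflect k x $ k)" using unique[OF st, of "- x$k"] xk by simp
        ultimately show ?thesis by (simp add: fv)
      qed
    qed
  qed
  show ?thesis using decay S.steady_state[OF P0] conv by blast
qed

end
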